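(* Let $k$ be an algebraically closed field of characteristic $0$, and let $f=\sum_{i=0}^{3} t^{a_{i0}}X^{a_{i1}}Y^{a_{i2}}$ (with $a_{ij}\in\mathbb{Z}_{\ge 0}$), regarded as a polynomial in $X,Y$ over the field $k(t)$. Assume that $f$ is absolutely irreducible over $k(t)$ and that the exponent matrix $A_f$ is nonsingular. Suppose that $f$ defines a curve of genus $1$ over $k(t)$. Then this curve is birational over $k(t)$ to a curve defined by a polynomial $g$ which also has four terms, i.e. $g=\sum_{i=0}^{3} t^{b_{i0}}X^{b_{i1}}Y^{b_{i2}}$ with $b_{ij}\in\mathbb{Z}_{\ge 0}$, and whose Newton polygon $\Gamma(g)$ is one of the following twelve polygons (each given as the convex hull of its corners): (1) $(0,0),(3,0),(0,2)$; (2) $(1,0),(3,0),(0,2)$; (3) $(0,1),(3,0),(0,2)$; (4) $(0,0),(4,0),(0,2)$; (5) $(0,0),(3,0),(0,3)$; (6) $(2,0),(0,1),(3,0),(0,2)$; (7) $(1,0),(0,1),(3,0),(0,2)$; (8) $(0,0),(2,1),(3,0),(0,2)$; (9) $(0,0),(2,1),(2,0),(0,2)$; (10) $(1,0),(0,1),(2,1),(1,2)$; (11) $(0,0),(1,2),(3,0),(0,2)$; (12) $(0,0),(2,0),(0,2),(2,2)$.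
   Context: The genus of a curve means its geometric genus. Exponent matrix: for $f=\sum_{i=0}^{3} t^{a_{i0}}X^{a_{i1}}Y^{a_{i2}}$, let $d=\max_i(a_{i0}+a_{i1}+a_{i2})$ and $a_{i3}=d-a_{i0}-a_{i1}-a_{i2}$, so that the homogenization of $f$ in the variables $t,X,Y,Z$ is $F=\sum_{i=0}^{3} t^{a_{i0}}X^{a_{i1}}Y^{a_{i2}}Z^{a_{i3}}$. Then $A_f=(a_{ij})_{0\le i,j\le 3}$ is the $4\times 4$ matrix of exponents. Newton polygon: writing a polynomial as $\sum_{(a,b)\in S}\alpha_{(a,b)}X^aY^b$ with $S\subset\mathbb{Z}^2$ finite and all coefficients $\alpha_{(a,b)}\in k(t)$ nonzero, its Newton polygon $\Gamma$ is the convex hull of $S$ in $\mathbb{R}^2$. *)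

theory Defs
  imports
    "HOL-Analysis.Convex"
    "HOL-Algebra.Algebraic_Closure_Type"
    "HOL-Algebra.QuotRing"
    "HOL-Algebra.Embedded_Algebras"
    "Jordan_Normal_Form.Determinant"
begin

section \<open>Plane curves over a field\<close>

text \<open>
  The polynomial ring \<open>K[X,Y]\<close> is \<open>K[X][Y]\<close>, that is \<open>'a poly poly\<close>: the inner
  variable is \<open>X\<close>, the outer one is \<open>Y\<close>.
\<close>

definition bimonom :: "'a::zero \<Rightarrow> nat \<Rightarrow> nat \<Rightarrow> 'a poly poly" where
  "bimonom c i j = monom (monom c i) j"

definition base_change :: "'a::field poly poly \<Rightarrow> 'a alg_closure poly poly" where
  "base_change f = map_poly (map_poly to_ac) f"

definition absolutely_irreducible :: "'a::field poly poly \<Rightarrow> bool" where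
  "absolutely_irreducible f \<longleftrightarrow> irreducible (base_change f)"

definition newton_polygon :: "'a::zero poly poly \<Rightarrow> (real \<times> real) set" where
  "newton_polygon f = convex hull {(real i, real j) | i j. coeff (coeff f j) i \<noteq> 0}"


section \<open>Function fields and birational equivalence\<close>

text \<open>
  The function field of the curve \<open>f = 0\<close> (with \<open>f\<close> irreducible) is the residue field at
  its generic point: the local ring \<open>K[X,Y]\<^bsub>(f)\<^esub>\<close>, formed inside \<open>K(X,Y)\<close>, modulo its
  maximal ideal.
\<close>

definition curve_local_ring :: "'a::field poly poly \<Rightarrow> 'a poly poly fract ring" where
  "curve_local_ring f =
     ring_of_type_algebra \<lparr>carrier := {Fract p q | p q. \<not> f dvd q}\<rparr>"

definition curve_maximal_ideal :: "'a::field poly poly \<Rightarrow> 'a poly poly fract set" where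
  "curve_maximal_ideal f = {Fract p q | p q. f dvd p \<and> \<not> f dvd q}"

definition function_field :: "'a::field poly poly \<Rightarrow> 'a poly poly fract set ring" where
  "function_field f = curve_local_ring f Quot curve_maximal_ideal f"

definition const_fun :: "'a::field poly poly \<Rightarrow> 'a \<Rightarrow> 'a poly poly fract set" where
  "const_fun f c = curve_maximal_ideal f +>\<^bsub>curve_local_ring f\<^esub> to_fract [:[:c:]:]"

text \<open>
  Two (irreducible) plane curves over \<open>K\<close> are birational over \<open>K\<close> if their function fields
  are isomorphic as extensions of \<open>K\<close>.
\<close>

definition birational :: "'a::field poly poly \<Rightarrow> 'a poly poly \<Rightarrow> bool" where
  "birational f g \<longleftrightarrow> irreducible f \<and> irreducible g \<and>
     (\<exists>\<phi> \<in> ring_iso (function_field f) (function_field g).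
        \<forall>c. \<phi> (const_fun f c) = const_fun g c)"


section \<open>Geometric genus\<close>

text \<open>
  Throughout this section, \<open>F\<close> is a field and \<open>K\<close> is the carrier of a subfield of \<open>F\<close>.
\<close>

definition derivations :: "'f set \<Rightarrow> ('f, 'm) ring_scheme \<Rightarrow> ('f \<Rightarrow> 'f) set" where
  "derivations K F = {D \<in> carrier F \<rightarrow>\<^sub>E carrier F.
     (\<forall>x \<in> carrier F. \<forall>y \<in> carrier F. D (x \<oplus>\<^bsub>F\<^esub> y) = D x \<oplus>\<^bsub>F\<^esub> D y) \<and>
     (\<forall>x \<in> carrier F. \<forall>y \<in> carrier F.
        D (x \<otimes>\<^bsub>F\<^esub> y) = (x \<otimes>\<^bsub>F\<^esub> D y) \<oplus>\<^bsub>F\<^esub> (y \<otimes>\<^bsub>F\<^esub> D x)) \<and>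
     (\<forall>c \<in> K. D c = \<zero>\<^bsub>F\<^esub>)}"

text \<open>
  The module of Kaehler differentials \<open>\<Omega>\<close> of \<open>F\<close> over \<open>K\<close> is an \<open>F\<close>-vector space whose
  dual is the space of derivations of \<open>F\<close> over \<open>K\<close>. As a vector space embeds in its double
  dual, \<open>\<Omega>\<close> is realised by the functions \<open>D \<mapsto> \<Sum>\<^sub>i a\<^sub>i D(b\<^sub>i)\<close> on derivations, each
  representing the differential \<open>\<Sum>\<^sub>i a\<^sub>i db\<^sub>i\<close>. For a subring \<open>A\<close>, the set
  \<open>differentials K F A\<close> is the image in \<open>\<Omega>\<close> of the differentials of \<open>A\<close> over \<open>K\<close>;
  for \<open>A = carrier F\<close> it is \<open>\<Omega>\<close> itself.
\<close>

definition differentials ::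
    "'f set \<Rightarrow> ('f, 'm) ring_scheme \<Rightarrow> 'f set \<Rightarrow> (('f \<Rightarrow> 'f) \<Rightarrow> 'f) set" where
  "differentials K F A =
     {\<lambda>D \<in> derivations K F. (\<Oplus>\<^bsub>F\<^esub>i\<in>{..<n}. a i \<otimes>\<^bsub>F\<^esub> D (b i)) | (n::nat) a b.
        a \<in> {..<n} \<rightarrow> A \<and> b \<in> {..<n} \<rightarrow> A}"

text \<open>
  The places of \<open>F\<close> over \<open>K\<close>, given by their valuation rings. For a function field in one
  variable these are the local rings at the closed points of the smooth projective model.
\<close>

definition places :: "'f set \<Rightarrow> ('f, 'm) ring_scheme \<Rightarrow> 'f set set" where
  "places K F = {A. subring A F \<and> K \<subseteq> A \<and> A \<noteq> carrier F \<and>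
     (\<forall>x \<in> carrier F - {\<zero>\<^bsub>F\<^esub>}. x \<in> A \<or> inv\<^bsub>F\<^esub> x \<in> A)}"

text \<open>The global sections of the canonical sheaf of the smooth projective model:\<close>

definition regular_differentials ::
    "'f set \<Rightarrow> ('f, 'm) ring_scheme \<Rightarrow> (('f \<Rightarrow> 'f) \<Rightarrow> 'f) set" where
  "regular_differentials K F =
     {\<omega> \<in> differentials K F (carrier F). \<forall>A \<in> places K F. \<omega> \<in> differentials K F A}"

text \<open>
  \<open>ring.dimension\<close> measures subspaces of a ring that contains the field of scalars.
  Differentials live in the ring of all functions from derivations to \<open>F\<close>, with pointwise
  operations; the scalars are the constant functions with value in \<open>K\<close>.
\<close>

definition pointwise_ring :: "'d set \<Rightarrow> ('f, 'm) ring_scheme \<Rightarrow> ('d \<Rightarrow> 'f) ring" where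
  "pointwise_ring I F = \<lparr>
     carrier = I \<rightarrow>\<^sub>E carrier F,
     monoid.mult = (\<lambda>u v. \<lambda>i\<in>I. u i \<otimes>\<^bsub>F\<^esub> v i),
     one = (\<lambda>i\<in>I. \<one>\<^bsub>F\<^esub>),
     ring.zero = (\<lambda>i\<in>I. \<zero>\<^bsub>F\<^esub>),
     add = (\<lambda>u v. \<lambda>i\<in>I. u i \<oplus>\<^bsub>F\<^esub> v i)\<rparr>"

definition function_field_has_genus :: "'f set \<Rightarrow> ('f, 'm) ring_scheme \<Rightarrow> nat \<Rightarrow> bool" where
  "function_field_has_genus K F g \<longleftrightarrow>
     ring.dimension (pointwise_ring (derivations K F) F) g
       {\<lambda>D \<in> derivations K F. c | c. c \<in> K}
       (regular_differentials K F)"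

text \<open>
  The geometric genus of an absolutely irreducible plane curve over \<open>K\<close> is the genus of the
  smooth projective model of the curve over the algebraic closure of \<open>K\<close>.
\<close>

definition has_geometric_genus :: "'a::field poly poly \<Rightarrow> nat \<Rightarrow> bool" where
  "has_geometric_genus f g \<longleftrightarrow>
     function_field_has_genus (range (const_fun (base_change f)))
       (function_field (base_change f)) g"


section \<open>Polynomials with four terms\<close>

text \<open>
  Exponents are given by \<open>a i j\<close> for \<open>i < 4\<close> and \<open>j < 3\<close>, where \<open>j = 0, 1, 2\<close> stand for
  \<open>t, X, Y\<close>; other values of \<open>a\<close> are irrelevant. The element \<open>t\<close> of \<open>k(t)\<close> is
  \<open>to_fract [:0, 1:]\<close>.
\<close>

definition four_term_poly :: "(nat \<Rightarrow> nat \<Rightarrow> nat) \<Rightarrow> 'k::field poly fract poly poly" where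
  "four_term_poly a = (\<Sum>i<4. bimonom (to_fract [:0, 1:] ^ a i 0) (a i 1) (a i 2))"

definition total_degree :: "(nat \<Rightarrow> nat \<Rightarrow> nat) \<Rightarrow> nat" where
  "total_degree a = Max ((\<lambda>i. a i 0 + a i 1 + a i 2) ` {..<4})"

definition exponent_matrix :: "(nat \<Rightarrow> nat \<Rightarrow> nat) \<Rightarrow> int mat" where
  "exponent_matrix a = mat 4 4 (\<lambda>(i, j).
     if j < 3 then int (a i j)
     else int (total_degree a) - int (a i 0) - int (a i 1) - int (a i 2))"

definition polygon_corners :: "(real \<times> real) set list" where
  "polygon_corners =
    [{(0,0), (3,0), (0,2)},
     {(1,0), (3,0), (0,2)},
     {(0,1), (3,0), (0,2)},
     {(0,0), (4,0), (0,2)},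
     {(0,0), (3,0), (0,3)},
     {(2,0), (0,1), (3,0), (0,2)},
     {(1,0), (0,1), (3,0), (0,2)},
     {(0,0), (2,1), (3,0), (0,2)},
     {(0,0), (2,1), (2,0), (0,2)},
     {(1,0), (0,1), (2,1), (1,2)},
     {(0,0), (1,2), (3,0), (0,2)},
     {(0,0), (2,0), (0,2), (2,2)}]"

end

theory Submission
  imports Defs
begin

text \<open>
  A lattice point \<open>(u, v)\<close> in the interior of the Newton polygon of \<open>f\<close> gives the differential
  \<open>x\<^sup>u y\<^sup>v dx / (x y f\<^sub>y)\<close>, and different points give independent differentials. It is regular at
  every place: since \<open>t\<close> is transcendental and the exponent matrix is nonsingular, \<open>f\<close> is nondegenerate
  with respect to its Newton polygon. Hence genus \<open>1\<close> allows at most one interior lattice point. Lattice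
  triangles and quadrilaterals with at most one interior lattice point are classified up to unimodular
  affine maps. If there is none, the polygon lies in a strip of width one or is the triangle of a conic,
  and the curve is rational, contradicting the existence of a regular differential. Otherwise the map to one
  of the twelve polygons is a monomial change of the coordinates \<open>X, Y\<close>, which is birational over \<open>k(t)\<close>.
\<close>

section \<open>Lattice polygons\<close>

text \<open>Places are given as bare subrings, so orders of vanishing are never numbers: values are
  compared by asking whether a quotient lies in the ring. Restricted to monomials this is plane
  geometry. At a given place some two terms of \<open>f\<close> with different exponents share the
  least value, so the exponents \<open>v\<close> with \<open>mono v\<close> in the ring fill a
  half-plane bounded by their direction, or the whole plane, and an interior lattice point lies
  strictly inside. This yields explicit local expressions for the differentials that treat all
  places alike.

  Elements of the function field are handled through representatives in \<open>K(X,Y)\<close>,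
  congruence modulo the maximal ideal replacing equality of cosets.

  Terms of \<open>f\<close> may share their monomial in \<open>X\<close> and \<open>Y\<close>, so
  there can be fewer than four exponent points. The coefficients are then sums of powers of
  \<open>t\<close>, which never vanish in characteristic 0, so no point disappears by
  cancellation.\<close>

definition lin :: "int \<Rightarrow> int \<Rightarrow> int \<times> int \<Rightarrow> int" where
  "lin \<alpha> \<beta> v = \<alpha> * fst v + \<beta> * snd v"

definition det2 :: "int \<times> int \<Rightarrow> int \<times> int \<Rightarrow> int" where
  "det2 u v = fst u * snd v - snd u * fst v"

text \<open>For finite \<open>S\<close> the convex hull is cut out by inequalities with integer
  coefficients, so these are the lattice points of the polygon. In this dual form a unimodular map
  acts by mere substitution, and membership is refuted by exhibiting one functional.\<close>

definition lattice_hull :: "(int \<times> int) set \<Rightarrow> (int \<times> int) set" where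
  "lattice_hull S = {r. \<forall>\<alpha> \<beta> c. (\<forall>s\<in>S. c \<le> lin \<alpha> \<beta> s) \<longrightarrow> c \<le> lin \<alpha> \<beta> r}"

text \<open>The strict interior in the same dual form: only the zero functional attains at
  \<open>r\<close> a lower bound for \<open>S\<close>. In particular the set is empty when
  \<open>S\<close> lies on a line.\<close>

definition lattice_interior :: "(int \<times> int) set \<Rightarrow> (int \<times> int) set" where
  "lattice_interior S = {r. \<forall>\<alpha> \<beta>. (\<forall>s\<in>S. lin \<alpha> \<beta> r \<le> lin \<alpha> \<beta> s) \<longrightarrow> \<alpha> = 0 \<and> \<beta> = 0}"

lemma lattice_hullD: "r \<in> lattice_hull S \<Longrightarrow> (\<And>s. s \<in> S \<Longrightarrow> c \<le> lin \<alpha> \<beta> s) \<Longrightarrow> c \<le> lin \<alpha> \<beta> r"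
  by (auto simp: lattice_hull_def)

lemma subset_lattice_hull: "s \<in> S \<Longrightarrow> s \<in> lattice_hull S"
  by (auto simp: lattice_hull_def)

text \<open>Testing against the hull instead of \<open>S\<close> lets arbitrary hull points serve as
  witnesses.\<close>

lemma lattice_interiorI:
  assumes "\<And>\<alpha> \<beta>. (\<And>s. s \<in> lattice_hull S \<Longrightarrow> lin \<alpha> \<beta> r \<le> lin \<alpha> \<beta> s) \<Longrightarrow> \<alpha> = 0 \<and> \<beta> = 0"
  shows "r \<in> lattice_interior S"
  unfolding lattice_interior_def
proof (intro CollectI allI impI)
  fix \<alpha> \<beta> assume "\<forall>s\<in>S. lin \<alpha> \<beta> r \<le> lin \<alpha> \<beta> s"
  hence "\<And>s. s \<in> lattice_hull S \<Longrightarrow> lin \<alpha> \<beta> r \<le> lin \<alpha> \<beta> s"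
    by (blast intro: lattice_hullD)
  thus "\<alpha> = 0 \<and> \<beta> = 0" by (rule assms)
qed

lemma lattice_interiorD:
  assumes "r \<in> lattice_interior S" "\<And>s. s \<in> S \<Longrightarrow> lin \<alpha> \<beta> r \<le> lin \<alpha> \<beta> s"
  shows "\<alpha> = 0" "\<beta> = 0"
proof -
  have "\<forall>s\<in>S. lin \<alpha> \<beta> r \<le> lin \<alpha> \<beta> s" using assms(2) by blast
  with assms(1) show "\<alpha> = 0" "\<beta> = 0" by (simp_all add: lattice_interior_def)
qed

lemma lattice_interior_less:
  assumes "r \<in> lattice_interior S" "\<alpha> \<noteq> 0 \<or> \<beta> \<noteq> 0"
  obtains s where "s \<in> S" "lin \<alpha> \<beta> s < lin \<alpha> \<beta> r"
  using lattice_interiorD[OF assms(1), of \<alpha> \<beta>] assms(2) by (meson not_le)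

lemma lattice_interior_subset: "lattice_interior S \<subseteq> lattice_hull S"
proof
  fix r assume r: "r \<in> lattice_interior S"
  show "r \<in> lattice_hull S"
    unfolding lattice_hull_def
  proof (intro CollectI allI impI)
    fix \<alpha> \<beta> c assume c: "\<forall>s\<in>S. c \<le> lin \<alpha> \<beta> s"
    show "c \<le> lin \<alpha> \<beta> r"
    proof (rule ccontr)
      assume "\<not> c \<le> lin \<alpha> \<beta> r"
      hence "\<And>s. s \<in> S \<Longrightarrow> lin \<alpha> \<beta> r \<le> lin \<alpha> \<beta> s" using c by force
      from lattice_interiorD[OF r this] have "\<alpha> = 0" "\<beta> = 0" by auto
      with \<open>\<not> c \<le> lin \<alpha> \<beta> r\<close> c have "S = {}" by (auto simp: lin_def)
      hence "\<And>s. s \<in> S \<Longrightarrow> lin 1 0 r \<le> lin 1 0 s" by auto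
      from lattice_interiorD[OF r this] show False by simp
    qed
  qed
qed

lemma lattice_hull_conv:
  assumes "u \<in> lattice_hull S" "v \<in> lattice_hull S" "w \<in> lattice_hull S"
    and "a \<ge> 0" "b \<ge> 0" "c \<ge> 0" "n = a + b + c" "n > 0"
    and "n * fst r = a * fst u + b * fst v + c * fst w"
    and "n * snd r = a * snd u + b * snd v + c * snd w"
  shows "r \<in> lattice_hull S"
  unfolding lattice_hull_def
proof (intro CollectI allI impI)
  fix \<alpha> \<beta> k assume k: "\<forall>s\<in>S. k \<le> lin \<alpha> \<beta> s"
  have "k \<le> lin \<alpha> \<beta> u" "k \<le> lin \<alpha> \<beta> v" "k \<le> lin \<alpha> \<beta> w"
    using assms(1-3) k by (auto intro: lattice_hullD)
  hence "a * k + b * k + c * k \<le> a * lin \<alpha> \<beta> u + b * lin \<alpha> \<beta> v + c * lin \<alpha> \<beta> w"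
    using assms(4-6) by (intro add_mono mult_left_mono)
  also have "\<dots> = \<alpha> * (n * fst r) + \<beta> * (n * snd r)"
    unfolding assms(9,10) by (simp add: lin_def algebra_simps)
  finally have "n * k \<le> n * lin \<alpha> \<beta> r"
    using assms(7) by (simp add: lin_def algebra_simps)
  thus "k \<le> lin \<alpha> \<beta> r" using assms(8) by simp
qed

text \<open>A functional that is minimal at a positive combination of \<open>u\<close>,
  \<open>v\<close>, \<open>w\<close> has nonnegative excess at the three points with weighted sum
  zero. It is therefore constant on them, and zero because they are not collinear.\<close>

lemma lattice_interior_conv:
  assumes "u \<in> lattice_hull S" "v \<in> lattice_hull S" "w \<in> lattice_hull S"
    and abc: "a > 0" "b > 0" "c > 0"
    and r: "(a + b + c) * fst r = a * fst u + b * fst v + c * fst w"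
    "(a + b + c) * snd r = a * snd u + b * snd v + c * snd w"
    and nc: "det2 (v - u) (w - u) \<noteq> 0"
  shows "r \<in> lattice_interior S"
proof (rule lattice_interiorI)
  fix \<alpha> \<beta> assume H: "\<And>s. s \<in> lattice_hull S \<Longrightarrow> lin \<alpha> \<beta> r \<le> lin \<alpha> \<beta> s"
  define x y z where "x = lin \<alpha> \<beta> u - lin \<alpha> \<beta> r" "y = lin \<alpha> \<beta> v - lin \<alpha> \<beta> r" "z = lin \<alpha> \<beta> w - lin \<alpha> \<beta> r"
  have xyz: "x \<ge> 0" "y \<ge> 0" "z \<ge> 0" using H assms(1-3) by (auto simp: x_y_z_def)
  have "a * x + b * y + c * z = \<alpha> * (a * fst u + b * fst v + c * fst w) + \<beta> * (a * snd u + b * snd v + c * snd w)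
      - (a + b + c) * lin \<alpha> \<beta> r"
    by (simp add: x_y_z_def lin_def algebra_simps)
  also have "\<dots> = 0" unfolding r[symmetric] by (simp add: lin_def algebra_simps)
  finally have "a * x + b * y + c * z = 0" .
  moreover have "a * x \<ge> 0" "b * y \<ge> 0" "c * z \<ge> 0" using xyz abc by auto
  ultimately have "a * x = 0" "b * y = 0" "c * z = 0" by linarith+
  hence 0: "x = 0" "y = 0" "z = 0" using abc by auto
  have e: "\<alpha> * (fst v - fst u) + \<beta> * (snd v - snd u) = 0" "\<alpha> * (fst w - fst u) + \<beta> * (snd w - snd u) = 0"
    using 0 by (auto simp: x_y_z_def lin_def algebra_simps)
  have "\<alpha> * det2 (v - u) (w - u) = 0" "\<beta> * det2 (v - u) (w - u) = 0"
    using e by (auto simp: det2_def) Groebner_Basis.algebra+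
  thus "\<alpha> = 0 \<and> \<beta> = 0" using nc by simp
qed

section \<open>Unimodular affine maps of the lattice\<close>

definition affmap :: "int \<Rightarrow> int \<Rightarrow> int \<Rightarrow> int \<Rightarrow> int \<Rightarrow> int \<Rightarrow> int \<times> int \<Rightarrow> int \<times> int" where
  "affmap a b c d e f v = (a * fst v + b * snd v + e, c * fst v + d * snd v + f)"

definition unimodular :: "(int \<times> int \<Rightarrow> int \<times> int) \<Rightarrow> bool" where
  "unimodular \<phi> \<longleftrightarrow> (\<exists>a b c d e f. \<phi> = affmap a b c d e f \<and> \<bar>a * d - b * c\<bar> = 1)"

lemma unimodularI: "\<bar>a * d - b * c\<bar> = 1 \<Longrightarrow> unimodular (affmap a b c d e f)"
  unfolding unimodular_def by blast

lemma unimodular_comp: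
  assumes "unimodular \<phi>" "unimodular \<psi>"
  shows "unimodular (\<phi> \<circ> \<psi>)"
proof -
  from assms obtain a b c d e f a' b' c' d' e' f' where
    *: "\<phi> = affmap a b c d e f" "\<bar>a * d - b * c\<bar> = 1" "\<psi> = affmap a' b' c' d' e' f'" "\<bar>a' * d' - b' * c'\<bar> = 1"
    unfolding unimodular_def by blast
  have "\<phi> \<circ> \<psi> = affmap (a * a' + b * c') (a * b' + b * d') (c * a' + d * c') (c * b' + d * d')
      (a * e' + b * f' + e) (c * e' + d * f' + f)"
    unfolding * by (auto simp: affmap_def fun_eq_iff algebra_simps)
  moreover have "(a * a' + b * c') * (c * b' + d * d') - (a * b' + b * d') * (c * a' + d * c')
      = (a * d - b * c) * (a' * d' - b' * c')" by (simp add: algebra_simps)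
  hence "\<bar>(a * a' + b * c') * (c * b' + d * d') - (a * b' + b * d') * (c * a' + d * c')\<bar> = 1"
    using *(2,4) by (simp add: abs_mult)
  ultimately show ?thesis by (auto intro: unimodularI)
qed

lemma unimodular_inverse:
  assumes "unimodular \<phi>"
  obtains \<psi> where "unimodular \<psi>" "\<And>v. \<psi> (\<phi> v) = v" "\<And>v. \<phi> (\<psi> v) = v"
proof -
  from assms obtain a b c d e f where
    *: "\<phi> = affmap a b c d e f" "\<bar>a * d - b * c\<bar> = 1"
    unfolding unimodular_def by blast
  define D where "D = a * d - b * c"
  have "D = 1 \<or> D = -1" using *(2) by (auto simp: D_def)
  hence DD: "D * D = 1" by auto
  \<comment> \<open>\<open>D\<close> is a sign and so its own inverse: the adjugate times
    \<open>D\<close> is an integral inverse matrix.\<close>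
  define \<psi> where "\<psi> = affmap (D * d) (- D * b) (- D * c) (D * a) (D * (b * f - d * e)) (D * (c * e - a * f))"
  have "D * d * (D * a) - (- D * b) * (- D * c) = D * D * D" by (simp add: D_def algebra_simps)
  also have "\<bar>\<dots>\<bar> = 1" using *(2) by (simp add: D_def abs_mult)
  finally have "unimodular \<psi>" unfolding \<psi>_def by (rule unimodularI)
  moreover have "\<psi> (\<phi> v) = v" for v
  proof -
    have "fst (\<psi> (\<phi> v)) = D * D * fst v" "snd (\<psi> (\<phi> v)) = D * D * snd v"
      by (simp_all add: \<psi>_def * affmap_def D_def algebra_simps)
    thus ?thesis using DD by (simp add: prod_eq_iff)
  qed
  moreover have "\<phi> (\<psi> v) = v" for v
  proof -
    have "fst (\<phi> (\<psi> v)) = D * (D * fst v) + e - D * D * e" "snd (\<phi> (\<psi> v)) = D * (D * snd v) + f - D * D * f"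
      by (simp_all add: \<psi>_def * affmap_def D_def algebra_simps)
    thus ?thesis using DD by (simp add: prod_eq_iff flip: mult.assoc)
  qed
  ultimately show ?thesis by (rule that)
qed

lemma lin_affmap:
  "lin \<alpha> \<beta> (affmap a b c d e f v) = lin (\<alpha> * a + \<beta> * c) (\<alpha> * b + \<beta> * d) v + (\<alpha> * e + \<beta> * f)"
  by (simp add: lin_def affmap_def algebra_simps)

lemma lattice_hull_image:
  assumes "unimodular \<phi>" "r \<in> lattice_hull S"
  shows "\<phi> r \<in> lattice_hull (\<phi> ` S)"
proof -
  from assms obtain a b c d e f where *: "\<phi> = affmap a b c d e f"
    unfolding unimodular_def by blast
  show ?thesis
    unfolding lattice_hull_def
  proof (intro CollectI allI impI)
    fix \<alpha> \<beta> k assume "\<forall>s\<in>\<phi> ` S. k \<le> lin \<alpha> \<beta> s"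
    hence "\<And>s. s \<in> S \<Longrightarrow> k - (\<alpha> * e + \<beta> * f) \<le> lin (\<alpha> * a + \<beta> * c) (\<alpha> * b + \<beta> * d) s"
      by (force simp: * lin_affmap)
    from lattice_hullD[OF assms(2) this] show "k \<le> lin \<alpha> \<beta> (\<phi> r)"
      by (simp add: * lin_affmap)
  qed
qed

lemma lattice_interior_image':
  assumes "unimodular \<phi>" "r \<in> lattice_interior S"
  shows "\<phi> r \<in> lattice_interior (\<phi> ` S)"
proof -
  from assms obtain a b c d e f where *: "\<phi> = affmap a b c d e f" "\<bar>a * d - b * c\<bar> = 1"
    unfolding unimodular_def by blast
  show ?thesis
    unfolding lattice_interior_def
  proof (intro CollectI allI impI)
    fix \<alpha> \<beta> assume "\<forall>s\<in>\<phi> ` S. lin \<alpha> \<beta> (\<phi> r) \<le> lin \<alpha> \<beta> s"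
    hence "\<And>s. s \<in> S \<Longrightarrow> lin (\<alpha> * a + \<beta> * c) (\<alpha> * b + \<beta> * d) r \<le> lin (\<alpha> * a + \<beta> * c) (\<alpha> * b + \<beta> * d) s"
      by (force simp: * lin_affmap)
    from lattice_interiorD[OF assms(2) this] have "\<alpha> * a + \<beta> * c = 0" "\<alpha> * b + \<beta> * d = 0" by auto
    hence "\<alpha> * (a * d - b * c) = 0" "\<beta> * (a * d - b * c) = 0" by Groebner_Basis.algebra+
    thus "\<alpha> = 0 \<and> \<beta> = 0" using *(2) by auto
  qed
qed

lemma lattice_interior_image:
  assumes "unimodular \<phi>"
  shows "lattice_interior (\<phi> ` S) = \<phi> ` lattice_interior S"
proof
  obtain \<psi> where \<psi>: "unimodular \<psi>" "\<And>v. \<psi> (\<phi> v) = v" "\<And>v. \<phi> (\<psi> v) = v"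
    using unimodular_inverse[OF assms] by blast
  show "\<phi> ` lattice_interior S \<subseteq> lattice_interior (\<phi> ` S)"
    using lattice_interior_image'[OF assms] by blast
  show "lattice_interior (\<phi> ` S) \<subseteq> \<phi> ` lattice_interior S"
  proof
    fix r assume "r \<in> lattice_interior (\<phi> ` S)"
    from lattice_interior_image'[OF \<psi>(1) this] have "\<psi> r \<in> lattice_interior S"
      by (simp add: image_image \<psi>(2))
    thus "r \<in> \<phi> ` lattice_interior S" by (rule rev_image_eqI) (simp add: \<psi>(3))
  qed
qed

section \<open>Primitive vectors and lattice frames\<close>

definition primitive :: "int \<times> int \<Rightarrow> bool" where
  "primitive v \<longleftrightarrow> coprime (fst v) (snd v)"

lemma primitive_complement:
  assumes "primitive v"
  obtains e where "det2 v e = 1"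
proof -
  obtain s t where "s * fst v + t * snd v = 1"
    using assms bezout_int[of "fst v" "snd v"] by (auto simp: primitive_def)
  hence "det2 v (- t, s) = 1" by (simp add: det2_def algebra_simps)
  thus ?thesis by (rule that)
qed

lemma primitive_multiple:
  assumes "v \<noteq> 0"
  obtains e g where "primitive e" "g \<ge> 1" "fst v = g * fst e" "snd v = g * snd e"
proof -
  define g where "g = gcd (fst v) (snd v)"
  have "fst v \<noteq> 0 \<or> snd v \<noteq> 0" using assms by (auto simp: prod_eq_iff)
  hence g: "g > 0" by (auto simp: g_def)
  have "primitive (fst v div g, snd v div g)"
    using g div_gcd_coprime[of "fst v" "snd v"] by (auto simp: primitive_def g_def)
  moreover have "fst v = g * (fst v div g)" "snd v = g * (snd v div g)" by (auto simp: g_def)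
  ultimately show ?thesis using that[of "(fst v div g, snd v div g)" g] g by auto
qed

lemma primitive_parallel:
  assumes "primitive u" "primitive v" "det2 u v = 0"
  shows "u = v \<or> u = - v"
proof -
  obtain e where e: "det2 u e = 1" using primitive_complement[OF assms(1)] .
  define k where "k = det2 v e"
  have 1: "fst v = k * fst u" "snd v = k * snd u"
    using e assms(3) unfolding k_def det2_def by Groebner_Basis.algebra+
  hence "k dvd fst v" "k dvd snd v" by auto
  hence "is_unit k" using assms(2) unfolding primitive_def by (metis coprime_common_divisor)
  hence "k = 1 \<or> k = -1" by (simp add: zdvd1_eq abs_if split: if_splits)
  thus ?thesis using 1 by (auto simp: prod_eq_iff)
qed

text \<open>Coordinates with origin \<open>q\<close> and basis \<open>u\<close>, \<open>v\<close>.
  The last equation is Cramer's rule, where dividing by the determinant is the same as multiplying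
  by it.\<close>

lemma unimodular_frame:
  assumes "\<bar>det2 u v\<bar> = 1"
  obtains \<phi> where "unimodular \<phi>" "\<And>a b. \<phi> (fst q + a * fst u + b * fst v, snd q + a * snd u + b * snd v) = (a, b)"
    "\<And>w. \<phi> w = (det2 u v * det2 (w - q) v, det2 u v * det2 u (w - q))"
proof -
  define D where "D = det2 u v"
  have "D = 1 \<or> D = -1" using assms by (auto simp: D_def)
  hence DD: "D * D = 1" by auto
  define \<phi> where "\<phi> = affmap (D * snd v) (- D * fst v) (- D * snd u) (D * fst u) (- D * det2 q v) (- D * det2 u q)"
  have "D * snd v * (D * fst u) - - D * fst v * (- D * snd u) = D * D * D"
    by (simp add: D_def det2_def algebra_simps)
  also have "\<dots> = D" using DD by simp
  finally have "unimodular \<phi>" unfolding \<phi>_def using assms by (intro unimodularI) (simp add: D_def)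
  moreover have 1: "\<phi> w = (D * det2 (w - q) v, D * det2 u (w - q))" for w
    by (simp add: \<phi>_def affmap_def det2_def algebra_simps)
  moreover have "\<phi> (fst q + a * fst u + b * fst v, snd q + a * snd u + b * snd v) = (a, b)" for a b
  proof -
    have "D * det2 ((fst q + a * fst u + b * fst v, snd q + a * snd u + b * snd v) - q) v = a * (D * D)"
      "D * det2 u ((fst q + a * fst u + b * fst v, snd q + a * snd u + b * snd v) - q) = b * (D * D)"
      by (simp_all add: D_def det2_def algebra_simps)
    thus ?thesis unfolding 1 using DD by simp
  qed
  ultimately show ?thesis using that unfolding D_def by blast
qed

section \<open>Heights over a lattice segment of length two\<close>

lemma int_quotient:
  fixes A d :: int
  assumes "d > 0"
  obtains m where "0 \<le> A - m * d" "A - m * d < d"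
  using that[of "A div d"] assms by (simp add: minus_div_mult_eq_mod)

text \<open>At height one the triangle with base from \<open>(0, 0)\<close> to \<open>(2, 0)\<close>
  and apex \<open>(a, p)\<close> is the interval that starts at \<open>a / p\<close> and has length
  \<open>(2 * p - 2) / p\<close>. The two inequalities put \<open>k\<close> strictly inside
  it.\<close>

lemma interior_over_segment:
  assumes "(0, 0) \<in> lattice_hull S" "(2, 0) \<in> lattice_hull S" "(a, p) \<in> lattice_hull S"
    and "p \<ge> 1" "0 < k * p - a" "k * p - a < 2 * p - 2"
  shows "(k, 1) \<in> lattice_interior S"
proof (rule lattice_interior_conv)
  \<comment> \<open>Barycentric weights with total \<open>2 * p\<close>.\<close>
  define \<delta> where "\<delta> = k * p - a"
  show "(0, 0) \<in> lattice_hull S" "(2, 0) \<in> lattice_hull S" "(a, p) \<in> lattice_hull S" by fact+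
  show "0 < 2 * p - 2 - \<delta>" "0 < \<delta>" "(0::int) < 2" using assms by (auto simp: \<delta>_def)
  show "(2 * p - 2 - \<delta> + \<delta> + 2) * fst (k, 1) = (2 * p - 2 - \<delta>) * fst (0, 0) + \<delta> * fst (2, 0) + 2 * fst (a, p)"
    "(2 * p - 2 - \<delta> + \<delta> + 2) * snd (k, 1) = (2 * p - 2 - \<delta>) * snd (0, 0) + \<delta> * snd (2, 0) + 2 * snd (a, p)"
    by (simp_all add: \<delta>_def algebra_simps)
  show "det2 ((2, 0) - (0, 0)) ((a, p) - (0, 0)) \<noteq> 0" using assms by (simp add: det2_def)
qed

text \<open>For \<open>p \<ge> 3\<close> the slice at height one is longer than 1 and contains an
  integer in its interior. For \<open>p = 2\<close> its length is exactly 1, and it avoids integers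
  only by starting at one, that is for even \<open>a\<close>.\<close>

lemma height_over_segment:
  assumes h: "(0, 0) \<in> lattice_hull S" "(2, 0) \<in> lattice_hull S" "(a, p) \<in> lattice_hull S"
    and no: "\<And>k. (k, 1) \<notin> lattice_interior S"
  shows "p \<le> 2" "p = 2 \<Longrightarrow> even a"
proof -
  show "p \<le> 2"
  proof (rule ccontr)
    assume p: "\<not> p \<le> 2"
    obtain m where "0 \<le> a - m * p" "a - m * p < p" using int_quotient[of p a] p by auto
    hence "0 < (m + 1) * p - a" "(m + 1) * p - a \<le> p" by (simp_all add: algebra_simps)
    with p have "(m + 1, 1) \<in> lattice_interior S"
      by (intro interior_over_segment[OF h]) auto
    with no show False by blast
  qed
  show "even a" if "p = 2"
  proof (rule ccontr)
    assume "odd a"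
    then obtain k where "a = 2 * k + 1" by (elim oddE)
    with that have "(k + 1, 1) \<in> lattice_interior S"
      by (intro interior_over_segment[OF h]) auto
    with no show False by blast
  qed
qed

lemma unimodular_neg_snd: "unimodular (affmap 1 0 0 (-1) 0 0)"
  by (rule unimodularI) simp

lemma height_under_segment:
  assumes h: "(0, 0) \<in> lattice_hull S" "(2, 0) \<in> lattice_hull S" "(a, -p) \<in> lattice_hull S"
    and no: "\<And>k. (k, -1) \<notin> lattice_interior S"
  shows "p \<le> 2" "p = 2 \<Longrightarrow> even a"
proof -
  let ?\<phi> = "affmap 1 0 0 (-1) 0 0"
  have "(0, 0) \<in> lattice_hull (?\<phi> ` S)" "(2, 0) \<in> lattice_hull (?\<phi> ` S)" "(a, p) \<in> lattice_hull (?\<phi> ` S)"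
    using h[THEN lattice_hull_image[OF unimodular_neg_snd]] by (simp_all add: affmap_def)
  moreover have "(k, 1) \<notin> lattice_interior (?\<phi> ` S)" for k
    unfolding lattice_interior_image[OF unimodular_neg_snd] using no[of k] by (auto simp: affmap_def)
  ultimately show "p \<le> 2" "p = 2 \<Longrightarrow> even a" by (blast dest: height_over_segment)+
qed

text \<open>Each polygon is listed by its corners together with all its lattice points.\<close>

definition genus_one_polygons :: "((int \<times> int) set \<times> (int \<times> int) set) set" where
  "genus_one_polygons =
    {({(0,0), (3,0), (0,2)}, {(0,0), (1,0), (2,0), (3,0), (0,1), (1,1), (0,2)}),
     ({(1,0), (3,0), (0,2)}, {(1,0), (2,0), (3,0), (1,1), (0,2)}),
     ({(0,1), (3,0), (0,2)}, {(0,1), (3,0), (0,2), (1,1)}),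
     ({(0,0), (4,0), (0,2)}, {(0,0), (1,0), (2,0), (3,0), (4,0), (0,1), (1,1), (2,1), (0,2)}),
     ({(0,0), (3,0), (0,3)}, {(0,0), (1,0), (2,0), (3,0), (0,1), (1,1), (2,1), (0,2), (1,2), (0,3)}),
     ({(2,0), (0,1), (3,0), (0,2)}, {(2,0), (0,1), (3,0), (0,2), (1,1)}),
     ({(1,0), (0,1), (3,0), (0,2)}, {(1,0), (2,0), (0,1), (3,0), (0,2), (1,1)}),
     ({(0,0), (2,1), (3,0), (0,2)}, {(0,0), (1,0), (2,0), (3,0), (0,1), (1,1), (2,1), (0,2)}),
     ({(0,0), (2,1), (2,0), (0,2)}, {(0,0), (1,0), (2,0), (0,1), (1,1), (2,1), (0,2)}),
     ({(1,0), (0,1), (2,1), (1,2)}, {(1,0), (0,1), (2,1), (1,2), (1,1)}),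
     ({(0,0), (1,2), (3,0), (0,2)}, {(0,0), (1,0), (2,0), (3,0), (0,1), (1,1), (2,1), (0,2), (1,2)}),
     ({(0,0), (2,0), (0,2), (2,2)}, {(0,0), (1,0), (2,0), (0,1), (1,1), (2,1), (0,2), (1,2), (2,2)})}"

text \<open>All corners must occur in the image and nothing may leave the polygon: this fixes the
  convex hull while leaving the position of a remaining point free.\<close>

definition genus_one_shape :: "(int \<times> int) set \<Rightarrow> bool" where
  "genus_one_shape S \<longleftrightarrow>
     (\<exists>\<phi>. unimodular \<phi> \<and> (\<exists>(P, Q) \<in> genus_one_polygons. P \<subseteq> \<phi> ` S \<and> \<phi> ` S \<subseteq> Q))"

text \<open>The two kinds of polygon without interior lattice points: lattice width at most one, or
  the triangle of conics.\<close>

definition genus_zero_shape :: "(int \<times> int) set \<Rightarrow> bool" where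
  "genus_zero_shape S \<longleftrightarrow>
     (\<exists>\<phi>. unimodular \<phi> \<and> ((\<forall>s\<in>S. snd (\<phi> s) \<in> {0, 1}) \<or>
        ({(0,0), (2,0), (0,2)} \<subseteq> \<phi> ` S \<and> \<phi> ` S \<subseteq> {(0,0), (1,0), (2,0), (0,1), (1,1), (0,2)})))"

lemma genus_one_shape_image:
  assumes "unimodular \<phi>" "genus_one_shape (\<phi> ` S)"
  shows "genus_one_shape S"
proof -
  from assms(2) obtain \<psi> P Q where "unimodular \<psi>" "(P, Q) \<in> genus_one_polygons"
    "P \<subseteq> \<psi> ` \<phi> ` S" "\<psi> ` \<phi> ` S \<subseteq> Q" unfolding genus_one_shape_def by blast
  thus ?thesis unfolding genus_one_shape_def
    by (intro exI[of _ "\<psi> \<circ> \<phi>"] conjI unimodular_comp assms bexI[of _ "(P, Q)"]) (auto simp: image_comp)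
qed

lemma genus_zero_shape_image:
  assumes "unimodular \<phi>" "genus_zero_shape (\<phi> ` S)"
  shows "genus_zero_shape S"
proof -
  from assms(2) obtain \<psi> where "unimodular \<psi>" "(\<forall>s\<in>\<phi> ` S. snd (\<psi> s) \<in> {0, 1}) \<or>
        ({(0,0), (2,0), (0,2)} \<subseteq> \<psi> ` \<phi> ` S \<and> \<psi> ` \<phi> ` S \<subseteq> {(0,0), (1,0), (2,0), (0,1), (1,1), (0,2)})"
    unfolding genus_zero_shape_def by blast
  thus ?thesis unfolding genus_zero_shape_def
    by (intro exI[of _ "\<psi> \<circ> \<phi>"] conjI unimodular_comp assms) (auto simp: image_comp)
qed

text \<open>If \<open>s\<close> were a proper multiple of \<open>e\<close>, then \<open>e\<close>
  would lie strictly between the interior point 0 and the hull point \<open>s\<close>, and would be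
  a second interior point.\<close>

lemma primitive_if_unique_interior:
  assumes 0: "lattice_interior S = {0}" and s: "s \<in> lattice_hull S" "s \<noteq> 0"
  shows "primitive s"
proof -
  obtain e g where eg: "primitive e" "g \<ge> 1" "fst s = g * fst e" "snd s = g * snd e"
    using primitive_multiple[OF s(2)] .
  show ?thesis
  proof (cases "g = 1")
    case True
    thus ?thesis using eg by (simp add: primitive_def)
  next
    case False
    have "e \<in> lattice_interior S"
    proof (rule lattice_interiorI)
      fix \<alpha> \<beta> assume H: "\<And>s. s \<in> lattice_hull S \<Longrightarrow> lin \<alpha> \<beta> e \<le> lin \<alpha> \<beta> s"
      have "lin \<alpha> \<beta> e \<le> g * lin \<alpha> \<beta> e" using H[OF s(1)] by (simp add: lin_def eg algebra_simps)
      hence "0 \<le> (g - 1) * lin \<alpha> \<beta> e" by (simp add: algebra_simps)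
      hence "0 \<le> lin \<alpha> \<beta> e" using False eg(2) by (simp add: zero_le_mult_iff)
      hence "\<And>s. s \<in> S \<Longrightarrow> lin \<alpha> \<beta> 0 \<le> lin \<alpha> \<beta> s"
        using H[OF subset_lattice_hull] by (force simp: lin_def)
      from lattice_interiorD[OF _ this] show "\<alpha> = 0 \<and> \<beta> = 0" using 0 by blast
    qed
    hence "e = 0" using 0 by blast
    thus ?thesis using eg s(2) by (simp add: prod_eq_iff)
  qed
qed

section \<open>Polygons without interior lattice points\<close>

lemma card_four_cover:
  assumes "finite S" "card S \<le> 4" "p \<in> S" "q \<in> S" "r \<in> S" "distinct [p, q, r]"
  obtains w where "w \<in> S" "S = {p, q, r, w}"
proof -
  have "card (S - {p, q, r}) \<le> 1" using assms by (subst card_Diff_subset) auto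
  hence "S - {p, q, r} = {} \<or> (\<exists>w. S - {p, q, r} = {w})"
    using assms(1) by (metis One_nat_def card_0_eq card_1_singletonE finite_Diff le_SucE le_zero_eq)
  thus ?thesis
  proof
    assume "S - {p, q, r} = {}"
    hence "S = {p, q, r, p}" using assms(3-5) by auto
    thus ?thesis using assms(3) that by blast
  next
    assume "\<exists>w. S - {p, q, r} = {w}"
    then obtain w where "S - {p, q, r} = {w}" by blast
    hence "S = {p, q, r, w}" "w \<in> S" using assms(3-5) by auto
    thus ?thesis using that by blast
  qed
qed

text \<open>Two hull points congruent modulo 2 span a lattice segment of length at least two, which
  bounds the height of everything above it. Without such a pair all hull segments are primitive,
  every proper triangle in \<open>S\<close> is unimodular, and the fourth point is confined to a few
  positions.\<close>

lemma hollow_genus_zero_shape: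
  assumes empty: "lattice_interior S = {}" and S: "finite S" "card S \<le> 4"
    and nc: "v0 \<in> S" "v1 \<in> S" "v2 \<in> S" "det2 (v1 - v0) (v2 - v0) \<noteq> 0"
  shows "genus_zero_shape S"
proof (cases "\<exists>u\<in>lattice_hull S. \<exists>w\<in>lattice_hull S. u \<noteq> w \<and> even (fst u - fst w) \<and> even (snd u - snd w)")
  case True
  then obtain u w where uw: "u \<in> lattice_hull S" "w \<in> lattice_hull S" "u \<noteq> w"
    "even (fst w - fst u)" "even (snd w - snd u)" by auto
  obtain e g where eg: "primitive e" "g \<ge> 1" "fst (w - u) = g * fst e" "snd (w - u) = g * snd e"
    using primitive_multiple[of "w - u"] uw by auto
  have "even g"
  proof (rule ccontr)
    assume "odd g"
    hence "even (fst e)" "even (snd e)" using eg(3,4) uw(4,5) by (metis even_mult_iff fst_diff snd_diff)+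
    thus False using eg(1) unfolding primitive_def by (metis coprime_common_divisor odd_one)
  qed
  hence g2: "g \<ge> 2" using eg(2) by (cases "g = 1") auto
  define u2 where "u2 = (fst u + 2 * fst e, snd u + 2 * snd e)"
  have u2: "u2 \<in> lattice_hull S"
    by (rule lattice_hull_conv[OF uw(1,2,2), where a = "g - 2" and b = 2 and c = 0 and n = g])
       (use eg g2 in \<open>auto simp: u2_def algebra_simps\<close>)
  obtain e' where e': "det2 e e' = 1" using primitive_complement[OF eg(1)] .
  obtain \<phi> where \<phi>: "unimodular \<phi>" "\<And>a b. \<phi> (fst u + a * fst e + b * fst e', snd u + a * snd e + b * snd e') = (a, b)"
    using unimodular_frame[of e e' u] e' by (metis abs_one)
  have base: "(0, 0) \<in> lattice_hull (\<phi> ` S)" "(2, 0) \<in> lattice_hull (\<phi> ` S)"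
    using lattice_hull_image[OF \<phi>(1) uw(1)] lattice_hull_image[OF \<phi>(1) u2] \<phi>(2)[of 0 0] \<phi>(2)[of 2 0]
    by (simp_all add: u2_def)
  have emp: "lattice_interior (\<phi> ` S) = {}" using empty by (simp add: lattice_interior_image[OF \<phi>(1)])
  \<comment> \<open>The midpoint of the segment is not interior, so \<open>S\<close> lies on one
    side of it; a reflection makes this the upper side.\<close>
  obtain \<psi> where \<psi>: "unimodular \<psi>" "(0, 0) \<in> lattice_hull (\<psi> ` S)" "(2, 0) \<in> lattice_hull (\<psi> ` S)"
      "lattice_interior (\<psi> ` S) = {}" "\<And>s. s \<in> \<psi> ` S \<Longrightarrow> snd s \<ge> 0"
  proof (cases "\<forall>s\<in>\<phi> ` S. snd s \<ge> 0")
    case True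
    thus ?thesis using that[of \<phi>] \<phi>(1) base emp by blast
  next
    case False
    then obtain s1 where s1: "s1 \<in> \<phi> ` S" "snd s1 < 0" by (meson not_le)
    have neg: "snd s \<le> 0" if "s \<in> \<phi> ` S" for s
    proof (rule ccontr)
      assume "\<not> snd s \<le> 0"
      hence s: "snd s > 0" by simp
      have "(1, 0) \<in> lattice_interior (\<phi> ` S)"
      proof (rule lattice_interiorI)
        fix \<alpha> \<beta> assume H: "\<And>s. s \<in> lattice_hull (\<phi> ` S) \<Longrightarrow> lin \<alpha> \<beta> (1, 0) \<le> lin \<alpha> \<beta> s"
        have "\<alpha> = 0" using H[OF base(1)] H[OF base(2)] by (simp add: lin_def)
        moreover have "\<beta> = 0" using H[OF subset_lattice_hull[OF that]] H[OF subset_lattice_hull[OF s1(1)]] s s1(2)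
          \<open>\<alpha> = 0\<close> by (auto simp: lin_def zero_le_mult_iff)
        ultimately show "\<alpha> = 0 \<and> \<beta> = 0" by simp
      qed
      thus False using emp by blast
    qed
    let ?\<nu> = "affmap 1 0 0 (-1) 0 0"
    have im: "(?\<nu> \<circ> \<phi>) ` S = ?\<nu> ` \<phi> ` S" by (simp add: image_comp)
    show ?thesis
    proof (rule that[of "?\<nu> \<circ> \<phi>"], unfold im)
      show "unimodular (?\<nu> \<circ> \<phi>)" by (intro unimodular_comp unimodular_neg_snd \<phi>(1))
      show "(0, 0) \<in> lattice_hull (?\<nu> ` \<phi> ` S)" "(2, 0) \<in> lattice_hull (?\<nu> ` \<phi> ` S)"
        using base[THEN lattice_hull_image[OF unimodular_neg_snd]] by (simp_all add: affmap_def)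
      show "lattice_interior (?\<nu> ` \<phi> ` S) = {}" by (simp add: lattice_interior_image[OF unimodular_neg_snd] emp)
      fix s assume "s \<in> ?\<nu> ` \<phi> ` S"
      then obtain r where "r \<in> \<phi> ` S" "s = ?\<nu> r" by blast
      thus "snd s \<ge> 0" using neg[of r] by (simp add: affmap_def)
    qed
  qed
  have "genus_zero_shape (\<psi> ` S)"
  proof (cases "\<forall>s\<in>\<psi> ` S. snd s \<le> 1")
    case True
    \<comment> \<open>This map is the identity.\<close>
    have "unimodular (affmap 1 0 0 1 0 0)" by (rule unimodularI) simp
    moreover have "\<forall>s\<in>\<psi> ` S. snd (affmap 1 0 0 1 0 0 s) \<in> {0, 1}"
    proof
      fix s assume "s \<in> \<psi> ` S"
      hence "0 \<le> snd s" "snd s \<le> 1" using True \<psi>(5) by blast+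
      thus "snd (affmap 1 0 0 1 0 0 s) \<in> {0, 1}" by (auto simp: affmap_def)
    qed
    ultimately show ?thesis unfolding genus_zero_shape_def by blast
  next
    case False
    have hts: "snd s \<le> 2" "snd s = 2 \<Longrightarrow> even (fst s)" if "s \<in> \<psi> ` S" for s
    proof -
      have "(fst s, snd s) \<in> lattice_hull (\<psi> ` S)" using subset_lattice_hull[OF that] by simp
      from height_over_segment[OF \<psi>(2,3) this] show "snd s \<le> 2" "snd s = 2 \<Longrightarrow> even (fst s)"
        using \<psi>(4) by blast+
    qed
    obtain s where s': "s \<in> \<psi> ` S" "\<not> snd s \<le> 1" using False by blast
    hence s: "s \<in> \<psi> ` S" "snd s = 2" using hts(1)[of s] by auto
    define k where "k = fst s div 2"
    have k: "fst s = 2 * k" using hts(2)[OF s] by (simp add: k_def)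
    \<comment> \<open>The apex has even abscissa, so a shear fixing the base moves it to
      \<open>(0, 2)\<close>. Then \<open>(0, 1)\<close> and \<open>(1, 1)\<close> are the midpoints
      of the other two sides, and their not being interior confines the image to the
      triangle.\<close>
    define \<sigma> where "\<sigma> = affmap 1 (- k) 0 1 0 0"
    define T where "T = \<sigma> ` \<psi> ` S"
    have \<sigma>: "unimodular \<sigma>" unfolding \<sigma>_def by (rule unimodularI) simp
    have "\<sigma> s = (0, 2)" using s k by (simp add: \<sigma>_def affmap_def)
    hence T02: "(0, 2) \<in> T" using s(1) unfolding T_def by force
    have T: "(0, 0) \<in> lattice_hull T" "(2, 0) \<in> lattice_hull T" "lattice_interior T = {}"
      using lattice_hull_image[OF \<sigma> \<psi>(2)] lattice_hull_image[OF \<sigma> \<psi>(3)] lattice_interior_image[OF \<sigma>] \<psi>(4)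
      by (simp_all add: T_def \<sigma>_def affmap_def)
    have T_snd: "0 \<le> snd s \<and> snd s \<le> 2" if "s \<in> T" for s
    proof -
      from that[unfolded T_def] obtain r where r: "s = \<sigma> r" "r \<in> \<psi> ` S" by (rule imageE)
      have "snd s = snd r" by (simp add: r(1) \<sigma>_def affmap_def)
      thus ?thesis using \<psi>(5)[OF r(2)] hts(1)[OF r(2)] by simp
    qed
    have T_fst: "0 \<le> fst s" if "s \<in> T" for s
    proof (rule ccontr)
      assume neg: "\<not> 0 \<le> fst s"
      have "(0, 1) \<in> lattice_interior T"
      proof (rule lattice_interiorI)
        fix \<alpha> \<beta> assume H: "\<And>s. s \<in> lattice_hull T \<Longrightarrow> lin \<alpha> \<beta> (0, 1) \<le> lin \<alpha> \<beta> s"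
        have "\<beta> = 0" using H[OF T(1)] H[OF subset_lattice_hull[OF T02]] by (simp add: lin_def)
        moreover have "\<alpha> \<ge> 0" using H[OF T(2)] \<open>\<beta> = 0\<close> by (simp add: lin_def)
        moreover have "\<alpha> * fst s \<ge> 0" using H[OF subset_lattice_hull[OF that]] \<open>\<beta> = 0\<close> by (simp add: lin_def)
        ultimately show "\<alpha> = 0 \<and> \<beta> = 0" using neg by (auto simp: zero_le_mult_iff)
      qed
      thus False using T(3) by blast
    qed
    have T_sum: "fst s + snd s \<le> 2" if "s \<in> T" for s
    proof (rule ccontr)
      assume neg: "\<not> fst s + snd s \<le> 2"
      have "(1, 1) \<in> lattice_interior T"
      proof (rule lattice_interiorI)
        fix \<alpha> \<beta> assume H: "\<And>s. s \<in> lattice_hull T \<Longrightarrow> lin \<alpha> \<beta> (1, 1) \<le> lin \<alpha> \<beta> s"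
        have "\<alpha> = \<beta>" using H[OF T(2)] H[OF subset_lattice_hull[OF T02]] by (simp add: lin_def)
        moreover have "\<alpha> \<le> 0" using H[OF T(1)] \<open>\<alpha> = \<beta>\<close> by (simp add: lin_def)
        moreover have "\<alpha> * (fst s + snd s - 2) \<ge> 0" using H[OF subset_lattice_hull[OF that]] \<open>\<alpha> = \<beta>\<close>
          by (simp add: lin_def algebra_simps)
        ultimately show "\<alpha> = 0 \<and> \<beta> = 0" using neg by (auto simp: zero_le_mult_iff)
      qed
      thus False using T(3) by blast
    qed
    have sub: "T \<subseteq> {(0,0), (1,0), (2,0), (0,1), (1,1), (0,2)}"
    proof
      fix s assume "s \<in> T"
      from T_fst[OF this] T_sum[OF this] T_snd[OF this]
      have "fst s \<in> {0, 1, 2} \<and> snd s \<in> {0, 1, 2} \<and> fst s + snd s \<le> 2" by auto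
      thus "s \<in> {(0,0), (1,0), (2,0), (0,1), (1,1), (0,2)}" by (cases s) auto
    qed
    \<comment> \<open>A corner of the triangle that belongs to the hull must belong to
      \<open>T\<close> itself, as one functional separates it from the other lattice points.\<close>
    have "(0, 0) \<in> T"
    proof (rule ccontr)
      assume "(0, 0) \<notin> T"
      hence "\<And>s. s \<in> T \<Longrightarrow> 1 \<le> lin 1 1 s" using sub by (fastforce simp: lin_def)
      from lattice_hullD[OF T(1) this] show False by (simp add: lin_def)
    qed
    moreover have "(2, 0) \<in> T"
    proof (rule ccontr)
      assume "(2, 0) \<notin> T"
      hence "\<And>s. s \<in> T \<Longrightarrow> -1 \<le> lin (-1) 0 s" using sub by (fastforce simp: lin_def)
      from lattice_hullD[OF T(2) this] show False by (simp add: lin_def)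
    qed
    ultimately have "{(0,0), (2,0), (0,2)} \<subseteq> \<sigma> ` \<psi> ` S" using T02 by (simp add: T_def)
    thus ?thesis using sub \<sigma> unfolding genus_zero_shape_def T_def by blast
  qed
  thus ?thesis by (rule genus_zero_shape_image[OF \<psi>(1)])
next
  case False
  have edge: "primitive (v - u)" if "u \<in> lattice_hull S" "v \<in> lattice_hull S" "u \<noteq> v" for u v
  proof -
    obtain e g where eg: "primitive e" "g \<ge> 1" "fst (v - u) = g * fst e" "snd (v - u) = g * snd e"
      using primitive_multiple[of "v - u"] \<open>u \<noteq> v\<close> by auto
    show ?thesis
    proof (cases "g = 1")
      case True
      thus ?thesis using eg by (simp add: primitive_def)
    next
      case g: False
      define u2 where "u2 = (fst u + 2 * fst e, snd u + 2 * snd e)"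
      have u2: "u2 \<in> lattice_hull S"
        by (rule lattice_hull_conv[OF that(1,2,2), where a = "g - 2" and b = 2 and c = 0 and n = g])
           (use eg g in \<open>auto simp: u2_def algebra_simps\<close>)
      have "u2 \<noteq> u"
      proof
        assume "u2 = u"
        hence "fst e = 0" "snd e = 0" by (auto simp: u2_def prod_eq_iff)
        thus False using eg(1) by (simp add: primitive_def)
      qed
      moreover have "even (fst u2 - fst u)" "even (snd u2 - snd u)" by (simp_all add: u2_def)
      ultimately show ?thesis using False u2 that(1) by blast
    qed
  qed
  \<comment> \<open>If the determinant is \<open>d \<ge> 2\<close>, take the lattice point
    \<open>r\<close> at height one over the edge from \<open>u\<close> to \<open>v\<close>. For
    \<open>t = d\<close> or \<open>t = d - 1\<close> the vector \<open>w - u\<close> or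
    \<open>w - v\<close> is divisible by \<open>d\<close>, contrary to primitivity; for smaller
    \<open>t\<close> the point \<open>r\<close> is interior.\<close>
  have pos: "det2 (v - u) (w - u) \<le> 1" if h: "u \<in> S" "v \<in> S" "w \<in> S" for u v w
  proof (rule ccontr)
    define d where "d = det2 (v - u) (w - u)"
    assume "\<not> det2 (v - u) (w - u) \<le> 1"
    hence d: "d \<ge> 2" by (simp add: d_def)
    note hu = h[THEN subset_lattice_hull]
    have ne: "u \<noteq> v" "u \<noteq> w" "v \<noteq> w" using d by (auto simp: d_def det2_def)
    obtain e where e: "det2 (v - u) e = 1" using primitive_complement[OF edge[OF hu(1,2) ne(1)]] .
    define A where "A = det2 (w - u) e"
    have w: "fst (w - u) = A * fst (v - u) + d * fst e" "snd (w - u) = A * snd (v - u) + d * snd e"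
      using e unfolding A_def d_def det2_def by Groebner_Basis.algebra+
    obtain m where m: "0 \<le> A - m * d" "A - m * d < d" using int_quotient[of d A] d by auto
    define k where "k = m + 1"
    define r where "r = (fst u + k * fst (v - u) + fst e, snd u + k * snd (v - u) + snd e)"
    define t where "t = k * d - A"
    have t: "0 < t" "t \<le> d" using m by (auto simp: t_def k_def algebra_simps)
    have dr: "d * fst r = (d - 1 - t) * fst u + t * fst v + fst w" "d * snd r = (d - 1 - t) * snd u + t * snd v + snd w"
      using w by (auto simp: r_def t_def algebra_simps)
    consider "t = d" | "t = d - 1" | "t < d - 1" using t by linarith
    thus False
    proof cases
      case 1
      hence "A = (k - 1) * d" by (simp add: t_def algebra_simps)
      hence "fst (w - u) = d * ((k - 1) * fst (v - u) + fst e)" "snd (w - u) = d * ((k - 1) * snd (v - u) + snd e)"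
        unfolding w by Groebner_Basis.algebra+
      hence "d dvd fst (w - u)" "d dvd snd (w - u)" by auto
      moreover have "coprime (fst (w - u)) (snd (w - u))" using edge[OF hu(1,3) ne(2)] by (simp add: primitive_def)
      ultimately have "is_unit d" by (metis coprime_common_divisor)
      thus False using d by auto
    next
      case 2
      have "fst (w - v) = d * (fst r - fst v)" "snd (w - v) = d * (snd r - snd v)"
        using dr 2 by (auto simp: algebra_simps)
      hence "d dvd fst (w - v)" "d dvd snd (w - v)" by auto
      moreover have "coprime (fst (w - v)) (snd (w - v))" using edge[OF hu(2,3) ne(3)] by (simp add: primitive_def)
      ultimately have "is_unit d" by (metis coprime_common_divisor)
      thus False using d by auto
    next
      case 3
      have "r \<in> lattice_interior S"
        by (rule lattice_interior_conv[OF hu, where a = "d - 1 - t" and b = t and c = 1])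
           (use 3 t d dr in \<open>auto simp: d_def\<close>)
      thus False using empty by blast
    qed
  qed
  have le1: "\<bar>det2 (v - u) (w - u)\<bar> \<le> 1" if "u \<in> S" "v \<in> S" "w \<in> S" for u v w
    using pos[OF that] pos[OF that(1,3,2)] by (auto simp: det2_def abs_le_iff algebra_simps)
  have D: "\<bar>det2 (v1 - v0) (v2 - v0)\<bar> = 1" using le1[OF nc(1-3)] nc(4) by linarith
  obtain \<phi> where \<phi>: "unimodular \<phi>" "\<And>a b. \<phi> (fst v0 + a * fst (v1 - v0) + b * fst (v2 - v0), snd v0 + a * snd (v1 - v0) + b * snd (v2 - v0)) = (a, b)"
    "\<And>w. \<phi> w = (det2 (v1 - v0) (v2 - v0) * det2 (w - v0) (v2 - v0), det2 (v1 - v0) (v2 - v0) * det2 (v1 - v0) (w - v0))"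
    using unimodular_frame[OF D] by metis
  have v: "\<phi> v0 = (0, 0)" "\<phi> v1 = (1, 0)" "\<phi> v2 = (0, 1)"
    using \<phi>(2)[of 0 0] \<phi>(2)[of 1 0] \<phi>(2)[of 0 1] by simp_all
  have "distinct [v0, v1, v2]" using nc(4) by (auto simp: det2_def)
  then obtain w where w: "w \<in> S" "S = {v0, v1, v2, w}" using card_four_cover[OF S nc(1-3)] by blast
  show ?thesis
  proof (cases "w \<in> S")
    case False
    hence "\<forall>s\<in>S. snd (\<phi> s) \<in> {0, 1}" using w v by auto
    thus ?thesis using \<phi>(1) unfolding genus_zero_shape_def by blast
  next
    case True
    define a b where "a = fst (\<phi> w)" "b = snd (\<phi> w)"
    have b: "\<bar>b\<bar> \<le> 1" using le1[OF nc(1,2) True] D by (simp add: a_b_def \<phi>(3) abs_mult)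
    have a: "\<bar>a\<bar> \<le> 1" using le1[OF nc(1) True nc(3)] D by (simp add: a_b_def \<phi>(3) abs_mult)
    \<comment> \<open>The triangle on \<open>v1\<close>, \<open>v2\<close>, \<open>w\<close> has
      determinant \<open>a + b - 1\<close> up to sign. Its bound excludes that both coordinates are
      \<open>-1\<close>.\<close>
    have "a + b - 1 = - det2 (v1 - v0) (v2 - v0) * det2 (v1 - w) (v2 - w) + (det2 (v1 - v0) (v2 - v0) * det2 (v1 - v0) (v2 - v0) - 1)"
      by (simp add: a_b_def \<phi>(3) det2_def algebra_simps)
    moreover have "det2 (v1 - v0) (v2 - v0) * det2 (v1 - v0) (v2 - v0) = 1"
      using D by (auto simp: abs_if split: if_splits)
    ultimately have "a + b - 1 = - det2 (v1 - v0) (v2 - v0) * det2 (v1 - w) (v2 - w)" by simp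
    hence ab: "\<bar>a + b - 1\<bar> \<le> 1" using le1[OF True nc(2,3)] D by (simp add: abs_mult)
    have "b \<in> {0, 1} \<or> a \<in> {0, 1}" using a b ab by auto
    thus ?thesis
    proof
      assume "b \<in> {0, 1}"
      hence "\<forall>s\<in>S. snd (\<phi> s) \<in> {0, 1}" using w v by (auto simp: a_b_def)
      thus ?thesis using \<phi>(1) unfolding genus_zero_shape_def by blast
    next
      assume "a \<in> {0, 1}"
      hence "\<forall>s\<in>S. snd ((affmap 0 1 1 0 0 0 \<circ> \<phi>) s) \<in> {0, 1}" using w v by (auto simp: a_b_def affmap_def)
      moreover have "unimodular (affmap 0 1 1 0 0 0)" by (rule unimodularI) simp
      hence "unimodular (affmap 0 1 1 0 0 0 \<circ> \<phi>)" using \<phi>(1) by (rule unimodular_comp)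
      ultimately show ?thesis unfolding genus_zero_shape_def by blast
    qed
  qed
qed


text \<open>Instantiations list the entries in the order \<open>a\<close>, \<open>d\<close>,
  \<open>b\<close>, \<open>c\<close>, \<open>e\<close>, \<open>f\<close> of their first occurrence
  here: diagonal, off-diagonal, translation.\<close>

lemma genus_one_shapeI:
  assumes "\<bar>a * d - b * c\<bar> = 1" "(P, Q) \<in> genus_one_polygons" "P \<subseteq> affmap a b c d e f ` S" "affmap a b c d e f ` S \<subseteq> Q"
  shows "genus_one_shape S"
  using assms unimodularI[OF assms(1)] unfolding genus_one_shape_def by blast


text \<open>Numbered like the twelve polygons of the theorem, so that \<open>polygon_mem(n)\<close>
  selects the target.\<close>

lemma polygon_mem:
  shows "({(0,0), (3,0), (0,2)}, {(0,0), (1,0), (2,0), (3,0), (0,1), (1,1), (0,2)}) \<in> genus_one_polygons"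
    and "({(1,0), (3,0), (0,2)}, {(1,0), (2,0), (3,0), (1,1), (0,2)}) \<in> genus_one_polygons"
    and "({(0,1), (3,0), (0,2)}, {(0,1), (3,0), (0,2), (1,1)}) \<in> genus_one_polygons"
    and "({(0,0), (4,0), (0,2)}, {(0,0), (1,0), (2,0), (3,0), (4,0), (0,1), (1,1), (2,1), (0,2)}) \<in> genus_one_polygons"
    and "({(0,0), (3,0), (0,3)}, {(0,0), (1,0), (2,0), (3,0), (0,1), (1,1), (2,1), (0,2), (1,2), (0,3)}) \<in> genus_one_polygons"
    and "({(2,0), (0,1), (3,0), (0,2)}, {(2,0), (0,1), (3,0), (0,2), (1,1)}) \<in> genus_one_polygons"
    and "({(1,0), (0,1), (3,0), (0,2)}, {(1,0), (2,0), (0,1), (3,0), (0,2), (1,1)}) \<in> genus_one_polygons"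
    and "({(0,0), (2,1), (3,0), (0,2)}, {(0,0), (1,0), (2,0), (3,0), (0,1), (1,1), (2,1), (0,2)}) \<in> genus_one_polygons"
    and "({(0,0), (2,1), (2,0), (0,2)}, {(0,0), (1,0), (2,0), (0,1), (1,1), (2,1), (0,2)}) \<in> genus_one_polygons"
    and "({(1,0), (0,1), (2,1), (1,2)}, {(1,0), (0,1), (2,1), (1,2), (1,1)}) \<in> genus_one_polygons"
    and "({(0,0), (1,2), (3,0), (0,2)}, {(0,0), (1,0), (2,0), (3,0), (0,1), (1,1), (2,1), (0,2), (1,2)}) \<in> genus_one_polygons"
    and "({(0,0), (2,0), (0,2), (2,2)}, {(0,0), (1,0), (2,0), (0,1), (1,1), (2,1), (0,2), (1,2), (2,2)}) \<in> genus_one_polygons"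
  unfolding genus_one_polygons_def
  by (rule insertI1, rule insertI2, rule insertI1,
    rule insertI2, rule insertI2, rule insertI1,
    rule insertI2, rule insertI2, rule insertI2, rule insertI1,
    rule insertI2, rule insertI2, rule insertI2, rule insertI2, rule insertI1,
    rule insertI2, rule insertI2, rule insertI2, rule insertI2, rule insertI2, rule insertI1,
    rule insertI2, rule insertI2, rule insertI2, rule insertI2, rule insertI2, rule insertI2, rule insertI1,
    rule insertI2, rule insertI2, rule insertI2, rule insertI2, rule insertI2, rule insertI2, rule insertI2, rule insertI1,
    rule insertI2, rule insertI2, rule insertI2, rule insertI2, rule insertI2, rule insertI2, rule insertI2, rule insertI2, rule insertI1,
    rule insertI2, rule insertI2, rule insertI2, rule insertI2, rule insertI2, rule insertI2, rule insertI2, rule insertI2, rule insertI2, rule insertI1,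
    rule insertI2, rule insertI2, rule insertI2, rule insertI2, rule insertI2, rule insertI2, rule insertI2, rule insertI2, rule insertI2, rule insertI2, rule insertI1,
    rule insertI2, rule insertI2, rule insertI2, rule insertI2, rule insertI2, rule insertI2, rule insertI2, rule insertI2, rule insertI2, rule insertI2, rule insertI2, rule insertI1)

text \<open>This lemma and the next five treat the configurations of
  \<open>flat_genus_one_shape\<close>: heights between \<open>-1\<close> and 1, with the hull
  meeting the axis exactly in the segment from 0 to 2. The affine maps come from matching
  corners.\<close>

lemma shape_a:
  assumes "0 \<le> x" "x \<le> 4"
  shows "genus_one_shape {(0, 0), (2, 0), (0, 1), (x, -1)}"
proof -
  consider "x = 0" | "x = 1" | "x = 2" | "x = 3" | "x = 4" using assms by linarith
  thus ?thesis
  proof cases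
    case 1
    have "genus_one_shape {(0, 0), (2, 0), (0, 1), (0, -1)}"
      by (rule genus_one_shapeI[OF _ polygon_mem(2), of "-1" 0 "-1" 1 2 0]) (auto simp: affmap_def)
    thus ?thesis by (simp add: 1)
  next
    case 2
    have "genus_one_shape {(0, 0), (2, 0), (0, 1), (1, -1)}"
      by (rule genus_one_shapeI[OF _ polygon_mem(6), of "-1" 0 1 1 2 0]) (auto simp: affmap_def)
    thus ?thesis by (simp add: 2)
  next
    case 3
    have "genus_one_shape {(0, 0), (2, 0), (0, 1), (2, -1)}"
      by (rule genus_one_shapeI[OF _ polygon_mem(10), of "-1" "-1" "-1" 0 2 1]) (auto simp: affmap_def)
    thus ?thesis by (simp add: 3)
  next
    case 4
    have "genus_one_shape {(0, 0), (2, 0), (0, 1), (3, -1)}"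
      by (rule genus_one_shapeI[OF _ polygon_mem(6), of 1 "-1" 0 "-1" 0 2]) (auto simp: affmap_def)
    thus ?thesis by (simp add: 4)
  next
    case 5
    have "genus_one_shape {(0, 0), (2, 0), (0, 1), (4, -1)}"
      by (rule genus_one_shapeI[OF _ polygon_mem(2), of 1 "-2" 1 "-1" 0 2]) (auto simp: affmap_def)
    thus ?thesis by (simp add: 5)
  qed
qed

lemma shape_b:
  assumes "1 \<le> x" "x \<le> 4"
  shows "genus_one_shape {(0, 0), (0, 1), (x, 1), (4 - x, -1)}"
proof -
  consider "x = 1" | "x = 2" | "x = 3" | "x = 4" using assms by linarith
  thus ?thesis
  proof cases
    case 1
    have "genus_one_shape {(0, 0), (0, 1), (1, 1), (3, -1)}"
      by (rule genus_one_shapeI[OF _ polygon_mem(7), of 1 "-1" 0 "-1" 0 2]) (auto simp: affmap_def)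
    thus ?thesis by (simp add: 1)
  next
    case 2
    have "genus_one_shape {(0, 0), (0, 1), (2, 1), (2, -1)}"
      by (rule genus_one_shapeI[OF _ polygon_mem(9), of "-1" "-1" 0 0 2 1]) (auto simp: affmap_def)
    thus ?thesis by (simp add: 2)
  next
    case 3
    have "genus_one_shape {(0, 0), (0, 1), (3, 1), (1, -1)}"
      by (rule genus_one_shapeI[OF _ polygon_mem(8), of "-1" "-1" 1 0 2 1]) (auto simp: affmap_def)
    thus ?thesis by (simp add: 3)
  next
    case 4
    have "genus_one_shape {(0, 0), (0, 1), (4, 1), (0, -1)}"
      by (rule genus_one_shapeI[OF _ polygon_mem(4), of 1 "-1" 0 0 0 1]) (auto simp: affmap_def)
    thus ?thesis by (simp add: 4)
  qed
qed

lemma shape_b0: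
  assumes "0 \<le> x" "x \<le> 4"
  shows "genus_one_shape {(0, 0), (0, 1), (4, -1), (x, -1)}"
proof -
  consider "x = 0" | "x = 1" | "x = 2" | "x = 3" | "x = 4" using assms by linarith
  thus ?thesis
  proof cases
    case 1
    have "genus_one_shape {(0, 0), (0, 1), (4, -1), (0, -1)}"
      by (rule genus_one_shapeI[OF _ polygon_mem(4), of 1 1 0 0 0 1]) (auto simp: affmap_def)
    thus ?thesis by (simp add: 1)
  next
    case 2
    have "genus_one_shape {(0, 0), (0, 1), (4, -1), (1, -1)}"
      by (rule genus_one_shapeI[OF _ polygon_mem(8), of "-1" 1 "-2" 0 2 1]) (auto simp: affmap_def)
    thus ?thesis by (simp add: 2)
  next
    case 3
    have "genus_one_shape {(0, 0), (0, 1), (4, -1), (2, -1)}"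
      by (rule genus_one_shapeI[OF _ polygon_mem(9), of "-1" 1 "-2" 0 2 1]) (auto simp: affmap_def)
    thus ?thesis by (simp add: 3)
  next
    case 4
    have "genus_one_shape {(0, 0), (0, 1), (4, -1), (3, -1)}"
      by (rule genus_one_shapeI[OF _ polygon_mem(7), of 1 "-2" 3 "-1" 0 2]) (auto simp: affmap_def)
    thus ?thesis by (simp add: 4)
  next
    case 5
    have "genus_one_shape {(0, 0), (0, 1), (4, -1), (4, -1)}"
      by (rule genus_one_shapeI[OF _ polygon_mem(2), of 1 "-2" 1 "-1" 0 2]) (auto simp: affmap_def)
    thus ?thesis by (simp add: 5)
  qed
qed

lemma shape_c_top:
  assumes "0 \<le> x" "x \<le> 4"
  shows "genus_one_shape {(0, 1), (0, -1), (2, 0), (x, 1)}"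
proof -
  consider "x = 0" | "x = 1" | "x = 2" | "x = 3" | "x = 4" using assms by linarith
  thus ?thesis
  proof cases
    case 1
    have "genus_one_shape {(0, 1), (0, -1), (2, 0), (0, 1)}"
      by (rule genus_one_shapeI[OF _ polygon_mem(2), of "-1" 0 "-1" 1 2 0]) (auto simp: affmap_def)
    thus ?thesis by (simp add: 1)
  next
    case 2
    have "genus_one_shape {(0, 1), (0, -1), (2, 0), (1, 1)}"
      by (rule genus_one_shapeI[OF _ polygon_mem(7), of "-1" 0 "-1" 1 2 0]) (auto simp: affmap_def)
    thus ?thesis by (simp add: 2)
  next
    case 3
    have "genus_one_shape {(0, 1), (0, -1), (2, 0), (2, 1)}"
      by (rule genus_one_shapeI[OF _ polygon_mem(9), of 1 "-1" 0 0 0 1]) (auto simp: affmap_def)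
    thus ?thesis by (simp add: 3)
  next
    case 4
    have "genus_one_shape {(0, 1), (0, -1), (2, 0), (3, 1)}"
      by (rule genus_one_shapeI[OF _ polygon_mem(8), of 1 "-1" 0 0 0 1]) (auto simp: affmap_def)
    thus ?thesis by (simp add: 4)
  next
    case 5
    have "genus_one_shape {(0, 1), (0, -1), (2, 0), (4, 1)}"
      by (rule genus_one_shapeI[OF _ polygon_mem(4), of 1 "-1" 0 0 0 1]) (auto simp: affmap_def)
    thus ?thesis by (simp add: 5)
  qed
qed

lemma shape_c_bottom:
  assumes "0 \<le> x" "x \<le> 4"
  shows "genus_one_shape {(0, 1), (0, -1), (2, 0), (x, -1)}"
proof -
  consider "x = 0" | "x = 1" | "x = 2" | "x = 3" | "x = 4" using assms by linarith
  thus ?thesis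
  proof cases
    case 1
    have "genus_one_shape {(0, 1), (0, -1), (2, 0), (0, -1)}"
      by (rule genus_one_shapeI[OF _ polygon_mem(2), of "-1" 0 "-1" 1 2 0]) (auto simp: affmap_def)
    thus ?thesis by (simp add: 1)
  next
    case 2
    have "genus_one_shape {(0, 1), (0, -1), (2, 0), (1, -1)}"
      by (rule genus_one_shapeI[OF _ polygon_mem(7), of "-1" 0 1 1 2 0]) (auto simp: affmap_def)
    thus ?thesis by (simp add: 2)
  next
    case 3
    have "genus_one_shape {(0, 1), (0, -1), (2, 0), (2, -1)}"
      by (rule genus_one_shapeI[OF _ polygon_mem(9), of 1 1 0 0 0 1]) (auto simp: affmap_def)
    thus ?thesis by (simp add: 3)
  next
    case 4
    have "genus_one_shape {(0, 1), (0, -1), (2, 0), (3, -1)}"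
      by (rule genus_one_shapeI[OF _ polygon_mem(8), of 1 1 0 0 0 1]) (auto simp: affmap_def)
    thus ?thesis by (simp add: 4)
  next
    case 5
    have "genus_one_shape {(0, 1), (0, -1), (2, 0), (4, -1)}"
      by (rule genus_one_shapeI[OF _ polygon_mem(4), of 1 1 0 0 0 1]) (auto simp: affmap_def)
    thus ?thesis by (simp add: 5)
  qed
qed

lemma shape_d:
  assumes "1 \<le> x" "x \<le> 3"
  shows "genus_one_shape {(0, 1), (0, -1), (x, 1), (4 - x, -1)}"
proof -
  consider "x = 1" | "x = 2" | "x = 3" using assms by linarith
  thus ?thesis
  proof cases
    case 1
    have "genus_one_shape {(0, 1), (0, -1), (1, 1), (3, -1)}"
      by (rule genus_one_shapeI[OF _ polygon_mem(11), of "-1" 1 "-1" 0 2 1]) (auto simp: affmap_def)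
    thus ?thesis by (simp add: 1)
  next
    case 2
    have "genus_one_shape {(0, 1), (0, -1), (2, 1), (2, -1)}"
      by (rule genus_one_shapeI[OF _ polygon_mem(12), of "-1" "-1" 0 0 2 1]) (auto simp: affmap_def)
    thus ?thesis by (simp add: 2)
  next
    case 3
    have "genus_one_shape {(0, 1), (0, -1), (3, 1), (1, -1)}"
      by (rule genus_one_shapeI[OF _ polygon_mem(11), of "-1" "-1" 1 0 2 1]) (auto simp: affmap_def)
    thus ?thesis by (simp add: 3)
  qed
qed


section \<open>Polygons with exactly one interior lattice point\<close>

lemma subset_avoid: "A \<subseteq> B \<Longrightarrow> \<forall>x\<in>B. x \<notin> C \<longrightarrow> x \<notin> A \<Longrightarrow> A \<subseteq> C"
  by blast

text \<open>The bounds leave thirteen candidate points. As \<open>(2, 1)\<close> and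
  \<open>(1, 2)\<close> are not interior, the far ones exclude each other, and those present decide
  the polygon.\<close>

lemma corner_genus_one_shape:
  assumes S: "finite S" "card S \<le> 4" and corner: "(0, 0) \<in> S"
    and hull: "(0, 2) \<in> lattice_hull S" "(2, 0) \<in> lattice_hull S"
    and cone: "\<And>s. s \<in> S \<Longrightarrow> 0 \<le> fst s" "\<And>s. s \<in> S \<Longrightarrow> 0 \<le> snd s"
    and le: "\<And>s. s \<in> S \<Longrightarrow> fst s + snd s \<le> 4"
    and ev: "\<And>s. s \<in> S \<Longrightarrow> fst s + snd s = 4 \<Longrightarrow> even (fst s)"
    and int: "lattice_interior S = {(1, 1)}"
  shows "genus_one_shape S"
proof -
  have region: "S \<subseteq> {(0,0), (1,0), (2,0), (3,0), (0,1), (1,1), (2,1), (0,2), (1,2), (0,3), (4,0), (2,2), (0,4)}"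
  proof
    fix s assume "s \<in> S"
    note * = cone[OF this] le[OF this] ev[OF this]
    obtain x y where xy: "s = (x, y)" by (cases s)
    have "x \<in> {0,1,2,3,4}" "y \<in> {0,1,2,3,4}" using *(1-3) xy by auto
    moreover have "x + y \<le> 4" "x + y = 4 \<Longrightarrow> even x" using * xy by auto
    ultimately show "s \<in> {(0,0), (1,0), (2,0), (3,0), (0,1), (1,1), (2,1), (0,2), (1,2), (0,3), (4,0), (2,2), (0,4)}"
      unfolding xy by (elim insertE emptyE; simp)
  qed
  \<comment> \<open>Contradicts uniqueness of the interior point as soon as enough points of
    \<open>S\<close> surround \<open>(2, 1)\<close>.\<close>
  have no21: False if "\<And>\<alpha> \<beta>. (\<And>s. s \<in> S \<Longrightarrow> 2 * \<alpha> + \<beta> \<le> lin \<alpha> \<beta> s) \<Longrightarrow> \<alpha> = 0 \<and> \<beta> = 0"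
  proof -
    have "(2, 1) \<in> lattice_interior S" using that by (auto simp: lattice_interior_def lin_def mult.commute)
    thus False using int by auto
  qed
  have no12: False if "\<And>\<alpha> \<beta>. (\<And>s. s \<in> S \<Longrightarrow> \<alpha> + 2 * \<beta> \<le> lin \<alpha> \<beta> s) \<Longrightarrow> \<alpha> = 0 \<and> \<beta> = 0"
  proof -
    have "(1, 2) \<in> lattice_interior S" using that by (auto simp: lattice_interior_def lin_def mult.commute)
    thus False using int by auto
  qed
  have xaxis: "(2, 0) \<in> S \<or> (3, 0) \<in> S \<or> (4, 0) \<in> S"
  proof (rule ccontr)
    assume "\<not> ((2, 0) \<in> S \<or> (3, 0) \<in> S \<or> (4, 0) \<in> S)"
    \<comment> \<open>The functional is \<open>-2\<close> at \<open>(2, 0)\<close> and at least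
      \<open>-1\<close> at every candidate except \<open>(2, 0)\<close>, \<open>(3, 0)\<close> and
      \<open>(4, 0)\<close>.\<close>
    hence "\<And>s. s \<in> S \<Longrightarrow> -1 \<le> lin (-1) 4 s" using region by (fastforce simp: lin_def)
    from lattice_hullD[OF hull(2) this] show False by (simp add: lin_def)
  qed
  have yaxis: "(0, 2) \<in> S \<or> (0, 3) \<in> S \<or> (0, 4) \<in> S"
  proof (rule ccontr)
    assume "\<not> ((0, 2) \<in> S \<or> (0, 3) \<in> S \<or> (0, 4) \<in> S)"
    hence "\<And>s. s \<in> S \<Longrightarrow> -1 \<le> lin 4 (-1) s" using region by (fastforce simp: lin_def)
    from lattice_hullD[OF hull(1) this] show False by (simp add: lin_def)
  qed
  have "(1, 1) \<in> lattice_interior S" using int by simp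
  then obtain s where s': "s \<in> S" "lin (-1) (-1) s < lin (-1) (-1) (1, 1)"
    by (rule lattice_interior_less[where \<alpha> = "-1" and \<beta> = "-1"]) simp
  hence s: "s \<in> S" "fst s + snd s \<ge> 3" by (auto simp: lin_def)
  \<comment> \<open>The mirrored version of \<open>idI\<close>, for configurations that stretch
    along the second axis.\<close>
  have swapI: "genus_one_shape S" if "(P, Q) \<in> genus_one_polygons" "\<forall>p\<in>P. (snd p, fst p) \<in> S"
    "S \<subseteq> R" "\<forall>p\<in>R. (snd p, fst p) \<in> Q" for P Q R
    by (rule genus_one_shapeI[OF _ that(1), of 0 0 1 1 0 0]) (use that(2-4) in \<open>force simp: affmap_def image_iff\<close>)+
  have idI: "genus_one_shape S" if "(P, Q) \<in> genus_one_polygons" "P \<subseteq> S" "S \<subseteq> R" "R \<subseteq> Q" for P Q R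
    by (rule genus_one_shapeI[OF _ that(1), of 1 1 0 0 0 0]) (use that(2-4) in \<open>force simp: affmap_def image_iff\<close>)+
  consider "(4, 0) \<in> S" | "(0, 4) \<in> S" | "(2, 2) \<in> S" "(4, 0) \<notin> S" "(0, 4) \<notin> S"
    | "(4, 0) \<notin> S" "(0, 4) \<notin> S" "(2, 2) \<notin> S" by blast
  thus ?thesis
  proof cases
    case 1
    have bad: "p \<notin> S" if "p \<in> {(0,3), (1,2), (2,2), (0,4)}" for p
    proof
      assume p: "p \<in> S"
      have y: "(0, 2) \<in> S \<or> (0, 3) \<in> S \<or> (0, 4) \<in> S" by (rule yaxis)
      show False
      proof (rule no21)
        fix \<alpha> \<beta> assume H: "\<And>s. s \<in> S \<Longrightarrow> 2 * \<alpha> + \<beta> \<le> lin \<alpha> \<beta> s"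
        show "\<alpha> = 0 \<and> \<beta> = 0"
          using H[OF corner] H[OF 1] H[OF p] that y H[of "(0, 2)"] H[of "(0, 3)"] H[of "(0, 4)"]
          by (auto simp: lin_def)
      qed
    qed
    have sub: "S \<subseteq> {(0,0), (1,0), (2,0), (3,0), (0,1), (1,1), (2,1), (0,2), (4,0)}" 
      by (rule subset_avoid[OF region]) (use bad[of "(0,3)"] bad[of "(1,2)"] bad[of "(2,2)"] bad[of "(0,4)"] in simp)
    moreover have "(0, 2) \<in> S" using yaxis bad by auto
    ultimately show ?thesis using 1 corner by (intro idI[OF polygon_mem(4) _ sub]) simp_all
  next
    case 2
    have bad: "p \<notin> S" if "p \<in> {(3,0), (2,1), (2,2), (4,0)}" for p
    proof
      assume p: "p \<in> S"
      have y: "(2, 0) \<in> S \<or> (3, 0) \<in> S \<or> (4, 0) \<in> S" by (rule xaxis)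
      show False
      proof (rule no12)
        fix \<alpha> \<beta> assume H: "\<And>s. s \<in> S \<Longrightarrow> \<alpha> + 2 * \<beta> \<le> lin \<alpha> \<beta> s"
        show "\<alpha> = 0 \<and> \<beta> = 0"
          using H[OF corner] H[OF 2] H[OF p] that y H[of "(2, 0)"] H[of "(3, 0)"] H[of "(4, 0)"]
          by (auto simp: lin_def)
      qed
    qed
    have sub: "S \<subseteq> {(0,0), (1,0), (2,0), (0,1), (1,1), (0,2), (1,2), (0,3), (0,4)}" 
      by (rule subset_avoid[OF region]) (use bad[of "(3,0)"] bad[of "(2,1)"] bad[of "(2,2)"] bad[of "(4,0)"] in simp)
    moreover have "(2, 0) \<in> S" using xaxis bad by auto
    ultimately show ?thesis using 2 corner by (intro swapI[OF polygon_mem(4) _ sub]) simp_all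
  next
    case 3
    have "(3, 0) \<notin> S"
    proof
      assume p: "(3, 0) \<in> S"
      show False
      proof (rule no21)
        fix \<alpha> \<beta> assume H: "\<And>s. s \<in> S \<Longrightarrow> 2 * \<alpha> + \<beta> \<le> lin \<alpha> \<beta> s"
        show "\<alpha> = 0 \<and> \<beta> = 0"
          using H[OF corner] H[OF 3(1)] H[OF p] yaxis H[of "(0, 2)"] H[of "(0, 3)"] H[of "(0, 4)"]
          by (auto simp: lin_def)
      qed
    qed
    moreover have "(0, 3) \<notin> S"
    proof
      assume p: "(0, 3) \<in> S"
      show False
      proof (rule no12)
        fix \<alpha> \<beta> assume H: "\<And>s. s \<in> S \<Longrightarrow> \<alpha> + 2 * \<beta> \<le> lin \<alpha> \<beta> s"
        show "\<alpha> = 0 \<and> \<beta> = 0"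
          using H[OF corner] H[OF 3(1)] H[OF p] xaxis H[of "(2, 0)"] H[of "(3, 0)"] H[of "(4, 0)"]
          by (auto simp: lin_def)
      qed
    qed
    ultimately have sub: "S \<subseteq> {(0,0), (1,0), (2,0), (0,1), (1,1), (2,1), (0,2), (1,2), (2,2)}" 
      using 3 by (intro subset_avoid[OF region]) simp_all
    have "(2, 0) \<in> S" "(0, 2) \<in> S" using sub 3 xaxis yaxis by auto
    with 3 corner show ?thesis by (intro idI[OF polygon_mem(12) _ sub]) simp_all
  next
    case 4
    hence region': "S \<subseteq> {(0,0), (1,0), (2,0), (3,0), (0,1), (1,1), (2,1), (0,2), (1,2), (0,3)}" 
      by (intro subset_avoid[OF region]) simp
    show ?thesis
    proof (cases "(3, 0) \<in> S"; cases "(0, 3) \<in> S")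
      assume "(3, 0) \<in> S" "(0, 3) \<in> S"
      thus ?thesis using corner by (intro idI[OF polygon_mem(5) _ region']) simp_all
    next
      assume x: "(3, 0) \<in> S" "(0, 3) \<notin> S"
      hence y: "(0, 2) \<in> S" using yaxis 4 by blast
      consider "(1, 2) \<in> S" | "(1, 2) \<notin> S" "(2, 1) \<in> S" | "(1, 2) \<notin> S" "(2, 1) \<notin> S" by blast
      thus ?thesis
      proof cases
        case 1
        have sub: "S \<subseteq> {(0,0), (1,0), (2,0), (3,0), (0,1), (1,1), (2,1), (0,2), (1,2)}" 
          by (rule subset_avoid[OF region']) (use x in simp)
        thus ?thesis using x y 1 corner by (intro idI[OF polygon_mem(11) _ sub]) simp_all
      next
        case 2
        have sub: "S \<subseteq> {(0,0), (1,0), (2,0), (3,0), (0,1), (1,1), (2,1), (0,2)}" 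
          by (rule subset_avoid[OF region']) (use x 2 in simp)
        thus ?thesis using x y 2 corner by (intro idI[OF polygon_mem(8) _ sub]) simp_all
      next
        case 3
        have sub: "S \<subseteq> {(0,0), (1,0), (2,0), (3,0), (0,1), (1,1), (0,2)}" 
          by (rule subset_avoid[OF region']) (use x 3 in simp)
        thus ?thesis using x y 3 corner by (intro idI[OF polygon_mem(1) _ sub]) simp_all
      qed
    next
      assume x: "(3, 0) \<notin> S" "(0, 3) \<in> S"
      hence y: "(2, 0) \<in> S" using xaxis 4 by blast
      consider "(2, 1) \<in> S" | "(2, 1) \<notin> S" "(1, 2) \<in> S" | "(2, 1) \<notin> S" "(1, 2) \<notin> S" by blast
      thus ?thesis
      proof cases
        case 1
        have sub: "S \<subseteq> {(0,0), (1,0), (2,0), (0,1), (1,1), (2,1), (0,2), (1,2), (0,3)}" 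
          by (rule subset_avoid[OF region']) (use x in simp)
        thus ?thesis using x y 1 corner by (intro swapI[OF polygon_mem(11) _ sub]) simp_all
      next
        case 2
        have sub: "S \<subseteq> {(0,0), (1,0), (2,0), (0,1), (1,1), (0,2), (1,2), (0,3)}" 
          by (rule subset_avoid[OF region']) (use x 2 in simp)
        thus ?thesis using x y 2 corner by (intro swapI[OF polygon_mem(8) _ sub]) simp_all
      next
        case 3
        have sub: "S \<subseteq> {(0,0), (1,0), (2,0), (0,1), (1,1), (0,2), (0,3)}" 
          by (rule subset_avoid[OF region']) (use x 3 in simp)
        thus ?thesis using x y 3 corner by (intro swapI[OF polygon_mem(1) _ sub]) simp_all
      qed
    next
      assume x: "(3, 0) \<notin> S" "(0, 3) \<notin> S"
      hence y: "(2, 0) \<in> S" "(0, 2) \<in> S" using xaxis yaxis 4 by blast+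
      \<comment> \<open>Since \<open>(1, 1)\<close> is interior, some point of \<open>S\<close> lies
        beyond the line through \<open>(2, 0)\<close> and \<open>(0, 2)\<close>; it must be the
        fourth point.\<close>
      obtain w where w: "w \<in> S" "S = {(0, 0), (2, 0), (0, 2), w}"
        using card_four_cover[OF S corner y] by auto
      have "s \<in> {(2, 1), (1, 2)}" using s region' x by auto
      moreover from this have "s = w" using s(1) w(2) by auto
      ultimately consider "w = (2, 1)" | "w = (1, 2)" by blast
      thus ?thesis
      proof cases
        case 1
        show ?thesis unfolding w(2) 1 by (rule genus_one_shapeI[OF _ polygon_mem(9), of 1 1 0 0 0 0]) (auto simp: affmap_def)
      next
        case 2
        show ?thesis unfolding w(2) 2 by (rule genus_one_shapeI[OF _ polygon_mem(9), of 0 0 1 1 0 0]) (auto simp: affmap_def)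
      qed
    qed
  qed
qed


text \<open>The hull meets the axis exactly between \<open>(0, 0)\<close> and \<open>(2, 0)\<close>,
  since otherwise an end point would be interior. Hence a top and a bottom abscissa have sum between
  0 and 4, and each end of the segment is either in \<open>S\<close> or the midpoint of a top and a
  bottom point. The four combinations give the cases.\<close>

lemma flat_genus_one_shape:
  assumes S: "finite S" "card S \<le> 4"
    and hull: "(0, 0) \<in> lattice_hull S" "(2, 0) \<in> lattice_hull S"
    and int: "lattice_interior S = {(1, 0)}"
    and flat: "\<And>s. s \<in> S \<Longrightarrow> \<bar>snd s\<bar> \<le> 1"
    and top: "(0, 1) \<in> S" "\<And>x. (x, 1) \<in> S \<Longrightarrow> 0 \<le> x"
  shows "genus_one_shape S"
proof -
  have "(1, 0) \<in> lattice_interior S" using int by simp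
  then obtain b where "b \<in> S" "lin 0 1 b < lin 0 1 (1, 0)"
    by (rule lattice_interior_less[where \<alpha> = 0 and \<beta> = 1]) simp
  hence "b \<in> S" "snd b = -1" using flat[of b] by (auto simp: lin_def)
  then obtain x0 where x0: "(x0, -1) \<in> S" by (metis prod.collapse)
  have no00: False if "\<And>\<alpha> \<beta>. (\<And>s. s \<in> lattice_hull S \<Longrightarrow> 0 \<le> lin \<alpha> \<beta> s) \<Longrightarrow> \<alpha> = 0 \<and> \<beta> = 0"
  proof -
    have "(0, 0) \<in> lattice_interior S" using that by (intro lattice_interiorI) (auto simp: lin_def)
    thus False using int by auto
  qed
  have no20: False if "\<And>\<alpha> \<beta>. (\<And>s. s \<in> lattice_hull S \<Longrightarrow> 2 * \<alpha> \<le> lin \<alpha> \<beta> s) \<Longrightarrow> \<alpha> = 0 \<and> \<beta> = 0"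
  proof -
    have "(2, 0) \<in> lattice_interior S" using that by (intro lattice_interiorI) (auto simp: lin_def mult.commute)
    thus False using int by auto
  qed
  note sub = subset_lattice_hull
  have mid: "0 \<le> x \<and> x \<le> 2" if "(x, 0) \<in> S" for x
  proof (intro conjI; rule ccontr)
    assume x: "\<not> 0 \<le> x"
    show False
    proof (rule no00)
      fix \<alpha> \<beta> assume H: "\<And>s. s \<in> lattice_hull S \<Longrightarrow> 0 \<le> lin \<alpha> \<beta> s"
      have "0 \<le> \<alpha>" "0 \<le> \<alpha> * x" using H[OF hull(2)] H[OF sub[OF that]] by (auto simp: lin_def)
      hence "\<alpha> = 0" using x by (auto simp: zero_le_mult_iff)
      thus "\<alpha> = 0 \<and> \<beta> = 0" using H[OF sub[OF top(1)]] H[OF sub[OF x0]] by (simp add: lin_def)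
    qed
  next
    assume x: "\<not> x \<le> 2"
    show False
    proof (rule no20)
      fix \<alpha> \<beta> assume H: "\<And>s. s \<in> lattice_hull S \<Longrightarrow> 2 * \<alpha> \<le> lin \<alpha> \<beta> s"
      have "\<alpha> \<le> 0" "0 \<le> \<alpha> * (x - 2)" using H[OF hull(1)] H[OF sub[OF that]] by (auto simp: lin_def algebra_simps)
      hence "\<alpha> = 0" using x by (auto simp: zero_le_mult_iff)
      thus "\<alpha> = 0 \<and> \<beta> = 0" using H[OF sub[OF top(1)]] H[OF sub[OF x0]] by (simp add: lin_def)
    qed
  qed
  have pair: "0 \<le> x + y \<and> x + y \<le> 4" if "(x, 1) \<in> S" "(y, -1) \<in> S" for x y
  proof (intro conjI; rule ccontr)
    assume xy: "\<not> 0 \<le> x + y"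
    show False
    proof (rule no00)
      fix \<alpha> \<beta> assume H: "\<And>s. s \<in> lattice_hull S \<Longrightarrow> 0 \<le> lin \<alpha> \<beta> s"
      have *: "0 \<le> \<alpha> * x + \<beta>" "0 \<le> \<alpha> * y - \<beta>" "0 \<le> \<alpha>"
        using H[OF sub[OF that(1)]] H[OF sub[OF that(2)]] H[OF hull(2)] by (auto simp: lin_def)
      hence "0 \<le> \<alpha> * (x + y)" by (simp add: algebra_simps)
      hence "\<alpha> = 0" using xy * by (auto simp: zero_le_mult_iff)
      thus "\<alpha> = 0 \<and> \<beta> = 0" using * by simp
    qed
  next
    assume xy: "\<not> x + y \<le> 4"
    show False
    proof (rule no20)
      fix \<alpha> \<beta> assume H: "\<And>s. s \<in> lattice_hull S \<Longrightarrow> 2 * \<alpha> \<le> lin \<alpha> \<beta> s"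
      have *: "2 * \<alpha> \<le> \<alpha> * x + \<beta>" "2 * \<alpha> \<le> \<alpha> * y - \<beta>" "\<alpha> \<le> 0"
        using H[OF sub[OF that(1)]] H[OF sub[OF that(2)]] H[OF hull(1)] by (auto simp: lin_def)
      hence "0 \<le> \<alpha> * (x + y - 4)" by (simp add: algebra_simps)
      hence "\<alpha> = 0" using xy * by (auto simp: zero_le_mult_iff)
      thus "\<alpha> = 0 \<and> \<beta> = 0" using * by simp
    qed
  qed
  have bot: "0 \<le> y \<and> y \<le> 4" if "(y, -1) \<in> S" for y using pair[OF top(1) that] by simp
  have top4: "x \<le> 4" if "(x, 1) \<in> S" for x using pair[OF that x0] bot[OF x0] by simp
  have cases: "(\<exists>x. s = (x, 1)) \<or> s = (0, 0) \<or> s = (1, 0) \<or> s = (2, 0) \<or> (\<exists>y. s = (y, -1))" if "s \<in> S" for s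
  proof -
    obtain x y where xy: "s = (x, y)" by (cases s)
    have "y = -1 \<or> y = 0 \<or> y = 1" using flat[OF that] xy by auto
    thus ?thesis using mid[of x] that xy by auto
  qed
  have left: "(0, 0) \<in> S \<or> (0, -1) \<in> S"
  proof (rule ccontr)
    assume n: "\<not> ((0, 0) \<in> S \<or> (0, -1) \<in> S)"
    \<comment> \<open>The line through \<open>(0, 1)\<close> and \<open>(1, -1)\<close>, which
      leaves \<open>(0, 0)\<close> on the other side.\<close>
    have "1 \<le> lin 2 1 s" if "s \<in> S" for s
    proof -
      have "\<And>y. s = (y, -1) \<Longrightarrow> y \<noteq> 0" using n that by auto
      thus ?thesis using cases[OF that] top(2) bot n that by (force simp: lin_def)
    qed
    from lattice_hullD[OF hull(1) this] show False by (simp add: lin_def)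
  qed
  have right: "(2, 0) \<in> S \<or> (\<exists>x. (x, 1) \<in> S \<and> (4 - x, -1) \<in> S)"
  proof (rule ccontr)
    assume n: "\<not> ((2, 0) \<in> S \<or> (\<exists>x. (x, 1) \<in> S \<and> (4 - x, -1) \<in> S))"
    define T where "T = fst ` {s \<in> S. snd s = 1}"
    have T: "finite T" "T \<noteq> {}" using S(1) top(1) by (auto simp: T_def)
    define d where "d = Max T"
    have "d \<in> T" using T by (simp add: d_def)
    hence d: "(d, 1) \<in> S" by (auto simp: T_def)
    have d': "x \<le> d" if "(x, 1) \<in> S" for x
      unfolding d_def using that T(1) by (intro Max_ge) (force simp: T_def)+
    \<comment> \<open>The line through \<open>(d, 1)\<close> and \<open>(3 - d, -1)\<close> meets
      the axis at \<open>3 / 2\<close> and so separates \<open>(2, 0)\<close> from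
      \<open>S\<close>.\<close>
    have "-3 \<le> lin (-2) (2 * d - 3) s" if s: "s \<in> S" for s
    proof -
      have "y + d \<le> 3" if "s = (y, -1)" for y
      proof -
        have "y + d \<noteq> 4"
        proof
          assume "y + d = 4"
          hence "y = 4 - d" by simp
          thus False using n d s that by auto
        qed
        thus ?thesis using pair[OF d, of y] s that by auto
      qed
      thus ?thesis using cases[OF s] d' n s by (force simp: lin_def)
    qed
    from lattice_hullD[OF hull(2) this] show False by (simp add: lin_def)
  qed
  show ?thesis
  proof (cases "(0, 0) \<in> S"; cases "(2, 0) \<in> S")
    assume 1: "(0, 0) \<in> S" "(2, 0) \<in> S"
    obtain w where w: "w \<in> S" "S = {(0, 0), (2, 0), (0, 1), w}"
      by (rule card_four_cover[OF S 1 top(1)]) auto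
    have "w = (x0, -1)" using x0 w(2) by auto
    thus ?thesis using w(2) shape_a[of x0] bot[OF x0] by simp
  next
    assume 1: "(0, 0) \<in> S" "(2, 0) \<notin> S"
    then obtain x where x: "(x, 1) \<in> S" "(4 - x, -1) \<in> S" using right by blast
    show ?thesis
    proof (cases "x = 0")
      case False
      obtain w where w: "w \<in> S" "S = {(0, 0), (0, 1), (x, 1), w}"
        by (rule card_four_cover[OF S 1(1) top(1) x(1)]) (use False in auto)
      have "w = (4 - x, -1)" using x w(2) by auto
      thus ?thesis using w(2) shape_b[of x] top(2)[OF x(1)] top4[OF x(1)] False by simp
    next
      case True
      hence x4: "(4, -1) \<in> S" using x by simp
      obtain w where w: "w \<in> S" "S = {(0, 0), (0, 1), (4, -1), w}"
        by (rule card_four_cover[OF S 1(1) top(1) x4]) auto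
      show ?thesis
      proof (cases "\<exists>y. w = (y, -1)")
        case True
        thus ?thesis using w shape_b0 bot by auto
      next
        case False
        have "w = (0, 1) \<or> w = (0, 0) \<or> w = (1, 0) \<or> w = (2, 0)"
          using cases[OF w(1)] False pair[OF _ x4] top(2) w(1) by force
        thus ?thesis unfolding w(2)
          by (intro genus_one_shapeI[OF _ polygon_mem(2), of 1 "-2" 1 "-1" 0 2]) (auto simp: affmap_def)
      qed
    qed
  next
    assume 1: "(0, 0) \<notin> S" "(2, 0) \<in> S"
    hence b: "(0, -1) \<in> S" using left by blast
    obtain w where w: "w \<in> S" "S = {(0, 1), (0, -1), (2, 0), w}"
      by (rule card_four_cover[OF S top(1) b 1(2)]) auto
    consider x where "w = (x, 1)" | y where "w = (y, -1)" | "w = (1, 0) \<or> w = (2, 0)"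
      using cases[OF w(1)] w(1) 1(1) by blast
    thus ?thesis
    proof cases
      case 1
      thus ?thesis using w shape_c_top[of x] top(2)[of x] top4[of x] by simp
    next
      case 2
      thus ?thesis using w shape_c_bottom[of y] bot[of y] by simp
    next
      case 3
      thus ?thesis unfolding w(2)
        by (intro genus_one_shapeI[OF _ polygon_mem(2), of "-1" 0 "-1" 1 2 0]) (auto simp: affmap_def)
    qed
  next
    assume 1: "(0, 0) \<notin> S" "(2, 0) \<notin> S"
    hence b: "(0, -1) \<in> S" using left by blast
    obtain x where x: "(x, 1) \<in> S" "(4 - x, -1) \<in> S" using right 1(2) by blast
    consider "x = 0" | "x = 4" | "1 \<le> x" "x \<le> 3" using top(2)[OF x(1)] top4[OF x(1)] by linarith
    thus ?thesis
    proof cases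
      case 1
      hence x4: "(4, -1) \<in> S" using x by simp
      have "affmap 1 0 0 1 0 1 s \<in> {(0,0), (1,0), (2,0), (3,0), (4,0), (0,1), (1,1), (2,1), (0,2)}" if "s \<in> S" for s
      proof -
        have "y = 0 \<or> y = 1 \<or> y = 2 \<or> y = 3 \<or> y = 4" if "s = (y, -1)" for y
        proof -
          have "(y, -1) \<in> S" using that \<open>s \<in> S\<close> by simp
          from bot[OF this] show ?thesis by presburger
        qed
        moreover have "y = 0" if "s = (y, 1)" for y
        proof -
          have "(y, 1) \<in> S" using that \<open>s \<in> S\<close> by simp
          from pair[OF this x4] top(2)[OF this] show ?thesis by simp
        qed
        ultimately show ?thesis using cases[OF that] by (elim disjE exE) (auto simp: affmap_def)
      qed
      hence "affmap 1 0 0 1 0 1 ` S \<subseteq> {(0,0), (1,0), (2,0), (3,0), (4,0), (0,1), (1,1), (2,1), (0,2)}"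
        by (rule image_subsetI)
      moreover have "affmap 1 0 0 1 0 1 ` {(0, -1), (4, -1), (0, 1)} \<subseteq> affmap 1 0 0 1 0 1 ` S"
        using b x4 top(1) by (intro image_mono) simp
      hence "{(0,0), (4,0), (0,2)} \<subseteq> affmap 1 0 0 1 0 1 ` S" by (simp add: affmap_def)
      ultimately show ?thesis
        by (intro genus_one_shapeI[OF _ polygon_mem(4), of 1 1 0 0 0 1]) simp_all
    next
      case 2
      hence x4: "(4, 1) \<in> S" using x by simp
      have "affmap 1 0 0 (-1) 0 1 s \<in> {(0,0), (1,0), (2,0), (3,0), (4,0), (0,1), (1,1), (2,1), (0,2)}" if "s \<in> S" for s
      proof -
        have "y = 0 \<or> y = 1 \<or> y = 2 \<or> y = 3 \<or> y = 4" if "s = (y, 1)" for y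
        proof -
          have "(y, 1) \<in> S" using that \<open>s \<in> S\<close> by simp
          from top(2)[OF this] top4[OF this] show ?thesis by presburger
        qed
        moreover have "y = 0" if "s = (y, -1)" for y
        proof -
          have "(y, -1) \<in> S" using that \<open>s \<in> S\<close> by simp
          from pair[OF x4 this] bot[OF this] show ?thesis by simp
        qed
        ultimately show ?thesis using cases[OF that] by (elim disjE exE) (auto simp: affmap_def)
      qed
      hence "affmap 1 0 0 (-1) 0 1 ` S \<subseteq> {(0,0), (1,0), (2,0), (3,0), (4,0), (0,1), (1,1), (2,1), (0,2)}"
        by (rule image_subsetI)
      moreover have "affmap 1 0 0 (-1) 0 1 ` {(0, -1), (4, 1), (0, 1)} \<subseteq> affmap 1 0 0 (-1) 0 1 ` S"
        using b x4 top(1) by (intro image_mono) simp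
      hence "{(0,0), (4,0), (0,2)} \<subseteq> affmap 1 0 0 (-1) 0 1 ` S" by (simp add: affmap_def)
      ultimately show ?thesis
        by (intro genus_one_shapeI[OF _ polygon_mem(4), of 1 "-1" 0 0 0 1]) simp_all
    next
      case 3
      obtain w where w: "w \<in> S" "S = {(0, 1), (0, -1), (x, 1), w}"
        by (rule card_four_cover[OF S top(1) b x(1)]) (use 3 in auto)
      have "w = (4 - x, -1)" using x w(2) 3 by auto
      thus ?thesis using w(2) shape_d[of x] 3 by simp
    qed
  qed
qed


text \<open>A planar Caratheodory argument. Turning from \<open>s0\<close> counterclockwise,
  \<open>u\<close> is the last point in the open half-plane to its left. As 0 is interior, some
  \<open>w\<close> lies beyond \<open>u\<close>; it is opposite to \<open>s0\<close> or closes a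
  triangle around 0.\<close>

lemma triangle_around_interior:
  assumes S: "finite S" and int: "lattice_interior S = {0}"
  obtains v1 v2 v3 where "v1 \<in> lattice_hull S" "v2 \<in> lattice_hull S" "v3 \<in> lattice_hull S"
      "det2 v1 v2 > 0" "det2 v2 v3 > 0" "det2 v3 v1 > 0"
  | u where "u \<noteq> 0" "u \<in> lattice_hull S" "- u \<in> lattice_hull S"
proof -
  have "0 \<in> lattice_interior S" using int by simp
  then obtain s0 where "s0 \<in> S" "lin 1 0 s0 < lin 1 0 0"
    by (rule lattice_interior_less[where \<alpha> = 1 and \<beta> = 0]) simp
  hence s0: "s0 \<in> S" "s0 \<noteq> 0" by auto
  have lin_det: "det2 s0 v = lin (- snd s0) (fst s0) v" for v by (simp add: det2_def lin_def)
  have "\<exists>s\<in>S. 0 < det2 s0 s"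
  proof -
    obtain s where "s \<in> S" "lin (snd s0) (- fst s0) s < lin (snd s0) (- fst s0) 0"
      using lattice_interior_less[of 0 S "snd s0" "- fst s0"] int s0(2) by (auto simp: prod_eq_iff)
    thus ?thesis by (auto simp: det2_def lin_def)
  qed
  define T where "T = {s \<in> S. 0 < det2 s0 s}"
  have T: "finite T" "T \<noteq> {}" using S \<open>\<exists>s\<in>S. 0 < det2 s0 s\<close> by (auto simp: T_def)
  obtain e where e: "det2 s0 e = 1"
    using primitive_complement[OF primitive_if_unique_interior[OF int subset_lattice_hull[OF s0(1)] s0(2)]] .
  \<comment> \<open>The quotient of the coordinates of \<open>v\<close> in the basis
    \<open>s0\<close>, \<open>e\<close>, in effect the cotangent of the angle from
    \<open>s0\<close>: its minimum belongs to the largest angle.\<close>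
  define slope :: "int \<times> int \<Rightarrow> rat" where "slope v = of_int (det2 v e) / of_int (det2 s0 v)" for v
  define u where "u = arg_min_on slope T"
  have u: "u \<in> T" "\<And>v. v \<in> T \<Longrightarrow> slope u \<le> slope v"
    unfolding u_def using arg_min_if_finite(1)[OF T, of slope] arg_min_if_finite(2)[OF T, of slope]
    by (auto simp: not_less)
  have Tpos: "0 < det2 s0 v" if "v \<in> T" for v using that by (simp add: T_def)
  have uT: "0 \<le> det2 v u" if v: "v \<in> T" for v
  proof -
    have "of_int (det2 u e) * of_int (det2 s0 v) \<le> (of_int (det2 v e) * of_int (det2 s0 u) :: rat)"
      using u(2)[OF v] Tpos[OF v] Tpos[OF u(1)] by (simp add: slope_def field_simps)
    hence "det2 u e * det2 s0 v \<le> det2 v e * det2 s0 u"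
      by (simp flip: of_int_mult)
    \<comment> \<open>The Plucker relation between four plane vectors.\<close>
    moreover have "det2 v e * det2 s0 u - det2 u e * det2 s0 v = det2 v u * det2 s0 e"
      by (simp add: det2_def algebra_simps)
    ultimately show ?thesis using e by simp
  qed
  obtain w where w: "w \<in> S" "det2 w u < 0"
  proof -
    have "u \<noteq> 0" using Tpos[OF u(1)] by (auto simp: det2_def)
    hence "snd u \<noteq> 0 \<or> - fst u \<noteq> 0" by (auto simp: prod_eq_iff)
    with \<open>0 \<in> lattice_interior S\<close> obtain w where "w \<in> S" "lin (snd u) (- fst u) w < lin (snd u) (- fst u) 0"
      by (rule lattice_interior_less)
    thus ?thesis using that by (simp add: det2_def lin_def mult.commute)
  qed
  have "det2 s0 w \<le> 0" using uT[of w] w by (force simp: T_def)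
  show ?thesis
  proof (cases "det2 s0 w = 0")
    case True
    have "w \<noteq> 0" using w(2) by (auto simp: det2_def)
    hence "s0 = w \<or> s0 = - w"
      using primitive_if_unique_interior[OF int subset_lattice_hull[OF s0(1)] s0(2)]
        primitive_if_unique_interior[OF int subset_lattice_hull[OF w(1)]] True by (intro primitive_parallel) auto
    moreover have "s0 \<noteq> w" using w(2) Tpos[OF u(1)] by auto
    ultimately show ?thesis using that(2)[OF \<open>w \<noteq> 0\<close>] s0 w by (metis subset_lattice_hull)
  next
    case False
    hence "det2 w s0 > 0" using \<open>det2 s0 w \<le> 0\<close> by (simp add: det2_def algebra_simps)
    moreover have "det2 u w > 0" using w(2) by (simp add: det2_def algebra_simps)
    moreover have "u \<in> S" using u(1) by (simp add: T_def)
    ultimately show ?thesis using that(1)[of s0 u w] Tpos[OF u(1)] s0(1) w(1) by (auto intro: subset_lattice_hull)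
  qed
qed

text \<open>As \<open>v2\<close> is primitive, the triangle on 0, \<open>v1\<close>,
  \<open>v2\<close> contains a further lattice point \<open>r\<close> with
  \<open>det2 v1 r = 1\<close>. It replaces \<open>v2\<close> or \<open>v1\<close> according to the
  side of the line through 0 and \<open>v3\<close> on which it lies, and the total area drops. On
  that line it would be the opposite of \<open>v3\<close>.\<close>

lemma shrink_triangle:
  assumes int: "lattice_interior S = {0}"
    and v: "v1 \<in> lattice_hull S" "v2 \<in> lattice_hull S" "v3 \<in> lattice_hull S"
    and pos: "det2 v1 v2 > 0" "det2 v2 v3 > 0" "det2 v3 v1 > 0" and big: "det2 v1 v2 \<ge> 2"
    and no: "\<nexists>u. u \<noteq> 0 \<and> u \<in> lattice_hull S \<and> - u \<in> lattice_hull S"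
  obtains w1 w2 w3 where "w1 \<in> lattice_hull S" "w2 \<in> lattice_hull S" "w3 \<in> lattice_hull S"
    "det2 w1 w2 > 0" "det2 w2 w3 > 0" "det2 w3 w1 > 0"
    "det2 w1 w2 + det2 w2 w3 + det2 w3 w1 < det2 v1 v2 + det2 v2 v3 + det2 v3 v1"
proof -
  define d where "d = det2 v1 v2"
  have d: "d \<ge> 2" using big by (simp add: d_def)
  have nz: "v1 \<noteq> 0" "v2 \<noteq> 0" "v3 \<noteq> 0" using pos by (auto simp: det2_def)
  have prim: "primitive v1" "primitive v2" "primitive v3"
    using primitive_if_unique_interior[OF int] v nz by auto
  have 0: "0 \<in> lattice_hull S" using int lattice_interior_subset by blast
  obtain e where e: "det2 v1 e = 1" using primitive_complement[OF prim(1)] .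
  define A where "A = det2 v2 e"
  have v2: "fst v2 = A * fst v1 + d * fst e" "snd v2 = A * snd v1 + d * snd e"
    using e unfolding A_def d_def det2_def by Groebner_Basis.algebra+
  obtain m where m: "0 \<le> A - m * d" "A - m * d < d" using int_quotient[of d A] d by auto
  define k where "k = m + 1"
  define t where "t = k * d - A"
  define r where "r = (k * fst v1 + fst e, k * snd v1 + snd e)"
  have "t \<noteq> d"
  proof
    assume "t = d"
    hence "A = m * d" by (simp add: t_def k_def algebra_simps)
    hence "fst v2 = d * (m * fst v1 + fst e)" "snd v2 = d * (m * snd v1 + snd e)"
      using v2 by (auto simp: algebra_simps)
    hence "d dvd fst v2" "d dvd snd v2" by auto
    moreover have "coprime (fst v2) (snd v2)" using prim(2) by (simp add: primitive_def)
    ultimately have "is_unit d" by (metis coprime_common_divisor)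
    thus False using d by auto
  qed
  moreover have "0 < t" "t \<le> d" using m by (auto simp: t_def k_def algebra_simps)
  ultimately have t: "0 < t" "t \<le> d - 1" by auto
  have dr: "d * fst r = fst v2 + t * fst v1" "d * snd r = snd v2 + t * snd v1"
    using v2 by (auto simp: r_def t_def algebra_simps)
  have r: "r \<in> lattice_hull S"
    by (rule lattice_hull_conv[OF v(2,1) 0, where a = 1 and b = t and c = "d - 1 - t" and n = d])
       (use t d dr in auto)
  have r1: "det2 v1 r = 1" using e by (simp add: r_def det2_def algebra_simps)
  have "d * det2 r v2 = t * d" using dr unfolding d_def det2_def by Groebner_Basis.algebra
  hence r2: "det2 r v2 = t" using d by simp
  have r3: "d * det2 r v3 = det2 v2 v3 - t * det2 v3 v1" using dr unfolding d_def det2_def by Groebner_Basis.algebra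
  have "r \<noteq> 0" using r1 by (auto simp: det2_def)
  consider "det2 r v3 = 0" | "det2 r v3 > 0" | "det2 r v3 < 0" by linarith
  thus ?thesis
  proof cases
    case 1
    have "r = v3 \<or> r = - v3"
      using primitive_parallel[OF primitive_if_unique_interior[OF int r \<open>r \<noteq> 0\<close>] prim(3) 1] .
    moreover have "r \<noteq> v3"
    proof
      assume "r = v3"
      hence "det2 v3 v1 = -1" using r1 by (simp add: det2_def algebra_simps)
      thus False using pos(3) by simp
    qed
    ultimately show ?thesis using no r v(3) nz(3) by blast
  next
    case 2
    have "d * det2 r v3 < d * det2 v2 v3 + d * (d - 1)"
    proof -
      have "det2 v2 v3 \<le> d * det2 v2 v3" using d pos(2) by simp
      moreover have "0 < t * det2 v3 v1" using t pos(3) by simp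
      moreover have "0 < d * (d - 1)" using d by simp
      ultimately show ?thesis unfolding r3 by linarith
    qed
    hence "d * det2 r v3 < d * (det2 v2 v3 + d - 1)" by (simp add: algebra_simps)
    hence "det2 r v3 < det2 v2 v3 + d - 1" using d by simp
    thus ?thesis using that[OF v(1) r v(3)] r1 2 pos(3) by (simp add: d_def)
  next
    case 3
    have r3': "det2 v3 r = - det2 r v3" by (simp add: det2_def)
    have "d * det2 v3 r < d * (det2 v3 v1 + d - t)"
    proof -
      have "d * det2 v3 r = t * det2 v3 v1 - det2 v2 v3" unfolding r3' using r3 by simp
      also have "\<dots> < d * det2 v3 v1"
        using mult_strict_right_mono[of t d "det2 v3 v1"] t pos by linarith
      also have "\<dots> \<le> d * (det2 v3 v1 + d - t)" using d t by (intro mult_left_mono) auto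
      finally show ?thesis .
    qed
    hence "det2 v3 r < det2 v3 v1 + d - t" using d by simp
    thus ?thesis using that[OF r v(2,3)] r2 3 r3' pos(2) t by (simp add: d_def)
  qed
qed

text \<open>In a surrounding triangle of least area all three determinants are 1, by
  \<open>shrink_triangle\<close> applied to its rotations; then the vertices have sum 0.\<close>

lemma symmetric_pair_or_triangle:
  assumes S: "finite S" and int: "lattice_interior S = {0}"
    and no: "\<nexists>u. u \<noteq> 0 \<and> u \<in> lattice_hull S \<and> - u \<in> lattice_hull S"
  obtains v1 v2 where "v1 \<in> lattice_hull S" "v2 \<in> lattice_hull S" "- (v1 + v2) \<in> lattice_hull S" "det2 v1 v2 = 1"
proof -
  define Q where "Q = (\<lambda>n. \<exists>v1 v2 v3. v1 \<in> lattice_hull S \<and> v2 \<in> lattice_hull S \<and> v3 \<in> lattice_hull S \<and>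
      det2 v1 v2 > 0 \<and> det2 v2 v3 > 0 \<and> det2 v3 v1 > 0 \<and> n = nat (det2 v1 v2 + det2 v2 v3 + det2 v3 v1))"
  have "\<exists>n. Q n"
    using triangle_around_interior[OF S int] no unfolding Q_def by metis
  then obtain n where n: "Q n" "\<And>m. m < n \<Longrightarrow> \<not> Q m" using exists_least_iff[of Q] by auto
  obtain v1 v2 v3 where v: "v1 \<in> lattice_hull S" "v2 \<in> lattice_hull S" "v3 \<in> lattice_hull S"
      "det2 v1 v2 > 0" "det2 v2 v3 > 0" "det2 v3 v1 > 0" "n = nat (det2 v1 v2 + det2 v2 v3 + det2 v3 v1)"
    using n(1) unfolding Q_def by blast
  have min: "u1 \<in> lattice_hull S \<Longrightarrow> u2 \<in> lattice_hull S \<Longrightarrow> u3 \<in> lattice_hull S \<Longrightarrow>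
      det2 u1 u2 > 0 \<Longrightarrow> det2 u2 u3 > 0 \<Longrightarrow> det2 u3 u1 > 0 \<Longrightarrow>
      det2 u1 u2 + det2 u2 u3 + det2 u3 u1 = det2 v1 v2 + det2 v2 v3 + det2 v3 v1 \<Longrightarrow> det2 u1 u2 = 1" for u1 u2 u3
  proof (rule ccontr)
    assume u: "u1 \<in> lattice_hull S" "u2 \<in> lattice_hull S" "u3 \<in> lattice_hull S"
      "det2 u1 u2 > 0" "det2 u2 u3 > 0" "det2 u3 u1 > 0"
      "det2 u1 u2 + det2 u2 u3 + det2 u3 u1 = det2 v1 v2 + det2 v2 v3 + det2 v3 v1" "det2 u1 u2 \<noteq> 1"
    hence "det2 u1 u2 \<ge> 2" by simp
    from shrink_triangle[OF int u(1-6) this no] obtain w1 w2 w3 where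
      w: "w1 \<in> lattice_hull S" "w2 \<in> lattice_hull S" "w3 \<in> lattice_hull S"
      "det2 w1 w2 > 0" "det2 w2 w3 > 0" "det2 w3 w1 > 0"
      "det2 w1 w2 + det2 w2 w3 + det2 w3 w1 < det2 u1 u2 + det2 u2 u3 + det2 u3 u1" .
    have "Q (nat (det2 w1 w2 + det2 w2 w3 + det2 w3 w1))" unfolding Q_def using w by blast
    moreover have "nat (det2 w1 w2 + det2 w2 w3 + det2 w3 w1) < n" using w(4-7) u(7) v(7) by simp
    ultimately show False using n(2) by blast
  qed
  have 12: "det2 v1 v2 = 1" by (rule min[of v1 v2 v3]) (use v in auto)
  have 23: "det2 v2 v3 = 1" by (rule min[of v2 v3 v1]) (use v in auto)
  have 31: "det2 v3 v1 = 1" by (rule min[of v3 v1 v2]) (use v in auto)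
  have "fst v3 = - (fst v1 + fst v2)" "snd v3 = - (snd v1 + snd v2)"
    using 12 23 31 unfolding det2_def by Groebner_Basis.algebra+
  hence "v3 = - (v1 + v2)" by (simp add: prod_eq_iff)
  thus ?thesis using that v 12 by blast
qed

text \<open>The vertices \<open>v1\<close>, \<open>v2\<close>, \<open>v3\<close> have sum zero and
  span three unimodular cones that cover the plane, so every point of \<open>S\<close> has
  nonnegative integral coordinates in one of them. Only the vertices and 0 survive, which is the
  third polygon up to a unimodular map.\<close>

lemma triangle_genus_one_shape:
  assumes int: "lattice_interior S = {0}"
    and no: "\<nexists>u. u \<noteq> 0 \<and> u \<in> lattice_hull S \<and> - u \<in> lattice_hull S"
    and v: "v1 \<in> lattice_hull S" "v2 \<in> lattice_hull S" "- (v1 + v2) \<in> lattice_hull S" "det2 v1 v2 = 1"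
  shows "genus_one_shape S"
proof -
  define v3 where "v3 = - (v1 + v2)"
  have v3: "v3 \<in> lattice_hull S" "fst v3 = - fst v1 - fst v2" "snd v3 = - snd v1 - snd v2"
    using v(3) by (simp_all add: v3_def)
  have nz: "v1 \<noteq> 0" "v2 \<noteq> 0" "v3 \<noteq> 0" using v(4) v3(2,3) by (auto simp: det2_def prod_eq_iff algebra_simps)
  \<comment> \<open>a lattice point inside a cone over two vertices would produce the opposite of the third\<close>
  have cone: "a = 0 \<and> b \<le> 1 \<or> b = 0 \<and> a \<le> 1"
    if p: "p \<in> lattice_hull S" "q \<in> lattice_hull S" "- (p + q) \<in> lattice_hull S" "primitive p" "primitive q" "p + q \<noteq> 0"
      and s: "s \<in> lattice_hull S" "fst s = a * fst p + b * fst q" "snd s = a * snd p + b * snd q"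
      and ab: "a \<ge> 0" "b \<ge> 0" for p q s a b
  proof -
    have prim: "s = 0 \<or> primitive s" using primitive_if_unique_interior[OF int s(1)] by blast
    have unit: "c \<le> 1" if "fst s = c * fst p'" "snd s = c * snd p'" "c \<ge> 0" "primitive p'" for c p'
    proof (rule ccontr)
      assume c: "\<not> c \<le> 1"
      hence "s \<noteq> 0" using that by (auto simp: primitive_def)
      hence "coprime (fst s) (snd s)" using prim by (simp add: primitive_def)
      moreover have "c dvd fst s" "c dvd snd s" using that by auto
      ultimately have "is_unit c" by (metis coprime_common_divisor)
      thus False using c by auto
    qed
    consider "a = 0" | "b = 0" | "a \<ge> 1" "b \<ge> 1" using ab by linarith
    thus ?thesis
    proof cases
      case 1
      thus ?thesis using unit[of b q] s ab p(5) by auto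
    next
      case 2
      thus ?thesis using unit[of a p] s ab p(4) by auto
    next
      case 3
      have "p + q \<in> lattice_hull S"
        by (rule lattice_hull_conv[OF s(1) p(1,2), where a = 1 and b = "b - 1" and c = "a - 1" and n = "a + b - 1"])
           (use 3 s in \<open>auto simp: algebra_simps\<close>)
      thus ?thesis using no p(3,6) by blast
    qed
  qed
  have s12: "v1 + v2 \<noteq> 0" using nz(3) unfolding v3_def by (metis minus_zero)
  have prim: "primitive v1" "primitive v2" "primitive v3"
    using primitive_if_unique_interior[OF int] v v3(1) nz by auto
  obtain \<phi> where \<phi>: "unimodular \<phi>" "\<And>a b. \<phi> (fst 0 + a * fst v1 + b * fst v2, snd 0 + a * snd v1 + b * snd v2) = (a, b)"
    "\<And>w. \<phi> w = (det2 v1 v2 * det2 (w - 0) v2, det2 v1 v2 * det2 v1 (w - 0))"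
    using unimodular_frame[of v1 v2 0 thesis] v(4) by simp
  have im: "\<phi> s \<in> {(0, 0), (1, 0), (0, 1), (-1, -1)}" if "s \<in> S" for s
  proof -
    define a b where "a = det2 s v2" "b = det2 v1 s"
    have s: "fst s = a * fst v1 + b * fst v2" "snd s = a * snd v1 + b * snd v2"
      using v(4) unfolding a_b_def det2_def by Groebner_Basis.algebra+
    have \<phi>s: "\<phi> s = (a, b)" using \<phi>(3)[of s] v(4) by (simp add: a_b_def)
    note sS = subset_lattice_hull[OF that]
    consider "a \<ge> 0" "b \<ge> 0" | "b \<le> a" "b \<le> 0" | "a \<le> b" "a \<le> 0" by linarith
    thus ?thesis
    proof cases
      case 1
      have "a = 0 \<and> b \<le> 1 \<or> b = 0 \<and> a \<le> 1"
        by (rule cone[OF v(1,2) _ prim(1,2) _ sS s 1]) (use v3 s12 in \<open>simp_all add: v3_def\<close>)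
      thus ?thesis using 1 \<phi>s by force
    next
      case 2
      have "a - b = 0 \<and> - b \<le> 1 \<or> - b = 0 \<and> a - b \<le> 1"
        by (rule cone[OF v(1) v3(1) _ prim(1,3) _ sS]) (use 2 s v3 v(2) nz in \<open>auto simp: v3_def algebra_simps\<close>)
      thus ?thesis using 2 \<phi>s by force
    next
      case 3
      have "b - a = 0 \<and> - a \<le> 1 \<or> - a = 0 \<and> b - a \<le> 1"
        by (rule cone[OF v(2) v3(1) _ prim(2,3) _ sS]) (use 3 s v3 v(1) nz in \<open>auto simp: v3_def algebra_simps\<close>)
      thus ?thesis using 3 \<phi>s by force
    qed
  qed
  have "v3 = (fst 0 + -1 * fst v1 + -1 * fst v2, snd 0 + -1 * snd v1 + -1 * snd v2)"
    by (simp add: prod_eq_iff v3(2,3))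
  hence "\<phi> v3 = (-1, -1)" using \<phi>(2)[of "-1" "-1"] by metis
  moreover have "\<phi> v1 = (1, 0)" "\<phi> v2 = (0, 1)" using \<phi>(2)[of 1 0] \<phi>(2)[of 0 1] by simp_all
  ultimately have hull: "(1, 0) \<in> lattice_hull (\<phi> ` S)" "(0, 1) \<in> lattice_hull (\<phi> ` S)" "(-1, -1) \<in> lattice_hull (\<phi> ` S)"
    using v(1,2)[THEN lattice_hull_image[OF \<phi>(1)]] v3(1)[THEN lattice_hull_image[OF \<phi>(1)]] by metis+
  have sub: "\<phi> ` S \<subseteq> {(0, 0), (1, 0), (0, 1), (-1, -1)}" using im by blast
  have "(1, 0) \<in> \<phi> ` S"
  proof (rule ccontr)
    assume n: "(1, 0) \<notin> \<phi> ` S"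
    have "0 \<le> lin (-1) 0 s" if "s \<in> \<phi> ` S" for s
    proof -
      have "s \<noteq> (1, 0)" using n that by metis
      thus ?thesis using subsetD[OF sub that] by (auto simp: lin_def)
    qed
    from lattice_hullD[OF hull(1) this] show False by (simp add: lin_def)
  qed
  moreover have "(0, 1) \<in> \<phi> ` S"
  proof (rule ccontr)
    assume n: "(0, 1) \<notin> \<phi> ` S"
    have "0 \<le> lin 0 (-1) s" if "s \<in> \<phi> ` S" for s
    proof -
      have "s \<noteq> (0, 1)" using n that by metis
      thus ?thesis using subsetD[OF sub that] by (auto simp: lin_def)
    qed
    from lattice_hullD[OF hull(2) this] show False by (simp add: lin_def)
  qed
  moreover have "(-1, -1) \<in> \<phi> ` S"
  proof (rule ccontr)
    assume n: "(-1, -1) \<notin> \<phi> ` S"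
    have "0 \<le> lin 1 0 s" if "s \<in> \<phi> ` S" for s
    proof -
      have "s \<noteq> (-1, -1)" using n that by metis
      thus ?thesis using subsetD[OF sub that] by (auto simp: lin_def)
    qed
    from lattice_hullD[OF hull(3) this] show False by (simp add: lin_def)
  qed
  ultimately have "{(1, 0), (0, 1), (-1, -1)} \<subseteq> \<phi> ` S" by simp
  note image_mono[OF this, of "affmap (-1) (-1) 0 1 1 1"] image_mono[OF sub, of "affmap (-1) (-1) 0 1 1 1"]
  hence "{(0,1), (3,0), (0,2)} \<subseteq> affmap (-1) (-1) 0 1 1 1 ` \<phi> ` S"
    "affmap (-1) (-1) 0 1 1 1 ` \<phi> ` S \<subseteq> {(0,1), (3,0), (0,2), (1,1)}"
    by (simp_all add: affmap_def insert_commute)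
  hence "genus_one_shape (\<phi> ` S)"
    by (intro genus_one_shapeI[OF _ polygon_mem(3), of "-1" 1 "-1" 0 1 1]) simp_all
  thus ?thesis by (rule genus_one_shape_image[OF \<phi>(1)])
qed


text \<open>The point at height two becomes the corner of the first quadrant and the segment the
  antidiagonal \<open>x + y = 2\<close>. The height \<open>y\<close> turns into
  \<open>2 - (x + y)\<close>, so the bounds for depths below the segment become those of
  \<open>corner_genus_one_shape\<close>.\<close>

lemma apex_genus_one_shape:
  assumes S: "finite S" "card S \<le> 4"
    and hull: "(0, 0) \<in> lattice_hull S" "(2, 0) \<in> lattice_hull S"
    and int: "lattice_interior S = {(1, 0)}"
    and s: "s \<in> S" "snd s = 2"
  shows "genus_one_shape S"
proof -
  note sub = subset_lattice_hull
  have over: "snd r \<le> 2" "snd r = 2 \<Longrightarrow> even (fst r)" if "r \<in> S" for r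
  proof -
    have "(fst r, snd r) \<in> lattice_hull S" using sub[OF that] by simp
    from height_over_segment[OF hull this] show "snd r \<le> 2" "snd r = 2 \<Longrightarrow> even (fst r)"
      by (simp_all add: int)
  qed
  have under: "- snd r \<le> 2" "- snd r = 2 \<Longrightarrow> even (fst r)" if "r \<in> S" for r
  proof -
    have "(fst r, - (- snd r)) \<in> lattice_hull S" using sub[OF that] by simp
    from height_under_segment[OF hull this] show "- snd r \<le> 2" "- snd r = 2 \<Longrightarrow> even (fst r)"
      by (simp_all add: int)
  qed
  obtain k where k: "fst s = 2 * k" using over(2)[OF s] by (elim evenE)
  \<comment> \<open>Sends \<open>(2 * k, 2)\<close> to \<open>(0, 0)\<close> and
    \<open>(0, 0)\<close> to \<open>(0, 2)\<close>, and fixes \<open>(2, 0)\<close>; the determinant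
    is \<open>-1\<close>.\<close>
  define \<phi> where "\<phi> = affmap 1 (- k) (- 1) (k - 1) 0 2"
  have \<phi>: "unimodular \<phi>" unfolding \<phi>_def by (rule unimodularI) simp
  have \<phi>_fst: "fst (\<phi> r) = fst r - k * snd r" and \<phi>_snd: "fst (\<phi> r) + snd (\<phi> r) = 2 - snd r" for r
    by (simp_all add: \<phi>_def affmap_def algebra_simps)
  define T where "T = \<phi> ` S"
  have "\<phi> s = (0, 0)" using s k by (simp add: \<phi>_def affmap_def)
  hence T00: "(0, 0) \<in> T" using s(1) unfolding T_def by force
  have "\<phi> (0, 0) = (0, 2)" "\<phi> (2, 0) = (2, 0)" "\<phi> (1, 0) = (1, 1)" by (simp_all add: \<phi>_def affmap_def)
  hence T: "(0, 2) \<in> lattice_hull T" "(2, 0) \<in> lattice_hull T" "lattice_interior T = {(1, 1)}"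
    using hull[THEN lattice_hull_image[OF \<phi>]] lattice_interior_image[OF \<phi>, of S] int
    by (simp_all add: T_def)
  have "genus_one_shape T"
  proof (rule corner_genus_one_shape[OF _ _ T00 T(1,2) _ _ _ _ T(3)])
    show "finite T" "card T \<le> 4" using S card_image_le[OF S(1), of \<phi>] by (auto simp: T_def)
    fix r assume r: "r \<in> T"
    from r[unfolded T_def] obtain r' where r': "r = \<phi> r'" "r' \<in> S" by (rule imageE)
    show "fst r + snd r \<le> 4" using under(1)[OF r'(2)] by (simp add: r' \<phi>_snd)
    show "even (fst r)" if "fst r + snd r = 4"
    proof -
      have "snd r' = -2" using that by (simp add: r' \<phi>_snd)
      thus ?thesis using under(2)[OF r'(2)] by (simp add: r' \<phi>_fst)
    qed
    show "0 \<le> fst r"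
    proof (rule ccontr)
      assume neg: "\<not> 0 \<le> fst r"
      have "(0, 1) \<in> lattice_interior T"
      proof (rule lattice_interiorI)
        fix \<alpha> \<beta> assume H: "\<And>s. s \<in> lattice_hull T \<Longrightarrow> lin \<alpha> \<beta> (0, 1) \<le> lin \<alpha> \<beta> s"
        have "\<beta> = 0" using H[OF T(1)] H[OF sub[OF T00]] by (simp add: lin_def)
        moreover have "\<alpha> \<ge> 0" using H[OF T(2)] \<open>\<beta> = 0\<close> by (simp add: lin_def)
        moreover have "\<alpha> * fst r \<ge> 0" using H[OF sub[OF r]] \<open>\<beta> = 0\<close> by (simp add: lin_def)
        ultimately show "\<alpha> = 0 \<and> \<beta> = 0" using neg by (auto simp: zero_le_mult_iff)
      qed
      thus False using T(3) by auto
    qed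
    show "0 \<le> snd r"
    proof (rule ccontr)
      assume neg: "\<not> 0 \<le> snd r"
      have "(1, 0) \<in> lattice_interior T"
      proof (rule lattice_interiorI)
        fix \<alpha> \<beta> assume H: "\<And>s. s \<in> lattice_hull T \<Longrightarrow> lin \<alpha> \<beta> (1, 0) \<le> lin \<alpha> \<beta> s"
        have "\<alpha> = 0" using H[OF T(2)] H[OF sub[OF T00]] by (simp add: lin_def)
        moreover have "\<beta> \<ge> 0" using H[OF T(1)] \<open>\<alpha> = 0\<close> by (simp add: lin_def)
        moreover have "\<beta> * snd r \<ge> 0" using H[OF sub[OF r]] \<open>\<alpha> = 0\<close> by (simp add: lin_def)
        ultimately show "\<alpha> = 0 \<and> \<beta> = 0" using neg by (auto simp: zero_le_mult_iff)
      qed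
      thus False using T(3) by auto
    qed
  qed
  thus ?thesis unfolding T_def by (rule genus_one_shape_image[OF \<phi>])
qed

text \<open>The segment bounds all heights by two in absolute value. Height two on either side is
  the apex case; otherwise a shear moves the leftmost top point to abscissa 0.\<close>

lemma segment_genus_one_shape:
  assumes S: "finite S" "card S \<le> 4"
    and hull: "(0, 0) \<in> lattice_hull S" "(2, 0) \<in> lattice_hull S"
    and int: "lattice_interior S = {(1, 0)}"
  shows "genus_one_shape S"
proof -
  note sub = subset_lattice_hull
  have over: "snd r \<le> 2" if "r \<in> S" for r
  proof -
    have "(fst r, snd r) \<in> lattice_hull S" using sub[OF that] by simp
    from height_over_segment(1)[OF hull this] show ?thesis by (simp add: int)
  qed
  have under: "- snd r \<le> 2" if "r \<in> S" for r
  proof -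
    have "(fst r, - (- snd r)) \<in> lattice_hull S" using sub[OF that] by simp
    from height_under_segment(1)[OF hull this] show ?thesis by (simp add: int)
  qed
  consider s where "s \<in> S" "snd s = 2" | s where "s \<in> S" "snd s = -2" | "\<forall>s\<in>S. snd s \<noteq> 2 \<and> snd s \<noteq> -2"
    by blast
  thus ?thesis
  proof cases
    case (1 s)
    thus ?thesis by (rule apex_genus_one_shape[OF assms])
  next
    case (2 s)
    let ?\<nu> = "affmap 1 0 0 (-1) 0 0"
    have "genus_one_shape (?\<nu> ` S)"
    proof (rule apex_genus_one_shape)
      show "finite (?\<nu> ` S)" "card (?\<nu> ` S) \<le> 4" using S card_image_le[OF S(1), of ?\<nu>] by auto
      show "(0, 0) \<in> lattice_hull (?\<nu> ` S)" "(2, 0) \<in> lattice_hull (?\<nu> ` S)"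
        using hull[THEN lattice_hull_image[OF unimodular_neg_snd]] by (simp_all add: affmap_def)
      show "lattice_interior (?\<nu> ` S) = {(1, 0)}"
        unfolding lattice_interior_image[OF unimodular_neg_snd] int by (simp add: affmap_def)
      show "?\<nu> s \<in> ?\<nu> ` S" "snd (?\<nu> s) = 2" using 2 by (auto simp: affmap_def)
    qed
    thus ?thesis by (rule genus_one_shape_image[OF unimodular_neg_snd])
  next
    case 3
    have flat: "\<bar>snd s\<bar> \<le> 1" if "s \<in> S" for s using over[OF that] under[OF that] 3 that by force
    have "(1, 0) \<in> lattice_interior S" using int by simp
    then obtain b where "b \<in> S" "lin 0 (-1) b < lin 0 (-1) (1, 0)"
      by (rule lattice_interior_less[where \<alpha> = 0 and \<beta> = "-1"]) simp
    hence b: "b \<in> S" "snd b = 1" using flat[of b] by (auto simp: lin_def)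
    define T where "T = fst ` {s \<in> S. snd s = 1}"
    have "fst b \<in> T" unfolding T_def using b by (intro imageI) simp
    hence T: "finite T" "T \<noteq> {}" using S(1) by (auto simp: T_def)
    define c where "c = Min T"
    have "c \<in> T" using T by (simp add: c_def)
    hence c: "(c, 1) \<in> S" by (auto simp: T_def)
    have c': "c \<le> x" if "(x, 1) \<in> S" for x
      unfolding c_def using that T(1) by (intro Min_le) (force simp: T_def)+
    define \<phi> where "\<phi> = affmap 1 (- c) 0 1 0 0"
    have \<phi>: "unimodular \<phi>" unfolding \<phi>_def by (rule unimodularI) simp
    have "genus_one_shape (\<phi> ` S)"
    proof (rule flat_genus_one_shape)
      show "finite (\<phi> ` S)" "card (\<phi> ` S) \<le> 4" using S card_image_le[OF S(1), of \<phi>] by auto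
      show "(0, 0) \<in> lattice_hull (\<phi> ` S)" "(2, 0) \<in> lattice_hull (\<phi> ` S)"
        using hull[THEN lattice_hull_image[OF \<phi>]] by (simp_all add: \<phi>_def affmap_def)
      show "lattice_interior (\<phi> ` S) = {(1, 0)}"
        unfolding lattice_interior_image[OF \<phi>] int by (simp add: \<phi>_def affmap_def)
      have "\<phi> (c, 1) \<in> \<phi> ` S" using c by (rule imageI)
      thus "(0, 1) \<in> \<phi> ` S" by (simp add: \<phi>_def affmap_def)
    next
      fix s assume "s \<in> \<phi> ` S"
      then obtain r where r: "s = \<phi> r" "r \<in> S" by (rule imageE)
      thus "\<bar>snd s\<bar> \<le> 1" using flat[OF r(2)] by (simp add: \<phi>_def affmap_def)
    next
      fix x assume "(x, 1) \<in> \<phi> ` S"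
      then obtain r where r: "(x, 1) = \<phi> r" "r \<in> S" by (rule imageE)
      hence "r = (x + c, 1)" by (auto simp: \<phi>_def affmap_def prod_eq_iff)
      thus "0 \<le> x" using c'[of "x + c"] r(2) by simp
    qed
    thus ?thesis by (rule genus_one_shape_image[OF \<phi>])
  qed
qed

text \<open>With the unique interior point at 0 there are two cases. A pair of opposite hull points
  spans a segment of lattice length two with midpoint 0. Without such a pair there is a unimodular
  triangle with barycentre 0.\<close>

theorem lattice_quadrilateral_classification:
  assumes S: "finite S" "card S \<le> 4"
    and nc: "v0 \<in> S" "v1 \<in> S" "v2 \<in> S" "det2 (v1 - v0) (v2 - v0) \<noteq> 0"
    and unique: "\<And>p q. p \<in> lattice_interior S \<Longrightarrow> q \<in> lattice_interior S \<Longrightarrow> p = q"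
  shows "genus_zero_shape S \<or> genus_one_shape S"
proof (cases "lattice_interior S = {}")
  case True
  thus ?thesis using hollow_genus_zero_shape[OF _ S nc] by blast
next
  case False
  then obtain q where "q \<in> lattice_interior S" by blast
  hence q: "lattice_interior S = {q}" using unique by blast
  define \<tau> where "\<tau> = affmap 1 0 0 1 (- fst q) (- snd q)"
  have \<tau>: "unimodular \<tau>" unfolding \<tau>_def by (rule unimodularI) simp
  define S' where "S' = \<tau> ` S"
  have S': "finite S'" "card S' \<le> 4" using S card_image_le[OF S(1), of \<tau>] by (auto simp: S'_def)
  have int: "lattice_interior S' = {0}"
    unfolding S'_def lattice_interior_image[OF \<tau>] q by (simp add: \<tau>_def affmap_def prod_eq_iff)
  have "genus_one_shape S'"
  proof (cases "\<exists>u. u \<noteq> 0 \<and> u \<in> lattice_hull S' \<and> - u \<in> lattice_hull S'")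
    case False
    from symmetric_pair_or_triangle[OF S'(1) int False] obtain v1 v2 where
      "v1 \<in> lattice_hull S'" "v2 \<in> lattice_hull S'" "- (v1 + v2) \<in> lattice_hull S'" "det2 v1 v2 = 1" .
    thus ?thesis by (rule triangle_genus_one_shape[OF int False])
  next
    case True
    then obtain u where u: "u \<noteq> 0" "u \<in> lattice_hull S'" "- u \<in> lattice_hull S'" by blast
    obtain e where e: "det2 u e = 1"
      using primitive_complement[OF primitive_if_unique_interior[OF int u(2,1)]] .
    hence "\<bar>det2 u e\<bar> = 1" by simp
    then obtain \<phi> where \<phi>: "unimodular \<phi>"
      "\<And>a b. \<phi> (fst (- u) + a * fst u + b * fst e, snd (- u) + a * snd u + b * snd e) = (a, b)"
      by (rule unimodular_frame[where q = "- u"]) blast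
    have \<phi>u: "\<phi> (- u) = (0, 0)" "\<phi> 0 = (1, 0)" "\<phi> u = (2, 0)"
      using \<phi>(2)[of 0 0] \<phi>(2)[of 1 0] \<phi>(2)[of 2 0] by (simp_all add: uminus_prod_def zero_prod_def)
    have "genus_one_shape (\<phi> ` S')"
    proof (rule segment_genus_one_shape)
      show "finite (\<phi> ` S')" "card (\<phi> ` S') \<le> 4" using S' card_image_le[OF S'(1), of \<phi>] by auto
      show "(0, 0) \<in> lattice_hull (\<phi> ` S')" "(2, 0) \<in> lattice_hull (\<phi> ` S')"
        using u(2,3)[THEN lattice_hull_image[OF \<phi>(1)]] by (simp_all add: \<phi>u)
      show "lattice_interior (\<phi> ` S') = {(1, 0)}"
        unfolding lattice_interior_image[OF \<phi>(1)] int by (simp add: \<phi>u)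
    qed
    thus ?thesis by (rule genus_one_shape_image[OF \<phi>(1)])
  qed
  hence "genus_one_shape S" unfolding S'_def by (rule genus_one_shape_image[OF \<tau>])
  thus ?thesis ..
qed

section \<open>Laurent monomials\<close>

abbreviation const_fract :: "'a::field \<Rightarrow> 'a poly poly fract" where
  "const_fract c \<equiv> to_fract [:[:c:]:]"

lemma const_fract_add: "const_fract (a + b) = const_fract a + const_fract b"
  by (simp flip: to_fract_add)

lemma const_fract_mult: "const_fract (a * b) = const_fract a * const_fract b"
  by (simp flip: to_fract_mult)

lemma const_fract_power: "const_fract (c ^ n) = const_fract c ^ n"
  by (induction n) (simp_all add: const_fract_mult flip: one_pCons)

lemma const_fract_inverse: "const_fract (inverse c) = inverse (const_fract c)"
proof (cases "c = 0")
  case False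
  hence "const_fract c * const_fract (inverse c) = 1"
    by (simp add: one_pCons del: to_fract_eq_iff flip: const_fract_mult) (simp flip: one_pCons)
  thus ?thesis by (simp add: inverse_unique)
qed simp

lemma const_fract_powi: "const_fract (c powi n) = const_fract c powi n"
  by (simp add: power_int_def const_fract_power const_fract_inverse)

lemma const_fract_of_nat: "const_fract (of_nat n) = of_nat n"
  by (induction n) (simp_all add: const_fract_add flip: one_pCons)

lemma const_fract_uminus: "const_fract (- c) = - const_fract c"
  by (simp flip: to_fract_uminus)

lemma const_fract_of_int: "const_fract (of_int n) = of_int n"
proof (cases n)
  case (nonneg m)
  thus ?thesis by (simp add: const_fract_of_nat)
next
  case (neg m)
  have "const_fract (of_int n) = - const_fract (of_nat (Suc m))"
    unfolding neg of_int_minus of_int_of_nat_eq const_fract_uminus ..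
  thus ?thesis unfolding neg const_fract_of_nat by simp
qed

lemma const_fract_left_inverse:
  assumes "c \<noteq> 0"
  shows "const_fract (inverse c) * const_fract c = 1"
proof -
  have "inverse c * c = 1" using assms by simp
  from arg_cong[OF this, of const_fract] show ?thesis
    unfolding const_fract_mult by (simp flip: one_pCons)
qed

definition ev :: "'a::field poly poly fract \<Rightarrow> 'a poly \<Rightarrow> 'a poly poly fract" where
  "ev z p = poly (map_poly const_fract p) z"

lemma ev_0 [simp]: "ev z 0 = 0" by (simp add: ev_def)

lemma ev_pCons [simp]: "ev z (pCons c p) = const_fract c + z * ev z p"
  by (cases "c = 0 \<and> p = 0") (auto simp: ev_def map_poly_pCons)

lemma ev_1 [simp]: "ev z 1 = 1"
  by (simp add: one_pCons) (simp flip: one_pCons)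

lemma ev_add [simp]: "ev z (p + q) = ev z p + ev z q"
  by (induction p q rule: poly_induct2) (simp_all add: const_fract_add algebra_simps)

lemma ev_smult [simp]: "ev z (smult c p) = const_fract c * ev z p"
  by (induction p) (simp_all add: const_fract_mult algebra_simps)

lemma ev_mult [simp]: "ev z (p * q) = ev z p * ev z q"
  by (induction p) (simp_all add: algebra_simps)

lemma ev_uminus [simp]: "ev z (- p) = - ev z p"
  using ev_add[of z p "- p"] by (simp add: add_eq_0_iff2)

lemma ev_diff [simp]: "ev z (p - q) = ev z p - ev z q"
  using ev_add[of z p "- q"] by simp

lemma ev_monom [simp]: "ev z (monom c n) = const_fract c * z ^ n"
  by (induction n) (simp_all add: monom_0 monom_Suc)

definition xv :: "'a::field poly poly fract" where "xv = to_fract [:[:0, 1:]:]"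
definition yv :: "'a::field poly poly fract" where "yv = to_fract [:0, 1:]"

lemma xv_nonzero: "xv \<noteq> 0" and yv_nonzero: "yv \<noteq> 0"
  by (simp_all add: xv_def yv_def)

definition smul :: "int \<Rightarrow> int \<times> int \<Rightarrow> int \<times> int" where
  "smul n v = (n * fst v, n * snd v)"

definition mono :: "int \<times> int \<Rightarrow> 'a::field poly poly fract" where
  "mono v = xv powi fst v * yv powi snd v"

lemma mono_nonzero: "mono v \<noteq> 0"
  by (simp add: mono_def xv_nonzero yv_nonzero)

lemma mono_add: "mono (u + v) = mono u * mono v"
  by (simp add: mono_def power_int_add xv_nonzero yv_nonzero)

lemma mono_0: "mono 0 = 1" by (simp add: mono_def)

lemma mono_uminus: "mono (- v) = inverse (mono v)"
  by (simp add: mono_def power_int_minus)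

lemma mono_diff: "mono (u - v) = mono u / mono v"
  using mono_add[of u "- v"] by (simp add: mono_uminus field_class.field_divide_inverse)

lemma mono_smul: "mono (smul n v) = mono v powi n"
  by (simp add: mono_def smul_def power_int_mult_distrib power_int_mult[symmetric] mult.commute)

lemma mono_sum: "finite I \<Longrightarrow> mono (\<Sum>i\<in>I. g i) = (\<Prod>i\<in>I. mono (g i))"
  by (induction I rule: finite_induct) (simp_all add: mono_0 mono_add)

lemma to_fract_pCons: "to_fract (pCons p q) = to_fract [:p:] + yv * to_fract q"
  and to_fract_const_pCons: "to_fract [:pCons c p:] = const_fract c + xv * to_fract [:p:]"
  by (simp_all add: xv_def yv_def flip: to_fract_mult to_fract_add)

lemma to_fract_bimonom: "to_fract (bimonom c i j) = const_fract c * mono (int i, int j)"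
proof -
  have 1: "to_fract (monom q j) = to_fract [:q:] * yv ^ j" for q :: "'a poly"
    by (induction j) (simp_all add: monom_0 monom_Suc to_fract_pCons[of 0])
  have 2: "to_fract [:monom c i:] = const_fract c * xv ^ i"
    by (induction i) (simp_all add: monom_0 monom_Suc to_fract_const_pCons[of 0])
  show ?thesis by (simp add: bimonom_def 1 2 mono_def)
qed

section \<open>The function field of a plane curve\<close>

text \<open>Elements of the function field are represented by elements of \<open>loc\<close>,
  identified when their difference lies in \<open>mx\<close>. Primality of \<open>f\<close> makes
  \<open>mx\<close> the complement of the units of \<open>loc\<close>.\<close>

locale plane_curve =
  fixes f :: "'a::field poly poly"
  assumes prime_f: "prime_elem f"
begin

definition loc :: "'a poly poly fract set" where
  "loc = {Fract p q | p q. \<not> f dvd q}"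

abbreviation "mx \<equiv> curve_maximal_ideal f"

lemma locI: "\<not> f dvd q \<Longrightarrow> Fract p q \<in> loc" by (auto simp: loc_def)

lemma locE:
  assumes "r \<in> loc"
  obtains p q where "r = Fract p q" "\<not> f dvd q" "q \<noteq> 0"
  using assms unfolding loc_def by force

lemma mxE:
  assumes "r \<in> mx"
  obtains p q where "r = Fract p q" "f dvd p" "\<not> f dvd q" "q \<noteq> 0"
  using assms unfolding curve_maximal_ideal_def by force

lemma not_dvd_mult: "\<not> f dvd p \<Longrightarrow> \<not> f dvd q \<Longrightarrow> \<not> f dvd p * q"
  using prime_f by (simp add: prime_elem_dvd_mult_iff)

lemma Fract_in_mx_iff:
  assumes "\<not> f dvd q"
  shows "Fract p q \<in> mx \<longleftrightarrow> f dvd p"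
proof
  assume "Fract p q \<in> mx"
  then obtain p' q' where *: "Fract p q = Fract p' q'" "f dvd p'" "\<not> f dvd q'" "q' \<noteq> 0" by (rule mxE)
  moreover have "q \<noteq> 0" using assms by auto
  ultimately have "p * q' = p' * q" by (simp add: eq_fract)
  hence "f dvd p * q'" using *(2) by simp
  thus "f dvd p" using *(3) prime_f by (simp add: prime_elem_dvd_mult_iff)
qed (use assms in \<open>auto simp: curve_maximal_ideal_def\<close>)

lemma mx_subset: "mx \<subseteq> loc" by (auto simp: curve_maximal_ideal_def loc_def)

lemma mx_loc: "r \<in> mx \<Longrightarrow> r \<in> loc" using mx_subset by blast

lemma not_dvd_1: "\<not> f dvd 1"
  using prime_f by auto

lemma to_fract_loc [simp]: "to_fract p \<in> loc"
  unfolding to_fract_def by (rule locI) (rule not_dvd_1)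

lemma to_fract_mx_iff [simp]: "to_fract p \<in> mx \<longleftrightarrow> f dvd p"
  unfolding to_fract_def by (rule Fract_in_mx_iff) (rule not_dvd_1)

lemma loc_0 [simp]: "0 \<in> loc" and loc_1 [simp]: "1 \<in> loc"
  using to_fract_loc[of 0] to_fract_loc[of 1] by simp_all

lemma mx_0 [simp]: "0 \<in> mx" and mx_1 [simp]: "1 \<notin> mx"
  using to_fract_mx_iff[of 0] to_fract_mx_iff[of 1] not_dvd_1 by simp_all

lemma loc_add [intro]: assumes "r \<in> loc" "s \<in> loc" shows "r + s \<in> loc"
proof -
  obtain p q p' q' where "r = Fract p q" "\<not> f dvd q" "q \<noteq> 0" "s = Fract p' q'" "\<not> f dvd q'" "q' \<noteq> 0"
    using assms by (metis locE)
  thus ?thesis by (simp add: locI not_dvd_mult)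
qed

lemma loc_mult [intro]: assumes "r \<in> loc" "s \<in> loc" shows "r * s \<in> loc"
proof -
  obtain p q p' q' where "r = Fract p q" "\<not> f dvd q" "q \<noteq> 0" "s = Fract p' q'" "\<not> f dvd q'" "q' \<noteq> 0"
    using assms by (metis locE)
  thus ?thesis by (simp add: locI not_dvd_mult)
qed

lemma loc_uminus [intro]: assumes "r \<in> loc" shows "- r \<in> loc"
  using assms by (auto elim!: locE intro!: locI)

lemma loc_diff [intro]: "r \<in> loc \<Longrightarrow> s \<in> loc \<Longrightarrow> r - s \<in> loc"
  using loc_add[of r "- s"] by (auto intro: loc_uminus)

lemma loc_sum: "(\<And>i. i \<in> I \<Longrightarrow> g i \<in> loc) \<Longrightarrow> sum g I \<in> loc"
  by (induction I rule: infinite_finite_induct) auto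

lemma mx_add [intro]: assumes "r \<in> mx" "s \<in> mx" shows "r + s \<in> mx"
proof -
  obtain p q p' q' where "r = Fract p q" "f dvd p" "\<not> f dvd q" "q \<noteq> 0"
    "s = Fract p' q'" "f dvd p'" "\<not> f dvd q'" "q' \<noteq> 0"
    using assms by (metis mxE)
  thus ?thesis by (simp add: Fract_in_mx_iff not_dvd_mult)
qed

lemma mx_mult_left [intro]: assumes "r \<in> loc" "s \<in> mx" shows "r * s \<in> mx"
proof -
  obtain p q p' q' where "r = Fract p q" "\<not> f dvd q" "q \<noteq> 0"
    "s = Fract p' q'" "f dvd p'" "\<not> f dvd q'" "q' \<noteq> 0"
    using assms by (metis mxE locE)
  thus ?thesis by (simp add: Fract_in_mx_iff not_dvd_mult)
qed

lemma mx_mult_right [intro]: "r \<in> mx \<Longrightarrow> s \<in> loc \<Longrightarrow> r * s \<in> mx"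
  using mx_mult_left[of s r] by (simp add: mult.commute)

lemma mx_uminus [intro]: "r \<in> mx \<Longrightarrow> - r \<in> mx"
  using mx_mult_left[of "-1" r] loc_uminus[OF loc_1] by simp

lemma mx_diff [intro]: "r \<in> mx \<Longrightarrow> s \<in> mx \<Longrightarrow> r - s \<in> mx"
  using mx_add[of r "- s"] by (auto intro: mx_uminus)

lemma mx_sum: "(\<And>i. i \<in> I \<Longrightarrow> g i \<in> mx) \<Longrightarrow> sum g I \<in> mx"
  by (induction I rule: infinite_finite_induct) auto

lemma mx_prime: assumes "r \<in> loc" "s \<in> loc" "r * s \<in> mx" shows "r \<in> mx \<or> s \<in> mx"
proof -
  obtain p q p' q' where *: "r = Fract p q" "\<not> f dvd q" "q \<noteq> 0" "s = Fract p' q'" "\<not> f dvd q'" "q' \<noteq> 0"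
    using assms by (metis locE)
  hence "f dvd p * p'" using assms(3) by (simp add: Fract_in_mx_iff not_dvd_mult)
  thus ?thesis using prime_f * by (simp add: prime_elem_dvd_mult_iff Fract_in_mx_iff)
qed

lemma loc_inverse: assumes "r \<in> loc" "r \<notin> mx" shows "inverse r \<in> loc"
proof -
  obtain p q where "r = Fract p q" "\<not> f dvd q" "q \<noteq> 0" using assms(1) by (rule locE)
  thus ?thesis using assms(2) by (auto simp: Fract_in_mx_iff intro: locI)
qed

lemma inverse_not_mx: assumes "r \<in> loc" "r \<notin> mx" shows "inverse r \<notin> mx"
proof
  assume "inverse r \<in> mx"
  moreover have "r \<noteq> 0" using assms(2) by auto
  ultimately have "1 \<in> mx" using mx_mult_left[OF assms(1)] by force
  thus False by simp
qed

lemma loc_divide: "r \<in> loc \<Longrightarrow> s \<in> loc \<Longrightarrow> s \<notin> mx \<Longrightarrow> r / s \<in> loc"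
  using loc_inverse by (auto simp: field_class.field_divide_inverse)

lemma mult_not_mx: "r \<in> loc \<Longrightarrow> s \<in> loc \<Longrightarrow> r \<notin> mx \<Longrightarrow> s \<notin> mx \<Longrightarrow> r * s \<notin> mx"
  using mx_prime by blast

lemma const_mx_iff [simp]: "const_fract c \<in> mx \<longleftrightarrow> c = 0"
proof -
  have "[:[:c:]:] dvd 1" if "c \<noteq> 0"
    using that by (simp add: const_poly_dvd_const_poly_iff one_pCons dvd_field_iff)
  thus ?thesis using not_dvd_1 by (auto dest: dvd_trans)
qed

abbreviation "LR \<equiv> curve_local_ring f"
abbreviation "FF \<equiv> function_field f"

definition cls :: "'a poly poly fract \<Rightarrow> 'a poly poly fract set" where
  "cls r = mx +>\<^bsub>LR\<^esub> r"

lemma LR_simps [simp]: "carrier LR = loc" "monoid.mult LR = (*)" "add LR = (+)" "monoid.one LR = 1" "ring.zero LR = 0"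
  by (simp_all add: curve_local_ring_def ring_of_type_algebra_def loc_def)

lemma cring_LR: "cring LR"
proof (intro cringI abelian_groupI comm_monoidI)
  fix x assume "x \<in> carrier LR"
  thus "\<exists>y\<in>carrier LR. y \<oplus>\<^bsub>LR\<^esub> x = \<zero>\<^bsub>LR\<^esub>" by (auto intro!: bexI[of _ "- x"])
qed (auto simp: algebra_simps)

lemma uminus_LR: "r \<in> loc \<Longrightarrow> \<ominus>\<^bsub>LR\<^esub> r = - r"
proof -
  interpret cring LR by (rule cring_LR)
  assume "r \<in> loc"
  thus ?thesis using minus_equality[of "- r" r] by auto
qed

lemma ideal_mx: "ideal mx LR"
proof (rule idealI)
  interpret cring LR by (rule cring_LR)
  show "ring LR" by (rule ring_axioms)
  show "subgroup mx (add_monoid LR)"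
  proof (rule group.subgroupI)
    show "group (add_monoid LR)" by (rule add.group_axioms)
    show "mx \<subseteq> carrier (add_monoid LR)" using mx_subset by simp
    show "mx \<noteq> {}" using mx_0 by blast
    show "inv\<^bsub>add_monoid LR\<^esub> a \<in> mx" if "a \<in> mx" for a
      using uminus_LR[of a] that mx_uminus[OF that] mx_loc[OF that] by (simp add: a_inv_def)
  qed auto
qed auto

lemma FF_simps: "carrier FF = cls ` loc" "ring.zero FF = cls 0" "monoid.one FF = cls 1"
  and FF_add: "\<And>r s. r \<in> loc \<Longrightarrow> s \<in> loc \<Longrightarrow> cls r \<oplus>\<^bsub>FF\<^esub> cls s = cls (r + s)"
  and FF_mult: "\<And>r s. r \<in> loc \<Longrightarrow> s \<in> loc \<Longrightarrow> cls r \<otimes>\<^bsub>FF\<^esub> cls s = cls (r * s)"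
proof -
  interpret ideal mx LR by (rule ideal_mx)
  show "carrier FF = cls ` loc" by (auto simp: function_field_def FactRing_def A_RCOSETS_def' cls_def)
  show "ring.zero FF = cls 0"
    using a_rcos_const[of 0] by (simp add: function_field_def FactRing_def cls_def)
  show "monoid.one FF = cls 1" by (simp add: function_field_def FactRing_def cls_def)
  show "cls r \<oplus>\<^bsub>FF\<^esub> cls s = cls (r + s)" "cls r \<otimes>\<^bsub>FF\<^esub> cls s = cls (r * s)" if "r \<in> loc" "s \<in> loc" for r s
    using a_rcos_sum[of r s] rcoset_mult_add[of r s] that by (simp_all add: function_field_def FactRing_def cls_def)
qed

lemma cls_eq_iff: assumes "r \<in> loc" "s \<in> loc" shows "cls r = cls s \<longleftrightarrow> r - s \<in> mx"
proof -
  have cls: "cls x = {m + x | m. m \<in> mx}" for x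
    by (auto simp: cls_def a_r_coset_def r_coset_def)
  show ?thesis
  proof
    assume "cls r = cls s"
    moreover have "r \<in> cls r" unfolding cls by (auto intro!: exI[of _ 0])
    ultimately have "r \<in> cls s" by simp
    then obtain m where "m \<in> mx" "r = m + s" unfolding cls by blast
    thus "r - s \<in> mx" by simp
  next
    assume rs: "r - s \<in> mx"
    have "\<exists>m'. m + r = m' + s \<and> m' \<in> mx" "\<exists>m'. m + s = m' + r \<and> m' \<in> mx" if "m \<in> mx" for m
    proof -
      have "m + r = (m + (r - s)) + s" "m + s = (m - (r - s)) + r" by simp_all
      with mx_add[OF that rs] mx_diff[OF that rs]
      show "\<exists>m'. m + r = m' + s \<and> m' \<in> mx" "\<exists>m'. m + s = m' + r \<and> m' \<in> mx" by blast+
    qed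
    thus "cls r = cls s" unfolding cls by blast
  qed
qed

lemma cls_0_iff: "r \<in> loc \<Longrightarrow> cls r = cls 0 \<longleftrightarrow> r \<in> mx"
  using cls_eq_iff[of r 0] by simp

lemma FF_cases:
  assumes "C \<in> carrier FF"
  obtains r where "r \<in> loc" "C = cls r"
  using assms by (auto simp: FF_simps)

definition rep :: "'a poly poly fract set \<Rightarrow> 'a poly poly fract" where
  "rep C = (SOME r. r \<in> loc \<and> C = cls r)"

lemma rep:
  assumes "C \<in> carrier FF"
  shows "rep C \<in> loc" "cls (rep C) = C"
proof -
  have "\<exists>r. r \<in> loc \<and> C = cls r" using assms by (auto simp: FF_simps)
  hence "rep C \<in> loc \<and> C = cls (rep C)" unfolding rep_def by (rule someI_ex)
  thus "rep C \<in> loc" "cls (rep C) = C" by simp_all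
qed

lemma cring_FF: "cring FF"
proof -
  interpret ideal mx LR by (rule ideal_mx)
  show ?thesis unfolding function_field_def by (rule quotient_is_cring) (rule cring_LR)
qed

lemma FF_inv: assumes "r \<in> loc" "r \<notin> mx" shows "inv\<^bsub>FF\<^esub> (cls r) = cls (inverse r)"
proof -
  interpret cring FF by (rule cring_FF)
  have "r \<noteq> 0" using assms by auto
  hence "cls r \<otimes>\<^bsub>FF\<^esub> cls (inverse r) = \<one>\<^bsub>FF\<^esub>"
    using assms loc_inverse[OF assms] by (simp add: FF_mult FF_simps)
  thus ?thesis using assms loc_inverse[OF assms]
    by (intro comm_inv_char) (auto simp: FF_simps)
qed

lemma FF_uminus: assumes "r \<in> loc" shows "\<ominus>\<^bsub>FF\<^esub> (cls r) = cls (- r)"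
proof -
  interpret cring FF by (rule cring_FF)
  show ?thesis
    using assms loc_uminus[OF assms] FF_add[of "- r" r]
    by (intro minus_equality) (simp_all add: FF_simps)
qed

lemma FF_finsum:
  assumes "\<And>i. i < (n::nat) \<Longrightarrow> g i \<in> loc"
  shows "(\<Oplus>\<^bsub>FF\<^esub>i\<in>{..<n}. cls (g i)) = cls (\<Sum>i<n. g i)"
  using assms
proof (induction n)
  case 0
  interpret cring FF by (rule cring_FF)
  show ?case by (simp add: FF_simps)
next
  case (Suc n)
  interpret cring FF by (rule cring_FF)
  have "(\<Oplus>\<^bsub>FF\<^esub>i\<in>{..<Suc n}. cls (g i)) = cls (g n) \<oplus>\<^bsub>FF\<^esub> (\<Oplus>\<^bsub>FF\<^esub>i\<in>{..<n}. cls (g i))"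
    unfolding lessThan_Suc using Suc.prems by (intro finsum_insert) (auto simp: FF_simps)
  also have "(\<Oplus>\<^bsub>FF\<^esub>i\<in>{..<n}. cls (g i)) = cls (\<Sum>i<n. g i)" using Suc by auto
  finally show ?case using Suc.prems by (subst (asm) FF_add) (auto intro: loc_sum simp: add.commute)
qed


section \<open>Congruence modulo the maximal ideal\<close>

definition cong_mx :: "'a poly poly fract \<Rightarrow> 'a poly poly fract \<Rightarrow> bool" (infix "\<approx>" 50) where
  "r \<approx> s \<longleftrightarrow> r - s \<in> mx"

lemma cong_refl [simp]: "r \<approx> r" by (simp add: cong_mx_def)

lemma cong_sym: "r \<approx> s \<Longrightarrow> s \<approx> r"
  using mx_uminus[of "r - s"] by (simp add: cong_mx_def)

lemma cong_trans [trans]: "r \<approx> s \<Longrightarrow> s \<approx> t \<Longrightarrow> r \<approx> t"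
  using mx_add[of "r - s" "s - t"] by (simp add: cong_mx_def)

lemma cong_add: "r \<approx> r' \<Longrightarrow> s \<approx> s' \<Longrightarrow> r + s \<approx> r' + s'"
  using mx_add[of "r - r'" "s - s'"] by (simp add: cong_mx_def algebra_simps)

lemma cong_diff: "r \<approx> r' \<Longrightarrow> s \<approx> s' \<Longrightarrow> r - s \<approx> r' - s'"
  using mx_diff[of "r - r'" "s - s'"] by (simp add: cong_mx_def algebra_simps)

lemma cong_uminus: "r \<approx> r' \<Longrightarrow> - r \<approx> - r'"
  using cong_diff[of 0 0 r r'] by simp

lemma cong_mult_left: "t \<in> loc \<Longrightarrow> r \<approx> s \<Longrightarrow> t * r \<approx> t * s"
  using mx_mult_left[of t "r - s"] by (simp add: cong_mx_def algebra_simps)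

lemma cong_mult: "r \<in> loc \<Longrightarrow> s' \<in> loc \<Longrightarrow> r \<approx> r' \<Longrightarrow> s \<approx> s' \<Longrightarrow> r * s \<approx> r' * s'"
  using cong_mult_left[of r s s'] cong_mult_left[of s' r r'] cong_trans by (metis mult.commute)

lemma cong_sum: "(\<And>i. i \<in> I \<Longrightarrow> g i \<approx> h i) \<Longrightarrow> sum g I \<approx> sum h I"
  by (induction I rule: infinite_finite_induct) (auto intro: cong_add)

lemma cong_0_iff: "r \<approx> 0 \<longleftrightarrow> r \<in> mx" by (simp add: cong_mx_def)

lemma cong_loc: "r \<approx> s \<Longrightarrow> s \<in> loc \<Longrightarrow> r \<in> loc"
  using loc_add[of "r - s" s] mx_loc[of "r - s"] by (simp add: cong_mx_def)

lemma cls_cong: "r \<in> loc \<Longrightarrow> s \<in> loc \<Longrightarrow> cls r = cls s \<longleftrightarrow> r \<approx> s"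
  by (simp add: cls_eq_iff cong_mx_def)

text \<open>Derivations of the function field, lifted to representatives in the local ring.\<close>

definition cder :: "('a poly poly fract \<Rightarrow> 'a poly poly fract) \<Rightarrow> bool" where
  "cder d \<longleftrightarrow> (\<forall>r\<in>loc. d r \<in> loc) \<and> (\<forall>r\<in>loc. \<forall>s\<in>loc. d (r + s) \<approx> d r + d s) \<and>
     (\<forall>r\<in>loc. \<forall>s\<in>loc. d (r * s) \<approx> r * d s + s * d r) \<and>
     (\<forall>c. d (const_fract c) \<approx> 0) \<and> (\<forall>r\<in>loc. \<forall>s\<in>loc. r \<approx> s \<longrightarrow> d r \<approx> d s)"

lemma cderD:
  assumes "cder d"
  shows "\<And>r. r \<in> loc \<Longrightarrow> d r \<in> loc" "\<And>r s. r \<in> loc \<Longrightarrow> s \<in> loc \<Longrightarrow> d (r + s) \<approx> d r + d s"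
    "\<And>r s. r \<in> loc \<Longrightarrow> s \<in> loc \<Longrightarrow> d (r * s) \<approx> r * d s + s * d r"
    "\<And>c. d (const_fract c) \<approx> 0" "\<And>r s. r \<in> loc \<Longrightarrow> s \<in> loc \<Longrightarrow> r \<approx> s \<Longrightarrow> d r \<approx> d s"
  using assms by (auto simp: cder_def)

abbreviation "KK \<equiv> range (const_fun f)"

lemma const_fun_cls: "const_fun f c = cls (const_fract c)"
  by (simp add: const_fun_def cls_def)

text \<open>A choice of representatives spoils exact additivity and the exact product rule, which is
  why \<open>cder\<close> asks for them only up to congruence.\<close>

lemma derivation_lift:
  assumes "D \<in> derivations KK FF"
  obtains d where "cder d" "\<And>r. r \<in> loc \<Longrightarrow> D (cls r) = cls (d r)"
proof -
  define d where "d r = rep (D (cls r))" for r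
  have D: "D \<in> carrier FF \<rightarrow> carrier FF"
    "\<And>x y. x \<in> carrier FF \<Longrightarrow> y \<in> carrier FF \<Longrightarrow> D (x \<oplus>\<^bsub>FF\<^esub> y) = D x \<oplus>\<^bsub>FF\<^esub> D y"
    "\<And>x y. x \<in> carrier FF \<Longrightarrow> y \<in> carrier FF \<Longrightarrow> D (x \<otimes>\<^bsub>FF\<^esub> y) = (x \<otimes>\<^bsub>FF\<^esub> D y) \<oplus>\<^bsub>FF\<^esub> (y \<otimes>\<^bsub>FF\<^esub> D x)"
    "\<And>c. c \<in> KK \<Longrightarrow> D c = \<zero>\<^bsub>FF\<^esub>"
    using assms by (auto simp: derivations_def)
  have d: "d r \<in> loc \<and> D (cls r) = cls (d r)" if "r \<in> loc" for r
  proof -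
    have "D (cls r) \<in> carrier FF" using D(1) that by (auto simp: FF_simps)
    from rep[OF this] show ?thesis by (simp add: d_def)
  qed
  have "cder d"
    unfolding cder_def
  proof (intro conjI ballI allI impI)
    fix r s assume rs: "r \<in> loc" "s \<in> loc"
    have "cls (d (r + s)) = cls (d r + d s)"
      using D(2)[of "cls r" "cls s"] d rs by (auto simp: FF_simps FF_add)
    thus "d (r + s) \<approx> d r + d s" using d rs by (subst (asm) cls_cong) auto
    have "cls (d (r * s)) = cls (r * d s + s * d r)"
      using D(3)[of "cls r" "cls s"] d rs by (auto simp: FF_simps FF_mult FF_add loc_mult)
    thus "d (r * s) \<approx> r * d s + s * d r" using d rs by (subst (asm) cls_cong) auto
    show "d r \<approx> d s" if "r \<approx> s"
    proof -
      have "cls (d r) = cls (d s)" using that rs d by (metis cls_cong)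
      thus ?thesis using d rs by (subst (asm) cls_cong) auto
    qed
  next
    fix c
    have "cls (d (const_fract c)) = cls 0"
      using D(4)[of "const_fun f c"] d[of "const_fract c"] by (simp add: const_fun_cls FF_simps)
    thus "d (const_fract c) \<approx> 0" using d by (subst (asm) cls_cong) auto
  qed (use d in auto)
  thus ?thesis using d that by blast
qed

text \<open>Compatibility with congruence makes the value independent of the representative chosen
  by \<open>rep\<close>.\<close>

lemma derivation_of_cder:
  assumes d: "cder d"
  obtains D where "D \<in> derivations KK FF" "\<And>r. r \<in> loc \<Longrightarrow> D (cls r) = cls (d r)"
proof -
  define D where "D = (\<lambda>C \<in> carrier FF. cls (d (rep C)))"
  have D: "D (cls r) = cls (d r)" if "r \<in> loc" for r
  proof -
    have C: "cls r \<in> carrier FF" using that by (simp add: FF_simps)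
    have "rep (cls r) \<approx> r" using rep[OF C] that by (subst cls_cong[symmetric]) auto
    hence "d (rep (cls r)) \<approx> d r" using cderD(5)[OF d] rep(1)[OF C] that by blast
    thus ?thesis using C rep(1)[OF C] that cderD(1)[OF d] by (simp add: D_def cls_cong)
  qed
  have "D \<in> derivations KK FF"
    unfolding derivations_def
  proof (intro CollectI conjI ballI)
    show "D \<in> carrier FF \<rightarrow>\<^sub>E carrier FF"
      unfolding D_def using rep(1) cderD(1)[OF d] by (auto simp: FF_simps(1))
  next
    fix x y assume "x \<in> carrier FF" "y \<in> carrier FF"
    then obtain r s where rs: "x = cls r" "r \<in> loc" "y = cls s" "s \<in> loc" by (metis FF_cases)
    note dl = cderD(1)[OF d]
    show "D (x \<oplus>\<^bsub>FF\<^esub> y) = D x \<oplus>\<^bsub>FF\<^esub> D y"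
      using rs cderD(2)[OF d rs(2,4)] dl by (simp add: FF_add D loc_add cls_cong)
    show "D (x \<otimes>\<^bsub>FF\<^esub> y) = (x \<otimes>\<^bsub>FF\<^esub> D y) \<oplus>\<^bsub>FF\<^esub> (y \<otimes>\<^bsub>FF\<^esub> D x)"
      using rs cderD(3)[OF d rs(2,4)] dl by (simp add: FF_add FF_mult D loc_add loc_mult cls_cong)
  next
    fix c assume "c \<in> KK"
    then obtain c' where "c = cls (const_fract c')" by (auto simp: const_fun_cls)
    thus "D c = \<zero>\<^bsub>FF\<^esub>" using cderD(1,4)[OF d] by (simp add: D FF_simps cls_cong)
  qed
  thus ?thesis using D that by blast
qed

definition val_ring :: "'a poly poly fract set \<Rightarrow> bool" where
  "val_ring A \<longleftrightarrow> A \<subseteq> loc \<and> mx \<subseteq> A \<and> (\<forall>c. const_fract c \<in> A) \<and>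
     (\<forall>r\<in>A. \<forall>s\<in>A. r + s \<in> A) \<and> (\<forall>r\<in>A. \<forall>s\<in>A. r * s \<in> A) \<and>
     (\<forall>r\<in>loc - mx. r \<in> A \<or> inverse r \<in> A)"

lemma places_pullback:
  assumes "A \<in> places KK FF"
  shows "val_ring {r \<in> loc. cls r \<in> A}"
proof -
  have A: "subring A FF" "KK \<subseteq> A" "\<And>x. x \<in> carrier FF - {\<zero>\<^bsub>FF\<^esub>} \<Longrightarrow> x \<in> A \<or> inv\<^bsub>FF\<^esub> x \<in> A"
    using assms by (auto simp: places_def)
  show ?thesis
    unfolding val_ring_def
  proof (intro conjI ballI allI subsetI)
    fix r assume r: "r \<in> mx"
    hence "cls r = \<zero>\<^bsub>FF\<^esub>" using cls_0_iff[of r] mx_loc[OF r] by (simp add: FF_simps)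
    thus "r \<in> {r \<in> loc. cls r \<in> A}" using r mx_loc subringE(2)[OF A(1)] by simp
  next
    fix r assume r: "r \<in> loc - mx"
    hence "cls r \<noteq> \<zero>\<^bsub>FF\<^esub>" using cls_0_iff[of r] by (auto simp: FF_simps)
    hence "cls r \<in> A \<or> inv\<^bsub>FF\<^esub> (cls r) \<in> A" using A(3)[of "cls r"] r by (auto simp: FF_simps)
    thus "r \<in> {r \<in> loc. cls r \<in> A} \<or> inverse r \<in> {r \<in> loc. cls r \<in> A}"
      using r FF_inv[of r] loc_inverse[of r] by auto
  qed (use A(2) subringE(6,7)[OF A(1)] in \<open>auto simp: const_fun_cls simp flip: FF_add FF_mult\<close>)
qed

lemma val_ring_cong: "val_ring A \<Longrightarrow> r \<in> A \<Longrightarrow> s \<approx> r \<Longrightarrow> s \<in> A"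
  unfolding val_ring_def cong_mx_def by (metis diff_add_cancel subsetD)

lemma cls_in_image_iff:
  assumes "val_ring A" "r \<in> loc"
  shows "cls r \<in> cls ` A \<longleftrightarrow> r \<in> A"
proof
  assume "cls r \<in> cls ` A"
  then obtain s where s: "s \<in> A" "cls r = cls s" by blast
  moreover have "s \<in> loc" using s(1) assms(1) by (auto simp: val_ring_def)
  ultimately have "r \<approx> s" using assms(2) by (simp add: cls_cong)
  thus "r \<in> A" using val_ring_cong[OF assms(1) s(1)] by simp
qed simp

lemma val_ring_place:
  assumes A: "val_ring A" "A \<noteq> loc"
  shows "cls ` A \<in> places KK FF"
proof -
  interpret cring FF by (rule cring_FF)
  have A': "A \<subseteq> loc" "mx \<subseteq> A" "\<And>c. const_fract c \<in> A" "\<And>r s. r \<in> A \<Longrightarrow> s \<in> A \<Longrightarrow> r + s \<in> A"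
    "\<And>r s. r \<in> A \<Longrightarrow> s \<in> A \<Longrightarrow> r * s \<in> A" "\<And>r. r \<in> loc \<Longrightarrow> r \<notin> mx \<Longrightarrow> r \<in> A \<or> inverse r \<in> A"
    using A(1) by (auto simp: val_ring_def)
  have "const_fract (-1 :: 'a) = - to_fract [:[:1:]:]" by (simp flip: to_fract_uminus)
  hence A1: "1 \<in> A" "-1 \<in> A" using A'(3)[of 1] A'(3)[of "-1"] by (simp_all flip: one_pCons)
  have "subring (cls ` A) FF"
  proof (rule subringI)
    show "cls ` A \<subseteq> carrier FF" using A'(1) by (auto simp: FF_simps)
    show "\<one>\<^bsub>FF\<^esub> \<in> cls ` A" using A1 by (simp add: FF_simps)
    show "\<ominus>\<^bsub>FF\<^esub> h \<in> cls ` A" if "h \<in> cls ` A" for h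
      using that A'(5)[OF A1(2)] A'(1) by (auto simp: FF_uminus)
  qed (use A' in \<open>auto simp: FF_add FF_mult subset_iff\<close>)
  moreover have "KK \<subseteq> cls ` A" using A'(3) by (auto simp: const_fun_cls)
  moreover have "cls ` A \<noteq> carrier FF"
  proof
    assume eq: "cls ` A = carrier FF"
    have "r \<in> A" if "r \<in> loc" for r
      using cls_in_image_iff[OF A(1) that] that by (simp add: eq FF_simps)
    thus False using A(2) A'(1) by blast
  qed
  moreover have "x \<in> cls ` A \<or> inv\<^bsub>FF\<^esub> x \<in> cls ` A" if x: "x \<in> carrier FF - {\<zero>\<^bsub>FF\<^esub>}" for x
  proof -
    obtain r where r: "r \<in> loc" "x = cls r" using x by (auto simp: FF_simps)
    hence "r \<notin> mx" using x cls_0_iff[of r] by (auto simp: FF_simps)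
    thus ?thesis using r A'(6)[of r] FF_inv[of r] by auto
  qed
  ultimately show ?thesis by (auto simp: places_def)
qed

lemma differentialsI:
  assumes "\<And>i. i < (n::nat) \<Longrightarrow> a i \<in> loc \<and> cls (a i) \<in> B \<and> b i \<in> loc \<and> cls (b i) \<in> B"
  shows "(\<lambda>D \<in> derivations KK FF. \<Oplus>\<^bsub>FF\<^esub>i\<in>{..<n}. cls (a i) \<otimes>\<^bsub>FF\<^esub> D (cls (b i))) \<in> differentials KK FF B"
  unfolding differentials_def
  by (intro CollectI exI[of _ n] exI[of _ "\<lambda>i. cls (a i)"] exI[of _ "\<lambda>i. cls (b i)"]) (use assms in auto)

lemma differential_value:
  assumes "\<And>i. i < (n::nat) \<Longrightarrow> a i \<in> loc \<and> b i \<in> loc"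
    and "cder d" "\<And>r. r \<in> loc \<Longrightarrow> D (cls r) = cls (d r)"
  shows "(\<Oplus>\<^bsub>FF\<^esub>i\<in>{..<n}. cls (a i) \<otimes>\<^bsub>FF\<^esub> D (cls (b i))) = cls (\<Sum>i<n. a i * d (b i))"
proof -
  interpret cring FF by (rule cring_FF)
  have "(\<Oplus>\<^bsub>FF\<^esub>i\<in>{..<n}. cls (a i) \<otimes>\<^bsub>FF\<^esub> D (cls (b i))) = (\<Oplus>\<^bsub>FF\<^esub>i\<in>{..<n}. cls (a i * d (b i)))"
    using assms(1,3) cderD(1)[OF assms(2)] by (intro finsum_cong') (auto simp: FF_simps FF_mult loc_mult)
  also have "\<dots> = cls (\<Sum>i<n. a i * d (b i))"
    by (rule FF_finsum) (use assms(1) cderD(1)[OF assms(2)] in auto)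
  finally show ?thesis .
qed

lemma differentialsE:
  assumes "\<omega> \<in> differentials KK FF B" "B \<subseteq> carrier FF"
  obtains n :: nat and a b where "\<And>i. i < n \<Longrightarrow> a i \<in> loc \<and> cls (a i) \<in> B \<and> b i \<in> loc \<and> cls (b i) \<in> B"
    "\<omega> = (\<lambda>D \<in> derivations KK FF. \<Oplus>\<^bsub>FF\<^esub>i\<in>{..<n}. cls (a i) \<otimes>\<^bsub>FF\<^esub> D (cls (b i)))"
proof -
  interpret cring FF by (rule cring_FF)
  obtain n :: nat and a b where *: "a \<in> {..<n} \<rightarrow> B" "b \<in> {..<n} \<rightarrow> B"
    "\<omega> = (\<lambda>D \<in> derivations KK FF. \<Oplus>\<^bsub>FF\<^esub>i\<in>{..<n}. a i \<otimes>\<^bsub>FF\<^esub> D (b i))"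
    using assms(1) unfolding differentials_def by blast
  have ab: "a i \<in> B" "b i \<in> B" "a i \<in> carrier FF" "b i \<in> carrier FF" if "i < n" for i
    using that * assms(2) by auto
  show ?thesis
  proof (rule that[of n "\<lambda>i. rep (a i)" "\<lambda>i. rep (b i)"])
    show "rep (a i) \<in> loc \<and> cls (rep (a i)) \<in> B \<and> rep (b i) \<in> loc \<and> cls (rep (b i)) \<in> B" if "i < n" for i
      using ab[OF that] rep by auto
    show "\<omega> = (\<lambda>D \<in> derivations KK FF. \<Oplus>\<^bsub>FF\<^esub>i\<in>{..<n}. cls (rep (a i)) \<otimes>\<^bsub>FF\<^esub> D (cls (rep (b i))))"
      unfolding *(3)
    proof (intro restrict_ext)
      fix D assume "D \<in> derivations KK FF"
      hence "D \<in> carrier FF \<rightarrow> carrier FF" by (auto simp: derivations_def)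
      thus "(\<Oplus>\<^bsub>FF\<^esub>i\<in>{..<n}. a i \<otimes>\<^bsub>FF\<^esub> D (b i)) = (\<Oplus>\<^bsub>FF\<^esub>i\<in>{..<n}. cls (rep (a i)) \<otimes>\<^bsub>FF\<^esub> D (cls (rep (b i))))"
        using ab rep by (intro finsum_cong') (auto intro!: m_closed dest: funcset_mem)
    qed
  qed
qed

end

section \<open>The ring of functions on derivations\<close>

lemma ring_pointwise_ring:
  assumes "ring F"
  shows "ring (pointwise_ring I F)"
proof -
  interpret ring F by fact
  have mem: "\<And>x i. x \<in> carrier (pointwise_ring I F) \<Longrightarrow> i \<in> I \<Longrightarrow> x i \<in> carrier F"
    and ext: "\<And>x y. x \<in> carrier (pointwise_ring I F) \<Longrightarrow> y \<in> carrier (pointwise_ring I F) \<Longrightarrow>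
      (\<And>i. i \<in> I \<Longrightarrow> x i = y i) \<Longrightarrow> x = y"
    by (auto simp: pointwise_ring_def intro: PiE_ext)
  have add: "\<And>x y. x \<oplus>\<^bsub>pointwise_ring I F\<^esub> y = (\<lambda>i\<in>I. x i \<oplus>\<^bsub>F\<^esub> y i)"
    and mult: "\<And>x y. x \<otimes>\<^bsub>pointwise_ring I F\<^esub> y = (\<lambda>i\<in>I. x i \<otimes>\<^bsub>F\<^esub> y i)"
    and zero: "\<zero>\<^bsub>pointwise_ring I F\<^esub> = (\<lambda>i\<in>I. \<zero>\<^bsub>F\<^esub>)"
    and one: "\<one>\<^bsub>pointwise_ring I F\<^esub> = (\<lambda>i\<in>I. \<one>\<^bsub>F\<^esub>)"
    by (simp_all add: pointwise_ring_def)
  have restrict: "\<And>g. (\<And>i. i \<in> I \<Longrightarrow> g i \<in> carrier F) \<Longrightarrow> (\<lambda>i\<in>I. g i) \<in> carrier (pointwise_ring I F)"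
    by (auto simp: pointwise_ring_def)
  note ops = add mult zero one
  show ?thesis
  proof (intro ringI abelian_groupI monoidI)
    fix x assume x: "x \<in> carrier (pointwise_ring I F)"
    show "\<exists>y\<in>carrier (pointwise_ring I F). y \<oplus>\<^bsub>pointwise_ring I F\<^esub> x = \<zero>\<^bsub>pointwise_ring I F\<^esub>"
      by (intro bexI[of _ "\<lambda>i\<in>I. \<ominus>\<^bsub>F\<^esub> x i"] restrict ext) (auto simp: ops mem x l_neg intro!: restrict)
  next
    fix x y z assume x: "x \<in> carrier (pointwise_ring I F)" and y: "y \<in> carrier (pointwise_ring I F)"
      and z: "z \<in> carrier (pointwise_ring I F)"
    note c = x y z
    show "(x \<oplus>\<^bsub>pointwise_ring I F\<^esub> y) \<oplus>\<^bsub>pointwise_ring I F\<^esub> z = x \<oplus>\<^bsub>pointwise_ring I F\<^esub> (y \<oplus>\<^bsub>pointwise_ring I F\<^esub> z)"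
      "(x \<otimes>\<^bsub>pointwise_ring I F\<^esub> y) \<otimes>\<^bsub>pointwise_ring I F\<^esub> z = x \<otimes>\<^bsub>pointwise_ring I F\<^esub> (y \<otimes>\<^bsub>pointwise_ring I F\<^esub> z)"
      "(x \<oplus>\<^bsub>pointwise_ring I F\<^esub> y) \<otimes>\<^bsub>pointwise_ring I F\<^esub> z = x \<otimes>\<^bsub>pointwise_ring I F\<^esub> z \<oplus>\<^bsub>pointwise_ring I F\<^esub> y \<otimes>\<^bsub>pointwise_ring I F\<^esub> z"
      "z \<otimes>\<^bsub>pointwise_ring I F\<^esub> (x \<oplus>\<^bsub>pointwise_ring I F\<^esub> y) = z \<otimes>\<^bsub>pointwise_ring I F\<^esub> x \<oplus>\<^bsub>pointwise_ring I F\<^esub> z \<otimes>\<^bsub>pointwise_ring I F\<^esub> y"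
      using mem[OF x] mem[OF y] mem[OF z]
      by (simp_all add: ops a_assoc m_assoc l_distr r_distr cong: restrict_cong)
  next
    fix x y assume c: "x \<in> carrier (pointwise_ring I F)" "y \<in> carrier (pointwise_ring I F)"
    show "x \<oplus>\<^bsub>pointwise_ring I F\<^esub> y = y \<oplus>\<^bsub>pointwise_ring I F\<^esub> x"
      using mem[OF c(1)] mem[OF c(2)] by (simp add: ops a_comm cong: restrict_cong)
    show "x \<oplus>\<^bsub>pointwise_ring I F\<^esub> y \<in> carrier (pointwise_ring I F)"
      "x \<otimes>\<^bsub>pointwise_ring I F\<^esub> y \<in> carrier (pointwise_ring I F)"
      using mem[OF c(1)] mem[OF c(2)] by (auto simp: ops intro!: restrict)
  next
    fix x assume x: "x \<in> carrier (pointwise_ring I F)"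
    show "\<zero>\<^bsub>pointwise_ring I F\<^esub> \<oplus>\<^bsub>pointwise_ring I F\<^esub> x = x"
      "\<one>\<^bsub>pointwise_ring I F\<^esub> \<otimes>\<^bsub>pointwise_ring I F\<^esub> x = x" "x \<otimes>\<^bsub>pointwise_ring I F\<^esub> \<one>\<^bsub>pointwise_ring I F\<^esub> = x"
      by (auto intro!: ext restrict simp: ops mem[OF x] x)
  qed (auto simp: ops intro!: restrict)
qed

text \<open>Dimension is built inductively by adjoining lines to the zero space; a single step
  leaves the multiples of one vector.\<close>

lemma (in ring) dimension_one_span:
  assumes "dimension 1 K E" "K \<subseteq> carrier R"
  obtains v where "v \<in> carrier R" "v \<noteq> \<zero>" "E = {k \<otimes> v | k. k \<in> K}"
  using assms(1)
proof cases
  case zero_dim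
  thus ?thesis by simp
next
  case (Suc_dim v E' n)
  hence "E' = {\<zero>}" using dimension.cases[of 0 K E'] by force
  moreover have "line_extension K v {\<zero>} = {k \<otimes> v | k. k \<in> K}"
    using Suc_dim assms(2) by (force simp: line_extension_def r_coset_def set_add_def' subset_iff)
  ultimately show ?thesis using Suc_dim that by auto
qed


section \<open>Consequences of genus one\<close>

context plane_curve
begin

lemma xv_loc [simp]: "xv \<in> loc" and yv_loc [simp]: "yv \<in> loc"
  by (simp_all add: xv_def yv_def)

abbreviation "\<Omega>R \<equiv> pointwise_ring (derivations KK FF) FF"
abbreviation "const_functions \<equiv> {\<lambda>D \<in> derivations KK FF. c | c. c \<in> KK}"

lemma const_functions_subset: "const_functions \<subseteq> carrier \<Omega>R"
  by (auto simp: pointwise_ring_def const_fun_cls FF_simps)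

lemma genus_one_span:
  assumes "function_field_has_genus KK FF 1"
  obtains v where "v \<in> regular_differentials KK FF" "v \<noteq> \<zero>\<^bsub>\<Omega>R\<^esub>"
    "regular_differentials KK FF = {k \<otimes>\<^bsub>\<Omega>R\<^esub> v | k. k \<in> const_functions}"
proof -
  interpret FF: cring FF by (rule cring_FF)
  interpret P: ring \<Omega>R by (rule ring_pointwise_ring) (rule FF.ring_axioms)
  from assms have "P.dimension 1 const_functions (regular_differentials KK FF)"
    by (simp add: function_field_has_genus_def)
  then obtain v where v: "v \<in> carrier \<Omega>R" "v \<noteq> \<zero>\<^bsub>\<Omega>R\<^esub>"
    "regular_differentials KK FF = {k \<otimes>\<^bsub>\<Omega>R\<^esub> v | k. k \<in> const_functions}"
    by (rule P.dimension_one_span) (use const_functions_subset in auto)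
  have "\<one>\<^bsub>FF\<^esub> = const_fun f 1" by (simp add: FF_simps const_fun_cls flip: one_pCons)
  hence "\<one>\<^bsub>\<Omega>R\<^esub> \<in> const_functions" by (auto simp: pointwise_ring_def)
  hence "\<one>\<^bsub>\<Omega>R\<^esub> \<otimes>\<^bsub>\<Omega>R\<^esub> v \<in> regular_differentials KK FF" unfolding v(3) by blast
  thus ?thesis using v that by simp
qed

text \<open>A differential is a function on derivations, so a nonzero one is nonzero at some
  \<open>D\<close>. Evaluating all its local expressions at this single \<open>D\<close> gives
  congruences for one element \<open>h\<close>.\<close>

lemma genus_one_nonzero_differential:
  assumes "function_field_has_genus KK FF 1"
  obtains d h where "cder d" "h \<in> loc" "h \<notin> mx"
    "\<And>A. val_ring A \<Longrightarrow>
       \<exists>(n::nat) a b. (\<forall>i<n. a i \<in> A \<and> b i \<in> A) \<and> h \<approx> (\<Sum>i<n. a i * d (b i))"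
proof -
  interpret FF: cring FF by (rule cring_FF)
  obtain v where v: "v \<in> regular_differentials KK FF" "v \<noteq> \<zero>\<^bsub>\<Omega>R\<^esub>"
    using genus_one_span[OF assms] by blast
  have vdiff: "v \<in> differentials KK FF (carrier FF)"
    and vplace: "\<And>A. A \<in> places KK FF \<Longrightarrow> v \<in> differentials KK FF A"
    using v(1) by (auto simp: regular_differentials_def)
  from differentialsE[OF vdiff] obtain n :: nat and a b where
    ab: "\<And>i. i < n \<Longrightarrow> a i \<in> loc \<and> cls (a i) \<in> carrier FF \<and> b i \<in> loc \<and> cls (b i) \<in> carrier FF"
    "v = (\<lambda>D \<in> derivations KK FF. \<Oplus>\<^bsub>FF\<^esub>i\<in>{..<n}. cls (a i) \<otimes>\<^bsub>FF\<^esub> D (cls (b i)))" by blast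
  have "\<exists>D\<in>derivations KK FF. v D \<noteq> \<zero>\<^bsub>FF\<^esub>"
  proof (rule ccontr)
    assume "\<not> ?thesis"
    hence "v = \<zero>\<^bsub>\<Omega>R\<^esub>" using ab(2) by (auto simp: pointwise_ring_def fun_eq_iff restrict_def)
    thus False using v(2) by simp
  qed
  then obtain D where D: "D \<in> derivations KK FF" "v D \<noteq> \<zero>\<^bsub>FF\<^esub>" by blast
  obtain d where d: "cder d" "\<And>r. r \<in> loc \<Longrightarrow> D (cls r) = cls (d r)"
    using derivation_lift[OF D(1)] by blast
  define h where "h = (\<Sum>i<n. a i * d (b i))"
  have h: "h \<in> loc" unfolding h_def using ab(1) cderD(1)[OF d(1)] by (auto intro!: loc_sum)
  have vD: "v D = cls h"
    unfolding ab(2) h_def using D(1) ab(1) d differential_value[of n a b d D] by simp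
  have "h \<notin> mx" using D(2) vD cls_0_iff[OF h] by (simp add: FF_simps)
  moreover have "\<exists>(n::nat) a b. (\<forall>i<n. a i \<in> A \<and> b i \<in> A) \<and> h \<approx> (\<Sum>i<n. a i * d (b i))"
    if A: "val_ring A" for A
  proof (cases "A = loc")
    case True
    thus ?thesis using ab(1) unfolding h_def by (intro exI[of _ n] exI[of _ a] exI[of _ b]) auto
  next
    case False
    have sub: "A \<subseteq> loc" using A by (auto simp: val_ring_def)
    have "v \<in> differentials KK FF (cls ` A)" by (rule vplace) (rule val_ring_place[OF A False])
    moreover have "cls ` A \<subseteq> carrier FF" using sub by (auto simp: FF_simps)
    ultimately obtain m :: nat and a' b' where
      ab': "\<And>i. i < m \<Longrightarrow> a' i \<in> loc \<and> cls (a' i) \<in> cls ` A \<and> b' i \<in> loc \<and> cls (b' i) \<in> cls ` A"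
      "v = (\<lambda>D \<in> derivations KK FF. \<Oplus>\<^bsub>FF\<^esub>i\<in>{..<m}. cls (a' i) \<otimes>\<^bsub>FF\<^esub> D (cls (b' i)))"
      by (rule differentialsE) blast
    have mem: "a' i \<in> A \<and> b' i \<in> A" if "i < m" for i
      using ab'(1)[OF that] cls_in_image_iff[OF A] by blast
    have "v D = cls (\<Sum>i<m. a' i * d (b' i))"
      unfolding ab'(2) using D(1) ab'(1) d differential_value[of m a' b' d D] by simp
    hence "cls h = cls (\<Sum>i<m. a' i * d (b' i))" using vD by simp
    moreover have "(\<Sum>i<m. a' i * d (b' i)) \<in> loc"
      using ab'(1) cderD(1)[OF d(1)] by (auto intro!: loc_sum)
    ultimately have "h \<approx> (\<Sum>i<m. a' i * d (b' i))" using h cls_cong by blast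
    thus ?thesis using mem by blast
  qed
  ultimately show ?thesis using that[of d h] d(1) h by blast
qed

text \<open>The forms \<open>g1 dx\<close> and \<open>g2 dx\<close> are constant multiples of one
  differential. Evaluation at a derivation that does not kill \<open>x\<close> turns this into a
  linear relation between \<open>g1\<close> and \<open>g2\<close>. Local expressions with two
  summands suffice for the forms to which this is applied.\<close>

lemma genus_one_dependent:
  assumes genus: "function_field_has_genus KK FF 1"
    and g: "g1 \<in> loc" "g2 \<in> loc"
    and reg: "\<And>A g. val_ring A \<Longrightarrow> g \<in> {g1, g2} \<Longrightarrow>
      \<exists>a0 b0 a1 b1. {a0, b0, a1, b1} \<subseteq> A \<and> (\<forall>d. cder d \<longrightarrow> g * d xv \<approx> a0 * d b0 + a1 * d b1)"
    and d0: "cder d0" "d0 xv \<notin> mx"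
  obtains c1 c2 where "c1 \<noteq> 0 \<or> c2 \<noteq> 0" "const_fract c1 * g1 + const_fract c2 * g2 \<in> mx"
proof -
  interpret FF: cring FF by (rule cring_FF)
  define \<omega> where "\<omega> g = (\<lambda>D \<in> derivations KK FF. cls g \<otimes>\<^bsub>FF\<^esub> D (cls xv))" for g
  have val: "\<omega> g D = cls (g * d xv)"
    if "D \<in> derivations KK FF" "cder d" "\<And>r. r \<in> loc \<Longrightarrow> D (cls r) = cls (d r)" "g \<in> loc" for g D d
    using that cderD(1)[OF that(2)] by (simp add: \<omega>_def FF_mult)
  have "\<omega> g \<in> regular_differentials KK FF" if g': "g \<in> {g1, g2}" for g
  proof -
    have gl: "g \<in> loc" using g g' by auto
    have "\<omega> g = (\<lambda>D \<in> derivations KK FF. \<Oplus>\<^bsub>FF\<^esub>i\<in>{..<1::nat}. cls g \<otimes>\<^bsub>FF\<^esub> D (cls xv))"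
      unfolding \<omega>_def
    proof (intro restrict_ext)
      fix D assume "D \<in> derivations KK FF"
      then obtain d where d: "cder d" "\<And>r. r \<in> loc \<Longrightarrow> D (cls r) = cls (d r)" using derivation_lift by blast
      show "cls g \<otimes>\<^bsub>FF\<^esub> D (cls xv) = (\<Oplus>\<^bsub>FF\<^esub>i\<in>{..<1::nat}. cls g \<otimes>\<^bsub>FF\<^esub> D (cls xv))"
        using differential_value[of 1 "\<lambda>_. g" "\<lambda>_. xv" d D] d gl cderD(1)[OF d(1)] by (simp add: FF_mult)
    qed
    hence 1: "\<omega> g \<in> differentials KK FF (carrier FF)"
      using differentialsI[of 1 "\<lambda>_. g" "carrier FF" "\<lambda>_. xv"] gl by (simp add: FF_simps)
    have 2: "\<omega> g \<in> differentials KK FF A" if A: "A \<in> places KK FF" for A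
    proof -
      obtain a0 b0 a1 b1 where ab: "{a0, b0, a1, b1} \<subseteq> {r \<in> loc. cls r \<in> A}"
        "\<And>d. cder d \<Longrightarrow> g * d xv \<approx> a0 * d b0 + a1 * d b1"
        using reg[OF places_pullback[OF A] g'] by blast
      define a where "a i = (if i = (0::nat) then a0 else a1)" for i
      define b where "b i = (if i = (0::nat) then b0 else b1)" for i
      have mem: "a i \<in> loc \<and> cls (a i) \<in> A \<and> b i \<in> loc \<and> cls (b i) \<in> A" for i
        using ab(1) by (auto simp: a_def b_def)
      have "\<omega> g = (\<lambda>D \<in> derivations KK FF. \<Oplus>\<^bsub>FF\<^esub>i\<in>{..<2::nat}. cls (a i) \<otimes>\<^bsub>FF\<^esub> D (cls (b i)))"
        unfolding \<omega>_def
      proof (intro restrict_ext)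
        fix D assume "D \<in> derivations KK FF"
        then obtain d where d: "cder d" "\<And>r. r \<in> loc \<Longrightarrow> D (cls r) = cls (d r)" using derivation_lift by blast
        have "(\<Oplus>\<^bsub>FF\<^esub>i\<in>{..<2::nat}. cls (a i) \<otimes>\<^bsub>FF\<^esub> D (cls (b i))) = cls (\<Sum>i<2. a i * d (b i))"
          by (rule differential_value) (use mem d in auto)
        also have "(\<Sum>i<2. a i * d (b i)) = a0 * d b0 + a1 * d b1" by (simp add: a_def b_def numeral_2_eq_2)
        also have "cls \<dots> = cls (g * d xv)"
        proof (rule iffD2[OF cls_cong])
          have "a0 \<in> loc" "b0 \<in> loc" "a1 \<in> loc" "b1 \<in> loc" using ab(1) by auto
          thus "a0 * d b0 + a1 * d b1 \<in> loc" using cderD(1)[OF d(1)] by (intro loc_add loc_mult)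
          show "g * d xv \<in> loc" using cderD(1)[OF d(1)] gl by (intro loc_mult) auto
          show "a0 * d b0 + a1 * d b1 \<approx> g * d xv" by (rule cong_sym) (rule ab(2)[OF d(1)])
        qed
        finally show "cls g \<otimes>\<^bsub>FF\<^esub> D (cls xv) = (\<Oplus>\<^bsub>FF\<^esub>i\<in>{..<2::nat}. cls (a i) \<otimes>\<^bsub>FF\<^esub> D (cls (b i)))"
          using d gl cderD(1)[OF d(1)] by (simp add: FF_mult)
      qed
      thus ?thesis using differentialsI[of 2 a A b] mem by simp
    qed
    show ?thesis using 1 2 by (simp add: regular_differentials_def)
  qed
  hence reg: "\<omega> g1 \<in> regular_differentials KK FF" "\<omega> g2 \<in> regular_differentials KK FF" by auto
  obtain v where v: "v \<in> regular_differentials KK FF"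
    "regular_differentials KK FF = {k \<otimes>\<^bsub>\<Omega>R\<^esub> v | k. k \<in> const_functions}"
    using genus_one_span[OF genus] by blast
  obtain D where D: "D \<in> derivations KK FF" "\<And>r. r \<in> loc \<Longrightarrow> D (cls r) = cls (d0 r)"
    using derivation_of_cder[OF d0(1)] by blast
  have "v D \<in> carrier FF"
  proof -
    have "v \<in> differentials KK FF (carrier FF)" using v(1) by (simp add: regular_differentials_def)
    from differentialsE[OF this subset_refl] obtain n :: nat and a b where
      ab: "\<And>i. i < n \<Longrightarrow> a i \<in> loc \<and> cls (a i) \<in> carrier FF \<and> b i \<in> loc \<and> cls (b i) \<in> carrier FF"
      "v = (\<lambda>D \<in> derivations KK FF. \<Oplus>\<^bsub>FF\<^esub>i\<in>{..<n}. cls (a i) \<otimes>\<^bsub>FF\<^esub> D (cls (b i)))"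
      by blast
    have "v D = cls (\<Sum>i<n. a i * d0 (b i))"
      unfolding ab(2) using D ab(1) differential_value[of n a b d0 D] d0(1) by simp
    moreover have "(\<Sum>i<n. a i * d0 (b i)) \<in> loc"
      using ab(1) cderD(1)[OF d0(1)] by (auto intro!: loc_sum)
    ultimately show ?thesis by (simp add: FF_simps)
  qed
  then obtain w where w: "w \<in> loc" "v D = cls w" by (rule FF_cases)
  have mult: "\<exists>c. g * d0 xv \<approx> const_fract c * w" if g': "g \<in> loc" "\<omega> g \<in> regular_differentials KK FF" for g
  proof -
    obtain c where "\<omega> g = (\<lambda>D \<in> derivations KK FF. const_fun f c) \<otimes>\<^bsub>\<Omega>R\<^esub> v" using g'(2) unfolding v(2) by blast
    hence "\<omega> g D = cls (const_fract c * w)"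
      using D(1) w by (simp add: pointwise_ring_def const_fun_cls FF_mult)
    hence eq: "cls (g * d0 xv) = cls (const_fract c * w)" using val[OF D(1) d0(1) D(2) g'(1)] by simp
    have "d0 xv \<in> loc" by (rule cderD(1)[OF d0(1) xv_loc])
    hence "g * d0 xv \<approx> const_fract c * w"
      by (intro iffD1[OF cls_cong eq] loc_mult g'(1) w(1) to_fract_loc)
    thus ?thesis ..
  qed
  obtain c1 c2 where c: "g1 * d0 xv \<approx> const_fract c1 * w" "g2 * d0 xv \<approx> const_fract c2 * w"
    using mult[OF g(1) reg(1)] mult[OF g(2) reg(2)] by blast
  have d0x: "d0 xv \<in> loc" using cderD(1)[OF d0(1)] by simp
  show ?thesis
  proof (cases "c1 = 0")
    case True
    hence "g1 * d0 xv \<in> mx" using c(1) by (simp add: cong_0_iff)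
    hence "g1 \<in> mx" using mx_prime[OF g(1) d0x] d0(2) by blast
    thus ?thesis using that[of 1 0] g by (simp flip: one_pCons)
  next
    case False
    have "const_fract c2 * (g1 * d0 xv) - const_fract c1 * (g2 * d0 xv)
        \<approx> const_fract c2 * (const_fract c1 * w) - const_fract c1 * (const_fract c2 * w)"
      using c by (intro cong_diff cong_mult_left) auto
    hence "const_fract c2 * (g1 * d0 xv) - const_fract c1 * (g2 * d0 xv) \<in> mx"
      by (simp add: cong_0_iff mult.left_commute)
    hence "(const_fract c2 * g1 - const_fract c1 * g2) * d0 xv \<in> mx" by (simp add: algebra_simps)
    moreover have "const_fract c2 * g1 - const_fract c1 * g2 \<in> loc"
      using g by (intro loc_diff loc_mult to_fract_loc)
    ultimately have "const_fract c2 * g1 - const_fract c1 * g2 \<in> mx"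
      using mx_prime[OF _ d0x] d0(2) by metis
    moreover have "const_fract (- c1) = - const_fract c1" by (simp flip: to_fract_uminus)
    ultimately show ?thesis using that[of c2 "- c1"] False by simp
  qed
qed


text \<open>The Jacobian derivation that sends \<open>p\<close> to
  \<open>f_Y * p_X - f_X * p_Y\<close>, where \<open>pderiv\<close> differentiates by the outer
  variable \<open>Y\<close>. It kills \<open>f\<close> and so descends to the curve, with value
  \<open>f_Y\<close> on \<open>X\<close>.\<close>

definition dpoly :: "'a poly poly \<Rightarrow> 'a poly poly" where
  "dpoly p = pderiv f * map_poly pderiv p - map_poly pderiv f * pderiv p"

end

lemma map_poly_pderiv_add: "map_poly pderiv (p + q) = map_poly pderiv p + map_poly pderiv (q :: 'a::idom poly poly)"
  by (rule poly_eqI) (simp add: coeff_map_poly pderiv_add)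

lemma pderiv_sum: "pderiv (sum g A) = (\<Sum>x\<in>A. pderiv (g x :: 'a::idom poly))"
  by (induction A rule: infinite_finite_induct) (simp_all add: pderiv_add)

lemma map_poly_pderiv_mult:
  "map_poly pderiv (p * q) = p * map_poly pderiv q + q * map_poly pderiv (p :: 'a::idom poly poly)"
proof (rule poly_eqI)
  fix n
  have "coeff (map_poly pderiv (p * q)) n = (\<Sum>i\<le>n. coeff p i * pderiv (coeff q (n - i)) + coeff q (n - i) * pderiv (coeff p i))"
    by (simp add: coeff_map_poly coeff_mult pderiv_sum pderiv_mult)
  also have "\<dots> = coeff (p * map_poly pderiv q + map_poly pderiv p * q) n"
    unfolding coeff_add coeff_mult sum.distrib by (simp add: coeff_map_poly mult.commute)
  finally show "coeff (map_poly pderiv (p * q)) n = coeff (p * map_poly pderiv q + q * map_poly pderiv p) n"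
    by (simp add: mult.commute[of q "map_poly pderiv p"])
qed

context plane_curve
begin

lemma dpoly_add: "dpoly (p + q) = dpoly p + dpoly q"
  by (simp add: dpoly_def map_poly_pderiv_add pderiv_add algebra_simps)

lemma dpoly_mult: "dpoly (p * q) = p * dpoly q + q * dpoly p"
  by (simp add: dpoly_def map_poly_pderiv_mult pderiv_mult algebra_simps)

lemma dpoly_1 [simp]: "dpoly 1 = 0"
proof -
  have "dpoly (1 * 1) = 1 * dpoly 1 + 1 * dpoly 1" by (rule dpoly_mult)
  hence "dpoly 1 + 0 = dpoly 1 + dpoly 1" by (simp only: mult_1 add_0_right)
  thus ?thesis by (simp only: add_left_cancel)
qed

lemma dpoly_f: "dpoly f = 0"
  by (simp add: dpoly_def mult.commute)

text \<open>Extends \<open>dpoly\<close> to fractions by the quotient rule, the value being independent of the representation.\<close>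

definition dcan :: "'a poly poly fract \<Rightarrow> 'a poly poly fract" where
  "dcan r = (let (p, q) = (SOME (p, q). q \<noteq> 0 \<and> r = Fract p q) in Fract (q * dpoly p - p * dpoly q) (q * q))"

lemma dcan_Fract:
  assumes "q \<noteq> 0"
  shows "dcan (Fract p q) = Fract (q * dpoly p - p * dpoly q) (q * q)"
proof -
  define z where "z = (SOME (p', q'). q' \<noteq> 0 \<and> Fract p q = Fract p' q')"
  have "\<exists>z. case z of (p', q') \<Rightarrow> q' \<noteq> 0 \<and> Fract p q = Fract p' q'" using assms by auto
  hence "case z of (p', q') \<Rightarrow> q' \<noteq> 0 \<and> Fract p q = Fract p' q'" unfolding z_def by (rule someI_ex)
  then obtain p' q' where z: "z = (p', q')" "q' \<noteq> 0" "Fract p q = Fract p' q'" by (cases z) auto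
  have eq: "p * q' = p' * q" using z(2,3) assms by (simp add: eq_fract)
  hence "dpoly (p * q') = dpoly (p' * q)" by simp
  hence deq: "p * dpoly q' + q' * dpoly p = p' * dpoly q + q * dpoly p'" by (simp add: dpoly_mult)
  have "dcan (Fract p q) = Fract (q' * dpoly p' - p' * dpoly q') (q' * q')"
    unfolding dcan_def z_def[symmetric] z(1) by simp
  also have "\<dots> = Fract (q * dpoly p - p * dpoly q) (q * q)"
  proof -
    have "(q' * dpoly p' - p' * dpoly q') * (q * q) = q * q' * (q * dpoly p') - q * (p' * q) * dpoly q'"
      by (simp add: algebra_simps)
    also have "q * dpoly p' = p * dpoly q' + q' * dpoly p - p' * dpoly q" using deq by simp
    also have "q * q' * (p * dpoly q' + q' * dpoly p - p' * dpoly q) - q * (p' * q) * dpoly q'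
        = q * q' * (p * dpoly q' + q' * dpoly p) - q' * (p' * q) * dpoly q - q * (p' * q) * dpoly q'"
      by (simp add: algebra_simps)
    also have "\<dots> = (q * dpoly p - p * dpoly q) * (q' * q')" unfolding eq[symmetric]
      by (simp add: algebra_simps)
    finally have "(q' * dpoly p' - p' * dpoly q') * (q * q) = (q * dpoly p - p * dpoly q) * (q' * q')" .
    thus ?thesis using assms z(2) by (simp add: eq_fract)
  qed
  finally show ?thesis .
qed

text \<open>Since the derivation kills \<open>f\<close>, it sends multiples of \<open>f\<close> to
  multiples of \<open>f\<close>, and the quotient rule then preserves the local ring and its maximal
  ideal.\<close>

lemma cder_dcan: "cder dcan"
  unfolding cder_def
proof (intro conjI ballI allI impI)
  have mx: "dcan r \<in> mx" if r: "r \<in> mx" for r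
  proof -
    obtain p q where pq: "r = Fract p q" "f dvd p" "\<not> f dvd q" "q \<noteq> 0" using r by (rule mxE)
    obtain s where "p = f * s" using pq(2) by (elim dvdE)
    hence "dpoly p = f * dpoly s" by (simp add: dpoly_mult dpoly_f)
    thus ?thesis using pq by (simp add: dcan_Fract Fract_in_mx_iff not_dvd_mult)
  qed
  have add: "dcan (r + s) = dcan r + dcan s" if "r \<in> loc" "s \<in> loc" for r s
  proof -
    from that(1) obtain p q where pq: "r = Fract p q" "\<not> f dvd q" "q \<noteq> 0" by (rule locE)
    from that(2) obtain p' q' where pq': "s = Fract p' q'" "\<not> f dvd q'" "q' \<noteq> 0" by (rule locE)
    show ?thesis using pq pq' by (simp add: dcan_Fract dpoly_mult dpoly_add eq_fract algebra_simps)
  qed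
  fix r assume r: "r \<in> loc"
  then obtain p q where pq: "r = Fract p q" "\<not> f dvd q" "q \<noteq> 0" by (rule locE)
  thus "dcan r \<in> loc" by (simp add: dcan_Fract locI not_dvd_mult)
  fix s assume s: "s \<in> loc"
  then obtain p' q' where pq': "s = Fract p' q'" "\<not> f dvd q'" "q' \<noteq> 0" by (rule locE)
  show "dcan (r + s) \<approx> dcan r + dcan s" using add[OF r s] by simp
  have "dcan (r * s) = r * dcan s + s * dcan r"
    using pq pq' by (simp add: dcan_Fract dpoly_mult eq_fract algebra_simps)
  thus "dcan (r * s) \<approx> r * dcan s + s * dcan r" by simp
  assume "r \<approx> s"
  hence "dcan (r - s) \<in> mx" by (intro mx) (simp add: cong_mx_def)
  thus "dcan r \<approx> dcan s" using add[OF loc_diff[OF r s] s] by (simp add: cong_mx_def)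
next
  fix c
  have "dpoly [:[:c:]:] = 0" by (simp add: dpoly_def map_poly_pCons)
  thus "dcan (const_fract c) \<approx> 0"
    by (simp add: to_fract_def dcan_Fract Zero_fract_def flip: Zero_fract_def)
qed

lemma dcan_xv: "dcan xv = to_fract (pderiv f)"
proof -
  have "pderiv [:0, 1 :: 'a:] = 1" by (simp add: pderiv_pCons one_pCons)
  hence "map_poly pderiv [:[:0, 1 :: 'a:]:] = 1" by (simp add: map_poly_pCons one_pCons)
  hence "dpoly [:[:0, 1:]:] = pderiv f" by (simp add: dpoly_def)
  thus ?thesis by (simp add: xv_def to_fract_def dcan_Fract)
qed

end

context plane_curve
begin

subsection \<open>Rational function fields\<close>

lemma ev_loc [simp]: "z \<in> loc \<Longrightarrow> ev z p \<in> loc"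
  by (induction p) auto

lemma cong_cancel:
  assumes "t \<in> loc" "t \<notin> mx" "r \<in> loc" "s \<in> loc" "t * r \<approx> t * s"
  shows "r \<approx> s"
  using mx_prime[of t "r - s"] assms by (auto simp: cong_mx_def algebra_simps)

lemma cder_ev:
  assumes d: "cder d" and z: "z \<in> loc"
  shows "d (ev z p) \<approx> ev z (pderiv p) * d z"
proof (induction p)
  case 0
  show ?case using cderD(4)[OF d, of 0] by simp
next
  case (pCons c p)
  note dl = cderD(1)[OF d]
  have "d (const_fract c + z * ev z p) \<approx> d (const_fract c) + d (z * ev z p)"
    by (intro cderD(2)[OF d]) (use z in auto)
  also have "\<dots> \<approx> 0 + (z * d (ev z p) + ev z p * d z)"
    by (intro cong_add cderD(3,4)[OF d]) (use z in auto)
  also have "\<dots> \<approx> 0 + (z * (ev z (pderiv p) * d z) + ev z p * d z)"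
    by (intro cong_add cong_mult_left pCons.IH z cong_refl)
  also have "\<dots> = ev z (pderiv (pCons c p)) * d z"
    by (simp add: pderiv_pCons algebra_simps)
  finally show ?case by simp
qed

text \<open>Expresses \<open>r = p(z) / q(z)\<close> in the function field. Keeping numerator and
  denominator as polynomials makes their roots and degrees available.\<close>

definition represents :: "'a poly poly fract \<Rightarrow> 'a poly \<Rightarrow> 'a poly \<Rightarrow> 'a poly poly fract \<Rightarrow> bool" where
  "represents z p q r \<longleftrightarrow> r \<in> loc \<and> ev z q \<notin> mx \<and> r * ev z q \<approx> ev z p"

lemma represents_ev: "z \<in> loc \<Longrightarrow> represents z p 1 (ev z p)"
  by (simp add: represents_def)

lemma represents_const: "z \<in> loc \<Longrightarrow> represents z [:c:] 1 (const_fract c)"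
  by (simp add: represents_def)

lemma represents_add:
  assumes z: "z \<in> loc" and r: "represents z p q r" and s: "represents z p' q' s"
  shows "represents z (p * q' + p' * q) (q * q') (r + s)"
proof -
  have "(r * ev z q) * ev z q' + (s * ev z q') * ev z q \<approx> ev z p * ev z q' + ev z p' * ev z q"
    by (intro cong_add cong_mult) (use z r s in \<open>auto simp: represents_def\<close>)
  thus ?thesis using z r s mult_not_mx[of "ev z q" "ev z q'"]
    by (auto simp: represents_def algebra_simps)
qed

lemma represents_mult:
  assumes z: "z \<in> loc" and r: "represents z p q r" and s: "represents z p' q' s"
  shows "represents z (p * p') (q * q') (r * s)"
proof -
  have "(r * ev z q) * (s * ev z q') \<approx> ev z p * ev z p'"
    by (intro cong_mult) (use z r s in \<open>auto simp: represents_def\<close>)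
  thus ?thesis using z r s mult_not_mx[of "ev z q" "ev z q'"]
    by (auto simp: represents_def algebra_simps)
qed

lemma represents_not_mx:
  assumes z: "z \<in> loc" and r: "represents z p q r" "r \<notin> mx"
  shows "ev z p \<notin> mx"
proof
  assume "ev z p \<in> mx"
  hence "r * ev z q \<approx> 0"
    using r(1) cong_trans[of "r * ev z q" "ev z p" 0] by (simp add: represents_def cong_0_iff)
  thus False using mult_not_mx[of r "ev z q"] r z by (auto simp: represents_def cong_0_iff)
qed

lemma represents_inverse:
  assumes z: "z \<in> loc" and r: "represents z p q r" "r \<notin> mx"
  shows "represents z q p (inverse r)"
proof -
  have "r \<noteq> 0" using r(2) by auto
  have r': "r \<in> loc" "r * ev z q \<approx> ev z p" using r(1) by (simp_all add: represents_def)
  have "inverse r * (r * ev z q) \<approx> inverse r * ev z p"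
    by (intro cong_mult_left loc_inverse r' r(2))
  hence "inverse r * ev z p \<approx> ev z q" using cong_sym \<open>r \<noteq> 0\<close> by (simp flip: mult.assoc)
  thus ?thesis using represents_not_mx[OF assms] loc_inverse[OF r'(1) r(2)] by (simp add: represents_def)
qed

lemma represents_cong: "represents z p q r \<Longrightarrow> s \<approx> r \<Longrightarrow> z \<in> loc \<Longrightarrow> represents z p q s"
  using cong_mult_left[of "ev z q" s r] cong_loc[of s r] cong_trans[of "s * ev z q" "r * ev z q" "ev z p"]
  by (simp add: represents_def mult.commute)

lemma represents_eq:
  assumes z: "z \<in> loc" and r: "represents z p q r" "represents z p' q' r"
  shows "ev z (p * q') \<approx> ev z (p' * q)"
proof -
  have rr: "r * ev z q \<approx> ev z p" "r * ev z q' \<approx> ev z p'" using r by (auto simp: represents_def)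
  have "ev z q' * ev z p \<approx> ev z q' * (r * ev z q)"
    by (rule cong_mult_left[OF ev_loc[OF z] cong_sym[OF rr(1)]])
  also have "\<dots> = ev z q * (r * ev z q')" by (simp add: algebra_simps)
  also have "\<dots> \<approx> ev z q * ev z p'"
    by (rule cong_mult_left[OF ev_loc[OF z] rr(2)])
  finally show ?thesis by (simp add: algebra_simps)
qed

text \<open>Chain rule and quotient rule: the derivative of \<open>p(z) / q(z)\<close> is the
  Wronskian over \<open>q * q\<close>, times \<open>d z\<close>.\<close>

lemma represents_der:
  assumes d: "cder d" and z: "z \<in> loc" and r: "represents z p q r"
  obtains w where "represents z (pderiv p * q - p * pderiv q) (q * q) w" "d r \<approx> w * d z"
proof -
  define Q P where "Q = ev z q" "P = ev z p"
  have Q: "Q \<in> loc" "Q \<notin> mx" "P \<in> loc" "r \<in> loc" "r * Q \<approx> P" using r z by (auto simp: represents_def Q_P_def)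
  note dl = cderD(1)[OF d]
  have QQ: "Q * Q \<in> loc" "Q * Q \<notin> mx" using Q mult_not_mx by auto
  define w where "w = ev z (pderiv p * q - p * pderiv q) / (Q * Q)"
  have w: "w \<in> loc" unfolding w_def using QQ z by (intro loc_divide ev_loc)
  have "Q \<noteq> 0" using Q(2) by auto
  have "represents z (pderiv p * q - p * pderiv q) (q * q) w"
    using w QQ \<open>Q \<noteq> 0\<close> by (simp add: represents_def w_def Q_P_def)
  moreover have "d r \<approx> w * d z"
  proof (rule cong_cancel[of "Q * Q"])
    have 1: "r * d Q + Q * d r \<approx> d P"
      using cong_trans[OF cong_sym[OF cderD(3)[OF d Q(4,1)]] cderD(5)[OF d _ Q(3,5)]] Q by auto
    have "Q * Q * d r = Q * (r * d Q + Q * d r) - (r * Q) * d Q" by (simp add: algebra_simps)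
    also have "\<dots> \<approx> Q * d P - P * d Q"
      by (intro cong_diff cong_mult_left cong_mult 1 Q dl loc_mult cong_refl)
    also have "\<dots> \<approx> Q * (ev z (pderiv p) * d z) - P * (ev z (pderiv q) * d z)"
      unfolding Q_P_def by (intro cong_diff cong_mult_left cder_ev d z ev_loc)
    also have "\<dots> = ev z (pderiv p * q - p * pderiv q) * d z" by (simp add: Q_P_def algebra_simps)
    also have "ev z (pderiv p * q - p * pderiv q) = Q * Q * w" using \<open>Q \<noteq> 0\<close> by (simp add: w_def)
    also have "Q * Q * w * d z = Q * Q * (w * d z)" by (simp add: mult.assoc)
    finally show "Q * Q * d r \<approx> Q * Q * (w * d z)" .
  qed (use QQ Q dl w z in auto)
  ultimately show ?thesis by (rule that)
qed

text \<open>The elements rational in \<open>z\<close> are closed under the field operations and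
  contain the constants, so they exhaust the field once both coordinates are among them.\<close>

lemma generated_closure:
  assumes z: "z \<in> loc" and xy: "\<exists>p q. represents z p q xv" "\<exists>p q. represents z p q yv"
    and r: "r \<in> loc"
  shows "\<exists>p q. represents z p q r"
proof -
  have X: "\<exists>a b. represents z a b (to_fract [:p:])" for p
  proof (induction p)
    case 0
    show ?case using represents_const[OF z, of 0] by auto
  next
    case (pCons c p)
    have "to_fract [:pCons c p:] = const_fract c + xv * to_fract [:p:]"
      by (simp add: xv_def flip: to_fract_add to_fract_mult)
    thus ?case using represents_add[OF z] represents_mult[OF z] represents_const[OF z] pCons.IH xy(1) by metis
  qed
  have XY: "\<exists>a b. represents z a b (to_fract p)" for p
  proof (induction p)
    case 0
    show ?case using represents_const[OF z, of 0] by auto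
  next
    case (pCons c p)
    have "to_fract (pCons c p) = to_fract [:c:] + yv * to_fract p"
      by (simp add: yv_def flip: to_fract_add to_fract_mult)
    thus ?case using represents_add[OF z] represents_mult[OF z] X pCons.IH xy(2) by metis
  qed
  obtain p q where pq: "r = Fract p q" "\<not> f dvd q" "q \<noteq> 0" using r by (rule locE)
  hence "r = to_fract p * inverse (to_fract q)" by (simp add: Fract_conv_to_fract field_class.field_divide_inverse)
  moreover have "\<exists>a b. represents z a b (inverse (to_fract q))"
    using XY[of q] represents_inverse[OF z] pq(2) by (meson to_fract_mx_iff)
  ultimately show ?thesis using XY[of p] represents_mult[OF z] by metis
qed

end

lemma coeff_mult_degree_bound:
  fixes p q :: "'b::idom poly"
  assumes "degree p \<le> m" "degree q \<le> n"
  shows "coeff (p * q) (m + n) = coeff p m * coeff q n"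
proof (cases "degree p = m \<and> degree q = n")
  case True
  thus ?thesis using coeff_mult_degree_sum[of p q] by auto
next
  case False
  hence "coeff p m * coeff q n = 0" using assms by (auto simp: coeff_eq_0)
  moreover have "degree (p * q) < m + n" using degree_mult_le[of p q] assms False by linarith
  ultimately show ?thesis by (simp add: coeff_eq_0)
qed

section \<open>Regular differentials on a rational curve\<close>

locale closed_plane_curve = plane_curve f for f :: "'a::{alg_closed_field, field_char_0} poly poly"
begin

text \<open>Over an algebraically closed field a nonconstant polynomial splits off linear factors,
  and no \<open>z - c\<close> vanishes on the curve.\<close>

lemma transcendental:
  assumes z: "z \<in> loc" and nc: "\<And>c. z - const_fract c \<notin> mx" and p: "ev z p \<in> mx"
  shows "p = 0"
  using p
proof (induction "degree p" arbitrary: p rule: less_induct)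
  case less
  show ?case
  proof (cases "degree p = 0")
    case True
    then obtain c where "p = [:c:]" by (elim degree_eq_zeroE)
    thus ?thesis using less.prems const_mx_iff[of c] by (simp del: to_fract_mx_iff const_mx_iff)
  next
    case False
    then obtain a where "poly p a = 0" using alg_closed_imp_poly_has_root[of p] by auto
    then obtain q where q: "p = [:- a, 1:] * q" unfolding poly_eq_0_iff_dvd by (rule dvdE)
    have "q \<noteq> 0" using False q by auto
    hence "degree q < degree p" by (simp add: q degree_mult_eq del: mult_pCons_left)
    moreover have "const_fract (- a) = - const_fract a" by (simp flip: to_fract_uminus)
    hence "ev z p = (z - const_fract a) * ev z q" by (simp only: q ev_mult) (simp flip: one_pCons)
    hence "ev z q \<in> mx"
      using less.prems nc[of a] mx_prime[of "z - const_fract a" "ev z q"] loc_diff[OF z to_fract_loc] ev_loc[OF z]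
      by metis
    ultimately have "q = 0" using less.hyps by blast
    thus ?thesis using q by simp
  qed
qed

text \<open>The denominator has least degree: at a common root \<open>a\<close> the factor
  \<open>z - a\<close> could be cancelled, because it is a unit.\<close>

lemma reduced_representation:
  assumes z: "z \<in> loc" and nc: "\<And>c. z - const_fract c \<notin> mx" and ex: "\<exists>p q. represents z p q r"
  obtains p q where "represents z p q r" "\<And>a. poly p a = 0 \<Longrightarrow> poly q a = 0 \<Longrightarrow> False"
proof -
  define Q where "Q n \<longleftrightarrow> (\<exists>p q. represents z p q r \<and> n = degree q)" for n
  have "\<exists>n. Q n" using ex by (auto simp: Q_def)
  then obtain n where n: "Q n" "\<And>m. m < n \<Longrightarrow> \<not> Q m" using exists_least_iff[of Q] by auto
  obtain p q where pq: "represents z p q r" "n = degree q" using n(1) by (auto simp: Q_def)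
  show ?thesis
  proof (rule that[OF pq(1)])
    fix a assume "poly p a = 0" "poly q a = 0"
    hence "[:- a, 1:] dvd p" "[:- a, 1:] dvd q" by (simp_all add: poly_eq_0_iff_dvd)
    then obtain p' q' where p': "p = [:- a, 1:] * p'" and q': "q = [:- a, 1:] * q'"
      unfolding dvd_def by blast
    have l: "ev z [:- a, 1:] = z - const_fract a"
    proof -
      have "const_fract (- a) = - const_fract a" by (simp flip: to_fract_uminus)
      thus ?thesis by (simp flip: one_pCons)
    qed
    have rl: "r \<in> loc" "ev z q \<notin> mx" "r * ev z q \<approx> ev z p" using pq(1) by (auto simp: represents_def)
    have zl: "z - const_fract a \<in> loc" using z by auto
    have "ev z q' \<notin> mx" using rl(2) mx_mult_left[OF zl] unfolding q' ev_mult l by blast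
    moreover have e: "(z - const_fract a) * (r * ev z q') \<approx> (z - const_fract a) * ev z p'"
      using rl(3) unfolding p' q' ev_mult l by (simp add: mult.left_commute)
    have "r * ev z q' \<approx> ev z p'"
      by (rule cong_cancel[OF zl nc _ _ e]) (intro loc_mult rl ev_loc z)+
    ultimately have "represents z p' q' r" using rl by (simp add: represents_def)
    hence "Q (degree q')" by (auto simp: Q_def)
    moreover have "q' \<noteq> 0" using rl(2) q' by auto
    hence "degree q' < n" unfolding pq(2) q' by (simp add: degree_mult_eq del: mult_pCons_left)
    ultimately show False using n(2) by blast
  qed
qed

text \<open>The place \<open>z = a\<close> of the projective line. The dichotomy between an element
  and its inverse comes from a representation without common roots.\<close>

lemma val_ring_finite:
  assumes z: "z \<in> loc" and nc: "\<And>c. z - const_fract c \<notin> mx"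
    and gen: "\<And>r. r \<in> loc \<Longrightarrow> \<exists>p q. represents z p q r"
  shows "val_ring {r. \<exists>p q. represents z p q r \<and> poly q a \<noteq> 0}" (is "val_ring ?A")
  unfolding val_ring_def
proof (intro conjI ballI allI subsetI)
  fix r assume "r \<in> ?A" thus "r \<in> loc" by (auto simp: represents_def)
next
  fix r assume "r \<in> mx"
  hence "represents z 0 1 r" using mx_loc by (simp add: represents_def cong_0_iff)
  thus "r \<in> ?A" by (intro CollectI exI[of _ "0::'a poly"] exI[of _ "1::'a poly"]) simp
next
  fix c show "const_fract c \<in> ?A" using represents_const[OF z, of c]
    by (intro CollectI exI[of _ "[:c:]"] exI[of _ "1::'a poly"]) simp
next
  fix r s assume "r \<in> ?A" "s \<in> ?A"
  then obtain p q p' q' where *: "represents z p q r" "poly q a \<noteq> 0" "represents z p' q' s" "poly q' a \<noteq> 0"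
    by blast
  have "poly (q * q') a \<noteq> 0" using * by simp
  thus "r + s \<in> ?A" "r * s \<in> ?A"
    using represents_add[OF z *(1,3)] represents_mult[OF z *(1,3)] by blast+
next
  fix r assume r: "r \<in> loc - mx"
  obtain p q where pq: "represents z p q r" "\<And>a. poly p a = 0 \<Longrightarrow> poly q a = 0 \<Longrightarrow> False"
    using reduced_representation[OF z nc gen[of r]] r by blast
  thus "r \<in> ?A \<or> inverse r \<in> ?A" using represents_inverse[OF z pq(1)] r by blast
qed

text \<open>The place at infinity of the projective line.\<close>

lemma val_ring_infinite:
  assumes z: "z \<in> loc" and gen: "\<And>r. r \<in> loc \<Longrightarrow> \<exists>p q. represents z p q r"
  shows "val_ring {r. \<exists>p q. represents z p q r \<and> degree p \<le> degree q}" (is "val_ring ?A")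
  unfolding val_ring_def
proof (intro conjI ballI allI subsetI)
  fix r assume "r \<in> ?A" thus "r \<in> loc" by (auto simp: represents_def)
next
  fix r assume "r \<in> mx"
  hence "represents z 0 1 r" using mx_loc by (simp add: represents_def cong_0_iff)
  thus "r \<in> ?A" by (intro CollectI exI[of _ "0::'a poly"] exI[of _ "1::'a poly"]) simp
next
  fix c show "const_fract c \<in> ?A" using represents_const[OF z, of c]
    by (intro CollectI exI[of _ "[:c:]"] exI[of _ "1::'a poly"]) simp
next
  fix r s assume "r \<in> ?A" "s \<in> ?A"
  then obtain p q p' q' where *: "represents z p q r" "degree p \<le> degree q" "represents z p' q' s" "degree p' \<le> degree q'"
    by blast
  have nz: "q \<noteq> 0" "q' \<noteq> 0" using *(1,3) by (auto simp: represents_def)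
  have "degree (p * q' + p' * q) \<le> degree (q * q')"
    using *(2,4) nz by (intro degree_add_le order.trans[OF degree_mult_le]) (simp_all add: degree_mult_eq)
  thus "r + s \<in> ?A" using represents_add[OF z *(1,3)] by blast
  have "degree (p * p') \<le> degree (q * q')"
    using *(2,4) nz by (intro order.trans[OF degree_mult_le]) (simp add: degree_mult_eq)
  thus "r * s \<in> ?A" using represents_mult[OF z *(1,3)] by blast
next
  fix r assume r: "r \<in> loc - mx"
  obtain p q where pq: "represents z p q r" using gen[of r] r by blast
  hence "represents z q p (inverse r)" using represents_inverse[OF z] r by blast
  with pq have "degree p \<le> degree q \<longrightarrow> r \<in> ?A" "degree q \<le> degree p \<longrightarrow> inverse r \<in> ?A" by blast+
  thus "r \<in> ?A \<or> inverse r \<in> ?A" using nat_le_linear by blast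
qed

text \<open>With \<open>n = degree q\<close>, the coefficient of both products in degree
  \<open>2 * n - 1\<close> is \<open>n\<close> times the product of the two \<open>n\<close>-th
  coefficients, so it cancels. This additional drop expresses that \<open>dz\<close> has a double
  pole at infinity.\<close>

lemma degree_wronskian:
  fixes p q :: "'a poly"
  assumes "degree p \<le> degree q"
  shows "pderiv p * q - p * pderiv q = 0 \<or> degree (pderiv p * q - p * pderiv q) + 2 \<le> degree (q * q)"
proof (cases "degree q = 0")
  case True
  then obtain c c' where "q = [:c:]" "p = [:c':]" using assms by (metis degree_eq_zeroE le_zero_eq)
  thus ?thesis by simp
next
  case False
  define n where "n = degree q"
  have n: "n > 0" "q \<noteq> 0" using False by (auto simp: n_def)
  define W where "W = pderiv p * q - p * pderiv q"
  have dW: "degree W \<le> 2 * n - 1"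
  proof -
    have "degree (pderiv p * q) \<le> (degree p - 1) + n" "degree (p * pderiv q) \<le> degree p + (n - 1)"
      using degree_mult_le[of "pderiv p" q] degree_mult_le[of p "pderiv q"] degree_pderiv[of p] degree_pderiv[of q]
      by (auto simp: n_def)
    thus ?thesis unfolding W_def using assms n by (intro degree_diff_le) (auto simp: n_def)
  qed
  have "coeff W (2 * n - 1) = 0"
  proof -
    have n1: "2 * n - 1 = (n - 1) + n" "2 * n - 1 = n + (n - 1)" using n by auto
    have dp: "degree (pderiv p) \<le> n - 1" "degree (pderiv q) \<le> n - 1" "degree p \<le> n"
      using degree_pderiv[of p] degree_pderiv[of q] assms by (auto simp: n_def)
    have "coeff (pderiv p * q) (2 * n - 1) = coeff (pderiv p) (n - 1) * coeff q n"
      unfolding n1(1) by (rule coeff_mult_degree_bound) (use dp in \<open>auto simp: n_def\<close>)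
    moreover have "coeff (p * pderiv q) (2 * n - 1) = coeff p n * coeff (pderiv q) (n - 1)"
      unfolding n1(2) by (rule coeff_mult_degree_bound) (use dp in \<open>auto simp: n_def\<close>)
    ultimately show ?thesis using n by (simp add: W_def coeff_pderiv algebra_simps)
  qed
  hence "W = 0 \<or> degree W \<noteq> 2 * n - 1" by (metis leading_coeff_0_iff)
  thus ?thesis using dW n by (auto simp: W_def n_def degree_mult_eq)
qed


text \<open>The projective line has no nonzero regular differential. Writing the form as
  \<open>u dz\<close>, regularity at the finite places makes \<open>u\<close> a polynomial in
  \<open>z\<close>, and regularity at infinity makes it vanish there to order two; so
  \<open>u\<close> is zero.\<close>

lemma rational_no_differential:
  assumes z: "z \<in> loc" and gen: "\<And>r. r \<in> loc \<Longrightarrow> \<exists>p q. represents z p q r"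
    and d: "cder d" and h: "h \<in> loc"
    and reg: "\<And>A. val_ring A \<Longrightarrow> \<exists>(n::nat) a b. (\<forall>i<n. a i \<in> A \<and> b i \<in> A) \<and> h \<approx> (\<Sum>i<n. a i * d (b i))"
  shows "h \<in> mx"
\<comment> \<open>A derivation that kills \<open>z\<close> kills every rational expression in
  \<open>z\<close>, and \<open>h\<close> is a combination of its values.\<close>
proof (cases "d z \<in> mx")
  case True
  have d0: "d r \<in> mx" if r: "r \<in> loc" for r
  proof -
    obtain p q where pq: "represents z p q r" using gen[OF r] by blast
    obtain w where w: "represents z (pderiv p * q - p * pderiv q) (q * q) w" "d r \<approx> w * d z"
      using represents_der[OF d z pq] .
    have "w * d z \<in> mx" using True w(1) by (intro mx_mult_left) (auto simp: represents_def)
    thus ?thesis using w(2) cong_trans[of "d r" "w * d z" 0] by (simp add: cong_0_iff)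
  qed
  have "val_ring loc" unfolding val_ring_def using mx_subset by auto
  from reg[OF this] obtain n :: nat and a b where
    ab: "\<And>i. i < n \<Longrightarrow> a i \<in> loc \<and> b i \<in> loc" "h \<approx> (\<Sum>i<n. a i * d (b i))" by blast
  have "(\<Sum>i<n. a i * d (b i)) \<in> mx" using ab(1) d0 by (intro mx_sum mx_mult_left) auto
  thus ?thesis using ab(2) cong_trans[of h "\<Sum>i<n. a i * d (b i)" 0] by (simp add: cong_0_iff)
next
  case dz: False
  note dl = cderD(1)[OF d]
  have nc: "z - const_fract c \<notin> mx" for c
  proof
    assume "z - const_fract c \<in> mx"
    hence "d z \<approx> d (const_fract c)" by (intro cderD(5)[OF d z]) (auto simp: cong_mx_def)
    hence "d z \<approx> 0" using cderD(4)[OF d] cong_trans by blast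
    thus False using dz by (simp add: cong_0_iff)
  qed
  have nz: "d z \<noteq> 0" using dz by auto
  define u where "u = h / d z"
  have u: "u \<in> loc" unfolding u_def by (intro loc_divide h dl z dz)
  \<comment> \<open>Membership of \<open>h\<close> in the differentials of a valuation ring is a condition on \<open>u\<close>.\<close>
  have transfer: "u \<in> B" if A: "val_ring A"
    and B: "\<And>x w. x \<in> A \<Longrightarrow> w \<in> loc \<Longrightarrow> d x \<approx> w * d z \<Longrightarrow> w \<in> B"
      "\<And>x w. x \<in> A \<Longrightarrow> w \<in> B \<Longrightarrow> x * w \<in> B" "\<And>w w'. w \<in> B \<Longrightarrow> w' \<in> B \<Longrightarrow> w + w' \<in> B" "0 \<in> B"
      "\<And>w w'. w \<in> B \<Longrightarrow> w' \<approx> w \<Longrightarrow> w' \<in> B" for A B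
  proof -
    obtain n :: nat and a b where
      ab: "\<And>i. i < n \<Longrightarrow> a i \<in> A \<and> b i \<in> A" "h \<approx> (\<Sum>i<n. a i * d (b i))" using reg[OF A] by blast
    have Al: "A \<subseteq> loc" using A by (simp add: val_ring_def)
    define w where "w i = d (b i) / d z" for i
    have wl: "w i \<in> loc" if "i < n" for i
      unfolding w_def using ab(1)[OF that] Al by (intro loc_divide dl z dz) auto
    have "w i \<in> B" if "i < n" for i
      by (rule B(1)[of "b i"]) (use ab(1)[OF that] wl[OF that] nz in \<open>auto simp: w_def\<close>)
    hence "(\<Sum>i<n. a i * w i) \<in> B"
      using ab(1) by (induction n) (auto intro!: B(2-4))
    moreover have "u \<approx> (\<Sum>i<n. a i * w i)"
    proof (rule cong_cancel[of "d z"])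
      have "d z * u = h" using nz by (simp add: u_def)
      also have "h \<approx> (\<Sum>i<n. a i * d (b i))" by fact
      also have "\<dots> = d z * (\<Sum>i<n. a i * w i)" using nz by (simp add: w_def sum_distrib_left)
      finally show "d z * u \<approx> d z * (\<Sum>i<n. a i * w i)" .
      show "(\<Sum>i<n. a i * w i) \<in> loc" using ab(1) wl Al by (intro loc_sum loc_mult) auto
    qed (use u dl z dz in auto)
    ultimately show ?thesis using B(5) by blast
  qed
  have der: "\<exists>p' q'. represents z p' q' w \<and> p' = pderiv p * q - p * pderiv q \<and> q' = q * q"
    if x: "represents z p q x" "w \<in> loc" "d x \<approx> w * d z" for p q x w
  proof -
    obtain w' where w': "represents z (pderiv p * q - p * pderiv q) (q * q) w'" "d x \<approx> w' * d z"
      using represents_der[OF d z x(1)] .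
    have e: "d z * w \<approx> d z * w'"
      using cong_trans[OF cong_sym[OF x(3)] w'(2)] by (simp add: mult.commute)
    have "w' \<in> loc" using w'(1) by (simp add: represents_def)
    from cong_cancel[OF dl[OF z] dz x(2) this e] have "w \<approx> w'" .
    thus ?thesis using represents_cong[OF w'(1) _ z] by blast
  qed
  obtain p q where pq: "represents z p q u" "\<And>a. poly p a = 0 \<Longrightarrow> poly q a = 0 \<Longrightarrow> False"
    using reduced_representation[OF z nc gen[OF u]] by blast
  have uniq: "p * q' = p' * q" if "represents z p' q' u" for p' q'
  proof -
    have "ev z (p * q' - p' * q) \<in> mx"
      using represents_eq[OF z pq(1) that] by (simp add: cong_mx_def)
    from transcendental[OF z nc this] show ?thesis by simp
  qed
  have qnz: "q \<noteq> 0" using pq(1) by (auto simp: represents_def)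
  have "poly q a \<noteq> 0" for a
  proof
    assume qa: "poly q a = 0"
    let ?A = "{r. \<exists>p q. represents z p q r \<and> poly q a \<noteq> 0}"
    have A: "val_ring ?A" by (rule val_ring_finite[OF z nc gen])
    have "u \<in> ?A"
    proof (rule transfer[OF A])
      fix x w assume "x \<in> ?A" "w \<in> loc" "d x \<approx> w * d z"
      then obtain p q where pq: "represents z p q x" "poly q a \<noteq> 0" by blast
      have "poly (q * q) a \<noteq> 0" using pq by simp
      thus "w \<in> ?A" using der[OF pq(1) \<open>w \<in> loc\<close> \<open>d x \<approx> w * d z\<close>] by blast
    next
      fix x w assume "x \<in> ?A" "w \<in> ?A"
      thus "x * w \<in> ?A" using A unfolding val_ring_def by blast
    next
      fix w w' assume "w \<in> ?A" "w' \<in> ?A"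
      thus "w + w' \<in> ?A" using A unfolding val_ring_def by blast
    next
      show "0 \<in> ?A" using A mx_0 unfolding val_ring_def by blast
    next
      fix w w' assume "w \<in> ?A" "w' \<approx> w"
      thus "w' \<in> ?A" by (rule val_ring_cong[OF A])
    qed
    then obtain p' q' where p'q': "represents z p' q' u" "poly q' a \<noteq> 0" by blast
    have "poly (p * q') a = poly (p' * q) a" using uniq[OF p'q'(1)] by simp
    hence "poly p a = 0" using qa p'q'(2) by simp
    thus False using pq(2) qa by blast
  qed
  hence "degree q = 0" using alg_closed_imp_poly_has_root[of q] by fastforce
  let ?A = "{r. \<exists>p q. represents z p q r \<and> degree p \<le> degree q}"
  \<comment> \<open>The functions vanishing at infinity to order at least two. Derivatives of
    elements of \<open>?A\<close>, divided by \<open>d z\<close>, land here, and \<open>?B\<close>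
    is closed under multiplication by \<open>?A\<close>.\<close>
  let ?B = "{r. \<exists>p q. represents z p q r \<and> (p = 0 \<or> degree p + 2 \<le> degree q)}"
  have A: "val_ring ?A" by (rule val_ring_infinite[OF z gen])
  have "u \<in> ?B"
  proof (rule transfer[OF A])
    fix x w assume *: "x \<in> ?A" "w \<in> loc" "d x \<approx> w * d z"
    then obtain p q where "represents z p q x" "degree p \<le> degree q" by blast
    thus "w \<in> ?B" using der[OF _ *(2,3)] degree_wronskian[of p q] by blast
  next
    fix x w assume "x \<in> ?A" "w \<in> ?B"
    then obtain p q p' q' where *: "represents z p q x" "degree p \<le> degree q"
      "represents z p' q' w" "p' = 0 \<or> degree p' + 2 \<le> degree q'" by blast
    have nz: "q \<noteq> 0" "q' \<noteq> 0" using *(1,3) by (auto simp: represents_def)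
    have "p * p' = 0 \<or> degree (p * p') + 2 \<le> degree (q * q')"
      using *(2,4) nz degree_mult_le[of p p'] by (auto simp: degree_mult_eq)
    thus "x * w \<in> ?B" using represents_mult[OF z *(1,3)] by blast
  next
    fix w w' assume "w \<in> ?B" "w' \<in> ?B"
    then obtain p q p' q' where *: "represents z p q w" "p = 0 \<or> degree p + 2 \<le> degree q"
      "represents z p' q' w'" "p' = 0 \<or> degree p' + 2 \<le> degree q'" by blast
    have nz: "q \<noteq> 0" "q' \<noteq> 0" using *(1,3) by (auto simp: represents_def)
    have 1: "p * q' = 0 \<or> degree (p * q') + 2 \<le> degree (q * q')"
      using *(2) nz degree_mult_le[of p q'] by (auto simp: degree_mult_eq)
    have 2: "p' * q = 0 \<or> degree (p' * q) + 2 \<le> degree (q * q')"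
      using *(4) nz degree_mult_le[of p' q] by (auto simp: degree_mult_eq)
    have "p * q' + p' * q = 0 \<or> degree (p * q' + p' * q) + 2 \<le> degree (q * q')"
    proof (cases "p * q' = 0 \<or> p' * q = 0")
      case True
      thus ?thesis using 1 2 by (metis add_0 add_0_right)
    next
      case False
      hence "degree (p * q') + 2 \<le> degree (q * q')" "degree (p' * q) + 2 \<le> degree (q * q')"
        using 1 2 by blast+
      thus ?thesis using degree_add_le_max[of "p * q'" "p' * q"] by linarith
    qed
    thus "w + w' \<in> ?B" using represents_add[OF z *(1,3)] by blast
  next
    show "0 \<in> ?B" using represents_const[OF z, of 0] by auto
  next
    fix w w' assume "w \<in> ?B" "w' \<approx> w"
    thus "w' \<in> ?B" using represents_cong[OF _ _ z] by blast
  qed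
  then obtain p' q' where p'q': "represents z p' q' u" "p' = 0 \<or> degree p' + 2 \<le> degree q'" by blast
  have "q' \<noteq> 0" using p'q'(1) by (auto simp: represents_def)
  have "p = 0"
  proof (rule ccontr)
    assume p: "p \<noteq> 0"
    have eq: "p * q' = p' * q" by (rule uniq[OF p'q'(1)])
    hence "p' \<noteq> 0" using p \<open>q' \<noteq> 0\<close> by auto
    hence "degree p' + 2 \<le> degree q'" using p'q'(2) by blast
    moreover have "degree (p * q') = degree (p' * q)" using eq by simp
    hence "degree p + degree q' = degree p'" using p \<open>q' \<noteq> 0\<close> \<open>p' \<noteq> 0\<close> qnz \<open>degree q = 0\<close>
      by (simp add: degree_mult_eq)
    ultimately show False by simp
  qed
  hence "u * ev z q \<in> mx" using pq(1) by (simp add: represents_def cong_0_iff)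
  hence "u \<in> mx" using mx_prime[OF u ev_loc[OF z]] pq(1) by (auto simp: represents_def)
  hence "u * d z \<in> mx" by (intro mx_mult_right dl z)
  thus ?thesis using nz by (simp add: u_def)
qed

end

text \<open>The linear relation \<open>det2 e v * q + det2 v q * e + det2 q e * v = 0\<close>
  between three plane vectors, scaled by \<open>s\<close> and arranged for use with a vector
  \<open>q\<close> outside a cone.\<close>

lemma smul_identity: "smul (s * det2 e v) (- q) + smul (- (s * det2 v q)) e = smul (- (s * det2 e q)) v"
proof (rule prod_eqI)
  show "fst (smul (s * det2 e v) (- q) + smul (- (s * det2 v q)) e) = fst (smul (- (s * det2 e q)) v)"
    unfolding smul_def det2_def fst_add fst_conv fst_uminus by Groebner_Basis.algebra
  show "snd (smul (s * det2 e v) (- q) + smul (- (s * det2 v q)) e) = snd (smul (- (s * det2 e q)) v)"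
    unfolding smul_def det2_def snd_add snd_conv snd_uminus by Groebner_Basis.algebra
qed

text \<open>A total additive set \<open>C\<close> is saturated: if \<open>n * v\<close> lies in
  \<open>C\<close> for some \<open>n > 0\<close>, then so does \<open>v\<close>, since otherwise
  \<open>n * v + (n - 1) * (- v)\<close> would show it. Hence \<open>C\<close> contains all
  multiples of \<open>e\<close> and, given one vector outside, is decided by the side of the line
  along \<open>e\<close>.\<close>

lemma total_cone_halfplane:
  assumes add: "\<And>u v. u \<in> C \<Longrightarrow> v \<in> C \<Longrightarrow> u + v \<in> C" and total: "\<And>v. v \<in> C \<or> - v \<in> C"
    and e: "e \<in> C" "- e \<in> C" "e \<noteq> 0" and ne: "C \<noteq> UNIV"
  obtains \<sigma> :: int where "\<sigma> = 1 \<or> \<sigma> = -1" "\<And>v. v \<in> C \<longleftrightarrow> 0 \<le> \<sigma> * det2 e v"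
proof -
  have 0: "0 \<in> C" using total[of 0] by simp
  have nmul: "smul (int n) v \<in> C" if "v \<in> C" for n v
  proof (induction n)
    case 0
    show ?case using \<open>0 \<in> C\<close> by (simp add: smul_def zero_prod_def)
  next
    case (Suc n)
    have "smul (int (Suc n)) v = v + smul (int n) v" by (simp add: smul_def prod_eq_iff algebra_simps)
    thus ?case using add[OF that Suc] by simp
  qed
  have mul: "smul n v \<in> C" if "v \<in> C" "n \<ge> 0" for n v
    using nmul[OF that(1), of "nat n"] that(2) by simp
  have div: "v \<in> C" if "smul n v \<in> C" "n > 0" for n v
  proof (rule ccontr)
    assume "v \<notin> C"
    hence "smul (n - 1) (- v) \<in> C" using total[of v] that(2) by (intro mul) auto
    from add[OF that(1) this] have "v \<in> C" by (simp add: smul_def algebra_simps)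
    thus False using \<open>v \<notin> C\<close> by simp
  qed
  have line: "smul n e \<in> C" for n
  proof (cases "n \<ge> 0")
    case False
    hence "smul (- n) (- e) \<in> C" using e by (intro mul) auto
    thus ?thesis by (simp add: smul_def)
  qed (use e mul in auto)
  obtain q where q: "q \<notin> C" using ne by blast
  hence nq: "- q \<in> C" using total by blast
  define \<delta> where "\<delta> = det2 e q"
  have "\<delta> \<noteq> 0"
  proof
    assume "\<delta> = 0"
    hence eq: "smul (fst e) q = smul (fst q) e" "smul (snd e) q = smul (snd q) e"
      by (simp_all add: \<delta>_def det2_def smul_def mult.commute)
    have neg: "smul (- n) v = - smul n v" for n v by (simp add: smul_def prod_eq_iff)
    have "fst e \<noteq> 0 \<or> snd e \<noteq> 0" using e(3) by (auto simp: prod_eq_iff)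
    define n where "n = (if fst e \<noteq> 0 then fst e else snd e)"
    define k where "k = (if fst e \<noteq> 0 then fst q else snd q)"
    have nk: "smul n q = smul k e" "n \<noteq> 0"
      using eq \<open>fst e \<noteq> 0 \<or> snd e \<noteq> 0\<close> by (simp_all add: n_def k_def)
    have "smul \<bar>n\<bar> q \<in> C"
    proof (cases "n > 0")
      case True
      thus ?thesis using nk(1) line[of k] by simp
    next
      case False
      have "smul (- n) q = smul (- k) e" unfolding neg nk(1) ..
      thus ?thesis using False line[of "- k"] by simp
    qed
    thus False using div[of "\<bar>n\<bar>" q] nk(2) q by simp
  qed
  \<comment> \<open>The sign puts the excluded vector \<open>q\<close> on the negative side.\<close>
  define \<sigma> where "\<sigma> = - sgn \<delta>"
  have \<sigma>: "\<sigma> = 1 \<or> \<sigma> = -1" "\<sigma> * \<delta> < 0" using \<open>\<delta> \<noteq> 0\<close> by (auto simp: \<sigma>_def sgn_if)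
  have "v \<in> C \<longleftrightarrow> 0 \<le> \<sigma> * det2 e v" for v
  proof
    assume "0 \<le> \<sigma> * det2 e v"
    hence "smul (\<sigma> * det2 e v) (- q) + smul (- (\<sigma> * det2 v q)) e \<in> C"
      by (intro add mul nq line)
    hence "smul (- (\<sigma> * \<delta>)) v \<in> C" unfolding smul_identity \<delta>_def .
    thus "v \<in> C" by (rule div) (use \<sigma>(2) in simp)
  next
    assume v: "v \<in> C"
    show "0 \<le> \<sigma> * det2 e v"
    proof (rule ccontr)
      assume n: "\<not> 0 \<le> \<sigma> * det2 e v"
      have "smul (- (\<sigma> * \<delta>)) v + smul (\<sigma> * det2 v q) e \<in> C"
        using \<sigma>(2) by (intro add mul v line) simp
      also have "smul (- (\<sigma> * \<delta>)) v = smul (\<sigma> * det2 e v) (- q) + smul (- (\<sigma> * det2 v q)) e"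
        unfolding smul_identity \<delta>_def ..
      also have "\<dots> + smul (\<sigma> * det2 v q) e = smul (- (\<sigma> * det2 e v)) q"
        by (simp add: smul_def)
      finally show False using div[of "- (\<sigma> * det2 e v)" q] n q by simp
    qed
  qed
  thus ?thesis using \<sigma>(1) that by blast
qed

text \<open>All of \<open>S - p\<close> lies in the closed half-plane. An interior point has a point
  of \<open>S\<close> strictly below it in the direction normal to \<open>e\<close>, so it lies in
  the open half-plane.\<close>

lemma interior_of_cone:
  assumes add: "\<And>u v. u \<in> C \<Longrightarrow> v \<in> C \<Longrightarrow> u + v \<in> C" and total: "\<And>v. v \<in> C \<or> - v \<in> C"
    and e: "e \<in> C" "- e \<in> C" "e \<noteq> 0" and ne: "C \<noteq> UNIV"
    and S: "\<And>s. s \<in> S \<Longrightarrow> s - p \<in> C" and r: "r \<in> lattice_interior S"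
  shows "r - p \<in> C" "det2 e (r - p) \<noteq> 0"
proof -
  obtain \<sigma> :: int where \<sigma>: "\<sigma> = 1 \<or> \<sigma> = -1" "\<And>v. v \<in> C \<longleftrightarrow> 0 \<le> \<sigma> * det2 e v"
    using total_cone_halfplane[OF add total e ne] by blast
  have lin: "lin (- \<sigma> * snd e) (\<sigma> * fst e) v = \<sigma> * det2 e v" for v
    by (simp add: lin_def det2_def algebra_simps)
  have "- \<sigma> * snd e \<noteq> 0 \<or> \<sigma> * fst e \<noteq> 0" using \<sigma>(1) e(3) by (auto simp: prod_eq_iff)
  with r obtain s where "s \<in> S" "lin (- \<sigma> * snd e) (\<sigma> * fst e) s < lin (- \<sigma> * snd e) (\<sigma> * fst e) r"
    by (rule lattice_interior_less)
  hence s: "s \<in> S" "\<sigma> * det2 e s < \<sigma> * det2 e r" unfolding lin by auto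
  have "0 \<le> \<sigma> * det2 e (s - p)" using S[OF s(1)] \<sigma>(2) by blast
  moreover have "\<sigma> * det2 e (r - p) = \<sigma> * det2 e (s - p) + (\<sigma> * det2 e r - \<sigma> * det2 e s)"
    by (simp add: det2_def algebra_simps)
  ultimately have "0 < \<sigma> * det2 e (r - p)" using s(2) by linarith
  thus "r - p \<in> C" "det2 e (r - p) \<noteq> 0" using \<sigma>(2) by auto
qed

section \<open>Units, logarithmic derivatives and valuation ideals\<close>

context plane_curve
begin

definition units :: "'a poly poly fract set" where "units = loc - mx"

lemma unitsI: "r \<in> loc \<Longrightarrow> r \<notin> mx \<Longrightarrow> r \<in> units" by (simp add: units_def)

lemma units_loc: "r \<in> units \<Longrightarrow> r \<in> loc" by (simp add: units_def)

lemma units_nz: "r \<in> units \<Longrightarrow> r \<noteq> 0" by (auto simp: units_def)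

lemma units_mult: "r \<in> units \<Longrightarrow> s \<in> units \<Longrightarrow> r * s \<in> units"
  by (auto simp: units_def mult_not_mx)

lemma units_inverse: "r \<in> units \<Longrightarrow> inverse r \<in> units"
  by (simp add: units_def loc_inverse inverse_not_mx)

lemma units_divide: "r \<in> units \<Longrightarrow> s \<in> units \<Longrightarrow> r / s \<in> units"
  using units_mult units_inverse by (simp add: field_class.field_divide_inverse)

lemma units_power: "r \<in> units \<Longrightarrow> r ^ n \<in> units"
  by (induction n) (auto simp: units_mult intro: unitsI)

lemma units_powi: "r \<in> units \<Longrightarrow> r powi n \<in> units"
  by (simp add: power_int_def units_power units_inverse)

lemma units_const: "c \<noteq> 0 \<Longrightarrow> const_fract c \<in> units"
  by (intro unitsI) (simp_all del: to_fract_mx_iff)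

definition dlog :: "('a poly poly fract \<Rightarrow> 'a poly poly fract) \<Rightarrow> 'a poly poly fract \<Rightarrow> 'a poly poly fract" where
  "dlog d r = d r / r"

lemma dlog_mult:
  assumes d: "cder d" and r: "r \<in> units" and s: "s \<in> units"
  shows "dlog d (r * s) \<approx> dlog d r + dlog d s"
proof -
  have "inverse (r * s) * d (r * s) \<approx> inverse (r * s) * (r * d s + s * d r)"
    by (intro cong_mult_left cderD(3)[OF d] units_loc r s units_inverse units_mult)
  also have "inverse (r * s) * (r * d s + s * d r) = dlog d r + dlog d s"
    using units_nz[OF r] units_nz[OF s] by (simp add: dlog_def field_simps)
  finally show ?thesis by (simp add: dlog_def field_class.field_divide_inverse mult.commute)
qed

lemma dlog_const:
  assumes d: "cder d" and c: "c \<noteq> 0"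
  shows "dlog d (const_fract c) \<approx> 0"
proof -
  have "inverse (const_fract c) * d (const_fract c) \<approx> inverse (const_fract c) * 0"
    by (intro cong_mult_left cderD(4)[OF d] units_loc units_inverse units_const c)
  thus ?thesis by (simp add: dlog_def field_class.field_divide_inverse mult.commute)
qed

lemma dlog_1: "cder d \<Longrightarrow> dlog d 1 \<approx> 0"
  using dlog_const[of d 1] by (simp flip: one_pCons)

lemma dlog_inverse:
  assumes d: "cder d" and r: "r \<in> units"
  shows "dlog d (inverse r) \<approx> - dlog d r"
proof -
  have "dlog d r + dlog d (inverse r) \<approx> dlog d (r * inverse r)"
    by (rule cong_sym[OF dlog_mult[OF d r units_inverse[OF r]]])
  also have "r * inverse r = 1" using units_nz[OF r] by simp
  also have "dlog d 1 \<approx> 0" by (rule dlog_1[OF d])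
  finally show ?thesis by (simp add: cong_mx_def add.commute)
qed

lemma dlog_power:
  assumes d: "cder d" and r: "r \<in> units"
  shows "dlog d (r ^ n) \<approx> of_nat n * dlog d r"
proof (induction n)
  case 0
  show ?case using dlog_1[OF d] by simp
next
  case (Suc n)
  have "dlog d (r * r ^ n) \<approx> dlog d r + dlog d (r ^ n)"
    by (rule dlog_mult[OF d r units_power[OF r]])
  also have "\<dots> \<approx> dlog d r + of_nat n * dlog d r" by (intro cong_add cong_refl Suc.IH)
  finally show ?case by (simp add: algebra_simps)
qed

lemma dlog_powi:
  assumes d: "cder d" and r: "r \<in> units"
  shows "dlog d (r powi n) \<approx> of_int n * dlog d r"
proof (cases "n \<ge> 0")
  case True
  thus ?thesis using dlog_power[OF d r, of "nat n"] by (simp add: power_int_def)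
next
  case False
  have "dlog d (inverse (r ^ nat (- n))) \<approx> - dlog d (r ^ nat (- n))"
    by (rule dlog_inverse[OF d units_power[OF r]])
  also have "\<dots> \<approx> - (of_nat (nat (- n)) * dlog d r)"
    by (rule cong_uminus[OF dlog_power[OF d r]])
  finally show ?thesis using False by (simp add: power_int_def power_inverse)
qed

lemma of_int_loc: "of_int n \<in> loc" and of_nat_loc: "of_nat m \<in> loc"
  by (simp_all flip: const_fract_of_int const_fract_of_nat)

text \<open>The maximal ideal of a valuation ring, containing \<open>mx\<close> as we work with representatives.\<close>

definition val_ideal :: "'a poly poly fract set \<Rightarrow> 'a poly poly fract set" where
  "val_ideal A = {r \<in> A. r \<in> mx \<or> inverse r \<notin> A}"

context
  fixes A assumes A: "val_ring A"
begin

lemma vr_loc: "r \<in> A \<Longrightarrow> r \<in> loc" and vr_mx: "r \<in> mx \<Longrightarrow> r \<in> A" and vr_const: "const_fract c \<in> A"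
  and vr_add: "r \<in> A \<Longrightarrow> s \<in> A \<Longrightarrow> r + s \<in> A" and vr_mult: "r \<in> A \<Longrightarrow> s \<in> A \<Longrightarrow> r * s \<in> A"
  and vr_total: "r \<in> units \<Longrightarrow> r \<in> A \<or> inverse r \<in> A"
  using A by (auto simp: val_ring_def units_def)

lemma vr_1: "1 \<in> A" using vr_const[of 1] by (simp flip: one_pCons)

lemma vr_uminus: "r \<in> A \<Longrightarrow> - r \<in> A"
  using vr_mult[OF vr_const[of "-1"]] by (simp add: const_fract_uminus flip: one_pCons)

lemma vr_sum: "(\<And>i. i \<in> I \<Longrightarrow> g i \<in> A) \<Longrightarrow> sum g I \<in> A"
  by (induction I rule: infinite_finite_induct) (auto intro: vr_add vr_mx)

lemma vr_power: "r \<in> A \<Longrightarrow> r ^ n \<in> A"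
  by (induction n) (auto intro: vr_mult vr_1)

lemma vr_powi: "r \<in> A \<Longrightarrow> inverse r \<in> A \<Longrightarrow> r powi n \<in> A"
  by (simp add: power_int_def vr_power)

lemma vr_of_int: "of_int n \<in> A" and vr_of_nat: "of_nat m \<in> A"
  using vr_const[of "of_int n"] vr_const[of "of_nat m"] by (simp_all add: const_fract_of_int const_fract_of_nat)

lemma vi_mx: "r \<in> mx \<Longrightarrow> r \<in> val_ideal A"
  by (simp add: val_ideal_def vr_mx)

lemma vi_vr: "r \<in> val_ideal A \<Longrightarrow> r \<in> A"
  by (simp add: val_ideal_def)

lemma vi_mult:
  assumes "a \<in> A" "r \<in> val_ideal A"
  shows "a * r \<in> val_ideal A"
proof (cases "a * r \<in> mx")
  case True
  thus ?thesis by (rule vi_mx)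
next
  case False
  hence "r \<notin> mx" using mx_mult_left[OF vr_loc[OF assms(1)]] by blast
  hence "inverse r \<notin> A" using assms(2) by (simp add: val_ideal_def)
  moreover have "a \<noteq> 0" using False by auto
  hence "inverse r = a * inverse (a * r)" by simp
  ultimately have "inverse (a * r) \<notin> A" using vr_mult[OF assms(1)] by metis
  thus ?thesis using assms by (auto simp: val_ideal_def intro: vr_mult)
qed

text \<open>One of the quotients lies in \<open>A\<close>, say \<open>r / s\<close>. If
  \<open>r + s\<close> had its inverse in \<open>A\<close>, then so would \<open>s\<close>, because
  \<open>inverse s = inverse (r + s) * (r / s + 1)\<close>.\<close>

lemma vi_add:
  assumes r: "r \<in> val_ideal A" and s: "s \<in> val_ideal A"
  shows "r + s \<in> val_ideal A"
proof -
  have *: "r + s \<in> val_ideal A" if r: "r \<in> val_ideal A" and s: "s \<in> val_ideal A" "s \<notin> mx" and rs: "r / s \<in> A" for r s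
  proof (rule ccontr)
    assume n: "r + s \<notin> val_ideal A"
    have "r + s \<in> A" using r s by (auto intro: vr_add vi_vr)
    hence rs': "r + s \<notin> mx" "inverse (r + s) \<in> A" using n by (auto simp: val_ideal_def)
    have "s \<noteq> 0" "r + s \<noteq> 0" using s(2) rs'(1) by auto
    hence "inverse s = inverse (r + s) * (r / s + 1)" by (simp add: field_simps)
    hence "inverse s \<in> A" using rs'(2) rs by (auto intro: vr_mult vr_add vr_1)
    thus False using s by (simp add: val_ideal_def)
  qed
  consider "r \<in> mx" "s \<in> mx" | "r \<in> mx" "s \<notin> mx" | "r \<notin> mx" "s \<in> mx" | "r \<notin> mx" "s \<notin> mx" by blast
  thus ?thesis
  proof cases
    case 1
    thus ?thesis by (intro vi_mx mx_add)
  next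
    case 2
    hence "r / s \<in> A" using loc_inverse[OF vr_loc[OF vi_vr[OF s]] 2(2)]
      by (simp add: field_class.field_divide_inverse vr_mx mx_mult_right)
    thus ?thesis using * r s 2 by blast
  next
    case 3
    hence "s / r \<in> A" using loc_inverse[OF vr_loc[OF vi_vr[OF r]] 3(1)]
      by (simp add: field_class.field_divide_inverse vr_mx mx_mult_right)
    thus ?thesis using *[OF s r 3(1)] by (simp add: add.commute)
  next
    case 4
    hence "r \<in> units" "s \<in> units" using r s by (auto intro!: unitsI vr_loc vi_vr)
    hence "r / s \<in> A \<or> s / r \<in> A" using vr_total[OF units_divide, of r s] by simp
    thus ?thesis using *[OF s r 4(1)] *[OF r s 4(2)] by (auto simp: add.commute)
  qed
qed

lemma vi_sum: "(\<And>i. i \<in> I \<Longrightarrow> g i \<in> val_ideal A) \<Longrightarrow> sum g I \<in> val_ideal A"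
  by (induction I rule: infinite_finite_induct) (auto intro: vi_add vi_mx)

lemma vi_uminus: "r \<in> val_ideal A \<Longrightarrow> - r \<in> val_ideal A"
  using vi_mult[OF vr_uminus[OF vr_1]] by simp

lemma vi_diff: "r \<in> val_ideal A \<Longrightarrow> s \<in> val_ideal A \<Longrightarrow> r - s \<in> val_ideal A"
  using vi_add[OF _ vi_uminus] by simp

text \<open>Nonzero constants have their inverses in \<open>A\<close>, so the constants embed into
  the residue field. Congruences between constants thereby become equalities.\<close>

lemma vi_const_iff: "const_fract c \<in> val_ideal A \<longleftrightarrow> c = 0"
  using vr_const[of c] vr_const[of "inverse c"] const_mx_iff[of c]
  by (auto simp: val_ideal_def const_fract_inverse vr_mx simp del: const_mx_iff to_fract_mx_iff)

lemma vi_unit: "r \<in> A \<Longrightarrow> r \<notin> val_ideal A \<Longrightarrow> r \<in> units \<and> inverse r \<in> A"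
  by (auto simp: val_ideal_def intro: unitsI vr_loc)

lemma vi_cong_mult:
  assumes "r \<in> A" "s' \<in> A" "r - r' \<in> val_ideal A" "s - s' \<in> val_ideal A"
  shows "r * s - r' * s' \<in> val_ideal A"
  using vi_add[OF vi_mult[OF assms(1,4)] vi_mult[OF assms(2,3)]] by (simp add: algebra_simps)

lemma vi_cong_power:
  assumes "r \<in> A" "s \<in> A" "r - s \<in> val_ideal A"
  shows "r ^ n - s ^ n \<in> val_ideal A"
proof (induction n)
  case (Suc n)
  thus ?case using vi_cong_mult[OF assms(1) vr_power[OF assms(2)] assms(3)] by simp
qed (simp add: vi_mx)

lemma vi_cong_inverse:
  assumes "r \<in> units" "inverse r \<in> A" "s \<in> units" "inverse s \<in> A" "r - s \<in> val_ideal A"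
  shows "inverse r - inverse s \<in> val_ideal A"
proof -
  have "inverse r - inverse s = (inverse r * inverse s) * - (r - s)"
    using units_nz[OF assms(1)] units_nz[OF assms(3)] by (simp add: field_simps)
  thus ?thesis using assms by (auto intro!: vi_mult vr_mult vi_uminus simp del: minus_diff_eq)
qed

lemma vi_cong_powi:
  assumes "r \<in> units" "r \<in> A" "inverse r \<in> A" "s \<in> units" "s \<in> A" "inverse s \<in> A" "r - s \<in> val_ideal A"
  shows "r powi n - s powi n \<in> val_ideal A"
  using vi_cong_power[OF assms(2,5,7)] vi_cong_power[OF assms(3,6) vi_cong_inverse[OF assms(1,3,4,6,7)]]
  by (simp add: power_int_def)

lemma vi_cong_prod:
  assumes "\<And>i. i \<in> I \<Longrightarrow> g i \<in> A" "\<And>i. i \<in> I \<Longrightarrow> h i \<in> A" "\<And>i. i \<in> I \<Longrightarrow> g i - h i \<in> val_ideal A"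
  shows "prod g I \<in> A \<and> prod h I \<in> A \<and> prod g I - prod h I \<in> val_ideal A"
  using assms
proof (induction I rule: infinite_finite_induct)
  case (insert i I)
  thus ?case by (simp add: vr_mult vi_cong_mult)
qed (auto simp: vr_1 vi_mx)

end

end

text \<open>\<open>cof\<close> consists of the signed areas of the triangles omitting one point,
  which form an affine relation between the four points; \<open>nonsingular\<close> is what the
  determinant of the exponent matrix says about it. After base change \<open>T\<close> is an
  ordinary constant, remembered only as transcendental over the rationals.\<close>

locale four_term_curve = closed_plane_curve f
  for f :: "'a::{alg_closed_field, field_char_0} poly poly" +
  fixes T :: 'a and e0 e1 e2 :: "nat \<Rightarrow> nat" and pt :: "nat \<Rightarrow> int \<times> int" and cof :: "nat \<Rightarrow> int"
  assumes f_eq: "f = (\<Sum>i<4. bimonom (T ^ e0 i) (e1 i) (e2 i))"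
    and T_transcendental: "\<And>q :: int poly. q \<noteq> 0 \<Longrightarrow> poly (map_poly of_int q) T \<noteq> 0"
    and pt_def: "\<And>i. pt i = (int (e1 i), int (e2 i))"
    and cof: "cof 0 = det2 (pt 2 - pt 1) (pt 3 - pt 1)" "cof 1 = - det2 (pt 2 - pt 0) (pt 3 - pt 0)"
      "cof 2 = det2 (pt 1 - pt 0) (pt 3 - pt 0)" "cof 3 = - det2 (pt 1 - pt 0) (pt 2 - pt 0)"
    and nonsingular: "(\<Sum>i<4. cof i * int (e0 i)) \<noteq> 0"
begin

lemma less_4_cases: "i < 4 \<Longrightarrow> i = 0 \<or> i = 1 \<or> i = 2 \<or> i = (3::nat)" by linarith

lemma sum_4: "(\<Sum>i<(4::nat). g i) = g 0 + g 1 + g 2 + (g 3 :: 'b::comm_monoid_add)"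
  by (simp add: eval_nat_numeral add.assoc)

lemma cof_sums: "(\<Sum>i<4. cof i) = 0" "(\<Sum>i<4. cof i * fst (pt i)) = 0" "(\<Sum>i<4. cof i * snd (pt i)) = 0"
  unfolding sum_4 cof det2_def fst_diff snd_diff by Groebner_Basis.algebra+

lemma not_collinear:
  assumes "\<And>i. i < 4 \<Longrightarrow> lin \<alpha> \<beta> (pt i) = c"
  shows "\<alpha> = 0 \<and> \<beta> = 0"
proof (rule ccontr)
  assume n: "\<not> (\<alpha> = 0 \<and> \<beta> = 0)"
  have "det2 (pt j - pt i) (pt k - pt i) = 0" if "i < 4" "j < 4" "k < 4" for i j k
  proof -
    have "\<alpha> * (fst (pt j) - fst (pt i)) + \<beta> * (snd (pt j) - snd (pt i)) = 0"
      "\<alpha> * (fst (pt k) - fst (pt i)) + \<beta> * (snd (pt k) - snd (pt i)) = 0"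
      using assms[OF that(1)] assms[OF that(2)] assms[OF that(3)] by (simp_all add: lin_def algebra_simps)
    hence "\<alpha> * det2 (pt j - pt i) (pt k - pt i) = 0" "\<beta> * det2 (pt j - pt i) (pt k - pt i) = 0"
      unfolding det2_def fst_diff snd_diff by Groebner_Basis.algebra+
    thus ?thesis using n by auto
  qed
  hence "cof 0 = 0" "cof 1 = 0" "cof 2 = 0" "cof 3 = 0" unfolding cof by simp_all
  thus False using nonsingular by (simp add: sum_4)
qed

text \<open>The corresponding integer polynomial takes the positive value \<open>card I\<close> at
  1. Terms of \<open>f\<close> sharing a monomial in \<open>X\<close> and \<open>Y\<close> therefore
  never cancel.\<close>

lemma T_powers_nonzero:
  assumes "finite I" "I \<noteq> {}"
  shows "(\<Sum>i\<in>I. T ^ e i) \<noteq> 0"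
proof -
  define q :: "int poly" where "q = (\<Sum>i\<in>I. monom 1 (e i))"
  have "poly q 1 = int (card I)" by (simp add: q_def poly_sum poly_monom)
  hence "q \<noteq> 0" using assms by auto
  moreover have "map_poly of_int q = (\<Sum>i\<in>I. monom (1::'a) (e i))"
    by (rule poly_eqI) (simp add: q_def coeff_map_poly coeff_sum coeff_monom of_int_sum if_distrib cong: if_cong)
  hence "poly (map_poly of_int q) T = (\<Sum>i\<in>I. T ^ e i)" by (simp add: poly_sum poly_monom)
  ultimately show ?thesis using T_transcendental[of q] by simp
qed

lemma T_nonzero: "T \<noteq> 0"
  using T_powers_nonzero[of "{0::nat}" "\<lambda>_. 1"] by simp

lemma coeff_f: "coeff (coeff f b) a = (\<Sum>i | i < 4 \<and> e1 i = a \<and> e2 i = b. T ^ e0 i)"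
proof -
  have "coeff (coeff f b) a = (\<Sum>i<4. if e1 i = a \<and> e2 i = b then T ^ e0 i else 0)"
    unfolding f_eq coeff_sum by (intro sum.cong) (auto simp: bimonom_def coeff_monom)
  also have "\<dots> = (\<Sum>i | i < 4 \<and> e1 i = a \<and> e2 i = b. T ^ e0 i)"
    by (subst sum.inter_filter[symmetric]) (auto intro: sum.cong)
  finally show ?thesis .
qed

lemma coeff_f_nonzero: "i < 4 \<Longrightarrow> coeff (coeff f (e2 i)) (e1 i) \<noteq> 0"
  unfolding coeff_f by (intro T_powers_nonzero) auto

lemma e2_le_degree: "i < 4 \<Longrightarrow> e2 i \<le> degree f"
  using coeff_f_nonzero[of i] by (intro le_degree) auto

lemma degree_f: "degree f > 0"
proof (rule ccontr)
  assume "\<not> degree f > 0"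
  hence "\<And>i. i < 4 \<Longrightarrow> lin 0 1 (pt i) = 0" using e2_le_degree by (fastforce simp: lin_def pt_def)
  from not_collinear[OF this] show False by simp
qed

lemma xv_units: "xv \<in> units"
proof (rule unitsI)
  have "\<not> f dvd [:[:0, 1:]:]"
  proof
    assume "f dvd [:[:0, 1:]:]"
    hence "degree f \<le> degree ([:[:0, 1:]:] :: 'a poly poly)" by (rule dvd_imp_degree_le) simp
    thus False using degree_f by simp
  qed
  thus "xv \<notin> mx" by (simp add: xv_def)
qed simp

text \<open>If \<open>f\<close> divided \<open>Y\<close>, it would be a constant multiple of
  \<open>Y\<close>, and the exponent points would lie on a line.\<close>

lemma yv_units: "yv \<in> units"
proof (rule unitsI)
  have "\<not> f dvd [:0, 1:]"
  proof
    assume "f dvd [:0, 1:]"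
    then obtain s where s: "[:0, 1:] = f * s" by (elim dvdE)
    have nz: "f \<noteq> 0" "s \<noteq> 0" using s degree_f by auto
    have "degree f + degree s = 1" using degree_mult_eq[OF nz] s[symmetric] by simp
    hence "degree f = 1" "degree s = 0" using degree_f by auto
    then obtain s0 where s0: "s = [:s0:]" by (elim degree_eq_zeroE)
    have "coeff [:0, 1:] 0 = coeff f 0 * s0" "coeff [:0, 1:] 1 = coeff f 1 * s0"
      unfolding s s0 by (simp_all add: coeff_mult)
    hence c: "coeff f 0 = 0" "coeff f 1 * s0 = 1" using nz(2) s0 by auto
    hence "coeff f 1 dvd 1" by (metis dvd_triv_left)
    moreover have "coeff f 1 \<noteq> 0" using c(2) by auto
    ultimately have "degree (coeff f 1) = 0" by (simp add: is_unit_iff_degree)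
    have "lin 1 0 (pt i) = 0" if i: "i < 4" for i
    proof -
      have "e2 i \<le> 1" using e2_le_degree[OF i] \<open>degree f = 1\<close> by simp
      moreover have "e2 i \<noteq> 0"
      proof
        assume "e2 i = 0"
        thus False using coeff_f_nonzero[OF i] c(1) by simp
      qed
      ultimately have "e2 i = 1" by simp
      hence "e1 i \<le> degree (coeff f 1)" using coeff_f_nonzero[OF i] by (intro le_degree) simp
      thus ?thesis using \<open>degree (coeff f 1) = 0\<close> by (simp add: lin_def pt_def)
    qed
    from not_collinear[OF this] show False by simp
  qed
  thus "yv \<notin> mx" by (simp add: yv_def)
qed simp

text \<open>In characteristic 0 the derivative is nonzero and of smaller degree than
  \<open>f\<close>. Thus \<open>x\<close> is a separating variable and its differential does not
  vanish.\<close>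

lemma pderiv_f_units: "to_fract (pderiv f) \<in> units"
proof (rule unitsI)
  have "pderiv f \<noteq> 0" using degree_f by (simp add: pderiv_eq_0_iff)
  hence "\<not> f dvd pderiv f"
    using dvd_imp_degree_le[of f "pderiv f"] degree_f by (auto simp: degree_pderiv)
  thus "to_fract (pderiv f) \<notin> mx" by simp
qed simp

lemma mono_units: "mono v \<in> units"
  unfolding mono_def by (intro units_mult units_powi xv_units yv_units)

definition tm :: "nat \<Rightarrow> 'a poly poly fract" where
  "tm i = const_fract (T ^ e0 i) * mono (pt i)"

lemma tm_units: "tm i \<in> units"
  unfolding tm_def by (intro units_mult units_const mono_units) (simp add: T_nonzero)

lemma tm_eq: "tm i = to_fract (bimonom (T ^ e0 i) (e1 i) (e2 i))"
  by (simp add: tm_def pt_def to_fract_bimonom)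

lemma sum_term_mx: "(\<Sum>i<4. tm i) \<in> mx"
proof -
  have "(\<Sum>i<4. tm i) = to_fract f" unfolding f_eq to_fract_sum tm_eq ..
  thus ?thesis by simp
qed

text \<open>The logarithmic partial derivatives \<open>y * f_y\<close> and \<open>x * f_x\<close>,
  written through the terms of \<open>f\<close>.\<close>

definition euler2 :: "'a poly poly fract" where "euler2 = (\<Sum>i<4. of_nat (e2 i) * tm i)"
definition euler1 :: "'a poly poly fract" where "euler1 = (\<Sum>i<4. of_nat (e1 i) * tm i)"

lemma euler2_eq: "euler2 = yv * to_fract (pderiv f)"
proof -
  have *: "of_nat n * to_fract (bimonom c a n) = yv * to_fract (pderiv (bimonom c a n))" for n a and c :: 'a
  proof (cases n)
    case 0
    thus ?thesis by (simp add: bimonom_def monom_0)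
  next
    case (Suc m)
    have "pderiv (bimonom c a n) = monom (of_nat n * monom c a) m"
      unfolding Suc bimonom_def pderiv_monom diff_Suc_1 ..
    hence "[:0, 1:] * pderiv (bimonom c a n) = monom (of_nat n * monom c a) n"
      by (simp add: Suc monom_Suc del: of_nat_Suc)
    also have "\<dots> = of_nat n * bimonom c a n"
      by (simp add: bimonom_def of_nat_poly[where ?'a = "'a poly"] smult_monom)
    finally have "of_nat n * bimonom c a n = [:0, 1:] * pderiv (bimonom c a n)" ..
    hence "to_fract (of_nat n * bimonom c a n) = to_fract ([:0, 1:] * pderiv (bimonom c a n))" by simp
    moreover have "to_fract (of_nat n) = (of_nat n :: 'a poly poly fract)" by (induction n) auto
    ultimately show ?thesis by (simp only: to_fract_mult yv_def)
  qed
  show ?thesis unfolding euler2_def tm_eq f_eq pderiv_sum to_fract_sum sum_distrib_left *[symmetric] ..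
qed

lemma euler2_units: "euler2 \<in> units"
  unfolding euler2_eq by (intro units_mult yv_units pderiv_f_units)

lemma dlog_mono:
  assumes d: "cder d"
  shows "dlog d (mono v) \<approx> of_int (fst v) * dlog d xv + of_int (snd v) * dlog d yv"
proof -
  have "dlog d (xv powi fst v * yv powi snd v) \<approx> dlog d (xv powi fst v) + dlog d (yv powi snd v)"
    by (intro dlog_mult d units_powi xv_units yv_units)
  also have "\<dots> \<approx> of_int (fst v) * dlog d xv + of_int (snd v) * dlog d yv"
    by (intro cong_add dlog_powi d xv_units yv_units)
  finally show ?thesis by (simp add: mono_def)
qed

lemma dlog_const_mono:
  assumes d: "cder d" and c: "c \<noteq> 0"
  shows "dlog d (const_fract c * mono v) \<approx> of_int (fst v) * dlog d xv + of_int (snd v) * dlog d yv"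
proof -
  have "dlog d (const_fract c * mono v) \<approx> dlog d (const_fract c) + dlog d (mono v)"
    by (intro dlog_mult d units_const c mono_units)
  also have "\<dots> \<approx> 0 + (of_int (fst v) * dlog d xv + of_int (snd v) * dlog d yv)"
    by (intro cong_add dlog_const dlog_mono d c)
  finally show ?thesis by simp
qed

lemma cder_sum:
  assumes d: "cder d" and "\<And>i. i \<in> I \<Longrightarrow> g i \<in> loc"
  shows "d (sum g I) \<approx> (\<Sum>i\<in>I. d (g i))"
  using assms(2)
proof (induction I rule: infinite_finite_induct)
  case (insert i I)
  have "d (g i + sum g I) \<approx> d (g i) + d (sum g I)"
    using insert.prems by (intro cderD(2)[OF d] loc_sum) auto
  also have "\<dots> \<approx> d (g i) + (\<Sum>i\<in>I. d (g i))" using insert by (intro cong_add cong_refl) auto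
  finally show ?case using insert by simp
qed (use cderD(4)[OF d, of 0] in auto)

text \<open>The equation of the curve is differentiated term by term, each term through its
  logarithmic derivative, in which its constant factor drops out.\<close>

lemma euler_relation:
  assumes d: "cder d"
  shows "euler1 * dlog d xv + euler2 * dlog d yv \<approx> 0"
proof -
  have "d (\<Sum>i<4. tm i) \<approx> d 0"
    by (intro cderD(5)[OF d] loc_sum units_loc tm_units loc_0) (simp add: cong_0_iff sum_term_mx)
  hence "d (\<Sum>i<4. tm i) \<approx> 0" using cderD(4)[OF d, of 0] cong_trans by simp
  from cong_sym[OF this] have "0 \<approx> d (\<Sum>i<4. tm i)" .
  also have "\<dots> \<approx> (\<Sum>i<4. d (tm i))" by (intro cder_sum d units_loc tm_units)
  also have "\<dots> \<approx> (\<Sum>i<4. tm i * (of_int (int (e1 i)) * dlog d xv + of_int (int (e2 i)) * dlog d yv))"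
  proof (rule cong_sum)
    fix i
    have "tm i * dlog d (tm i) \<approx> tm i * (of_int (fst (pt i)) * dlog d xv + of_int (snd (pt i)) * dlog d yv)"
      unfolding tm_def by (intro cong_mult_left dlog_const_mono d units_loc units_mult units_const mono_units)
        (simp_all add: T_nonzero)
    thus "d (tm i) \<approx> tm i * (of_int (int (e1 i)) * dlog d xv + of_int (int (e2 i)) * dlog d yv)"
      using units_nz[OF tm_units[of i]] by (simp add: dlog_def pt_def)
  qed
  also have "\<dots> = euler1 * dlog d xv + euler2 * dlog d yv"
    by (simp add: euler1_def euler2_def sum_distrib_left distrib_left sum.distrib mult_ac)
  finally show ?thesis by (rule cong_sym)
qed


text \<open>The sums are three linear equations for \<open>M\<close>, solved by the multiples of
  \<open>cof\<close>. The combination belonging to the affine function that vanishes at the two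
  remaining points leaves only \<open>M i\<close> and \<open>M j\<close>.\<close>

lemma cofactor_relation:
  assumes A: "val_ring A" and P: "S0 \<in> val_ideal A" "S1 \<in> val_ideal A" "S2 \<in> val_ideal A"
    and S: "S0 = (\<Sum>i<4. M i)" "S1 = (\<Sum>i<4. of_int (fst (pt i)) * M i)" "S2 = (\<Sum>i<4. of_int (snd (pt i)) * M i)"
    and ij: "i < 4" "j < 4"
  shows "of_int (cof i) * M j - of_int (cof j) * M i \<in> val_ideal A"
proof -
  have comb: "of_int \<alpha> * S0 + of_int \<beta> * S1 + of_int \<gamma> * S2 \<in> val_ideal A" for \<alpha> \<beta> \<gamma>
    by (intro vi_add[OF A] vi_mult[OF A] vr_of_int[OF A] P)
  have "of_int (cof 0) * M 1 - of_int (cof 1) * M 0 = (of_int (fst (pt 2) * snd (pt 3) - fst (pt 3) * snd (pt 2)) * S0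
      + of_int (snd (pt 2) - snd (pt 3)) * S1 + of_int (fst (pt 3) - fst (pt 2)) * S2)"
    unfolding S sum_4 cof det2_def fst_diff snd_diff of_int_diff of_int_mult of_int_minus by Groebner_Basis.algebra
  hence "of_int (cof 0) * M 1 - of_int (cof 1) * M 0 \<in> val_ideal A"
    using comb by (metis vi_uminus[OF A])
  note p01 = this
  have "of_int (cof 0) * M 2 - of_int (cof 2) * M 0 = - (of_int (fst (pt 1) * snd (pt 3) - fst (pt 3) * snd (pt 1)) * S0
      + of_int (snd (pt 1) - snd (pt 3)) * S1 + of_int (fst (pt 3) - fst (pt 1)) * S2)"
    unfolding S sum_4 cof det2_def fst_diff snd_diff of_int_diff of_int_mult of_int_minus by Groebner_Basis.algebra
  hence "of_int (cof 0) * M 2 - of_int (cof 2) * M 0 \<in> val_ideal A"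
    using comb by (metis vi_uminus[OF A])
  note p02 = this
  have "of_int (cof 0) * M 3 - of_int (cof 3) * M 0 = (of_int (fst (pt 1) * snd (pt 2) - fst (pt 2) * snd (pt 1)) * S0
      + of_int (snd (pt 1) - snd (pt 2)) * S1 + of_int (fst (pt 2) - fst (pt 1)) * S2)"
    unfolding S sum_4 cof det2_def fst_diff snd_diff of_int_diff of_int_mult of_int_minus by Groebner_Basis.algebra
  hence "of_int (cof 0) * M 3 - of_int (cof 3) * M 0 \<in> val_ideal A"
    using comb by (metis vi_uminus[OF A])
  note p03 = this
  have "of_int (cof 1) * M 2 - of_int (cof 2) * M 1 = (of_int (fst (pt 0) * snd (pt 3) - fst (pt 3) * snd (pt 0)) * S0
      + of_int (snd (pt 0) - snd (pt 3)) * S1 + of_int (fst (pt 3) - fst (pt 0)) * S2)"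
    unfolding S sum_4 cof det2_def fst_diff snd_diff of_int_diff of_int_mult of_int_minus by Groebner_Basis.algebra
  hence "of_int (cof 1) * M 2 - of_int (cof 2) * M 1 \<in> val_ideal A"
    using comb by (metis vi_uminus[OF A])
  note p12 = this
  have "of_int (cof 1) * M 3 - of_int (cof 3) * M 1 = - (of_int (fst (pt 0) * snd (pt 2) - fst (pt 2) * snd (pt 0)) * S0
      + of_int (snd (pt 0) - snd (pt 2)) * S1 + of_int (fst (pt 2) - fst (pt 0)) * S2)"
    unfolding S sum_4 cof det2_def fst_diff snd_diff of_int_diff of_int_mult of_int_minus by Groebner_Basis.algebra
  hence "of_int (cof 1) * M 3 - of_int (cof 3) * M 1 \<in> val_ideal A"
    using comb by (metis vi_uminus[OF A])
  note p13 = this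
  have "of_int (cof 2) * M 3 - of_int (cof 3) * M 2 = (of_int (fst (pt 0) * snd (pt 1) - fst (pt 1) * snd (pt 0)) * S0
      + of_int (snd (pt 0) - snd (pt 1)) * S1 + of_int (fst (pt 1) - fst (pt 0)) * S2)"
    unfolding S sum_4 cof det2_def fst_diff snd_diff of_int_diff of_int_mult of_int_minus by Groebner_Basis.algebra
  hence "of_int (cof 2) * M 3 - of_int (cof 3) * M 2 \<in> val_ideal A"
    using comb by (metis vi_uminus[OF A])
  note p23 = this
  have sym: "of_int (cof j) * M i - of_int (cof i) * M j \<in> val_ideal A"
    if "of_int (cof i) * M j - of_int (cof j) * M i \<in> val_ideal A" for i j
    using vi_uminus[OF A that] by simp
  have refl: "of_int (cof i) * M i - of_int (cof i) * M i \<in> val_ideal A" for i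
    using vi_mx[OF A mx_0] by simp
  from less_4_cases[OF ij(1)] less_4_cases[OF ij(2)] show ?thesis
    using p01 p02 p03 p12 p13 p23 sym refl by (elim disjE) (simp_all only:)
qed

definition rational :: "'a \<Rightarrow> bool" where
  "rational x \<longleftrightarrow> (\<exists>p q :: int. q \<noteq> 0 \<and> x * of_int q = of_int p)"

lemma rational_of_int: "rational (of_int n)"
  unfolding rational_def by (intro exI[of _ n] exI[of _ 1]) simp

lemma rational_mult: "rational x \<Longrightarrow> rational y \<Longrightarrow> rational (x * y)"
proof -
  assume "rational x" "rational y"
  then obtain p q p' q' :: int where "q \<noteq> 0" "x * of_int q = of_int p" "q' \<noteq> 0" "y * of_int q' = of_int p'"
    by (auto simp: rational_def)
  moreover from this have "x * y * of_int (q * q') = of_int (p * p')"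
    by (simp add: algebra_simps flip: of_int_mult) (metis mult.assoc mult.commute of_int_mult)
  ultimately show ?thesis unfolding rational_def by (intro exI[of _ "p * p'"] exI[of _ "q * q'"]) auto
qed

lemma rational_inverse: "rational x \<Longrightarrow> rational (inverse x)"
proof (cases "x = 0")
  case False
  assume "rational x"
  then obtain p q :: int where pq: "q \<noteq> 0" "x * of_int q = of_int p" by (auto simp: rational_def)
  hence "of_int p \<noteq> (0::'a)" using False by (metis mult_eq_0_iff of_int_eq_0_iff)
  hence "p \<noteq> 0" by auto
  moreover have "inverse x * of_int p = of_int q" using False unfolding pq(2)[symmetric] by simp
  ultimately show ?thesis by (auto simp: rational_def)
qed simp

lemma rational_power: "rational x \<Longrightarrow> rational (x ^ n)"
  by (induction n) (auto intro: rational_mult simp: rational_of_int[of 1, simplified])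

lemma rational_powi: "rational x \<Longrightarrow> rational (x powi n)"
  by (simp add: power_int_def rational_power rational_inverse)

lemma rational_prod: "(\<And>i. i \<in> I \<Longrightarrow> rational (g i)) \<Longrightarrow> rational (prod g I)"
  by (induction I rule: infinite_finite_induct) (auto intro: rational_mult simp: rational_of_int[of 1, simplified])

lemma T_power_irrational: "n > 0 \<Longrightarrow> \<not> rational (T ^ n)"
proof
  assume n: "n > 0" and "rational (T ^ n)"
  then obtain p q :: int where pq: "q \<noteq> 0" "T ^ n * of_int q = of_int p" by (auto simp: rational_def)
  define r where "r = monom q n - [:p:]"
  have "coeff r n = q" using n by (cases n) (simp_all add: r_def coeff_monom)
  hence "r \<noteq> 0" using pq(1) by auto
  moreover have "map_poly of_int r = monom (of_int q :: 'a) n - [:of_int p:]"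
    by (rule poly_eqI) (simp add: r_def coeff_map_poly coeff_monom coeff_pCons split: nat.splits)
  hence "poly (map_poly of_int r) T = 0" using pq(2) by (simp add: poly_monom mult.commute)
  ultimately show False using T_transcendental by blast
qed

lemma T_powi_irrational: "n \<noteq> 0 \<Longrightarrow> \<not> rational (T powi n)"
proof
  assume n: "n \<noteq> 0" and r: "rational (T powi n)"
  have "rational (T ^ nat \<bar>n\<bar>)"
  proof (cases "n > 0")
    case True
    thus ?thesis using r by (simp add: power_int_def)
  next
    case False
    thus ?thesis using rational_inverse[OF r] n by (simp add: power_int_def power_inverse)
  qed
  thus False using T_power_irrational[of "nat \<bar>n\<bar>"] n by simp
qed

text \<open>
  If both logarithmic derivatives of \<open>f\<close> vanished in the residue field of \<open>A\<close>, the terms of \<open>f\<close> would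
  reduce to a multiple of the cofactor vector; the multiplicative relation between the terms then
  makes a power of \<open>T\<close> rational.
\<close>

lemma nondegenerate:
  assumes A: "val_ring A" and i0: "i0 < 4" and M: "\<And>i. i < 4 \<Longrightarrow> tm i / tm i0 \<in> A"
  shows "euler1 / tm i0 \<notin> val_ideal A \<or> euler2 / tm i0 \<notin> val_ideal A"
proof (rule ccontr)
  assume "\<not> ?thesis"
  hence E: "euler1 / tm i0 \<in> val_ideal A" "euler2 / tm i0 \<in> val_ideal A" by auto
  define M where "M i = tm i / tm i0" for i
  have MA: "M i \<in> A" if "i < 4" for i using assms(3)[OF that] by (simp add: M_def)
  have Mu: "M i \<in> units" for i unfolding M_def by (intro units_divide tm_units)
  have M0: "M i0 = 1" using units_nz[OF tm_units[of i0]] by (simp add: M_def)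
  have "(\<Sum>i<4. M i) = (\<Sum>i<4. tm i) * inverse (tm i0)"
    by (simp add: M_def sum_distrib_right field_class.field_divide_inverse)
  hence S0: "(\<Sum>i<4. M i) \<in> val_ideal A"
    using mx_mult_right[OF sum_term_mx units_loc[OF units_inverse[OF tm_units[of i0]]]] by (simp add: vi_mx[OF A])
  have S1: "(\<Sum>i<4. of_int (fst (pt i)) * M i) \<in> val_ideal A"
    using E(1) by (simp add: M_def euler1_def pt_def sum_divide_distrib)
  have S2: "(\<Sum>i<4. of_int (snd (pt i)) * M i) \<in> val_ideal A"
    using E(2) by (simp add: M_def euler2_def pt_def sum_divide_distrib)
  have rel: "of_int (cof i0) * M j - of_int (cof j) \<in> val_ideal A" if "j < 4" for j
    using cofactor_relation[OF A S0 S1 S2 refl refl refl i0 that] M0 by simp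
  \<comment> \<open>Otherwise every \<open>cof j\<close> would lie in the valuation ideal and, being
    a constant, vanish.\<close>
  have ci0: "cof i0 \<noteq> 0"
  proof
    assume "cof i0 = 0"
    hence "const_fract (of_int (- cof j)) \<in> val_ideal A" if "j < 4" for j
      using rel[OF that] unfolding const_fract_of_int by simp
    hence "cof j = 0" if "j < 4" for j using that unfolding vi_const_iff[OF A] by simp
    thus False using nonsingular by (simp add: sum_4)
  qed
  define s where "s j = (of_int (cof j) / of_int (cof i0) :: 'a)" for j
  have Ms: "M j - const_fract (s j) \<in> val_ideal A" if "j < 4" for j
  proof -
    have "const_fract (inverse (of_int (cof i0))) * (of_int (cof i0) * M j - of_int (cof j)) \<in> val_ideal A"
      by (intro vi_mult[OF A] vr_const[OF A] rel that)
    also have "const_fract (inverse (of_int (cof i0))) * (of_int (cof i0) * M j - of_int (cof j)) = M j - const_fract (s j)"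
    proof -
      have "const_fract (s j) = const_fract (inverse (of_int (cof i0))) * of_int (cof j)"
        unfolding const_fract_of_int[symmetric] const_fract_mult[symmetric]
        by (simp add: s_def field_class.field_divide_inverse mult.commute)
      moreover have "const_fract (inverse (of_int (cof i0)) :: 'a) * of_int (cof i0) = 1"
      proof -
        have "inverse (of_int (cof i0)) * of_int (cof i0) = (1 :: 'a)" using ci0 by simp
        from arg_cong[OF this, of const_fract] show ?thesis
          unfolding const_fract_mult const_fract_of_int by (simp flip: one_pCons)
      qed
      ultimately show ?thesis by (simp add: right_diff_distrib flip: mult.assoc)
    qed
    finally show ?thesis .
  qed
  \<comment> \<open>Where \<open>cof j = 0\<close> the power is 1. Elsewhere the residue
    \<open>s j\<close> is nonzero, so \<open>M j\<close> is a unit of \<open>A\<close> and negative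
    exponents are allowed.\<close>
  have *: "M j powi cof j \<in> A \<and> const_fract (s j powi cof j) \<in> A \<and> M j powi cof j - const_fract (s j powi cof j) \<in> val_ideal A"
    if j: "j < 4" for j
  proof (cases "cof j = 0")
    case True
    thus ?thesis using vr_1[OF A] vi_mx[OF A mx_0] by (simp flip: one_pCons)
  next
    case False
    hence sj: "s j \<noteq> 0" using ci0 by (simp add: s_def)
    have "M j \<notin> val_ideal A"
    proof
      assume "M j \<in> val_ideal A"
      hence "const_fract (s j) \<in> val_ideal A" using vi_diff[OF A _ Ms[OF j]] by force
      thus False using sj unfolding vi_const_iff[OF A] by simp
    qed
    hence inv: "inverse (M j) \<in> A" using vi_unit[OF A MA[OF j]] by blast
    have c: "const_fract (s j) \<in> units" "const_fract (s j) \<in> A" "inverse (const_fract (s j)) \<in> A"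
      using units_const[OF sj] vr_const[OF A] unfolding const_fract_inverse[symmetric] by auto
    show ?thesis unfolding const_fract_powi
      using vi_cong_powi[OF A Mu MA[OF j] inv c Ms[OF j]] vr_powi[OF A MA[OF j] inv] vr_powi[OF A c(2,3)] by blast
  qed
  have "(\<Prod>j<4. M j powi cof j) - (\<Prod>j<4. const_fract (s j powi cof j)) \<in> val_ideal A"
    using vi_cong_prod[OF A, of "{..<4}" "\<lambda>j. M j powi cof j" "\<lambda>j. const_fract (s j powi cof j)"] * by auto
  moreover have "(\<Prod>j<4. const_fract (s j powi cof j)) = const_fract (\<Prod>j<4. s j powi cof j)"
  proof -
    have "(\<Prod>j\<in>I. const_fract (g j)) = const_fract (\<Prod>j\<in>I. g j)" for I :: "nat set" and g :: "nat \<Rightarrow> 'a"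
      by (induction I rule: infinite_finite_induct) (simp_all add: const_fract_mult flip: one_pCons)
    thus ?thesis by simp
  qed
  \<comment> \<open>Weighted by the affine relation \<open>cof\<close>, the monomials in
    \<open>x\<close> and \<open>y\<close> cancel together with the normalising term
    \<open>tm i0\<close>; a power of \<open>T\<close> remains.\<close>
  moreover have "(\<Prod>j<4. M j powi cof j) = const_fract (T powi (\<Sum>j<4. cof j * int (e0 j)))"
  proof -
    have Mj: "M j = const_fract (T powi (int (e0 j) - int (e0 i0))) * mono (pt j - pt i0)" for j
    proof -
      have "const_fract (T powi (int (e0 j) - int (e0 i0))) = const_fract (T ^ e0 j) / const_fract (T ^ e0 i0)"
        using T_nonzero by (simp add: power_int_diff field_class.field_divide_inverse const_fract_mult const_fract_inverse)
      thus ?thesis by (simp add: M_def tm_def mono_diff)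
    qed
    have "M j powi cof j = const_fract (T powi (cof j * (int (e0 j) - int (e0 i0)))) * mono (smul (cof j) (pt j - pt i0))" for j
      unfolding Mj power_int_mult_distrib const_fract_powi[symmetric] mono_smul by (simp add: power_int_mult[symmetric] mult.commute)
    hence "(\<Prod>j<4. M j powi cof j) = (\<Prod>j<4. const_fract (T powi (cof j * (int (e0 j) - int (e0 i0))))) * (\<Prod>j<4. mono (smul (cof j) (pt j - pt i0)))"
      by (simp add: prod.distrib)
    also have "(\<Prod>j<4. mono (smul (cof j) (pt j - pt i0))) = mono (\<Sum>j<4. smul (cof j) (pt j - pt i0))"
      by (simp add: mono_sum)
    also have "(\<Sum>j<4. smul (cof j) (pt j - pt i0)) = 0"
    proof -
      have "fst (\<Sum>j<4. smul (cof j) (pt j - pt i0)) = (\<Sum>j<4. cof j * fst (pt j)) - (\<Sum>j<4. cof j) * fst (pt i0)"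
        "snd (\<Sum>j<4. smul (cof j) (pt j - pt i0)) = (\<Sum>j<4. cof j * snd (pt j)) - (\<Sum>j<4. cof j) * snd (pt i0)"
        by (simp_all add: sum_4 smul_def algebra_simps)
      thus ?thesis using cof_sums by (simp add: prod_eq_iff)
    qed
    also have "(\<Prod>j<4. const_fract (T powi (cof j * (int (e0 j) - int (e0 i0))))) = const_fract (\<Prod>j<4. T powi (cof j * (int (e0 j) - int (e0 i0))))"
    proof -
      have "(\<Prod>j\<in>I. const_fract (g j)) = const_fract (\<Prod>j\<in>I. g j)" for I :: "nat set" and g :: "nat \<Rightarrow> 'a"
        by (induction I rule: infinite_finite_induct) (simp_all add: const_fract_mult flip: one_pCons)
      thus ?thesis by simp
    qed
    also have "(\<Prod>j<4. T powi (cof j * (int (e0 j) - int (e0 i0)))) = T powi (\<Sum>j<4. cof j * (int (e0 j) - int (e0 i0)))"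
      using T_nonzero by (simp add: eval_nat_numeral power_int_add)
    also have "(\<Sum>j<4. cof j * (int (e0 j) - int (e0 i0))) = (\<Sum>j<4. cof j * int (e0 j)) - (\<Sum>j<4. cof j) * int (e0 i0)"
      by (simp add: sum_4 algebra_simps)
    finally show ?thesis using cof_sums by (simp add: mono_0)
  qed
  ultimately have "const_fract (T powi (\<Sum>j<4. cof j * int (e0 j)) - (\<Prod>j<4. s j powi cof j)) \<in> val_ideal A"
    by (simp add: const_fract_add diff_conv_add_uminus const_fract_uminus del: add_uminus_conv_diff)
  hence "T powi (\<Sum>j<4. cof j * int (e0 j)) = (\<Prod>j<4. s j powi cof j)"
    unfolding vi_const_iff[OF A] by simp
  moreover have "rational (\<Prod>j<4. s j powi cof j)"
    unfolding s_def field_class.field_divide_inverse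
    by (intro rational_prod rational_powi rational_mult rational_inverse rational_of_int)
  ultimately show False using T_powi_irrational[OF nonsingular] by simp
qed


section \<open>Regular differentials from interior lattice points\<close>

definition points :: "(int \<times> int) set" where "points = pt ` {..<4}"

text \<open>The coefficient of \<open>dx\<close> in the form attached to \<open>r\<close>, with
  \<open>euler2\<close> standing for \<open>y * f_y\<close>.\<close>

definition form_coeff :: "int \<times> int \<Rightarrow> 'a poly poly fract" where
  "form_coeff r = mono r / (xv * euler2)"

lemma form_coeff_units: "form_coeff r \<in> units"
  unfolding form_coeff_def by (intro units_divide units_mult mono_units xv_units euler2_units)

text \<open>Divisibility in a valuation ring is a total preorder on units, so among finitely many
  terms one has least value.\<close>

lemma dominant_term:
  assumes A: "val_ring A"
  obtains i0 where "i0 < 4" "\<And>i. i < 4 \<Longrightarrow> tm i / tm i0 \<in> A"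
proof -
  have trans: "tm i / tm k \<in> A" if "tm i / tm j \<in> A" "tm j / tm k \<in> A" for i j k
    using vr_mult[OF A that] units_nz[OF tm_units[of j]] by simp
  have total: "tm i / tm j \<in> A \<or> tm j / tm i \<in> A" for i j
    using vr_total[OF A units_divide[OF tm_units tm_units], of i j] by simp
  have refl: "tm i / tm i \<in> A" for i
    using vr_1[OF A] units_nz[OF tm_units[of i]] by simp
  have "\<exists>i0<n. \<forall>i<n. tm i / tm i0 \<in> A" if "n > 0" for n
    using that
  proof (induction n)
    case (Suc n)
    show ?case
    proof (cases "n = 0")
      case True
      thus ?thesis using refl by auto
    next
      case False
      then obtain i0 where i0: "i0 < n" "\<And>i. i < n \<Longrightarrow> tm i / tm i0 \<in> A" using Suc.IH by auto
      show ?thesis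
      proof (cases "tm n / tm i0 \<in> A")
        case True
        hence "\<forall>i<Suc n. tm i / tm i0 \<in> A" using i0(2) less_Suc_eq by auto
        thus ?thesis using i0(1) less_Suc_eq by blast
      next
        case False
        hence n0: "tm i0 / tm n \<in> A" using total by blast
        have "tm i / tm n \<in> A" if "i < Suc n" for i
          using that i0(2) trans[OF _ n0] refl by (cases "i = n") auto
        thus ?thesis by blast
      qed
    qed
  qed simp
  thus ?thesis using that by (metis zero_less_numeral)
qed

text \<open>The terms sum to zero, so the least value cannot be attained at a single monomial. Terms
  with the exponents of \<open>i0\<close> are collected first; by \<open>T_powers_nonzero\<close>
  their coefficients add up to a nonzero constant.\<close>

lemma dominant_direction:
  assumes A: "val_ring A" and i0: "i0 < 4" and M: "\<And>i. i < 4 \<Longrightarrow> tm i / tm i0 \<in> A"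
  obtains i where "i < 4" "pt i \<noteq> pt i0" "tm i0 / tm i \<in> A"
proof (rule ccontr)
  assume "\<not> thesis"
  hence no: "\<And>i. i < 4 \<Longrightarrow> pt i \<noteq> pt i0 \<Longrightarrow> tm i0 / tm i \<notin> A" using that by blast
  define I where "I = {i. i < 4 \<and> pt i = pt i0}"
  have I: "I \<subseteq> {..<4}" "i0 \<in> I" "finite I" using i0 by (auto simp: I_def)
  have "(\<Sum>i<4. tm i / tm i0) = (\<Sum>i<4. tm i) * inverse (tm i0)"
    by (simp add: sum_distrib_right field_class.field_divide_inverse)
  hence "(\<Sum>i<4. tm i / tm i0) \<in> val_ideal A"
    using mx_mult_right[OF sum_term_mx units_loc[OF units_inverse[OF tm_units[of i0]]]] by (simp add: vi_mx[OF A])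
  moreover have "(\<Sum>i\<in>{..<4} - I. tm i / tm i0) \<in> val_ideal A"
  proof -
    have "tm i / tm i0 \<in> val_ideal A" if "i \<in> {..<4} - I" for i
      using that M no[of i] by (auto simp: val_ideal_def I_def)
    thus ?thesis by (rule vi_sum[OF A])
  qed
  ultimately have "(\<Sum>i\<in>I. tm i / tm i0) \<in> val_ideal A"
    using vi_diff[OF A] sum.subset_diff[OF I(1), of "\<lambda>i. tm i / tm i0"] by force
  also have "(\<Sum>i\<in>I. tm i / tm i0) = (\<Sum>i\<in>I. const_fract (T ^ e0 i)) * const_fract (inverse (T ^ e0 i0))"
    unfolding sum_distrib_right
  proof (rule sum.cong[OF refl])
    fix i assume "i \<in> I"
    hence "pt i = pt i0" by (simp add: I_def)
    thus "tm i / tm i0 = const_fract (T ^ e0 i) * const_fract (inverse (T ^ e0 i0))"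
      using units_nz[OF mono_units[of "pt i0"]] by (simp add: tm_def const_fract_inverse field_class.field_divide_inverse)
  qed
  also have "(\<Sum>i\<in>I. const_fract (T ^ e0 i)) = const_fract (\<Sum>i\<in>I. T ^ e0 i)"
    using I(3) by (induction I rule: finite_induct) (simp_all add: const_fract_add)
  finally have "(\<Sum>i\<in>I. T ^ e0 i) * inverse (T ^ e0 i0) = 0"
    unfolding const_fract_mult[symmetric] vi_const_iff[OF A] .
  thus False using T_powers_nonzero[of I e0] I T_nonzero by auto
qed

text \<open>On the curve the form is \<open>h dlog x / E2 = - h dlog y / E1\<close>, and
  nondegeneracy makes \<open>E1\<close> or \<open>E2\<close> a unit of \<open>A\<close>. The
  exponents of monomials in \<open>A\<close> fill a half-plane bounded by the direction
  \<open>e\<close> of two dominant terms, and \<open>r - pt i0\<close> lies strictly inside it. So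
  \<open>dlog x\<close> and \<open>dlog y\<close> are rational combinations of \<open>dlog h\<close>
  and \<open>dlog W\<close>, where \<open>W = mono e\<close> is a unit of \<open>A\<close> and
  \<open>h dlog h = dh\<close> has no pole.\<close>

lemma interior_form_regular:
  assumes A: "val_ring A" and r: "r \<in> lattice_interior points"
  shows "\<exists>a0 b0 a1 b1. {a0, b0, a1, b1} \<subseteq> A \<and>
    (\<forall>d. cder d \<longrightarrow> form_coeff r * d xv \<approx> a0 * d b0 + a1 * d b1)"
proof -
  obtain i0 where i0: "i0 < 4" "\<And>i. i < 4 \<Longrightarrow> tm i / tm i0 \<in> A" using dominant_term[OF A] by blast
  obtain i1 where i1: "i1 < 4" "pt i1 \<noteq> pt i0" "tm i0 / tm i1 \<in> A" using dominant_direction[OF A i0] .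
  define h where "h = mono r / tm i0"
  have hu: "h \<in> units" unfolding h_def by (intro units_divide mono_units tm_units)
  define E1 E2 where "E1 = euler1 / tm i0" "E2 = euler2 / tm i0"
  have Esum: "E1 = (\<Sum>i<4. of_nat (e1 i) * (tm i / tm i0))" "E2 = (\<Sum>i<4. of_nat (e2 i) * (tm i / tm i0))"
    by (simp_all add: E1_E2_def euler1_def euler2_def sum_divide_distrib)
  have EA: "E1 \<in> A" "E2 \<in> A"
    unfolding Esum by (intro vr_sum[OF A] vr_mult[OF A] vr_of_nat[OF A] i0(2); simp)+
  have E2u: "E2 \<in> units" unfolding E1_E2_def by (intro units_divide euler2_units tm_units)
  have t0: "tm i0 \<noteq> 0" by (rule units_nz[OF tm_units])
  \<comment> \<open>It suffices to treat \<open>h\<close> times the logarithmic derivatives of both coordinates.\<close>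
  have reduce: ?thesis
    if hx: "\<exists>a0 b0 a1 b1. {a0, b0, a1, b1} \<subseteq> A \<and> (\<forall>d. cder d \<longrightarrow> h * dlog d xv \<approx> a0 * d b0 + a1 * d b1)"
      and hy: "\<exists>a0 b0 a1 b1. {a0, b0, a1, b1} \<subseteq> A \<and> (\<forall>d. cder d \<longrightarrow> h * dlog d yv \<approx> a0 * d b0 + a1 * d b1)"
  proof -
    have form: "form_coeff r * d xv = inverse E2 * (h * dlog d xv)" for d
      using t0 units_nz[OF xv_units] units_nz[OF euler2_units]
      by (simp add: form_coeff_def h_def E1_E2_def dlog_def field_simps)
    have mult: "\<exists>a0 b0 a1 b1. {a0, b0, a1, b1} \<subseteq> A \<and> (\<forall>d. cder d \<longrightarrow> k * (h * dlog d v) \<approx> a0 * d b0 + a1 * d b1)"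
      if k: "k \<in> A" "\<exists>a0 b0 a1 b1. {a0, b0, a1, b1} \<subseteq> A \<and> (\<forall>d. cder d \<longrightarrow> h * dlog d v \<approx> a0 * d b0 + a1 * d b1)" for k v
    proof -
      obtain a0 b0 a1 b1 where ab: "{a0, b0, a1, b1} \<subseteq> A"
        "\<And>d. cder d \<Longrightarrow> h * dlog d v \<approx> a0 * d b0 + a1 * d b1" using k(2) by blast
      have "k * (h * dlog d v) \<approx> (k * a0) * d b0 + (k * a1) * d b1" if "cder d" for d
        using cong_mult_left[OF vr_loc[OF A \<open>k \<in> A\<close>] ab(2)[OF that]] by (simp add: algebra_simps)
      moreover have "{k * a0, b0, k * a1, b1} \<subseteq> A" using ab(1) \<open>k \<in> A\<close> by (auto intro: vr_mult[OF A])
      ultimately show ?thesis by blast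
    qed
    show ?thesis
    proof (cases "E2 \<in> val_ideal A")
      case False
      hence "inverse E2 \<in> A" using vi_unit[OF A EA(2)] by blast
      from mult[OF this hx] show ?thesis unfolding form .
    next
      case True
      hence "E1 \<notin> val_ideal A" using nondegenerate[OF A i0] by (simp add: E1_E2_def)
      hence E1: "E1 \<in> units" "inverse E1 \<in> A" using vi_unit[OF A EA(1)] by auto
      obtain a0 b0 a1 b1 where ab: "{a0, b0, a1, b1} \<subseteq> A"
        "\<And>d. cder d \<Longrightarrow> - inverse E1 * (h * dlog d yv) \<approx> a0 * d b0 + a1 * d b1"
        using mult[OF vr_uminus[OF A E1(2)] hy] by blast
      have "inverse E2 * (h * dlog d xv) \<approx> - inverse E1 * (h * dlog d yv)" if d: "cder d" for d
      proof -
        \<comment> \<open>The Euler relation, scaled so that its two summands become the two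
          expressions for the form.\<close>
        have "(inverse E1 * inverse E2 * h * inverse (tm i0)) * (euler1 * dlog d xv + euler2 * dlog d yv)
            \<approx> (inverse E1 * inverse E2 * h * inverse (tm i0)) * 0"
          by (intro cong_mult_left euler_relation d loc_mult units_loc units_inverse E1(1) E2u hu tm_units)
        also have "(inverse E1 * inverse E2 * h * inverse (tm i0)) * (euler1 * dlog d xv + euler2 * dlog d yv)
            = inverse E2 * (h * dlog d xv) - (- inverse E1 * (h * dlog d yv))"
        proof -
          have "euler1 = E1 * tm i0" "euler2 = E2 * tm i0" using t0 by (simp_all add: E1_E2_def)
          thus ?thesis using t0 units_nz[OF E1(1)] units_nz[OF E2u] by (simp add: field_simps)
        qed
        finally show ?thesis by (simp add: cong_mx_def)
      qed
      hence "\<And>d. cder d \<Longrightarrow> form_coeff r * d xv \<approx> a0 * d b0 + a1 * d b1"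
        unfolding form using ab(2) cong_trans by blast
      thus ?thesis using ab(1) by blast
    qed
  qed
  define C where "C = {v. mono v \<in> A}"
  have Cadd: "\<And>u v. u \<in> C \<Longrightarrow> v \<in> C \<Longrightarrow> u + v \<in> C" by (auto simp: C_def mono_add intro: vr_mult[OF A])
  have Ctotal: "\<And>v. v \<in> C \<or> - v \<in> C" using vr_total[OF A mono_units] by (auto simp: C_def mono_uminus)
  have ratio: "pt i - pt j \<in> C" if "tm i / tm j \<in> A" for i j
  proof -
    have "mono (pt i - pt j) = const_fract (inverse (T ^ e0 i) * T ^ e0 j) * (tm i / tm j)"
      using T_nonzero units_nz[OF mono_units[of "pt j"]]
      by (simp add: mono_diff tm_def const_fract_mult const_fract_inverse)
    thus ?thesis using vr_mult[OF A vr_const[OF A] that] by (simp add: C_def)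
  qed
  have hmono: "h = const_fract (inverse (T ^ e0 i0)) * mono (r - pt i0)"
    by (simp add: h_def tm_def mono_diff const_fract_inverse field_class.field_divide_inverse)
  show ?thesis
  \<comment> \<open>If all monomials lie in \<open>A\<close>, both coordinates are units of
    \<open>A\<close> and their logarithmic derivatives are already differentials of
    \<open>A\<close>.\<close>
  proof (cases "C = UNIV")
    case True
    have mA: "mono v \<in> A" for v using True by (auto simp: C_def)
    have hA: "h \<in> A" unfolding hmono by (intro vr_mult[OF A] vr_const[OF A] mA)
    have xy: "xv \<in> A" "yv \<in> A" using mA[of "(1, 0)"] mA[of "(0, 1)"] by (simp_all add: mono_def)
    have xy': "inverse xv \<in> A" "inverse yv \<in> A"
      using mA[of "(-1, 0)"] mA[of "(0, -1)"] by (simp_all add: mono_def power_int_minus)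
    have "\<exists>a0 b0 a1 b1. {a0, b0, a1, b1} \<subseteq> A \<and> (\<forall>d. cder d \<longrightarrow> h * dlog d v \<approx> a0 * d b0 + a1 * d b1)"
      if v: "v \<in> A" "inverse v \<in> A" for v
    proof -
      have eq: "h * dlog d v = (h * inverse v) * d v + 0 * d 0" for d
        by (simp add: dlog_def field_class.field_divide_inverse)
      have "h * dlog d v \<approx> (h * inverse v) * d v + 0 * d 0" for d
        unfolding eq by (simp add: cong_mx_def)
      moreover have "{h * inverse v, v, 0, 0} \<subseteq> A"
        using hA v vr_mx[OF A mx_0] vr_mult[OF A hA] by simp
      ultimately show ?thesis by blast
    qed
    from reduce[OF this[OF xy(1) xy'(1)] this[OF xy(2) xy'(2)]] show ?thesis .
  next
    case False
    define e where "e = pt i1 - pt i0"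
    have e: "e \<in> C" "- e \<in> C" "e \<noteq> 0"
      using ratio[OF i0(2)[OF i1(1)]] ratio[OF i1(3)] i1(2) by (auto simp: e_def)
    have S: "\<And>s. s \<in> points \<Longrightarrow> s - pt i0 \<in> C" using ratio[OF i0(2)] by (auto simp: points_def)
    define \<delta> where "\<delta> = r - pt i0"
    have \<delta>: "\<delta> \<in> C" "det2 e \<delta> \<noteq> 0"
      using interior_of_cone[OF Cadd Ctotal e False S r] by (auto simp: \<delta>_def)
    have hA: "h \<in> A" unfolding hmono using \<delta>(1) by (intro vr_mult[OF A] vr_const[OF A]) (simp add: C_def \<delta>_def)
    define W :: "'a poly poly fract" where "W = mono e"
    have W: "W \<in> A" "inverse W \<in> A" "W \<in> units" using e mono_units by (auto simp: W_def C_def mono_uminus)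
    define D where "D = (of_int (det2 e \<delta>) :: 'a poly poly fract)"
    have D: "inverse D \<in> A" "D \<noteq> 0"
    proof -
      have "inverse D = const_fract (inverse (of_int (det2 e \<delta>)))"
        unfolding const_fract_inverse const_fract_of_int D_def ..
      thus "inverse D \<in> A" using vr_const[OF A] by simp
      have "const_fract (of_int (det2 e \<delta>)) \<noteq> (0::'a poly poly fract)" using \<delta>(2) by simp
      thus "D \<noteq> 0" unfolding const_fract_of_int D_def .
    qed
    have dW: "dlog d W \<approx> of_int (fst e) * dlog d xv + of_int (snd e) * dlog d yv" if "cder d" for d
      unfolding W_def by (rule dlog_mono[OF that])
    have dh: "dlog d h \<approx> of_int (fst \<delta>) * dlog d xv + of_int (snd \<delta>) * dlog d yv" if "cder d" for d
      unfolding hmono \<delta>_def[symmetric] by (rule dlog_const_mono[OF that]) (simp add: T_nonzero)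
    \<comment> \<open>Cramer's rule with determinant \<open>D\<close>. The two summands come from
      \<open>h * dlog d h = d h\<close> and
      \<open>h * dlog d W = h * inverse W * d W\<close>.\<close>
    have comb: "\<exists>a0 b0 a1 b1. {a0, b0, a1, b1} \<subseteq> A \<and> (\<forall>d. cder d \<longrightarrow> h * dlog d v \<approx> a0 * d b0 + a1 * d b1)"
      if eqn: "\<And>d. D * dlog d v = of_int m * (of_int (fst \<delta>) * dlog d xv + of_int (snd \<delta>) * dlog d yv)
            + of_int n * (of_int (fst e) * dlog d xv + of_int (snd e) * dlog d yv)" for v m n
    proof -
      have "h * dlog d v \<approx> (inverse D * of_int m) * d h + (inverse D * of_int n * h * inverse W) * d W" if d: "cder d" for d
      proof -
        have "(inverse D * h) * (of_int m * dlog d h + of_int n * dlog d W)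
          \<approx> (inverse D * h) * (of_int m * (of_int (fst \<delta>) * dlog d xv + of_int (snd \<delta>) * dlog d yv)
            + of_int n * (of_int (fst e) * dlog d xv + of_int (snd e) * dlog d yv))"
          by (intro cong_mult_left cong_add dh dW d of_int_loc loc_mult vr_loc[OF A] D hA)
        also have "\<dots> = h * dlog d v" using D(2) by (simp add: eqn[symmetric])
        finally have "h * dlog d v \<approx> (inverse D * h) * (of_int m * dlog d h + of_int n * dlog d W)" by (rule cong_sym)
        also have "\<dots> = (inverse D * of_int m) * d h + (inverse D * of_int n * h * inverse W) * d W"
          using units_nz[OF hu] by (simp add: dlog_def field_class.field_divide_inverse algebra_simps)
        finally show ?thesis .
      qed
      moreover have "{inverse D * of_int m, h, inverse D * of_int n * h * inverse W, W} \<subseteq> A"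
        using D hA W by (auto intro!: vr_mult[OF A] vr_of_int[OF A])
      ultimately show ?thesis by blast
    qed
    show ?thesis
    proof (rule reduce)
      show "\<exists>a0 b0 a1 b1. {a0, b0, a1, b1} \<subseteq> A \<and> (\<forall>d. cder d \<longrightarrow> h * dlog d xv \<approx> a0 * d b0 + a1 * d b1)"
        by (rule comb[where m = "- snd e" and n = "snd \<delta>"]) (simp add: D_def det2_def algebra_simps)
      show "\<exists>a0 b0 a1 b1. {a0, b0, a1, b1} \<subseteq> A \<and> (\<forall>d. cder d \<longrightarrow> h * dlog d yv \<approx> a0 * d b0 + a1 * d b1)"
        by (rule comb[where m = "fst e" and n = "- fst \<delta>"]) (simp add: D_def det2_def algebra_simps)
    qed
  qed
qed

lemma interior_point_less:
  assumes r: "r \<in> lattice_interior points" and ab: "\<alpha> \<noteq> 0 \<or> \<beta> \<noteq> 0"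
  obtains i where "i < 4" "lin \<alpha> \<beta> (pt i) < lin \<alpha> \<beta> r"
proof -
  from r ab obtain s where s: "s \<in> points" "lin \<alpha> \<beta> s < lin \<alpha> \<beta> r" by (rule lattice_interior_less)
  from s(1) obtain i where "i < 4" "s = pt i" unfolding points_def by blast
  thus ?thesis using s(2) that by blast
qed

lemma interior_positive:
  assumes r: "r \<in> lattice_interior points"
  shows "0 \<le> fst r" "0 \<le> snd r" "snd r < int (degree f)"
proof -
  from r obtain i where "i < 4" "lin 1 0 (pt i) < lin 1 0 r"
    by (rule interior_point_less[where \<alpha> = "1" and \<beta> = "0"]) simp
  thus "0 \<le> fst r" by (simp add: lin_def pt_def)
  from r obtain i where "i < 4" "lin 0 1 (pt i) < lin 0 1 r"
    by (rule interior_point_less[where \<alpha> = "0" and \<beta> = "1"]) simp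
  thus "0 \<le> snd r" by (simp add: lin_def pt_def)
  from r obtain i where i: "i < 4" "lin 0 (-1) (pt i) < lin 0 (-1) r"
    by (rule interior_point_less[where \<alpha> = "0" and \<beta> = "-1"]) simp
  thus "snd r < int (degree f)" using e2_le_degree[OF i(1)] by (simp add: lin_def pt_def)
qed

text \<open>Interior points have nonnegative coordinates and a second coordinate below the
  \<open>Y\<close>-degree of \<open>f\<close>. A relation would make a polynomial of smaller degree
  divisible by \<open>f\<close>, hence zero.\<close>

lemma interior_forms_independent:
  assumes r: "r \<in> lattice_interior points" and s: "s \<in> lattice_interior points" and "r \<noteq> s"
    and c: "const_fract c1 * form_coeff r + const_fract c2 * form_coeff s \<in> mx"
  shows "c1 = 0 \<and> c2 = 0"
proof -
  have "const_fract c1 * mono r + const_fract c2 * mono s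
      = (const_fract c1 * form_coeff r + const_fract c2 * form_coeff s) * (xv * euler2)"
    using units_nz[OF xv_units] units_nz[OF euler2_units] by (simp add: form_coeff_def field_simps)
  also have "\<dots> \<in> mx" by (intro mx_mult_right c units_loc units_mult xv_units euler2_units)
  finally have mx: "const_fract c1 * mono r + const_fract c2 * mono s \<in> mx" .
  define p where "p = bimonom c1 (nat (fst r)) (nat (snd r)) + bimonom c2 (nat (fst s)) (nat (snd s))"
  note pos = interior_positive[OF r] interior_positive[OF s]
  have "to_fract p = const_fract c1 * mono r + const_fract c2 * mono s"
    using pos by (simp add: p_def to_fract_bimonom mono_def power_int_def mult.assoc)
  hence "f dvd p" using mx by (metis to_fract_mx_iff)
  moreover have "degree p < degree f"
  proof -
    have "degree (bimonom c1 (nat (fst r)) (nat (snd r))) < degree f" "degree (bimonom c2 (nat (fst s)) (nat (snd s))) < degree f"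
      using pos by (auto simp: bimonom_def intro!: le_less_trans[OF degree_monom_le])
    thus ?thesis unfolding p_def by (rule degree_add_less)
  qed
  ultimately have "p = 0" using dvd_imp_degree_le[of f p] by fastforce
  hence "coeff (coeff p (nat (snd r))) (nat (fst r)) = 0" "coeff (coeff p (nat (snd s))) (nat (fst s)) = 0" by simp_all
  moreover have "nat (fst r) \<noteq> nat (fst s) \<or> nat (snd r) \<noteq> nat (snd s)"
    using \<open>r \<noteq> s\<close> pos by (auto simp: prod_eq_iff)
  ultimately show ?thesis by (auto simp: p_def bimonom_def coeff_monom split: if_splits)
qed

theorem genus_one_unique_interior:
  assumes genus: "function_field_has_genus KK FF 1"
    and r: "r \<in> lattice_interior points" and s: "s \<in> lattice_interior points"
  shows "r = s"
proof (rule ccontr)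
  assume "r \<noteq> s"
  have reg: "\<exists>a0 b0 a1 b1. {a0, b0, a1, b1} \<subseteq> A \<and> (\<forall>d. cder d \<longrightarrow> g * d xv \<approx> a0 * d b0 + a1 * d b1)"
    if "val_ring A" "g \<in> {form_coeff r, form_coeff s}" for A g
    using that(2) interior_form_regular[OF that(1) r] interior_form_regular[OF that(1) s]
    by (elim insertE emptyE) (simp_all only:)
  have "dcan xv \<notin> mx" using pderiv_f_units by (simp add: dcan_xv units_def)
  from genus_one_dependent[OF genus units_loc[OF form_coeff_units] units_loc[OF form_coeff_units] reg cder_dcan this]
  obtain c1 c2 where c: "c1 \<noteq> 0 \<or> c2 \<noteq> 0" "const_fract c1 * form_coeff r + const_fract c2 * form_coeff s \<in> mx" .
  show False using interior_forms_independent[OF r s \<open>r \<noteq> s\<close> c(2)] c(1) by simp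
qed


subsection \<open>Polygons without interior lattice points\<close>

definition rational_in :: "'a poly poly fract \<Rightarrow> 'a poly poly fract set" where
  "rational_in u = {r. \<exists>p q. represents u p q r}"

context
  fixes u assumes u: "u \<in> loc"
begin

lemma ri_self: "u \<in> rational_in u"
  using represents_ev[OF u, of "[:0, 1:]"] by (auto simp: rational_in_def simp flip: one_pCons)

lemma ri_const: "const_fract c \<in> rational_in u"
  using represents_const[OF u] by (auto simp: rational_in_def)

lemma ri_add: "r \<in> rational_in u \<Longrightarrow> s \<in> rational_in u \<Longrightarrow> r + s \<in> rational_in u"
  using represents_add[OF u] unfolding rational_in_def by blast

lemma ri_mult: "r \<in> rational_in u \<Longrightarrow> s \<in> rational_in u \<Longrightarrow> r * s \<in> rational_in u"
  using represents_mult[OF u] unfolding rational_in_def by blast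

lemma ri_inverse: "r \<in> rational_in u \<Longrightarrow> r \<notin> mx \<Longrightarrow> inverse r \<in> rational_in u"
  using represents_inverse[OF u] unfolding rational_in_def by blast

lemma ri_uminus: "r \<in> rational_in u \<Longrightarrow> - r \<in> rational_in u"
  using ri_mult[OF ri_const[of "-1"]] by (simp add: const_fract_uminus flip: one_pCons)

lemma ri_diff: "r \<in> rational_in u \<Longrightarrow> s \<in> rational_in u \<Longrightarrow> r - s \<in> rational_in u"
  using ri_add[OF _ ri_uminus] by simp

lemma ri_cong: "r \<in> rational_in u \<Longrightarrow> s \<approx> r \<Longrightarrow> s \<in> rational_in u"
  using represents_cong[OF _ _ u] unfolding rational_in_def by blast

lemma ri_powi:
  assumes "r \<in> rational_in u" "r \<in> units"
  shows "r powi n \<in> rational_in u"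
proof -
  have "s ^ m \<in> rational_in u" if "s \<in> rational_in u" for s m
    using that ri_const[of 1] by (induction m) (auto intro: ri_mult simp flip: one_pCons)
  thus ?thesis using assms ri_inverse[OF assms(1)] by (simp add: power_int_def units_def)
qed

end

text \<open>Over an algebraically closed field the quadratic part factors into \<open>l1\<close> and
  \<open>l2\<close>. Distinct factors give a hyperbola, where the product of \<open>l1\<close> and
  \<open>l2\<close> is constant and \<open>l1\<close> is a parameter. Equal factors make
  \<open>l1\<close> itself constant, and \<open>a\<close> is a linear function of
  \<open>b\<close>.\<close>

lemma conic_rational:
  assumes ab: "a \<in> loc" "b \<in> loc" and nz: "\<alpha> \<noteq> 0" "\<delta> \<noteq> 0"
    and conic: "const_fract \<alpha> * a\<^sup>2 + const_fract \<beta> * (a * b) + const_fract \<gamma> * b\<^sup>2 + const_fract \<delta> \<in> mx"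
  obtains u where "u \<in> loc" "a \<in> rational_in u" "b \<in> rational_in u"
proof -
  have "degree [:\<gamma>, \<beta>, \<alpha>:] = 2" using nz(1) by simp
  then obtain r1 where r1: "poly [:\<gamma>, \<beta>, \<alpha>:] r1 = 0" using alg_closed_imp_poly_has_root[of "[:\<gamma>, \<beta>, \<alpha>:]"] by auto
  define r2 where "r2 = - \<beta> / \<alpha> - r1"
  have r12: "\<beta> = - \<alpha> * (r1 + r2)" "\<gamma> = \<alpha> * (r1 * r2)"
  proof -
    show "\<beta> = - \<alpha> * (r1 + r2)" using nz(1) by (simp add: r2_def)
    hence "r1 * \<beta> = r1 * (- \<alpha> * (r1 + r2))" by simp
    thus "\<gamma> = \<alpha> * (r1 * r2)" using r1 by (simp add: algebra_simps) (metis add.commute add_eq_0_iff add.left_commute minus_add_cancel)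
  qed
  define l1 l2 where "l1 = a - const_fract r1 * b" "l2 = a - const_fract r2 * b"
  have l: "l1 \<in> loc" "l2 \<in> loc" unfolding l1_l2_def using ab by (auto intro!: loc_diff loc_mult)
  have prod: "const_fract \<alpha> * (l1 * l2) + const_fract \<delta> \<in> mx"
  proof -
    have "const_fract \<alpha> * a\<^sup>2 + const_fract \<beta> * (a * b) + const_fract \<gamma> * b\<^sup>2 = const_fract \<alpha> * (l1 * l2)"
      unfolding r12 const_fract_mult const_fract_add const_fract_uminus l1_l2_def
      by (simp add: power2_eq_square algebra_simps)
    thus ?thesis using conic by simp
  qed
  show ?thesis
  proof (cases "r1 = r2")
    case False
    have "l1 \<notin> mx"
    proof
      assume "l1 \<in> mx"
      hence "const_fract \<alpha> * (l1 * l2) \<in> mx" using l by (intro mx_mult_left mx_mult_right) auto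
      hence "const_fract \<delta> \<in> mx" using mx_diff[OF prod] by force
      thus False using nz(2) const_mx_iff by blast
    qed
    have inv: "inverse l1 \<in> rational_in l1" using ri_inverse[OF l(1) ri_self[OF l(1)]] \<open>l1 \<notin> mx\<close> by blast
    have "l1 \<noteq> 0" using \<open>l1 \<notin> mx\<close> by auto
    have "inverse l1 * const_fract (inverse \<alpha>) * (const_fract \<alpha> * (l1 * l2) + const_fract \<delta>) \<in> mx"
      using prod loc_inverse[OF l(1) \<open>l1 \<notin> mx\<close>] by (intro mx_mult_left loc_mult) auto
    also have "inverse l1 * const_fract (inverse \<alpha>) * (const_fract \<alpha> * (l1 * l2) + const_fract \<delta>)
        = l2 - (- (inverse l1 * const_fract (inverse \<alpha> * \<delta>)))"
    proof -
      have "inverse l1 * const_fract (inverse \<alpha>) * (const_fract \<alpha> * (l1 * l2) + const_fract \<delta>)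
          = (const_fract (inverse \<alpha>) * const_fract \<alpha>) * ((inverse l1 * l1) * l2)
            + inverse l1 * (const_fract (inverse \<alpha>) * const_fract \<delta>)"
        by (simp only: ring_distribs ac_simps)
      thus ?thesis using \<open>l1 \<noteq> 0\<close> const_fract_left_inverse[OF nz(1)] by (simp add: const_fract_mult)
    qed
    finally have "l2 \<approx> - (inverse l1 * const_fract (inverse \<alpha> * \<delta>))" by (simp add: cong_mx_def)
    hence l2: "l2 \<in> rational_in l1"
      by (rule ri_cong[OF l(1), rotated]) (intro ri_uminus ri_mult ri_const inv l)
    have "b = const_fract (inverse (r2 - r1)) * (l1 - l2)"
    proof -
      have "l1 - l2 = const_fract (r2 - r1) * b"
        unfolding l1_l2_def diff_conv_add_uminus const_fract_add const_fract_uminus by (simp add: algebra_simps)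
      moreover have "const_fract (r2 - r1) \<noteq> 0" using False by simp
      ultimately show ?thesis unfolding const_fract_inverse by simp
    qed
    hence b: "b \<in> rational_in l1" by (simp only:) (intro ri_mult ri_diff ri_const ri_self l l2)
    have "a = l1 + const_fract r1 * b" by (simp add: l1_l2_def)
    hence "a \<in> rational_in l1" by (simp only:) (intro ri_add ri_mult ri_const ri_self l b)
    thus ?thesis using that l(1) b by blast
  next
    case True
    have "degree [:\<delta> / \<alpha>, 0, 1:] = 2" by simp
    then obtain s where "poly [:\<delta> / \<alpha>, 0, 1:] s = 0" using alg_closed_imp_poly_has_root[of "[:\<delta> / \<alpha>, 0, 1:]"] by auto
    hence s: "\<delta> = - \<alpha> * (s * s)" using nz(1) by (simp add: field_simps add_eq_0_iff)
    have "const_fract (inverse \<alpha>) * (const_fract \<alpha> * (l1 * l2) + const_fract \<delta>) \<in> mx"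
      using prod by (intro mx_mult_left) auto
    also have "const_fract (inverse \<alpha>) * (const_fract \<alpha> * (l1 * l2) + const_fract \<delta>)
        = (l1 - const_fract s) * (l1 - const_fract (- s))"
    proof -
      have "l2 = l1" using True by (simp add: l1_l2_def)
      have "const_fract (inverse \<alpha>) * (const_fract \<alpha> * (l1 * l2) + const_fract \<delta>)
          = (const_fract (inverse \<alpha>) * const_fract \<alpha>) * (l1 * l1 - const_fract s * const_fract s)"
        unfolding s const_fract_mult const_fract_uminus \<open>l2 = l1\<close> by (simp add: algebra_simps)
      thus ?thesis unfolding const_fract_left_inverse[OF nz(1)] by (simp add: const_fract_uminus algebra_simps)
    qed
    finally have "l1 - const_fract s \<in> mx \<or> l1 - const_fract (- s) \<in> mx"
      by (intro mx_prime) (use l(1) in \<open>auto intro!: loc_diff\<close>)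
    then obtain c where "l1 - const_fract c \<in> mx" by blast
    hence "a \<approx> const_fract c + const_fract r1 * b" by (simp add: cong_mx_def l1_l2_def algebra_simps)
    hence "a \<in> rational_in b"
      by (rule ri_cong[OF ab(2), rotated]) (intro ri_add ri_mult ri_const ri_self ab)
    thus ?thesis using that[OF ab(2)] ri_self[OF ab(2)] by blast
  qed
qed

text \<open>\<open>z\<close> and \<open>w\<close> are the monomials whose exponents are the columns
  of the inverse of \<open>\<phi>\<close>. In these coordinates the terms of \<open>f\<close> have
  the exponents moved by \<open>\<phi>\<close>, up to the common factor
  \<open>mono b\<close>.\<close>

lemma monomial_frame:
  assumes "unimodular \<phi>"
  obtains z w b k l k' l' where "z \<in> units" "w \<in> units"
    "\<And>v. mono v = mono b * (z powi fst (\<phi> v) * w powi snd (\<phi> v))"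
    "xv = z powi k * w powi l" "yv = z powi k' * w powi l'"
proof -
  obtain \<psi> where \<psi>: "unimodular \<psi>" "\<And>v. \<psi> (\<phi> v) = v" using unimodular_inverse[OF assms] by metis
  obtain a b c d e f where ab: "\<psi> = affmap a b c d e f" "\<bar>a * d - b * c\<bar> = 1"
    using \<psi>(1) unfolding unimodular_def by blast
  define D where "D = a * d - b * c"
  have "D = 1 \<or> D = -1" using ab(2) by (auto simp: D_def)
  hence DD: "D * D = 1" by auto
  define z w :: "'a poly poly fract" where "z = mono (a, c)" "w = mono (b, d)"
  have zw: "mono (smul s (a, c) + smul t (b, d)) = z powi s * w powi t" for s t
    by (simp add: z_w_def mono_add mono_smul)
  have 1: "mono v = mono (e, f) * (z powi fst (\<phi> v) * w powi snd (\<phi> v))" for v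
  proof -
    have "v = (e, f) + (smul (fst (\<phi> v)) (a, c) + smul (snd (\<phi> v)) (b, d))"
      using \<psi>(2)[of v] by (simp add: ab(1) affmap_def smul_def prod_eq_iff algebra_simps)
    hence "(mono v :: 'a poly poly fract) = mono ((e, f) + (smul (fst (\<phi> v)) (a, c) + smul (snd (\<phi> v)) (b, d)))" by simp
    thus ?thesis unfolding mono_add[of "(e, f)"] zw .
  qed
  have "(1, 0) = smul (D * d) (a, c) + smul (- (D * c)) (b, d)"
    using DD by (simp add: smul_def prod_eq_iff D_def algebra_simps)
  hence 2: "xv = z powi (D * d) * w powi (- (D * c))" using zw by (simp add: mono_def[of "(1, 0)", simplified, symmetric])
  have "(0, 1) = smul (- (D * b)) (a, c) + smul (D * a) (b, d)"
    using DD by (simp add: smul_def prod_eq_iff D_def algebra_simps)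
  hence 3: "yv = z powi (- (D * b)) * w powi (D * a)" using zw by (simp add: mono_def[of "(0, 1)", simplified, symmetric])
  show ?thesis by (rule that[OF _ _ 1 2 3]) (auto simp: z_w_def mono_units)
qed

text \<open>In the new monomial coordinates a strip of width one gives an equation
  \<open>P0(z) + w * P1(z) = 0\<close>, linear in \<open>w\<close>. The triangle gives a conic with
  at most one term besides the constant and the two squares.\<close>

lemma genus_zero_shape_rational:
  assumes "genus_zero_shape points"
  obtains u where "u \<in> loc" "\<And>r. r \<in> loc \<Longrightarrow> \<exists>p q. represents u p q r"
proof -
  note thesisI = that
  from assms obtain \<phi> where \<phi>: "unimodular \<phi>"
    and shape: "(\<forall>s\<in>points. snd (\<phi> s) \<in> {0, 1}) \<or>
      ({(0,0), (2,0), (0,2)} \<subseteq> \<phi> ` points \<and> \<phi> ` points \<subseteq> {(0,0), (1,0), (2,0), (0,1), (1,1), (0,2)})"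
    unfolding genus_zero_shape_def by blast
  obtain z w b k l k' l' where zw: "z \<in> units" "w \<in> units"
    and mono: "\<And>v. mono v = mono b * (z powi fst (\<phi> v) * w powi snd (\<phi> v))"
    and x: "xv = z powi k * w powi l" and y: "yv = z powi k' * w powi l'"
    using monomial_frame[OF \<phi>] by metis
  have zl: "z \<in> loc" and wl: "w \<in> loc" using zw by (auto intro: units_loc)
  have suffices: thesis if "u \<in> loc" "z \<in> rational_in u" "w \<in> rational_in u" for u
  proof -
    have "xv \<in> rational_in u" unfolding x by (intro ri_mult ri_powi that zw)
    moreover have "yv \<in> rational_in u" unfolding y by (intro ri_mult ri_powi that zw)
    ultimately show thesis
      using generated_closure[OF \<open>u \<in> loc\<close>] thesisI[OF \<open>u \<in> loc\<close>] unfolding rational_in_def by blast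
  qed
  define st where "st i = \<phi> (pt i)" for i
  have tm_zw: "tm i = mono b * (const_fract (T ^ e0 i) * (z powi fst (st i) * w powi snd (st i)))" for i
    unfolding tm_def mono[of "pt i"] st_def by (simp add: ac_simps)
  have "(\<Sum>i<4. const_fract (T ^ e0 i) * (z powi fst (st i) * w powi snd (st i))) = inverse (mono b) * (\<Sum>i<4. tm i)"
    unfolding tm_zw sum_distrib_left[symmetric] using units_nz[OF mono_units[of b]] by simp
  hence rel: "(\<Sum>i<4. const_fract (T ^ e0 i) * (z powi fst (st i) * w powi snd (st i))) \<in> mx"
    using mx_mult_left[OF units_loc[OF units_inverse[OF mono_units[of b]]] sum_term_mx] by simp
  from shape show thesis
  proof
    assume "\<forall>s\<in>points. snd (\<phi> s) \<in> {0, 1}"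
    hence snd01: "snd (st i) = 0 \<or> snd (st i) = 1" if "i < 4" for i using that by (auto simp: points_def st_def)
    \<comment> \<open>A shift that makes all exponents of \<open>z\<close> nonnegative.\<close>
    define K where "K = (\<Sum>i<4. \<bar>fst (st i)\<bar>)"
    have K: "fst (st i) + K \<ge> 0" if "i < 4" for i
    proof -
      have "\<bar>fst (st i)\<bar> \<le> K" unfolding K_def using that by (intro member_le_sum) auto
      thus ?thesis by linarith
    qed
    define n where "n i = nat (fst (st i) + K)" for i
    define I where "I t = {i. i < 4 \<and> snd (st i) = t}" for t
    define P where "P t = (\<Sum>i\<in>I t. monom (T ^ e0 i) (n i))" for t
    have evP: "ev z (P t) = (\<Sum>i\<in>I t. const_fract (T ^ e0 i) * z ^ n i)" for t
    proof -
      have "ev z (\<Sum>i\<in>J. monom (T ^ e0 i) (n i)) = (\<Sum>i\<in>J. const_fract (T ^ e0 i) * z ^ n i)" for J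
        by (induction J rule: infinite_finite_induct) auto
      thus ?thesis by (simp add: P_def)
    qed
    have "z powi K * (\<Sum>i<4. const_fract (T ^ e0 i) * (z powi fst (st i) * w powi snd (st i)))
        = (\<Sum>i<4. const_fract (T ^ e0 i) * z ^ n i * w powi snd (st i))"
      unfolding sum_distrib_left
    proof (rule sum.cong[OF refl])
      fix i :: nat assume i: "i \<in> {..<4}"
      have "z powi K * z powi fst (st i) = z powi (fst (st i) + K)"
        using units_nz[OF zw(1)] by (simp add: power_int_add mult.commute)
      also have "\<dots> = z ^ n i" using K[of i] i by (simp add: n_def power_int_def)
      finally have "z powi K * z powi fst (st i) = z ^ n i" .
      moreover have "z powi K * (const_fract (T ^ e0 i) * (z powi fst (st i) * w powi snd (st i)))
          = const_fract (T ^ e0 i) * (z powi K * z powi fst (st i)) * w powi snd (st i)" by (simp only: ac_simps)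
      ultimately show "z powi K * (const_fract (T ^ e0 i) * (z powi fst (st i) * w powi snd (st i))) = const_fract (T ^ e0 i) * z ^ n i * w powi snd (st i)"
        by simp
    qed
    also have "\<dots> = (\<Sum>i\<in>I 0 \<union> I 1. const_fract (T ^ e0 i) * z ^ n i * w powi snd (st i))"
      using snd01 by (intro sum.cong) (auto simp: I_def)
    also have "\<dots> = ev z (P 0) + w * ev z (P 1)"
      unfolding evP sum_distrib_left
      by (subst sum.union_disjoint) (auto simp: I_def intro!: sum.cong arg_cong2[where f = "(+)"])
    finally have rel': "ev z (P 0) + w * ev z (P 1) \<in> mx"
      using mx_mult_left[OF units_loc[OF units_powi[OF zw(1)]] rel, of K] by simp
    \<comment> \<open>Some exponent has height one because the points are not collinear, and
      coefficients of equal monomials do not cancel.\<close>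
    have "P 1 \<noteq> 0"
    proof -
      have "\<exists>i<4. snd (st i) = 1"
      proof (rule ccontr)
        assume "\<not> ?thesis"
        hence 0: "snd (st i) = 0" if "i < 4" for i using snd01 that by blast
        obtain a b' c d e f' where ab: "\<phi> = affmap a b' c d e f'" "\<bar>a * d - b' * c\<bar> = 1"
          using \<phi> unfolding unimodular_def by blast
        have "lin c d (pt i) = - f'" if "i < 4" for i
          using 0[OF that] by (simp add: st_def ab(1) affmap_def lin_def)
        from not_collinear[OF this] show False using ab(2) by simp
      qed
      then obtain i where i: "i < 4" "snd (st i) = 1" by blast
      have "coeff (P 1) (n i) = (\<Sum>j\<in>I 1. if n j = n i then T ^ e0 j else 0)"
        unfolding P_def coeff_sum by (intro sum.cong) (auto simp: coeff_monom)
      also have "\<dots> = (\<Sum>j\<in>{j\<in>I 1. n j = n i}. T ^ e0 j)"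
        by (rule sum.inter_filter[symmetric]) (auto simp: I_def)
      also have "\<dots> \<noteq> 0" using i by (intro T_powers_nonzero) (auto simp: I_def)
      finally show ?thesis by auto
    qed
    show thesis
    \<comment> \<open>If the coefficient of \<open>w\<close> vanishes on the curve, then
      \<open>z\<close> is algebraic over the constants and hence constant, and \<open>w\<close>
      generates the field.\<close>
    proof (cases "ev z (P 1) \<in> mx")
      case False
      have "w * ev z (P 1) \<approx> ev z (- P 0)" using rel' by (simp add: cong_mx_def add.commute)
      hence "represents z (- P 0) (P 1) w" using wl False by (simp add: represents_def)
      hence "w \<in> rational_in z" unfolding rational_in_def by blast
      thus thesis by (rule suffices[OF zl ri_self[OF zl]])
    next
      case True
      then obtain c where "z - const_fract c \<in> mx" using transcendental[OF zl] \<open>P 1 \<noteq> 0\<close> by blast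
      hence "z \<in> rational_in w" by (intro ri_cong[OF wl ri_const[OF wl]]) (simp add: cong_mx_def)
      thus thesis by (rule suffices[OF wl _ ri_self[OF wl]])
    qed
  next
    assume corners: "{(0,0), (2,0), (0,2)} \<subseteq> \<phi> ` points \<and> \<phi> ` points \<subseteq> {(0,0), (1,0), (2,0), (0,1), (1,1), (0,2)}"
    have im: "\<phi> ` points = st ` {..<4}" by (simp add: points_def st_def image_image)
    have "(0, 0) \<in> st ` {..<4}" "(2, 0) \<in> st ` {..<4}" "(0, 2) \<in> st ` {..<4}" using corners unfolding im by simp_all
    then obtain i1 i2 i3 where i: "i1 < 4" "st i1 = (0, 0)" "i2 < 4" "st i2 = (2, 0)" "i3 < 4" "st i3 = (0, 2)"
      by (auto simp: image_iff)
    have ne: "i1 \<noteq> i2" "i1 \<noteq> i3" "i2 \<noteq> i3" using i by auto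
    have "card ({..<4} - {i1, i2, i3}) = 1" using i ne by (subst card_Diff_subset) auto
    then obtain i4 where i4: "{..<4} - {i1, i2, i3} = {i4}" by (rule card_1_singletonE)
    hence split: "{..<4} = {i1, i2, i3, i4}" "i4 \<notin> {i1, i2, i3}" using i by auto
    define c where "c j = T ^ e0 j" for j
    have cnz: "c j \<noteq> 0" for j using T_nonzero by (simp add: c_def)
    \<comment> \<open>The fourth point may coincide with a corner of the triangle; its coefficient
      is then added to that of the corner.\<close>
    have csum: "c j + c i4 \<noteq> 0" if "j \<in> {i1, i2, i3}" for j
      using T_powers_nonzero[of "{j, i4}" e0] that split(2) by (auto simp: c_def)
    have rel': "const_fract (c i1) + const_fract (c i2) * z\<^sup>2 + const_fract (c i3) * w\<^sup>2
        + const_fract (c i4) * (z powi fst (st i4) * w powi snd (st i4)) \<in> mx"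
      using rel unfolding split(1) using split(2) ne i by (simp add: c_def add.assoc)
    have z0: "z \<noteq> 0" "w \<noteq> 0" using zw by (auto dest: units_nz)
    have conic: thesis
      if "a \<in> units" "b \<in> units" "\<alpha> \<noteq> 0" "\<delta> \<noteq> 0"
        "const_fract \<alpha> * a\<^sup>2 + const_fract \<beta> * (a * b) + const_fract \<gamma> * b\<^sup>2 + const_fract \<delta> \<in> mx"
        "\<And>u. u \<in> loc \<Longrightarrow> a \<in> rational_in u \<Longrightarrow> b \<in> rational_in u \<Longrightarrow> z \<in> rational_in u \<and> w \<in> rational_in u"
      for a b \<alpha> \<beta> \<gamma> \<delta>
      using conic_rational[OF units_loc[OF that(1)] units_loc[OF that(2)] that(3-5)] suffices that(6) by blast
    have "st i4 \<in> {(0,0), (1,0), (2,0), (0,1), (1,1), (0,2)}" using corners split(1) unfolding im by blast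
    then consider "st i4 = (0, 0)" | "st i4 = (1, 0)" | "st i4 = (2, 0)" | "st i4 = (0, 1)" | "st i4 = (1, 1)" | "st i4 = (0, 2)"
      by blast
    thus thesis
    proof cases
      case 1
      show thesis by (rule conic[OF zw, of "c i2" "c i1 + c i4" 0 "c i3"])
        (use rel' 1 cnz csum in \<open>simp_all add: const_fract_add ac_simps\<close>)
    next
      case 3
      show thesis by (rule conic[OF zw, of "c i2 + c i4" "c i1" 0 "c i3"])
        (use rel' 3 cnz csum in \<open>simp_all add: const_fract_add ring_distribs ac_simps\<close>)
    next
      case 6
      show thesis by (rule conic[OF zw, of "c i2" "c i1" 0 "c i3 + c i4"])
        (use rel' 6 cnz csum in \<open>simp_all add: const_fract_add ring_distribs ac_simps\<close>)
    next
      case 5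
      show thesis by (rule conic[OF zw, of "c i2" "c i1" "c i4" "c i3"])
        (use rel' 5 cnz in \<open>simp_all add: ac_simps\<close>)
    next
      \<comment> \<open>Division by the square of \<open>w\<close> turns the term linear in
        \<open>z\<close> into the mixed term in \<open>z / w\<close> and \<open>1 / w\<close>, and
        the constant into a square, so that the conic has the required form. The case of a term
        linear in \<open>w\<close> is symmetric.\<close>
      case 2
      have "inverse (w\<^sup>2) * (const_fract (c i1) + const_fract (c i2) * z\<^sup>2 + const_fract (c i3) * w\<^sup>2
        + const_fract (c i4) * (z powi fst (st i4) * w powi snd (st i4))) \<in> mx"
        by (intro mx_mult_left rel' units_loc units_inverse units_power zw)
      also have "inverse (w\<^sup>2) * (const_fract (c i1) + const_fract (c i2) * z\<^sup>2 + const_fract (c i3) * w\<^sup>2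
        + const_fract (c i4) * (z powi fst (st i4) * w powi snd (st i4)))
        = const_fract (c i2) * (z / w)\<^sup>2 + const_fract (c i4) * ((z / w) * (1 / w)) + const_fract (c i1) * (1 / w)\<^sup>2 + const_fract (c i3)"
        using z0 2 by (simp add: field_simps power2_eq_square)
      finally have rel'': "\<dots> \<in> mx" .
      show thesis
      proof (rule conic[OF _ _ cnz cnz rel''])
        show uw: "z / w \<in> units" "1 / w \<in> units" using zw units_divide units_inverse[OF zw(2)] by (simp_all add: field_class.field_divide_inverse[of 1])
        fix u assume u: "u \<in> loc" "z / w \<in> rational_in u" "1 / w \<in> rational_in u"
        have "w = inverse (1 / w)" "z = (z / w) * inverse (1 / w)" using z0 by auto
        thus "z \<in> rational_in u \<and> w \<in> rational_in u"
          using ri_inverse[OF u(1,3)] ri_mult[OF u(1,2)] uw(2) unfolding units_def by (metis DiffD2)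
      qed
    next
      case 4
      have "inverse (z\<^sup>2) * (const_fract (c i1) + const_fract (c i2) * z\<^sup>2 + const_fract (c i3) * w\<^sup>2
        + const_fract (c i4) * (z powi fst (st i4) * w powi snd (st i4))) \<in> mx"
        by (intro mx_mult_left rel' units_loc units_inverse units_power zw)
      also have "inverse (z\<^sup>2) * (const_fract (c i1) + const_fract (c i2) * z\<^sup>2 + const_fract (c i3) * w\<^sup>2
        + const_fract (c i4) * (z powi fst (st i4) * w powi snd (st i4)))
        = const_fract (c i3) * (w / z)\<^sup>2 + const_fract (c i4) * ((w / z) * (1 / z)) + const_fract (c i1) * (1 / z)\<^sup>2 + const_fract (c i2)"
        using z0 4 by (simp add: field_simps power2_eq_square)
      finally have rel'': "\<dots> \<in> mx" .
      show thesis
      proof (rule conic[OF _ _ cnz cnz rel''])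
        show uz: "w / z \<in> units" "1 / z \<in> units" using zw units_divide units_inverse[OF zw(1)] by (simp_all add: field_class.field_divide_inverse[of 1])
        fix u assume u: "u \<in> loc" "w / z \<in> rational_in u" "1 / z \<in> rational_in u"
        have "z = inverse (1 / z)" "w = (w / z) * inverse (1 / z)" using z0 by auto
        thus "z \<in> rational_in u \<and> w \<in> rational_in u"
          using ri_inverse[OF u(1,3)] ri_mult[OF u(1,2)] uz(2) unfolding units_def by (metis DiffD2)
      qed
    qed
  qed
qed

theorem genus_one_not_zero_shape:
  assumes genus: "function_field_has_genus KK FF 1"
  shows "\<not> genus_zero_shape points"
proof
  assume "genus_zero_shape points"
  from genus_zero_shape_rational[OF this] obtain u where
    u: "u \<in> loc" "\<And>r. r \<in> loc \<Longrightarrow> \<exists>p q. represents u p q r" by blast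
  from genus_one_nonzero_differential[OF genus] obtain d h where dh: "cder d" "h \<in> loc" "h \<notin> mx"
    "\<And>A. val_ring A \<Longrightarrow> \<exists>(n::nat) a b. (\<forall>i<n. a i \<in> A \<and> b i \<in> A) \<and> h \<approx> (\<Sum>i<n. a i * d (b i))" by blast
  show False using rational_no_differential[OF u dh(1,2,4)] dh(3) by blast
qed

end

section \<open>Monomial changes of coordinates\<close>

lemma comm_ring_homI:
  assumes "\<And>x y. h (x + y) = h x + h y" "\<And>x y. h (x * y) = h x * h y" "h 1 = 1" "h 0 = 0"
  shows "comm_ring_hom h"
  using assms by unfold_locales auto

lemma comm_ring_hom_eval:
  fixes h :: "'a::comm_ring_1 \<Rightarrow> 'b::comm_ring_1"
  assumes "comm_ring_hom h"
  shows "comm_ring_hom (\<lambda>p. poly (map_poly h p) y)"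
proof -
  interpret comm_ring_hom h by fact
  have pC: "poly (map_poly h (pCons c p)) y = h c + y * poly (map_poly h p) y" for c p
    by (cases "c = 0 \<and> p = 0") (auto simp: map_poly_pCons)
  have add: "poly (map_poly h (p + q)) y = poly (map_poly h p) y + poly (map_poly h q) y" for p q
    by (induction p q rule: poly_induct2) (simp_all add: pC hom_add algebra_simps)
  have smult: "poly (map_poly h (smult c p)) y = h c * poly (map_poly h p) y" for c p
    by (induction p) (simp_all add: pC hom_mult algebra_simps)
  have mult: "poly (map_poly h (p * q)) y = poly (map_poly h p) y * poly (map_poly h q) y" for p q
    by (induction p) (simp_all add: pC add smult algebra_simps)
  show ?thesis by (rule comm_ring_homI[OF add mult]) simp_all
qed

definition poly_subst :: "'a::field poly poly fract \<Rightarrow> 'a poly poly fract \<Rightarrow> 'a poly poly \<Rightarrow> 'a poly poly fract" where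
  "poly_subst r s p = poly (map_poly (ev r) p) s"

lemma poly_subst_hom: "comm_ring_hom (poly_subst r s)"
  unfolding poly_subst_def by (rule comm_ring_hom_eval, rule comm_ring_homI) simp_all

lemma poly_subst_bimonom: "poly_subst r s (bimonom c i j) = const_fract c * (r ^ i * s ^ j)"
  by (simp add: poly_subst_def bimonom_def map_poly_monom poly_monom)

definition fract_ext :: "('a::idom \<Rightarrow> 'b::field) \<Rightarrow> 'a fract \<Rightarrow> 'b" where
  "fract_ext h r = (THE s. \<exists>p q. q \<noteq> 0 \<and> r = Fract p q \<and> s = h p / h q)"

context
  fixes h :: "'a::idom \<Rightarrow> 'b::field"
  assumes hom: "comm_ring_hom h" and inj: "\<And>p. h p = 0 \<Longrightarrow> p = 0"
begin

interpretation comm_ring_hom h by (rule hom)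

lemma fract_ext_Fract: "q \<noteq> 0 \<Longrightarrow> fract_ext h (Fract p q) = h p / h q"
  unfolding fract_ext_def
proof (rule the_equality)
  fix s assume q: "q \<noteq> 0" and "\<exists>p' q'. q' \<noteq> 0 \<and> Fract p q = Fract p' q' \<and> s = h p' / h q'"
  then obtain p' q' where *: "q' \<noteq> 0" "p * q' = p' * q" "s = h p' / h q'" by (auto simp: eq_fract)
  from *(2) have "h p * h q' = h p' * h q" by (metis hom_mult)
  moreover have "h q \<noteq> 0" "h q' \<noteq> 0" using q *(1) inj by blast+
  ultimately show "s = h p / h q" by (simp add: *(3) field_simps)
qed blast

lemma fract_ext_hom: "comm_ring_hom (fract_ext h)"
proof (rule comm_ring_homI)
  fix r s :: "'a fract"
  obtain p q where r: "r = Fract p q" "q \<noteq> 0" by (cases r) auto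
  obtain p' q' where s: "s = Fract p' q'" "q' \<noteq> 0" by (cases s) auto
  have nz: "h q \<noteq> 0" "h q' \<noteq> 0" using r(2) s(2) inj by blast+
  show "fract_ext h (r + s) = fract_ext h r + fract_ext h s" "fract_ext h (r * s) = fract_ext h r * fract_ext h s"
    using r s nz by (simp_all add: fract_ext_Fract hom_add hom_mult field_simps)
next
  show "fract_ext h 1 = 1" "fract_ext h 0 = 0"
    by (simp_all add: One_fract_def Zero_fract_def fract_ext_Fract)
qed

lemma fract_ext_to_fract: "fract_ext h (to_fract p) = h p"
  by (simp add: to_fract_def fract_ext_Fract)

end

definition exponents :: "'a::zero poly poly \<Rightarrow> (nat \<times> nat) set" where
  "exponents p = {(i, j). coeff (coeff p j) i \<noteq> 0}"

lemma finite_exponents: "finite (exponents p)"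
proof (rule finite_subset)
  show "exponents p \<subseteq> (\<Union>j\<le>degree p. {..degree (coeff p j)} \<times> {j})"
  proof
    fix v assume "v \<in> exponents p"
    then obtain i j where v: "v = (i, j)" "coeff (coeff p j) i \<noteq> 0" by (auto simp: exponents_def)
    hence "coeff p j \<noteq> 0" by auto
    hence "j \<le> degree p" "i \<le> degree (coeff p j)" using v(2) by (auto intro: le_degree)
    thus "v \<in> (\<Union>j\<le>degree p. {..degree (coeff p j)} \<times> {j})" using v(1) by auto
  qed
qed auto

lemma monomial_expansion:
  "p = (\<Sum>v\<in>exponents p. bimonom (coeff (coeff p (snd v)) (fst v)) (fst v) (snd v))" (is "_ = ?q")
proof (rule poly_eqI, rule poly_eqI)
  fix m n
  have "coeff (coeff ?q m) n = (\<Sum>v\<in>exponents p. if v = (n, m) then coeff (coeff p m) n else 0)"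
    unfolding coeff_sum by (intro sum.cong) (auto simp: bimonom_def coeff_monom split: if_splits)
  also have "\<dots> = coeff (coeff p m) n" by (simp add: sum.delta[OF finite_exponents]) (simp add: exponents_def)
  finally show "coeff (coeff p m) n = coeff (coeff ?q m) n" ..
qed

text \<open>Multiplication by a large power of \<open>x * y\<close> makes all exponents nonnegative,
  after which polynomial coefficients can be compared.\<close>

lemma monomials_independent:
  assumes "finite I" "(\<Sum>v\<in>I. const_fract (c v) * mono v) = 0" "v \<in> I"
  shows "c v = 0"
proof -
  define N where "N = (\<Sum>v\<in>I. \<bar>fst v\<bar> + \<bar>snd v\<bar>)"
  have N: "fst v + N \<ge> 0" "snd v + N \<ge> 0" if "v \<in> I" for v
  proof -
    have "\<bar>fst v\<bar> + \<bar>snd v\<bar> \<le> N" unfolding N_def by (rule member_le_sum) (use that assms(1) in auto)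
    thus "fst v + N \<ge> 0" "snd v + N \<ge> 0" by linarith+
  qed
  define p where "p = (\<Sum>v\<in>I. bimonom (c v) (nat (fst v + N)) (nat (snd v + N)))"
  have "to_fract p = (\<Sum>v\<in>I. mono (N, N) * (const_fract (c v) * mono v))"
    unfolding p_def to_fract_sum
  proof (rule sum.cong[OF refl])
    fix v assume v: "v \<in> I"
    have "to_fract (bimonom (c v) (nat (fst v + N)) (nat (snd v + N))) = const_fract (c v) * mono (v + (N, N))"
      unfolding to_fract_bimonom using N[OF v] by (simp add: plus_prod_def)
    thus "to_fract (bimonom (c v) (nat (fst v + N)) (nat (snd v + N))) = mono (N, N) * (const_fract (c v) * mono v)"
      by (simp add: mono_add ac_simps)
  qed
  also have "\<dots> = 0" unfolding sum_distrib_left[symmetric] assms(2) by simp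
  finally have "p = 0" by simp
  hence "0 = coeff (coeff p (nat (snd v + N))) (nat (fst v + N))" by simp
  also have "\<dots> = (\<Sum>u\<in>I. if u = v then c v else 0)"
    unfolding p_def coeff_sum
  proof (rule sum.cong[OF refl])
    fix u assume u: "u \<in> I"
    have "nat (snd u + N) = nat (snd v + N) \<and> nat (fst u + N) = nat (fst v + N) \<longleftrightarrow> u = v"
      using N[OF u] N[OF assms(3)] by (auto simp: prod_eq_iff)
    thus "coeff (coeff (bimonom (c u) (nat (fst u + N)) (nat (snd u + N))) (nat (snd v + N))) (nat (fst v + N)) =
         (if u = v then c v else 0)"
      by (auto simp: bimonom_def coeff_monom)
  qed
  also have "\<dots> = c v" using assms by simp
  finally show ?thesis ..
qed

lemma fract_hom_identity:
  assumes hom: "comm_ring_hom s" and "\<And>c. s (const_fract c) = const_fract c" "s xv = xv" "s yv = yv"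
  shows "s r = r"
proof -
  interpret field_hom s
    by (intro field_hom.intro idom_hom.intro hom)
  have 1: "s (to_fract [:p:]) = to_fract [:p:]" for p
  proof (induction p)
    case (pCons c p)
    show ?case unfolding to_fract_const_pCons[of c p] hom_add hom_mult assms pCons.IH ..
  qed simp
  have 2: "s (to_fract p) = to_fract p" for p
  proof (induction p)
    case (pCons c p)
    show ?case unfolding to_fract_pCons[of c p] hom_add hom_mult assms pCons.IH 1 ..
  qed simp
  obtain p q where "r = Fract p q" "q \<noteq> 0" by (cases r) auto
  hence "r = to_fract p / to_fract q" by (simp add: to_fract_def)
  thus ?thesis using 2 by (simp add: field_class.field_divide_inverse hom_mult hom_inverse)
qed

text \<open>Sends \<open>x\<close> to \<open>x^a * y^c\<close> and \<open>y\<close> to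
  \<open>x^b * y^d\<close>, so that exponent vectors are multiplied by the matrix with rows
  \<open>a\<close>, \<open>b\<close> and \<open>c\<close>, \<open>d\<close>.\<close>

definition monomial_subst :: "int \<Rightarrow> int \<Rightarrow> int \<Rightarrow> int \<Rightarrow> 'a::field poly poly fract \<Rightarrow> 'a poly poly fract" where
  "monomial_subst a b c d = fract_ext (poly_subst (mono (a, c)) (mono (b, d)))"

context
  fixes a b c d :: int assumes det: "a * d - b * c \<noteq> 0"
begin

text \<open>By the determinant the exponent map \<open>L\<close> is injective, so distinct monomials
  go to distinct Laurent monomials, which are independent.\<close>

lemma poly_subst_mono_inj:
  fixes p :: "'a::field poly poly"
  assumes "poly_subst (mono (a, c)) (mono (b, d)) p = 0"
  shows "p = 0"
proof -
  interpret comm_ring_hom "poly_subst (mono (a, c)) (mono (b, d)) :: 'a poly poly \<Rightarrow> _" by (rule poly_subst_hom)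
  define L where "L = (\<lambda>v :: nat \<times> nat. (a * int (fst v) + b * int (snd v), c * int (fst v) + d * int (snd v)))"
  have inj: "inj L"
  proof (rule injI)
    fix u v assume "L u = L v"
    hence "a * (int (fst u) - int (fst v)) + b * (int (snd u) - int (snd v)) = 0"
      "c * (int (fst u) - int (fst v)) + d * (int (snd u) - int (snd v)) = 0"
      by (simp_all add: L_def algebra_simps)
    hence "(a * d - b * c) * (int (fst u) - int (fst v)) = 0" "(a * d - b * c) * (int (snd u) - int (snd v)) = 0"
      by Groebner_Basis.algebra+
    thus "u = v" using det by (simp add: prod_eq_iff)
  qed
  define g where "g v = coeff (coeff p (snd v)) (fst v)" for v
  have powers: "mono (a, c) ^ i * mono (b, d) ^ j = mono (L (i, j))" for i j
  proof -
    have "L (i, j) = smul (int i) (a, c) + smul (int j) (b, d)" by (simp add: L_def smul_def)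
    thus ?thesis by (simp add: mono_add mono_smul)
  qed
  have "0 = poly_subst (mono (a, c)) (mono (b, d)) (\<Sum>v\<in>exponents p. bimonom (g v) (fst v) (snd v))"
    using assms unfolding g_def monomial_expansion[of p, symmetric] by simp
  also have "\<dots> = (\<Sum>v\<in>exponents p. const_fract (g v) * mono (L v))"
    by (simp add: hom_sum poly_subst_bimonom powers)
  also have "\<dots> = (\<Sum>v\<in>L ` exponents p. const_fract (g (inv_into UNIV L v)) * mono v)"
    using inj by (subst sum.reindex) (auto simp: inj_on_def)
  finally have zero: "g (inv_into UNIV L v) = 0" if "v \<in> L ` exponents p" for v
    using monomials_independent[of "L ` exponents p" "\<lambda>v. g (inv_into UNIV L v)"] finite_exponents[of p] that by simp
  have "g v = 0" if "v \<in> exponents p" for v using zero[of "L v"] that inv_f_f[OF inj, of v] by simp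
  hence "exponents p = {}" by (force simp: g_def exponents_def)
  thus ?thesis by (subst monomial_expansion) simp
qed

lemma monomial_subst_hom: "comm_ring_hom (monomial_subst a b c d)"
  unfolding monomial_subst_def by (rule fract_ext_hom[OF poly_subst_hom poly_subst_mono_inj])

lemma monomial_subst_to_fract: "monomial_subst a b c d (to_fract p) = poly_subst (mono (a, c)) (mono (b, d)) p"
  unfolding monomial_subst_def by (rule fract_ext_to_fract[OF poly_subst_hom poly_subst_mono_inj])

lemma monomial_subst_const: "monomial_subst a b c d (const_fract r) = const_fract r"
  using poly_subst_bimonom[of _ _ r 0 0] by (simp add: monomial_subst_to_fract bimonom_def monom_0)

lemma monomial_subst_mono:
  fixes v :: "int \<times> int"
  shows "monomial_subst a b c d (mono v) = (mono (a * fst v + b * snd v, c * fst v + d * snd v) :: 'a::field poly poly fract)"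
proof -
  interpret field_hom "monomial_subst a b c d :: 'a poly poly fract \<Rightarrow> _"
    by (intro field_hom.intro idom_hom.intro monomial_subst_hom)
  have 1: "monomial_subst a b c d xv = mono (a, c)"
    using poly_subst_bimonom[of "mono (a, c)" "mono (b, d)" 1 1 0]
    by (simp add: xv_def monomial_subst_to_fract bimonom_def monom_0 monom_Suc flip: one_pCons)
  have 2: "monomial_subst a b c d yv = mono (b, d)"
    using poly_subst_bimonom[of "mono (a, c)" "mono (b, d)" 1 0 1]
    by (simp add: yv_def monomial_subst_to_fract bimonom_def monom_0 monom_Suc flip: one_pCons)
  have pow: "monomial_subst a b c d (r powi n) = monomial_subst a b c d r powi n" for r :: "'a poly poly fract" and n
    by (simp add: power_int_def hom_power hom_inverse)
  have "monomial_subst a b c d (mono v :: 'a poly poly fract) = mono (smul (fst v) (a, c) + smul (snd v) (b, d))"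
    unfolding mono_add mono_smul mono_def[of v] hom_mult pow 1 2 ..
  thus ?thesis by (simp add: smul_def mult.commute)
qed

end

section \<open>Divisibility up to monomials and the Laurent ring\<close>

lemma mono_nonneg:
  assumes "0 \<le> fst v" "0 \<le> snd v"
  shows "mono v = to_fract (bimonom 1 (nat (fst v)) (nat (snd v)))"
  using assms by (simp add: to_fract_bimonom flip: one_pCons)

lemma mono_denominator:
  "mono v * to_fract (bimonom 1 (nat (- fst v)) (nat (- snd v))) = to_fract (bimonom 1 (nat (fst v)) (nat (snd v)))"
proof -
  have "v + (int (nat (- fst v)), int (nat (- snd v))) = (int (nat (fst v)), int (nat (snd v)))"
    by (simp add: prod_eq_iff)
  thus ?thesis by (simp add: to_fract_bimonom mono_add[symmetric] flip: one_pCons)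
qed

text \<open>Monomials are units of the Laurent ring but not of the polynomial ring. For an
  \<open>f\<close> without monomial factors, divisibility by \<open>f\<close> means the same in both
  rings, so the local ring of the curve can be described by Laurent polynomials.\<close>

definition stripped :: "'a::field poly poly \<Rightarrow> bool" where
  "stripped p \<longleftrightarrow> \<not> [:[:0, 1:]:] dvd p \<and> \<not> [:0, 1:] dvd p"

lemma stripped_nonzero: "stripped p \<Longrightarrow> p \<noteq> 0"
  by (auto simp: stripped_def)

lemma prime_elem_variable: "prime_elem [:0, 1 :: 'a::idom:]"
proof (rule prime_elemI)
  have dvd: "[:0, 1:] dvd p \<longleftrightarrow> poly p 0 = 0" for p :: "'a poly"
    using poly_eq_0_iff_dvd[of p 0] by simp
  show "\<not> [:0, 1 :: 'a:] dvd 1" by (simp add: dvd)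
  show "[:0, 1 :: 'a:] dvd p \<or> [:0, 1:] dvd q" if "[:0, 1:] dvd p * q" for p q using that by (simp add: dvd)
qed simp

lemma prime_elem_dvd_cancel:
  fixes x :: "'a::idom"
  assumes "prime_elem x" "\<not> x dvd f" "f dvd x ^ n * p"
  shows "f dvd p"
  using assms(3)
proof (induction n)
  case (Suc n)
  then obtain k where k: "x * (x ^ n * p) = f * k" by (auto simp: mult.assoc)
  hence "x dvd f * k" by (metis dvd_triv_left)
  hence "x dvd k" using assms(1,2) by (simp add: prime_elem_dvd_mult_iff)
  then obtain l where "k = x * l" by auto
  hence "x * (x ^ n * p) = x * (f * l)" using k by (simp add: ac_simps)
  moreover have "x \<noteq> 0" using assms(1) by auto
  ultimately have "x ^ n * p = f * l" by simp
  thus ?case using Suc.IH by simp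
qed simp

lemma to_fract_power: "to_fract (p ^ n) = to_fract p ^ n"
  by (induction n) simp_all

lemma bimonom_one: "bimonom 1 i j = [:[:0, 1 :: 'a::field:]:] ^ i * [:0, 1:] ^ j"
proof -
  have "to_fract (bimonom 1 i j) = xv ^ i * (yv ^ j :: 'a poly poly fract)"
    unfolding to_fract_bimonom by (simp add: mono_def flip: one_pCons)
  also have "\<dots> = to_fract ([:[:0, 1:]:] ^ i * [:0, 1:] ^ j)"
    by (simp add: xv_def yv_def to_fract_power)
  finally show ?thesis unfolding to_fract_eq_iff .
qed

lemma stripped_dvd_cancel:
  assumes "stripped f" "f dvd p * bimonom 1 i j"
  shows "f dvd p"
proof -
  have "f dvd [:[:0, 1:]:] ^ i * ([:0, 1:] ^ j * p)" using assms(2) by (simp add: bimonom_one ac_simps)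
  hence "f dvd [:0, 1:] ^ j * p"
    by (rule prime_elem_dvd_cancel[rotated 2])
      (use assms(1) in \<open>auto simp: stripped_def intro: lift_prime_elem_poly prime_elem_variable\<close>)
  thus ?thesis
    by (rule prime_elem_dvd_cancel[rotated 2]) (use assms(1) in \<open>auto simp: stripped_def intro: prime_elem_variable\<close>)
qed

text \<open>With negative exponents moved to the other side, this is an equation of polynomials up
  to a monomial, which shares no factor with \<open>f\<close>.\<close>

lemma stripped_dvd:
  assumes "stripped f" "to_fract f * to_fract h * mono u = to_fract q * mono v"
  shows "f dvd q"
proof -
  have "to_fract f * to_fract h * mono (u - v) = to_fract q"
    using assms(2) by (simp add: mono_diff mono_nonzero field_simps)
  hence "to_fract q * to_fract (bimonom 1 (nat (- fst (u - v))) (nat (- snd (u - v))))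
      = to_fract f * to_fract h * to_fract (bimonom 1 (nat (fst (u - v))) (nat (snd (u - v))))"
    by (metis mono_denominator mult.assoc)
  hence "q * bimonom 1 (nat (- fst (u - v))) (nat (- snd (u - v))) = f * h * bimonom 1 (nat (fst (u - v))) (nat (snd (u - v)))"
    unfolding to_fract_mult[symmetric] by (simp only: to_fract_eq_iff)
  hence "f dvd q * bimonom 1 (nat (- fst (u - v))) (nat (- snd (u - v)))" by (simp add: mult.assoc)
  thus ?thesis by (rule stripped_dvd_cancel[OF assms(1)])
qed

text \<open>Variables are divided out while possible. Dividing by \<open>Y\<close> lowers the degree
  and dividing by \<open>X\<close> lowers the degree of the leading coefficient.\<close>

lemma stripped_exists:
  assumes "p \<noteq> 0"
  shows "\<exists>q u. stripped q \<and> to_fract p = to_fract q * mono u"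
  using assms
proof (induction "degree p + degree (lead_coeff p)" arbitrary: p rule: less_induct)
  case less
  show ?case
  proof (cases "stripped p")
    case True
    thus ?thesis by (intro exI[of _ p] exI[of _ 0]) (simp add: mono_0)
  next
    case False
    have "\<exists>p' v. p' \<noteq> 0 \<and> to_fract p = to_fract p' * mono v \<and>
        degree p' + degree (lead_coeff p') < degree p + degree (lead_coeff p)"
    proof (cases "[:0, 1:] dvd p")
      case True
      then obtain p' where p: "p = [:0, 1:] * p'" by blast
      hence "p' \<noteq> 0" using less.prems by auto
      thus ?thesis using p by (intro exI[of _ p'] exI[of _ "(0, 1)"]) (simp add: mono_def to_fract_pCons[of 0] mult.commute)
    next
      case F: False
      then obtain p' where p: "p = [:[:0, 1:]:] * p'" using False by (auto simp: stripped_def)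
      hence nz: "p' \<noteq> 0" using less.prems by auto
      have p': "p = smult [:0, 1:] p'" using p by simp
      have "degree (lead_coeff p) = Suc (degree (lead_coeff p'))"
        unfolding p' lead_coeff_smult using nz by (simp add: degree_mult_eq)
      moreover have "degree p = degree p'" unfolding p' by simp
      moreover have "to_fract p = to_fract p' * mono (1, 0)"
        unfolding p by (simp add: mono_def xv_def mult.commute flip: to_fract_mult)
      ultimately show ?thesis using nz by (intro exI[of _ p'] exI[of _ "(1, 0)"]) simp
    qed
    then obtain p' v where p': "p' \<noteq> 0" "to_fract p = to_fract p' * mono v"
      "degree p' + degree (lead_coeff p') < degree p + degree (lead_coeff p)" by blast
    from less.hyps[OF p'(3,1)] obtain q u where "stripped q" "to_fract p' = to_fract q * mono u" by blast
    thus ?thesis using p'(2) by (intro exI[of _ q] exI[of _ "u + v"]) (simp add: mono_add mult.assoc)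
  qed
qed

definition laurent_ring :: "'a::field poly poly fract set" where
  "laurent_ring = {to_fract p * mono v | p v. True}"

lemma laurentI: "to_fract p * mono v \<in> laurent_ring"
  unfolding laurent_ring_def by blast

lemma laurent_to_fract: "to_fract p \<in> laurent_ring"
  using laurentI[of p 0] by (simp add: mono_0)

lemma laurent_mono: "mono v \<in> laurent_ring"
  using laurentI[of 1 v] by simp

lemma laurent_mult:
  assumes "r \<in> laurent_ring" "s \<in> laurent_ring"
  shows "r * s \<in> laurent_ring"
proof -
  obtain p u q v where "r = to_fract p * mono u" "s = to_fract q * mono v"
    using assms unfolding laurent_ring_def by blast
  hence "r * s = to_fract (p * q) * mono (u + v)" by (simp add: mono_add)
  thus ?thesis by (simp only: laurentI)
qed

lemma laurent_add:
  assumes "r \<in> laurent_ring" "s \<in> laurent_ring"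
  shows "r + s \<in> laurent_ring"
proof -
  obtain p u q v where rs: "r = to_fract p * mono u" "s = to_fract q * mono v"
    using assms unfolding laurent_ring_def by blast
  define w where "w = (min (fst u) (fst v), min (snd u) (snd v))"
  obtain m n where mn: "(mono (u - w) :: 'a poly poly fract) = to_fract m" "(mono (v - w) :: 'a poly poly fract) = to_fract n"
    using mono_nonneg[of "u - w"] mono_nonneg[of "v - w"] by (simp add: w_def)
  have "mono u = to_fract m * mono w" "mono v = to_fract n * mono w"
    unfolding mn[symmetric] mono_add[symmetric] by simp_all
  hence "r + s = to_fract (p * m + q * n) * mono w" unfolding rs by (simp add: algebra_simps)
  thus ?thesis by (simp only: laurentI)
qed

definition laurent_dvd :: "'a::field poly poly \<Rightarrow> 'a poly poly fract \<Rightarrow> bool" where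
  "laurent_dvd f r \<longleftrightarrow> (\<exists>h\<in>laurent_ring. r = to_fract f * h)"

lemma laurent_dvd_iff:
  assumes "stripped f"
  shows "laurent_dvd f (to_fract q * mono v) \<longleftrightarrow> f dvd q"
proof
  assume "laurent_dvd f (to_fract q * mono v)"
  then obtain h u where "to_fract q * mono v = to_fract f * (to_fract h * mono u)"
    unfolding laurent_dvd_def laurent_ring_def by blast
  thus "f dvd q" using stripped_dvd[OF assms, of h u q v] by (simp add: mult.assoc)
next
  assume "f dvd q"
  then obtain h where "q = f * h" by blast
  hence "to_fract q * mono v = to_fract f * (to_fract h * mono v)" by (simp add: mult.assoc)
  thus "laurent_dvd f (to_fract q * mono v)" unfolding laurent_dvd_def using laurentI by blast
qed

lemma Fract_eq_divide: "Fract p q = to_fract p / to_fract q"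
  by (simp add: to_fract_def)

text \<open>\<open>Q\<close> and its Laurent version \<open>Q'\<close> restrict the numerators: the
  trivial predicate gives the local ring, divisibility by \<open>f\<close> its maximal ideal. The
  right-hand side mentions only the Laurent ring and divisibility there, which monomial
  automorphisms preserve.\<close>

lemma laurent_fractions:
  assumes f: "stripped f" and Q: "\<And>p v. Q' (to_fract p * mono v) \<longleftrightarrow> Q p" "\<And>p i j. Q p \<Longrightarrow> Q (p * bimonom 1 i j)"
  shows "r \<in> {Fract p q | p q. Q p \<and> \<not> f dvd q} \<longleftrightarrow> 
    (\<exists>s t. s \<in> laurent_ring \<and> t \<in> laurent_ring \<and> Q' s \<and> \<not> laurent_dvd f t \<and> r = s / t)"
proof
  assume "r \<in> {Fract p q | p q. Q p \<and> \<not> f dvd q}"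
  then obtain p q where r: "r = to_fract p / to_fract q" "Q p" "\<not> f dvd q" unfolding Fract_eq_divide by blast
  have "Q' (to_fract p)" using Q(1)[of p 0] r(2) by (simp add: mono_0)
  moreover have "\<not> laurent_dvd f (to_fract q)" using laurent_dvd_iff[OF f, of q 0] r(3) by (simp add: mono_0)
  ultimately show "\<exists>s t. s \<in> laurent_ring \<and> t \<in> laurent_ring \<and> Q' s \<and> \<not> laurent_dvd f t \<and> r = s / t"
    using r(1) laurent_to_fract by blast
next
  assume "\<exists>s t. s \<in> laurent_ring \<and> t \<in> laurent_ring \<and> Q' s \<and> \<not> laurent_dvd f t \<and> r = s / t"
  then obtain s t where st: "s \<in> laurent_ring" "t \<in> laurent_ring" "Q' s" "\<not> laurent_dvd f t" "r = s / t" by blast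
  obtain p u where s: "s = to_fract p * mono u" using st(1) unfolding laurent_ring_def by blast
  obtain q v where t: "t = to_fract q * mono v" using st(2) unfolding laurent_ring_def by blast
  have pq: "Q p" "\<not> f dvd q" using st(3,4) unfolding s t Q(1) laurent_dvd_iff[OF f] by auto
  define w where "w = u - v"
  define m n :: "'a poly poly" where "m = bimonom 1 (nat (fst w)) (nat (snd w))" "n = bimonom 1 (nat (- fst w)) (nat (- snd w))"
  have "n \<noteq> 0" by (simp add: m_n_def bimonom_def)
  have "mono w * to_fract n = to_fract m" unfolding m_n_def by (rule mono_denominator)
  hence w: "mono w = to_fract m / to_fract n" using \<open>n \<noteq> 0\<close> by (simp add: field_simps)
  have "r = to_fract p / to_fract q * mono w" unfolding st(5) s t w_def mono_diff by simp
  also have "\<dots> = Fract (p * m) (q * n)" unfolding w Fract_eq_divide by simp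
  finally have "r = Fract (p * m) (q * n)" .
  moreover have "Q (p * m)" unfolding m_n_def by (rule Q(2)[OF pq(1)])
  moreover have "\<not> f dvd q * n" using stripped_dvd_cancel[OF f] pq(2) unfolding m_n_def by blast
  ultimately show "r \<in> {Fract p q | p q. Q p \<and> \<not> f dvd q}" by blast
qed

lemma local_ring_iff:
  assumes f: "stripped f"
  shows "r \<in> {Fract p q | p q. \<not> f dvd q} \<longleftrightarrow>
    (\<exists>s t. s \<in> laurent_ring \<and> t \<in> laurent_ring \<and> \<not> laurent_dvd f t \<and> r = s / t)"
  using laurent_fractions[OF f, of "\<lambda>_. True" "\<lambda>_. True" r] by simp

lemma maximal_ideal_iff:
  assumes f: "stripped f"
  shows "r \<in> curve_maximal_ideal f \<longleftrightarrow>
    (\<exists>s t. s \<in> laurent_ring \<and> t \<in> laurent_ring \<and> laurent_dvd f s \<and> \<not> laurent_dvd f t \<and> r = s / t)"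
  unfolding curve_maximal_ideal_def
  by (rule laurent_fractions[OF f]) (simp_all add: laurent_dvd_iff[OF f])


section \<open>Transport of curves by monomial automorphisms\<close>

locale monomial_automorphism =
  fixes \<sigma> \<tau> :: "'a::field poly poly fract \<Rightarrow> 'a poly poly fract" and L L' :: "int \<times> int \<Rightarrow> int \<times> int"
  assumes hom: "comm_ring_hom \<sigma>" "comm_ring_hom \<tau>"
    and const: "\<And>c. \<sigma> (const_fract c) = const_fract c" "\<And>c. \<tau> (const_fract c) = const_fract c"
    and mono: "\<And>v. \<sigma> (mono v) = mono (L v)" "\<And>v. \<tau> (mono v) = mono (L' v)"
    and inverse: "\<And>r. \<tau> (\<sigma> r) = r" "\<And>r. \<sigma> (\<tau> r) = r"
begin

lemma swap: "monomial_automorphism \<tau> \<sigma> L' L"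
  by (intro monomial_automorphism.intro) (fact hom const mono inverse)+

interpretation field_hom \<sigma>
  by (intro field_hom.intro idom_hom.intro hom)

lemma laurent_closed:
  assumes "r \<in> laurent_ring"
  shows "\<sigma> r \<in> laurent_ring"
proof -
  have c: "const_fract c \<in> laurent_ring" for c :: 'a by (rule laurent_to_fract)
  have x: "(mono (1, 0) :: 'a poly poly fract) = xv" and y: "(mono (0, 1) :: 'a poly poly fract) = yv"
    by (simp_all add: mono_def)
  have sx: "\<sigma> xv = mono (L (1, 0))" and sy: "\<sigma> yv = mono (L (0, 1))"
    unfolding x[symmetric] y[symmetric] by (rule mono)+
  have 1: "\<sigma> (to_fract [:p:]) \<in> laurent_ring" for p
  proof (induction p)
    case (pCons a p)
    show ?case unfolding to_fract_const_pCons[of a p] hom_add hom_mult const sx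
      by (intro laurent_add laurent_mult c laurent_mono pCons.IH)
  qed (use c[of 0] in simp)
  have 2: "\<sigma> (to_fract p) \<in> laurent_ring" for p
  proof (induction p)
    case (pCons a p)
    show ?case unfolding to_fract_pCons[of a p] hom_add hom_mult sy
      by (intro laurent_add laurent_mult 1 laurent_mono pCons.IH)
  qed (use c[of 0] in simp)
  obtain p v where "r = to_fract p * mono v" using assms unfolding laurent_ring_def by blast
  thus ?thesis by (simp only: hom_mult mono) (intro laurent_mult 2 laurent_mono)
qed

lemma laurent_dvd_transfer:
  assumes "\<sigma> (to_fract f) = to_fract g * mono w" "laurent_dvd f r"
  shows "laurent_dvd g (\<sigma> r)"
proof -
  obtain h where h: "h \<in> laurent_ring" "r = to_fract f * h" using assms(2) unfolding laurent_dvd_def by blast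
  hence "\<sigma> r = to_fract g * (mono w * \<sigma> h)" by (simp add: hom_mult assms(1) mult.assoc)
  moreover have "mono w * \<sigma> h \<in> laurent_ring" by (intro laurent_mult laurent_mono laurent_closed h)
  ultimately show ?thesis unfolding laurent_dvd_def by blast
qed

text \<open>A factorisation of \<open>g\<close> is pulled back by \<open>\<tau>\<close> and, with
  monomials removed from the factors, becomes one of \<open>f\<close>. A factor that is a unit there
  comes back as a constant times a monomial, and it is a unit since \<open>g\<close> has no monomial
  factor.\<close>

lemma irreducible_transfer:
  assumes f: "irreducible f" "stripped f" and g: "stripped g"
    and eq: "\<tau> (to_fract g) = to_fract f * mono w"
  shows "irreducible g"
proof (rule irreducibleI)
  interpret T: field_hom \<tau> by (intro field_hom.intro idom_hom.intro hom)
  show "g \<noteq> 0" by (rule stripped_nonzero[OF g])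
  show "\<not> g dvd 1"
  proof
    assume "g dvd 1"
    then obtain q where q: "g = [:q:]" "q dvd 1" by (auto simp: is_unit_poly_iff)
    then obtain c where "q = [:c:]" by (auto simp: is_unit_poly_iff)
    hence "to_fract f * to_fract 1 * mono w = const_fract c * mono 0"
      using eq const(2) q(1) by (simp add: mono_0)
    hence "f dvd [:[:c:]:]" by (rule stripped_dvd[OF f(2)])
    moreover have "[:[:c:]:] dvd 1" using \<open>g dvd 1\<close> q(1) \<open>q = [:c:]\<close> by simp
    ultimately have "f dvd 1" by (rule dvd_trans)
    thus False using f(1) by (simp add: irreducible_def)
  qed
  have unit: "a dvd 1" if "a dvd g" "\<tau> (to_fract a) = to_fract a' * mono u" "a' dvd 1" for a a' u
  proof -
    obtain q where q: "a' = [:q:]" "q dvd 1" using \<open>a' dvd 1\<close> by (auto simp: is_unit_poly_iff)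
    then obtain c where c: "q = [:c:]" "c dvd 1" by (auto simp: is_unit_poly_iff)
    have "to_fract a = \<sigma> (\<tau> (to_fract a))" by (simp add: inverse)
    also have "\<dots> = const_fract c * mono (L u)"
      unfolding that(2) q(1) c(1) hom_mult const mono ..
    finally have "to_fract a * to_fract 1 * mono 0 = const_fract c * mono (L u)" by (simp add: mono_0)
    moreover have "stripped a" using g \<open>a dvd g\<close> dvd_trans unfolding stripped_def by blast
    ultimately have "a dvd [:[:c:]:]" by (intro stripped_dvd)
    moreover have "[:[:c:]:] dvd 1" using c(2) by (simp add: is_unit_poly_iff)
    ultimately show "a dvd 1" by (rule dvd_trans)
  qed
  fix a b assume ab: "g = a * b"
  hence nz: "a \<noteq> 0" "b \<noteq> 0" using stripped_nonzero[OF g] by auto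
  interpret S: monomial_automorphism \<tau> \<sigma> L' L by (rule swap)
  have strip: "\<exists>p' u. stripped p' \<and> \<tau> (to_fract p) = to_fract p' * mono u" if "p \<noteq> 0" for p
  proof -
    obtain q v where q: "\<tau> (to_fract p) = to_fract q * mono v"
      using S.laurent_closed[OF laurent_to_fract, of p] unfolding laurent_ring_def by blast
    have "\<tau> (to_fract p) \<noteq> 0" using that inverse(2)[of "to_fract p"] by force
    hence "q \<noteq> 0" using q by auto
    then obtain p' u where "stripped p'" "to_fract q = to_fract p' * mono u" using stripped_exists by blast
    thus ?thesis using q by (intro exI[of _ p'] exI[of _ "u + v"]) (simp add: mono_add mult.assoc)
  qed
  obtain a' u where a': "stripped a'" "\<tau> (to_fract a) = to_fract a' * mono u" using strip[OF nz(1)] by blast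
  obtain b' v where b': "stripped b'" "\<tau> (to_fract b) = to_fract b' * mono v" using strip[OF nz(2)] by blast
  have prod: "to_fract f * mono w = to_fract a' * to_fract b' * mono (u + v)"
    unfolding eq[symmetric] ab to_fract_mult T.hom_mult a'(2) b'(2) mono_add by (simp add: ac_simps)
  have "f dvd a' * b'" using stripped_dvd[OF f(2), of 1 w "a' * b'" "u + v"] prod by simp
  moreover have "stripped (a' * b')"
    using a'(1) b'(1) prime_elem_variable[where 'a = 'a] prime_elem_variable[where 'a = "'a poly"]
    by (simp add: stripped_def prime_elem_dvd_mult_iff lift_prime_elem_poly)
  hence "a' * b' dvd f" by (rule stripped_dvd[of _ 1 "u + v" f w]) (simp add: prod)
  then obtain k where "f = a' * b' * k" by blast
  hence k: "f = a' * (b' * k)" by (simp add: mult.assoc)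
  hence "a' dvd 1 \<or> b' * k dvd 1" using irreducibleD[OF f(1)] by blast
  hence "a' dvd 1 \<or> b' dvd 1" by (meson dvd_mult_left)
  thus "a dvd 1 \<or> b dvd 1" using unit[OF _ a'(2)] unit[OF _ b'(2)] ab by auto
qed

lemma local_ring_transfer:
  assumes st: "stripped f" "stripped g"
    and eq: "\<sigma> (to_fract f) = to_fract g * mono w" "\<tau> (to_fract g) = to_fract f * mono w'"
  shows "r \<in> {Fract p q | p q. \<not> f dvd q} \<Longrightarrow> \<sigma> r \<in> {Fract p q | p q. \<not> g dvd q}" (is "?P \<Longrightarrow> ?P'")
    and "r \<in> curve_maximal_ideal f \<Longrightarrow> \<sigma> r \<in> curve_maximal_ideal g" (is "?Q \<Longrightarrow> ?Q'")
proof -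
  interpret S: monomial_automorphism \<tau> \<sigma> L' L by (rule swap)
  have dvd: "laurent_dvd g (\<sigma> s) \<longleftrightarrow> laurent_dvd f s" for s
    using laurent_dvd_transfer[OF eq(1)] S.laurent_dvd_transfer[OF eq(2), of "\<sigma> s"] inverse(1)[of s] by metis
  have divide: "\<sigma> (s / t) = \<sigma> s / \<sigma> t" for s t
    by (simp add: field_class.field_divide_inverse hom_mult hom_inverse)
  show ?P' if P: ?P
  proof -
    obtain s t where s: "s \<in> laurent_ring" "t \<in> laurent_ring" "\<not> laurent_dvd f t" "r = s / t"
      using P unfolding local_ring_iff[OF st(1)] by blast
    thus ?thesis unfolding local_ring_iff[OF st(2)]
      by (intro exI[of _ "\<sigma> s"] exI[of _ "\<sigma> t"]) (simp add: laurent_closed dvd divide)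
  qed
  show ?Q' if Q: ?Q
  proof -
    obtain s t where s: "s \<in> laurent_ring" "t \<in> laurent_ring" "laurent_dvd f s" "\<not> laurent_dvd f t" "r = s / t"
      using Q unfolding maximal_ideal_iff[OF st(1)] by blast
    thus ?thesis unfolding maximal_ideal_iff[OF st(2)]
      by (intro exI[of _ "\<sigma> s"] exI[of _ "\<sigma> t"]) (simp add: laurent_closed dvd divide)
  qed
qed

text \<open>Elements of the function field are cosets, that is sets of fractions, so the isomorphism
  is the image map of \<open>\<sigma>\<close>. The operations of the quotient ring are first written
  as explicit unions, on which images can be computed.\<close>

lemma birational_transfer:
  assumes irr: "irreducible f" "irreducible g" and st: "stripped f" "stripped g"
    and eq: "\<sigma> (to_fract f) = to_fract g * mono w" "\<tau> (to_fract g) = to_fract f * mono w'"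
  shows "birational f g"
proof -
  interpret S: monomial_automorphism \<tau> \<sigma> L' L by (rule swap)
  define M N Of Og where "M = curve_maximal_ideal f" and "N = curve_maximal_ideal g"
    and "Of = {Fract p q | p q. \<not> f dvd q}" and "Og = {Fract p q | p q. \<not> g dvd q}"
  have image_eq: "\<sigma> ` A = B" if "\<And>r. r \<in> A \<Longrightarrow> \<sigma> r \<in> B" "\<And>r. r \<in> B \<Longrightarrow> \<tau> r \<in> A" for A B
  proof
    show "B \<subseteq> \<sigma> ` A" using that(2) inverse(2) by (metis image_eqI subsetI)
  qed (use that(1) in blast)
  have MN: "\<sigma> ` M = N" unfolding M_def N_def
    by (rule image_eq) (fact local_ring_transfer(2)[OF st eq] S.local_ring_transfer(2)[OF st(2,1) eq(2,1)])+
  have OO: "\<sigma> ` Of = Og" unfolding Of_def Og_def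
    by (rule image_eq) (fact local_ring_transfer(1)[OF st eq] S.local_ring_transfer(1)[OF st(2,1) eq(2,1)])+
  have coset: "I +>\<^bsub>curve_local_ring h\<^esub> r = (\<lambda>s. s + r) ` I" for I r and h :: "'a poly poly"
    by (auto simp: a_r_coset_def r_coset_def curve_local_ring_def ring_of_type_algebra_def)
  have FF: "carrier (function_field h) = (\<lambda>r. (\<lambda>s. s + r) ` curve_maximal_ideal h) ` {Fract p q | p q. \<not> h dvd q}"
    "C \<otimes>\<^bsub>function_field h\<^esub> D = (\<Union>x\<in>C. \<Union>y\<in>D. (\<lambda>s. s + x * y) ` curve_maximal_ideal h)"
    "C \<oplus>\<^bsub>function_field h\<^esub> D = (\<Union>x\<in>C. \<Union>y\<in>D. {x + y})"
    "\<one>\<^bsub>function_field h\<^esub> = (\<lambda>s. s + 1) ` curve_maximal_ideal h" for C D and h :: "'a poly poly"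
    unfolding function_field_def FactRing_def A_RCOSETS_def' rcoset_mult_def set_add_def set_mult_def coset
    by (auto simp: coset curve_local_ring_def ring_of_type_algebra_def)
  have shift: "(`) \<sigma> ((\<lambda>s. s + r) ` M) = (\<lambda>s. s + \<sigma> r) ` N" for r
    by (simp add: image_image hom_add flip: MN)
  have "(`) \<sigma> \<in> ring_iso (function_field f) (function_field g)"
  proof (rule ring_iso_memI)
    fix C D assume "C \<in> carrier (function_field f)" "D \<in> carrier (function_field f)"
    show "\<sigma> ` (C \<otimes>\<^bsub>function_field f\<^esub> D) = \<sigma> ` C \<otimes>\<^bsub>function_field g\<^esub> \<sigma> ` D"
      unfolding FF image_UN M_def[symmetric] N_def[symmetric] shift hom_mult by simp
    show "\<sigma> ` (C \<oplus>\<^bsub>function_field f\<^esub> D) = \<sigma> ` C \<oplus>\<^bsub>function_field g\<^esub> \<sigma> ` D"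
      unfolding FF image_UN by (simp add: hom_add)
  next
    show "\<sigma> ` \<one>\<^bsub>function_field f\<^esub> = \<one>\<^bsub>function_field g\<^esub>"
      unfolding FF M_def[symmetric] N_def[symmetric] shift by simp
    have eqC: "(`) \<sigma> ` carrier (function_field f) = carrier (function_field g)"
    proof -
      have "(`) \<sigma> ` carrier (function_field f) = (\<lambda>r. (\<lambda>s. s + \<sigma> r) ` N) ` Of"
        unfolding FF M_def[symmetric] Of_def[symmetric] image_image[of "(`) \<sigma>"] shift ..
      also have "\<dots> = carrier (function_field g)"
        unfolding FF N_def[symmetric] Og_def[symmetric] OO[symmetric] image_image ..
      finally show ?thesis .
    qed
    show "bij_betw ((`) \<sigma>) (carrier (function_field f)) (carrier (function_field g))"
      unfolding bij_betw_def eqC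
    proof
      have "inj \<sigma>" by (metis injI inverse(1))
      thus "inj_on ((`) \<sigma>) (carrier (function_field f))" by (meson inj_image_eq_iff inj_onI)
    qed simp
    show "\<sigma> ` C \<in> carrier (function_field g)" if "C \<in> carrier (function_field f)" for C
      using that eqC by blast
  qed
  moreover have "\<sigma> ` const_fun f c = const_fun g c" for c
    unfolding const_fun_def coset M_def[symmetric] N_def[symmetric] shift const ..
  ultimately show ?thesis unfolding birational_def using irr by blast
qed

end

section \<open>Newton polygons\<close>

text \<open>The signed areas of the three triangles with apex \<open>q\<close>, divided by the whole
  area, are the barycentric coordinates of \<open>q\<close>.\<close>

lemma convex_hull_triangle:
  fixes a b c q :: "int \<times> int"
  defines "\<rho> \<equiv> \<lambda>v :: int \<times> int. (real_of_int (fst v), real_of_int (snd v))"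
  assumes H: "convex H" "\<rho> a \<in> H" "\<rho> b \<in> H" "\<rho> c \<in> H"
    and det: "det2 (b - a) (c - a) > 0" "det2 (b - q) (c - q) \<ge> 0" "det2 (c - q) (a - q) \<ge> 0" "det2 (a - q) (b - q) \<ge> 0"
  shows "\<rho> q \<in> H"
proof -
  define D u v w where "D = real_of_int (det2 (b - a) (c - a))" and "u = real_of_int (det2 (b - q) (c - q))"
    and "v = real_of_int (det2 (c - q) (a - q))" and "w = real_of_int (det2 (a - q) (b - q))"
  have D: "D > 0" and nn: "u \<ge> 0" "v \<ge> 0" "w \<ge> 0" using det by (simp_all add: D_def u_def v_def w_def)
  have sum: "u + v + w = D"
    unfolding D_def u_def v_def w_def of_int_add[symmetric] of_int_eq_iff det2_def fst_diff snd_diff by Groebner_Basis.algebra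
  have "D * fst (\<rho> q) = u * fst (\<rho> a) + v * fst (\<rho> b) + w * fst (\<rho> c)"
    unfolding D_def u_def v_def w_def \<rho>_def fst_conv of_int_mult[symmetric] of_int_add[symmetric] of_int_eq_iff
      det2_def fst_diff snd_diff by Groebner_Basis.algebra
  moreover have "D * snd (\<rho> q) = u * snd (\<rho> a) + v * snd (\<rho> b) + w * snd (\<rho> c)"
    unfolding D_def u_def v_def w_def \<rho>_def snd_conv of_int_mult[symmetric] of_int_add[symmetric] of_int_eq_iff
      det2_def fst_diff snd_diff by Groebner_Basis.algebra
  ultimately have "\<rho> q = (u / D) *\<^sub>R \<rho> a + (v / D) *\<^sub>R \<rho> b + (w / D) *\<^sub>R \<rho> c"
    using D by (simp add: prod_eq_iff field_simps)
  moreover have "(u / D) *\<^sub>R \<rho> a + (v / D) *\<^sub>R \<rho> b + (w / D) *\<^sub>R \<rho> c \<in> convex hull {\<rho> a, \<rho> b, \<rho> c}"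
    unfolding convex_hull_3 using D nn sum by (intro CollectI exI[of _ "u / D"] exI[of _ "v / D"] exI[of _ "w / D"])
      (auto simp: add_divide_distrib[symmetric])
  moreover have "convex hull {\<rho> a, \<rho> b, \<rho> c} \<subseteq> H" by (rule hull_minimal) (use H in auto)
  ultimately show ?thesis by auto
qed

text \<open>A finite check of orientations that places each listed lattice point in a triangle of
  corners.\<close>

lemma genus_one_polygons_triangles:
  assumes "(P, Q) \<in> genus_one_polygons" "q \<in> Q"
  shows "\<exists>a\<in>P. \<exists>b\<in>P. \<exists>c\<in>P. det2 (b - a) (c - a) > 0 \<and> det2 (b - q) (c - q) \<ge> 0 \<and>
    det2 (c - q) (a - q) \<ge> 0 \<and> det2 (a - q) (b - q) \<ge> 0"
  using assms unfolding genus_one_polygons_def by (elim insertE emptyE Pair_inject; simp add: det2_def; elim disjE; simp)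

lemma genus_one_polygons_corners:
  assumes "(P, Q) \<in> genus_one_polygons"
  shows "(\<lambda>v. (real_of_int (fst v), real_of_int (snd v))) ` P \<in> set polygon_corners"
  using assms unfolding genus_one_polygons_def by (elim insertE emptyE Pair_inject) (simp_all add: polygon_corners_def)

text \<open>Touching both axes excludes monomial factors of the new polynomial, and lying in the
  first quadrant makes its exponents natural numbers.\<close>

lemma genus_one_polygons_axes:
  assumes "(P, Q) \<in> genus_one_polygons"
  shows "\<exists>p\<in>P. fst p = 0" "\<exists>p\<in>P. snd p = 0" "\<And>q. q \<in> Q \<Longrightarrow> 0 \<le> fst q \<and> 0 \<le> snd q"
  using assms unfolding genus_one_polygons_def by (auto elim!: insertE Pair_inject)

lemma genus_one_polygons_hull:
  fixes P Q S :: "(int \<times> int) set"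
  defines "\<rho> \<equiv> \<lambda>v :: int \<times> int. (real_of_int (fst v), real_of_int (snd v))"
  assumes PQ: "(P, Q) \<in> genus_one_polygons" and S: "P \<subseteq> S" "S \<subseteq> Q"
  shows "convex hull (\<rho> ` S) = convex hull (\<rho> ` P)"
proof
  show "convex hull (\<rho> ` P) \<subseteq> convex hull (\<rho> ` S)" by (intro hull_mono image_mono S)
  have "\<rho> q \<in> convex hull (\<rho> ` P)" if q: "q \<in> S" for q
  proof -
    obtain a b c where abc: "a \<in> P" "b \<in> P" "c \<in> P" and d: "det2 (b - a) (c - a) > 0" "det2 (b - q) (c - q) \<ge> 0"
      "det2 (c - q) (a - q) \<ge> 0" "det2 (a - q) (b - q) \<ge> 0"
      using genus_one_polygons_triangles[OF PQ, of q] q S(2) by blast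
    show ?thesis unfolding \<rho>_def
      by (rule convex_hull_triangle[OF _ _ _ _ d]) (use abc in \<open>auto intro!: hull_inc\<close>)
  qed
  thus "convex hull (\<rho> ` S) \<subseteq> convex hull (\<rho> ` P)" by (intro hull_minimal) auto
qed

section \<open>Polynomials with four terms\<close>

instance fract :: ("{idom, ring_char_0}") field_char_0
proof
  show "inj (of_nat :: nat \<Rightarrow> 'a fract)"
    by (rule injI) (simp add: of_nat_fract eq_fract)
qed

text \<open>The coefficient is a sum of powers of \<open>t\<close>, a polynomial whose value at 1
  counts the terms and is nonzero in characteristic 0. So the Newton polygon is the hull of all
  exponent points.\<close>

lemma coeff_four_term_nonzero:
  "coeff (coeff (four_term_poly a :: 'k::field_char_0 poly fract poly poly) j) i \<noteq> 0 \<longleftrightarrow> (\<exists>l<4. a l 1 = i \<and> a l 2 = j)"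
proof -
  define I where "I = {l. l < 4 \<and> a l 1 = i \<and> a l 2 = j}"
  define q :: "'k poly" where "q = (\<Sum>l\<in>I. monom 1 (a l 0))"
  have "coeff (coeff (four_term_poly a :: 'k poly fract poly poly) j) i
      = (\<Sum>l<4. if a l 1 = i \<and> a l 2 = j then to_fract [:0, 1:] ^ a l 0 else 0)"
    unfolding four_term_poly_def coeff_sum by (intro sum.cong) (auto simp: bimonom_def coeff_monom)
  also have "\<dots> = (\<Sum>l\<in>I. to_fract [:0, 1:] ^ a l 0)"
    unfolding I_def by (subst sum.inter_filter[symmetric]) (auto intro: sum.cong)
  also have "\<dots> = to_fract q"
    unfolding q_def to_fract_sum by (intro sum.cong) (simp_all add: monom_altdef flip: to_fract_power)
  finally have "coeff (coeff (four_term_poly a :: 'k poly fract poly poly) j) i = to_fract q" .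
  moreover have "q \<noteq> 0 \<longleftrightarrow> I \<noteq> {}"
  proof
    assume "I \<noteq> {}"
    have "poly q 1 = of_nat (card I)" by (simp add: q_def poly_sum poly_monom)
    also have "\<dots> \<noteq> 0" using \<open>I \<noteq> {}\<close> by (simp add: I_def card_eq_0_iff)
    finally show "q \<noteq> 0" by auto
  qed (auto simp: q_def)
  ultimately show ?thesis by (auto simp: I_def)
qed

lemma to_fract_four_term:
  "to_fract (four_term_poly a) = (\<Sum>i<4. const_fract (to_fract [:0, 1:] ^ a i 0) * mono (int (a i 1), int (a i 2)))"
  by (simp add: four_term_poly_def to_fract_bimonom)

lemma newton_polygon_four_term:
  "newton_polygon (four_term_poly a :: 'k::field_char_0 poly fract poly poly) =
    convex hull ((\<lambda>l. (real (a l 1), real (a l 2))) ` {..<4})"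
  unfolding newton_polygon_def coeff_four_term_nonzero by (rule arg_cong[where f = "(hull) convex"]) auto

lemma stripped_four_term:
  assumes "\<exists>l<4. a l 1 = 0" "\<exists>l<4. a l 2 = 0"
  shows "stripped (four_term_poly a :: 'k::field_char_0 poly fract poly poly)"
  unfolding stripped_def
proof
  let ?g = "four_term_poly a :: 'k poly fract poly poly"
  show "\<not> [:[:0, 1:]:] dvd ?g"
  proof
    assume "[:[:0, 1:]:] dvd ?g"
    then obtain h where "?g = smult [:0, 1:] h" by (auto elim: dvdE)
    hence "coeff (coeff ?g j) 0 = 0" for j by simp
    thus False using assms(1) coeff_four_term_nonzero[of a] by metis
  qed
  show "\<not> [:0, 1:] dvd ?g"
  proof
    assume "[:0, 1:] dvd ?g"
    then obtain h where "?g = pCons 0 h" by (auto elim: dvdE)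
    hence "coeff (coeff ?g 0) i = 0" for i by simp
    thus False using assms(2) coeff_four_term_nonzero[of a] by metis
  qed
qed

text \<open>An irreducible polynomial divisible by a variable is a constant multiple of it and has a
  single exponent point.\<close>

lemma irreducible_four_term_stripped:
  fixes a :: "nat \<Rightarrow> nat \<Rightarrow> nat"
  defines "f \<equiv> (four_term_poly a :: 'k::field_char_0 poly fract poly poly)"
  assumes irr: "irreducible f" and nc: "\<And>i j. \<exists>l<4. (a l 1, a l 2) \<noteq> (i, j)"
  shows "stripped f"
proof -
  have unit: "\<exists>c. h = [:[:c:]:]" if "h dvd 1" for h :: "'k poly fract poly poly"
    using that by (auto simp: is_unit_poly_iff)
  have variable: "\<not> x dvd f" if x: "\<not> x dvd 1" and c: "\<And>c. \<exists>i j. \<forall>m n. coeff (coeff (x * [:[:c:]:]) n) m \<noteq> 0 \<longrightarrow> m = i \<and> n = j" for x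
  proof
    assume "x dvd f"
    then obtain h where h: "f = x * h" by blast
    hence "h dvd 1" using irreducibleD[OF irr h] x by blast
    then obtain c where "h = [:[:c:]:]" using unit by blast
    then obtain i j where "\<And>m n. coeff (coeff f n) m \<noteq> 0 \<Longrightarrow> m = i \<and> n = j" using c[of c] h by blast
    hence "\<And>l. l < 4 \<Longrightarrow> a l 1 = i \<and> a l 2 = j" unfolding f_def coeff_four_term_nonzero by blast
    thus False using nc[of i j] by auto
  qed
  have u: "\<not> [:[:0, 1:]:] dvd (1 :: 'k poly fract poly poly)" "\<not> [:0, 1:] dvd (1 :: 'k poly fract poly poly)"
    by (auto simp: is_unit_poly_iff)
  show ?thesis unfolding stripped_def
  proof
    show "\<not> [:[:0, 1:]:] dvd f"
      by (rule variable[OF u(1)], rule exI[of _ 1], rule exI[of _ 0]) (auto simp: coeff_pCons split: nat.splits)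
    show "\<not> [:0, 1:] dvd f"
      by (rule variable[OF u(2)], rule exI[of _ 0], rule exI[of _ 1]) (auto simp: coeff_pCons split: nat.splits)
  qed
qed

lemma monomial_subst_inverse:
  fixes z :: "'a::field poly poly fract"
  assumes "p * s - q * r = D" "D * D = 1"
  shows "monomial_subst (D * s) (- (D * q)) (- (D * r)) (D * p) (monomial_subst p q r s z) = z"
proof -
  have D: "p * s - q * r \<noteq> 0" using assms by auto
  have "D * s * (D * p) - - (D * q) * - (D * r) = D * D * (p * s - q * r)" by Groebner_Basis.algebra
  hence D': "D * s * (D * p) - - (D * q) * - (D * r) \<noteq> 0" using assms D by simp
  interpret S: comm_ring_hom "monomial_subst p q r s :: 'a poly poly fract \<Rightarrow> _" by (rule monomial_subst_hom[OF D])
  interpret T: comm_ring_hom "monomial_subst (D * s) (- (D * q)) (- (D * r)) (D * p) :: 'a poly poly fract \<Rightarrow> _"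
    by (rule monomial_subst_hom[OF D'])
  have x: "(xv :: 'a poly poly fract) = mono (1, 0)" and y: "(yv :: 'a poly poly fract) = mono (0, 1)"
    by (simp_all add: mono_def)
  have "D * s * p + - (D * q) * r = D * (p * s - q * r)" "D * p * s + - (D * r) * q = D * (p * s - q * r)"
    by Groebner_Basis.algebra+
  hence 1: "D * s * p + - (D * q) * r = 1" "- (D * r) * q + D * p * s = 1" using assms by (simp_all add: add.commute)
  show ?thesis
  proof (rule fract_hom_identity[where s = "\<lambda>z. monomial_subst (D * s) (- (D * q)) (- (D * r)) (D * p) (monomial_subst p q r s z)"])
    show "comm_ring_hom (\<lambda>z :: 'a poly poly fract. monomial_subst (D * s) (- (D * q)) (- (D * r)) (D * p) (monomial_subst p q r s z))"
      by (rule comm_ring_homI) (simp_all add: S.hom_add S.hom_mult T.hom_add T.hom_mult)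
    show "monomial_subst (D * s) (- (D * q)) (- (D * r)) (D * p) (monomial_subst p q r s (const_fract c)) = const_fract c" for c :: 'a
      by (simp add: monomial_subst_const[OF D] monomial_subst_const[OF D'])
    show "monomial_subst (D * s) (- (D * q)) (- (D * r)) (D * p) (monomial_subst p q r s xv) = (xv :: 'a poly poly fract)"
      unfolding x monomial_subst_mono[OF D] monomial_subst_mono[OF D'] using 1 by (simp add: algebra_simps)
    show "monomial_subst (D * s) (- (D * q)) (- (D * r)) (D * p) (monomial_subst p q r s yv) = (yv :: 'a poly poly fract)"
      unfolding y monomial_subst_mono[OF D] monomial_subst_mono[OF D'] using 1 by (simp add: algebra_simps)
  qed
qed

text \<open>The linear part of \<open>\<phi>\<close> acts as a monomial substitution and its
  translation as multiplication by a monomial. The powers of \<open>t\<close> are constants for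
  both, so the coefficients are unchanged.\<close>

theorem four_term_birational:
  fixes a b :: "nat \<Rightarrow> nat \<Rightarrow> nat"
  defines "f \<equiv> (four_term_poly a :: 'k::field poly fract poly poly)" and "g \<equiv> four_term_poly b"
  assumes \<phi>: "unimodular \<phi>" and b: "\<And>i. i < 4 \<Longrightarrow> b i 0 = a i 0"
      "\<And>i. i < 4 \<Longrightarrow> \<phi> (int (a i 1), int (a i 2)) = (int (b i 1), int (b i 2))"
    and f: "irreducible f" "stripped f" and g: "stripped g"
  shows "birational f g"
proof -
  obtain p q r s e h where \<phi>_eq: "\<phi> = affmap p q r s e h" "\<bar>p * s - q * r\<bar> = 1"
    using \<phi> unfolding unimodular_def by blast
  define D where "D = p * s - q * r"
  have "D = 1 \<or> D = -1" using \<phi>_eq(2) by (auto simp: D_def)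
  hence DD: "D * D = 1" by auto
  define p' q' r' s' where "p' = D * s" and "q' = - (D * q)" and "r' = - (D * r)" and "s' = D * p"
  note defs = p'_def q'_def r'_def s'_def
  have "p' * s' - q' * r' = D * D * (p * s - q * r)" unfolding defs by Groebner_Basis.algebra
  hence D': "p' * s' - q' * r' = D" unfolding D_def[symmetric] DD by simp
  have nz: "p * s - q * r \<noteq> 0" "p' * s' - q' * r' \<noteq> 0" using DD D' D_def by auto
  have bk: "p = D * s'" "q = - (D * q')" "r = - (D * r')" "s = D * p'"
    using DD by (simp_all add: defs mult.assoc[symmetric])
  have inv: "monomial_subst p' q' r' s' (monomial_subst p q r s z) = z"
    "monomial_subst p q r s (monomial_subst p' q' r' s' z) = z" for z :: "'k poly fract poly poly fract"
    using monomial_subst_inverse[OF D_def[symmetric] DD, of z] monomial_subst_inverse[OF D' DD, of z]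
    unfolding defs[symmetric] bk[symmetric] .
  interpret monomial_automorphism "monomial_subst p q r s :: 'k poly fract poly poly fract \<Rightarrow> _" "monomial_subst p' q' r' s'"
    "\<lambda>v. (p * fst v + q * snd v, r * fst v + s * snd v)" "\<lambda>v. (p' * fst v + q' * snd v, r' * fst v + s' * snd v)"
    by (rule monomial_automorphism.intro)
      (simp_all only: monomial_subst_hom monomial_subst_const monomial_subst_mono nz inv not_False_eq_True)
  interpret field_hom "monomial_subst p q r s :: 'k poly fract poly poly fract \<Rightarrow> _"
    by (intro field_hom.intro idom_hom.intro hom)
  interpret T: field_hom "monomial_subst p' q' r' s' :: 'k poly fract poly poly fract \<Rightarrow> _"
    by (intro field_hom.intro idom_hom.intro hom)
  define w where "w = (e, h)"
  define w' where "w' = (p' * fst w + q' * snd w, r' * fst w + s' * snd w)"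
  have g_eq: "to_fract g = monomial_subst p q r s (to_fract f) * mono w"
  proof -
    have "monomial_subst p q r s (to_fract f) * mono w = (\<Sum>i<4. const_fract (to_fract [:0, 1:] ^ a i 0) *
        mono (p * int (a i 1) + q * int (a i 2), r * int (a i 1) + s * int (a i 2)) * mono w)"
      unfolding f_def to_fract_four_term hom_sum hom_mult const mono sum_distrib_right by simp
    also have "\<dots> = to_fract g" unfolding g_def to_fract_four_term
    proof (rule sum.cong[OF refl])
      fix i :: nat assume i: "i \<in> {..<4}"
      have "(p * int (a i 1) + q * int (a i 2), r * int (a i 1) + s * int (a i 2)) + w = (int (b i 1), int (b i 2))"
        using b(2)[of i] i by (simp add: \<phi>_eq(1) affmap_def w_def)
      thus "const_fract (to_fract [:0, 1:] ^ a i 0) * mono (p * int (a i 1) + q * int (a i 2), r * int (a i 1) + s * int (a i 2)) * mono w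
          = const_fract (to_fract [:0, 1:] ^ b i 0) * mono (int (b i 1), int (b i 2))"
        using b(1)[of i] i by (simp add: mult.assoc flip: mono_add)
    qed
    finally show ?thesis ..
  qed
  have eq1: "monomial_subst p q r s (to_fract f) = to_fract g * mono (- w)"
    unfolding g_eq mono_uminus by (simp add: mono_nonzero)
  have eq2: "monomial_subst p' q' r' s' (to_fract g) = to_fract f * mono w'"
    unfolding g_eq T.hom_mult inverse mono w'_def by simp
  show ?thesis
    by (rule birational_transfer[OF f(1) irreducible_transfer[OF f g eq2] f(2) g eq1 eq2])
qed

lemma exponent_matrix_carrier: "exponent_matrix a \<in> carrier_mat 4 4"
  by (simp add: exponent_matrix_def)

lemma exponent_matrix_mult_vec:
  assumes "v \<in> carrier_vec 4" "i < 4"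
  shows "(exponent_matrix a *\<^sub>v v) $ i = int (a i 0) * (v $ 0 - v $ 3) + int (a i 1) * (v $ 1 - v $ 3)
    + int (a i 2) * (v $ 2 - v $ 3) + int (total_degree a) * v $ 3"
  using assms by (simp add: exponent_matrix_def scalar_prod_def eval_nat_numeral algebra_simps)

text \<open>A line through all exponent points would give a vector in the kernel of the exponent
  matrix.\<close>

lemma exponents_not_collinear:
  assumes det: "det (exponent_matrix a) \<noteq> 0"
    and line: "\<And>i. i < 4 \<Longrightarrow> \<alpha> * int (a i 1) + \<beta> * int (a i 2) = \<gamma>"
  shows "\<alpha> = 0 \<and> \<beta> = 0"
proof -
  have inj: "v = 0\<^sub>v 4" if "v \<in> carrier_vec 4" "\<And>i. i < 4 \<Longrightarrow> (exponent_matrix a *\<^sub>v v) $ i = 0" for v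
  proof -
    have "exponent_matrix a *\<^sub>v v = 0\<^sub>v 4"
      using that exponent_matrix_carrier[of a] by (intro eq_vecI) auto
    thus ?thesis using det det_0_iff_vec_prod_zero[OF exponent_matrix_carrier[of a]] that(1) by blast
  qed
  \<comment> \<open>Every row has sum equal to the degree, so degree 0 would put the all-one vector
    into the kernel.\<close>
  have d: "total_degree a \<noteq> 0"
  proof
    assume "total_degree a = 0"
    hence "vec 4 (\<lambda>_. 1) = (0\<^sub>v 4 :: int vec)" by (intro inj) (simp_all add: exponent_matrix_mult_vec)
    from arg_cong[OF this, of "\<lambda>v :: int vec. v $ 0"] show False by simp
  qed
  define d where "d = int (total_degree a)"
  \<comment> \<open>As the rows have sum \<open>d\<close>, subtracting \<open>\<gamma>\<close> from
    every entry contributes \<open>- d * \<gamma>\<close> to the product, which cancels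
    \<open>d\<close> times the left side of the line equation.\<close>
  define v where "v = vec 4 (\<lambda>i. (if i = 1 then d * \<alpha> else if i = 2 then d * \<beta> else 0) - \<gamma>)"
  have "v = 0\<^sub>v 4"
  proof (rule inj)
    fix i :: nat assume i: "i < 4"
    have "(exponent_matrix a *\<^sub>v v) $ i = d * (\<alpha> * int (a i 1) + \<beta> * int (a i 2)) - d * \<gamma>"
      using i by (subst exponent_matrix_mult_vec) (simp_all add: v_def d_def algebra_simps)
    thus "(exponent_matrix a *\<^sub>v v) $ i = 0" using line[OF i] by simp
  qed (simp add: v_def)
  hence "v $ 1 = 0" "v $ 2 = 0" "v $ 3 = 0" by simp_all
  thus ?thesis using d by (simp add: v_def d_def)
qed

definition area_cofactor :: "(nat \<Rightarrow> int \<times> int) \<Rightarrow> nat \<Rightarrow> int" where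
  "area_cofactor p i = [det2 (p 2 - p 1) (p 3 - p 1), - det2 (p 2 - p 0) (p 3 - p 0),
     det2 (p 1 - p 0) (p 3 - p 0), - det2 (p 1 - p 0) (p 2 - p 0)] ! i"

lemma area_cofactor_simps: "area_cofactor p 0 = det2 (p 2 - p 1) (p 3 - p 1)" "area_cofactor p 1 = - det2 (p 2 - p 0) (p 3 - p 0)"
  "area_cofactor p 2 = det2 (p 1 - p 0) (p 3 - p 0)" "area_cofactor p 3 = - det2 (p 1 - p 0) (p 2 - p 0)"
  by (simp_all add: area_cofactor_def)

text \<open>If the sum vanished, the cofactors would form a left null vector of the matrix and hence
  all be zero; but vanishing areas force the exponent points onto a line.\<close>

lemma exponent_matrix_nonsingular:
  assumes det: "det (exponent_matrix a) \<noteq> 0"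
  defines "p \<equiv> \<lambda>i. (int (a i 1), int (a i 2))"
  shows "(\<Sum>i<4. area_cofactor p i * int (a i 0)) \<noteq> 0"
proof
  assume "(\<Sum>i<4. area_cofactor p i * int (a i 0)) = 0"
  hence sum0: "area_cofactor p 0 * int (a 0 0) + area_cofactor p 1 * int (a 1 0) + area_cofactor p 2 * int (a 2 0) + area_cofactor p 3 * int (a 3 0) = 0"
    by (simp add: eval_nat_numeral add.assoc)
  have sums: "area_cofactor p 0 + area_cofactor p 1 + area_cofactor p 2 + area_cofactor p 3 = 0"
    "area_cofactor p 0 * int (a 0 1) + area_cofactor p 1 * int (a 1 1) + area_cofactor p 2 * int (a 2 1) + area_cofactor p 3 * int (a 3 1) = 0"
    "area_cofactor p 0 * int (a 0 2) + area_cofactor p 1 * int (a 1 2) + area_cofactor p 2 * int (a 2 2) + area_cofactor p 3 * int (a 3 2) = 0"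
    unfolding area_cofactor_simps det2_def p_def fst_diff snd_diff fst_conv snd_conv by Groebner_Basis.algebra+
  define c where "c = vec 4 (area_cofactor p)"
  have "transpose_mat (exponent_matrix a) *\<^sub>v c = 0\<^sub>v 4"
  proof (rule eq_vecI)
    fix j assume j: "j < dim_vec (0\<^sub>v 4 :: int vec)"
    let ?e = "\<lambda>i. exponent_matrix a $$ (i, j)"
    have "(transpose_mat (exponent_matrix a) *\<^sub>v c) $ j
        = area_cofactor p 0 * ?e 0 + area_cofactor p 1 * ?e 1 + area_cofactor p 2 * ?e 2 + area_cofactor p 3 * ?e 3"
      using j by (simp add: c_def scalar_prod_def exponent_matrix_def eval_nat_numeral algebra_simps)
    also have "\<dots> = 0"
    proof -
      have "j = 0 \<or> j = 1 \<or> j = 2 \<or> j = 3" using j by auto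
      thus ?thesis
      proof (elim disjE)
        assume "j = 3"
        have "area_cofactor p 0 * ?e 0 + area_cofactor p 1 * ?e 1 + area_cofactor p 2 * ?e 2 + area_cofactor p 3 * ?e 3
          = int (total_degree a) * (area_cofactor p 0 + area_cofactor p 1 + area_cofactor p 2 + area_cofactor p 3)
          - (area_cofactor p 0 * int (a 0 0) + area_cofactor p 1 * int (a 1 0) + area_cofactor p 2 * int (a 2 0) + area_cofactor p 3 * int (a 3 0))
          - (area_cofactor p 0 * int (a 0 1) + area_cofactor p 1 * int (a 1 1) + area_cofactor p 2 * int (a 2 1) + area_cofactor p 3 * int (a 3 1))
          - (area_cofactor p 0 * int (a 0 2) + area_cofactor p 1 * int (a 1 2) + area_cofactor p 2 * int (a 2 2) + area_cofactor p 3 * int (a 3 2))"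
          using \<open>j = 3\<close> by (simp add: exponent_matrix_def algebra_simps)
        thus ?thesis unfolding sum0 sums by simp
      qed (use sum0 sums in \<open>simp_all add: exponent_matrix_def\<close>)
    qed
    finally show "(transpose_mat (exponent_matrix a) *\<^sub>v c) $ j = 0\<^sub>v 4 $ j" using j by simp
  qed (simp add: exponent_matrix_def)
  moreover have "det (transpose_mat (exponent_matrix a)) \<noteq> 0"
    using det by (simp add: det_transpose[OF exponent_matrix_carrier])
  moreover have "c \<in> carrier_vec 4" by (simp add: c_def)
  ultimately have "c = 0\<^sub>v 4"
    using det_0_iff_vec_prod_zero[OF transpose_carrier_mat[THEN iffD2, OF exponent_matrix_carrier[of a]]] by blast
  hence "c $ 1 = 0" "c $ 2 = 0" "c $ 3 = 0" by simp_all
  hence dets: "det2 (p 2 - p 0) (p 3 - p 0) = 0" "det2 (p 1 - p 0) (p 3 - p 0) = 0" "det2 (p 1 - p 0) (p 2 - p 0) = 0"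
    by (simp_all add: c_def area_cofactor_simps area_cofactor_simps(2)[unfolded One_nat_def])
  \<comment> \<open>A nonzero difference \<open>p j - p 0\<close> parallel to all the others would
    put the points on a line.\<close>
  have line: "p j = p 0" if j: "j < 4" and zero: "\<And>i. i < 4 \<Longrightarrow> det2 (p j - p 0) (p i - p 0) = 0" for j
  proof -
    define \<alpha> \<beta> where "\<alpha> = - snd (p j - p 0)" and "\<beta> = fst (p j - p 0)"
    have "\<alpha> * int (a i 1) + \<beta> * int (a i 2) = \<alpha> * int (a 0 1) + \<beta> * int (a 0 2)" if "i < 4" for i
      using zero[OF that] by (simp add: det2_def \<alpha>_def \<beta>_def p_def algebra_simps)
    hence "\<alpha> = 0 \<and> \<beta> = 0" by (rule exponents_not_collinear[OF det])
    thus ?thesis by (simp add: \<alpha>_def \<beta>_def prod_eq_iff)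
  qed
  have anti: "det2 u v = - det2 v u" for u v by (simp add: det2_def)
  have dets': "det2 (p 3 - p 0) (p 2 - p 0) = 0" "det2 (p 3 - p 0) (p 1 - p 0) = 0" "det2 (p 2 - p 0) (p 1 - p 0) = 0"
    unfolding anti[of "p 3 - p 0" "p 2 - p 0"] anti[of "p 3 - p 0" "p 1 - p 0"] anti[of "p 2 - p 0" "p 1 - p 0"] dets by simp_all
  have self: "det2 u u = 0" "det2 (u - u) v = 0" "det2 v (u - u) = 0" for u v by (simp_all add: det2_def)
  have "\<forall>j\<in>{0, 1, 2, 3}. \<forall>i\<in>{0, 1, 2, 3}. det2 (p j - p 0) (p i - p 0) = 0"
    by (simp only: ball_simps dets dets' self simp_thms)
  moreover have "i \<in> {0, 1, 2, 3}" if "i < 4" for i :: nat using that by auto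
  ultimately have zero: "det2 (p j - p 0) (p i - p 0) = 0" if "j < 4" "i < 4" for i j using that by blast
  have "1 * int (a j 1) + 0 * int (a j 2) = int (a 0 1)" if j: "j < 4" for j
  proof -
    have "p j = p 0"
    proof (rule line)
      show "det2 (p j - p 0) (p i - p 0) = 0" if "i < 4" for i using j that by (rule zero)
    qed (fact j)
    thus ?thesis by (simp add: p_def)
  qed
  from exponents_not_collinear[OF det this] show False by simp
qed

text \<open>Equal exponents would give two equal rows, since the last column is determined by the
  others.\<close>

lemma exponents_distinct:
  assumes det: "det (exponent_matrix a) \<noteq> 0" and "i < 4" "j < 4" "a i 0 = a j 0" "a i 1 = a j 1" "a i 2 = a j 2"
  shows "i = j"
proof (rule ccontr)
  assume "i \<noteq> j"
  have "a i k = a j k" if "k < 3" for k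
  proof -
    have "k = 0 \<or> k = 1 \<or> k = 2" using that by linarith
    thus ?thesis using assms(4-6) by blast
  qed
  hence "row (exponent_matrix a) i = row (exponent_matrix a) j"
    using assms by (intro eq_vecI) (auto simp: exponent_matrix_def)
  thus False using det_identical_rows[OF exponent_matrix_carrier \<open>i \<noteq> j\<close> assms(2,3)] det by blast
qed

section \<open>Extension of the base field\<close>

lemma base_change_mult: "base_change (p * q) = base_change p * base_change q"
proof -
  have mult: "map_poly h (p * q) = map_poly h p * map_poly h q"
    if h: "\<And>x y. h (x + y) = h x + h y" "\<And>x y. h (x * y) = h x * h y" "h 0 = 0"
    for h :: "'b::comm_ring_1 \<Rightarrow> 'c::comm_ring_1" and p q
  proof (rule poly_eqI)
    fix n
    have sum: "h (sum g I) = (\<Sum>i\<in>I. h (g i))" for g :: "nat \<Rightarrow> 'b" and I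
      by (induction I rule: infinite_finite_induct) (simp_all add: h)
    show "coeff (map_poly h (p * q)) n = coeff (map_poly h p * map_poly h q) n"
      by (simp add: coeff_map_poly h coeff_mult sum)
  qed
  have add: "map_poly to_ac (p + q) = map_poly to_ac p + map_poly to_ac q" for p q :: "'a poly"
    by (rule poly_eqI) (simp add: coeff_map_poly)
  show ?thesis unfolding base_change_def by (intro mult add) simp_all
qed

lemma coeff_base_change: "coeff (coeff (base_change f) j) i = to_ac (coeff (coeff f j) i)"
  by (simp add: base_change_def coeff_map_poly)

text \<open>A factor that becomes a unit over the closure becomes a nonzero constant, and its
  coefficients show that it was one before.\<close>

lemma irreducible_of_base_change:
  assumes "irreducible (base_change f)"
  shows "irreducible f"
proof (rule irreducibleI)
  have one: "base_change 1 = (1 :: 'a alg_closure poly poly)"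
    by (intro poly_eqI) (simp add: coeff_base_change)
  have unit: "base_change p dvd 1" if "p dvd 1" for p :: "'a poly poly"
    using that one by (metis base_change_mult dvd_def)
  show "f \<noteq> 0" using assms by (auto simp: base_change_def)
  show "\<not> f dvd 1" using assms unit unfolding irreducible_def by blast
  have descend: "p dvd 1" if "base_change p dvd 1" for p :: "'a poly poly"
  proof -
    obtain c where c: "base_change p = [:[:c:]:]" "c dvd 1" using \<open>base_change p dvd 1\<close> by (auto simp: is_unit_poly_iff)
    define x where "x = coeff (coeff p 0) 0"
    have "to_ac (coeff (coeff p j) i) = to_ac (coeff (coeff [:[:x:]:] j) i)" for i j
    proof (cases "i = 0 \<and> j = 0")
      case False
      hence "coeff (coeff (base_change p) j) i = 0" "coeff (coeff [:[:x:]:] j) i = 0"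
        unfolding c(1) by (auto simp: coeff_pCons split: nat.splits)
      thus ?thesis by (simp add: coeff_base_change)
    qed (simp add: x_def)
    hence "p = [:[:x:]:]" by (intro poly_eqI) simp
    moreover have "to_ac x = c" using c(1) coeff_base_change[of p 0 0] by (simp add: x_def)
    hence "x \<noteq> 0" using c(2) by auto
    ultimately show ?thesis by (simp add: is_unit_poly_iff dvd_field_iff)
  qed
  show "a dvd 1 \<or> b dvd 1" if "f = a * b" for a b
    using irreducibleD[OF assms, of "base_change a" "base_change b"] descend that by (auto simp: base_change_mult)
qed

lemma base_change_four_term:
  "base_change (four_term_poly a) = (\<Sum>i<4. bimonom (to_ac (to_fract [:0, 1:]) ^ a i 0) (a i 1) (a i 2))"
proof (intro poly_eqI)
  fix i j
  show "coeff (coeff (base_change (four_term_poly a)) j) i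
      = coeff (coeff (\<Sum>i<4. bimonom (to_ac (to_fract [:0, 1:]) ^ a i 0) (a i 1) (a i 2)) j) i"
    unfolding coeff_base_change four_term_poly_def coeff_sum to_ac_sum
    by (intro sum.cong) (auto simp: bimonom_def coeff_monom)
qed

text \<open>The value at \<open>t\<close> is the polynomial itself, read in \<open>k[t]\<close>, and
  integer coefficients stay nonzero in characteristic 0.\<close>

lemma variable_transcendental:
  fixes q :: "int poly"
  assumes "q \<noteq> 0"
  shows "poly (map_poly of_int q) (to_ac (to_fract [:0, 1 :: 'k::field_char_0:])) \<noteq> 0"
proof -
  have nz: "map_poly of_int q \<noteq> (0 :: 'k poly)"
  proof
    assume "map_poly of_int q = (0 :: 'k poly)"
    hence "coeff (map_poly of_int q) n = (0 :: 'k)" for n by simp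
    hence "q = 0" by (intro poly_eqI) (simp add: coeff_map_poly)
    thus False using assms by simp
  qed
  have "poly (map_poly of_int p) (to_ac (to_fract [:0, 1:])) = to_ac (to_fract (map_poly of_int p :: 'k poly))" for p
  proof (induction p)
    case (pCons c p)
    have nat: "of_nat n = to_fract [:of_nat n :: 'k:]" for n
    proof (induction n)
      case (Suc n)
      have "to_fract [:of_nat (Suc n) :: 'k:] = to_fract ([:1:] + [:of_nat n:])" by simp
      thus ?case unfolding to_fract_add using Suc by (simp flip: one_pCons)
    qed simp
    have c: "of_int c = to_fract [:of_int c :: 'k:]"
      by (cases c rule: int_diff_cases) (simp add: nat flip: to_fract_diff)
    have "to_fract (map_poly of_int (pCons c p) :: 'k poly) = of_int c + to_fract [:0, 1:] * to_fract (map_poly of_int p)"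
      unfolding c to_fract_mult[symmetric] to_fract_add[symmetric] by (simp add: map_poly_pCons)
    thus ?case using pCons by (simp add: map_poly_pCons)
  qed simp
  thus ?thesis using nz by simp
qed

theorem theorem1p1:
  fixes a :: "nat \<Rightarrow> nat \<Rightarrow> nat"
    and f :: "'k::{alg_closed_field, field_char_0} poly fract poly poly"
  assumes "f = four_term_poly a"
    and "absolutely_irreducible f"
    and "det (exponent_matrix a) \<noteq> 0"
    and "has_geometric_genus f 1"
  shows "\<exists>(b :: nat \<Rightarrow> nat \<Rightarrow> nat) (g :: 'k poly fract poly poly).
           g = four_term_poly b \<and>
           inj_on (\<lambda>i. (b i 0, b i 1, b i 2)) {..<4} \<and>
           birational f g \<and>
           (\<exists>P \<in> set polygon_corners. newton_polygon g = convex hull P)"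
proof -
  define p where "p = (\<lambda>i. (int (a i 1), int (a i 2)))"
  note det = assms(3)
  have irr: "irreducible (base_change f)" using assms(2) by (simp add: absolutely_irreducible_def)
  hence "prime_elem (base_change f)" by (rule irreducible_imp_prime_poly)
  \<comment> \<open>Over the algebraic closure of \<open>k(t)\<close> the element \<open>t\<close>
    is a constant and takes the role of \<open>T\<close>.\<close>
  then interpret C: four_term_curve "base_change f" "to_ac (to_fract [:0, 1 :: 'k:])" "\<lambda>i. a i 0" "\<lambda>i. a i 1" "\<lambda>i. a i 2" p "area_cofactor p"
    by unfold_locales
      (use variable_transcendental exponent_matrix_nonsingular[OF det] in
        \<open>auto simp: assms(1) base_change_four_term p_def area_cofactor_simps area_cofactor_simps(2)[unfolded One_nat_def]\<close>)
  have genus: "function_field_has_genus (range (const_fun (base_change f))) (function_field (base_change f)) 1"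
    using assms(4) by (simp add: has_geometric_genus_def)
  obtain v0 v1 v2 where v: "v0 \<in> C.points" "v1 \<in> C.points" "v2 \<in> C.points" "det2 (v1 - v0) (v2 - v0) \<noteq> 0"
  proof -
    have "\<exists>i<4. area_cofactor p i \<noteq> 0"
      using C.nonsingular by (metis (no_types, lifting) lessThan_iff mult_zero_left sum.neutral)
    then obtain i where i: "i < 4" "area_cofactor p i \<noteq> 0" by blast
    have "p j \<in> C.points" if "j < 4" for j using that by (simp add: C.points_def)
    hence pts: "p 0 \<in> C.points" "p 1 \<in> C.points" "p 2 \<in> C.points" "p 3 \<in> C.points" by simp_all
    from C.less_4_cases[OF i(1)] show thesis
    proof (elim disjE)
      assume "i = 0" thus thesis using that[OF pts(2,3,4)] i(2) by (simp add: area_cofactor_simps)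
    next
      assume "i = 1" thus thesis using that[OF pts(1,3,4)] i(2) area_cofactor_simps(2)[of p] by simp
    next
      assume "i = 2" thus thesis using that[OF pts(1,2,4)] i(2) by (simp add: area_cofactor_simps)
    next
      assume "i = 3" thus thesis using that[OF pts(1,2,3)] i(2) by (simp add: area_cofactor_simps)
    qed
  qed
  have "finite C.points" by (simp add: C.points_def)
  moreover have "card C.points \<le> 4" unfolding C.points_def using card_image_le[of "{..<4::nat}" p] by simp
  ultimately have "genus_one_shape C.points"
    using lattice_quadrilateral_classification[OF _ _ v C.genus_one_unique_interior[OF genus]]
      C.genus_one_not_zero_shape[OF genus] by blast
  then obtain \<phi> P Q where \<phi>: "unimodular \<phi>" and PQ: "(P, Q) \<in> genus_one_polygons"
    and S: "P \<subseteq> \<phi> ` C.points" "\<phi> ` C.points \<subseteq> Q" unfolding genus_one_shape_def by blast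
  \<comment> \<open>The exponents of \<open>t\<close> are kept and those of \<open>X\<close> and
    \<open>Y\<close> are moved by \<open>\<phi>\<close>; \<open>nat\<close> loses nothing because
    \<open>Q\<close> lies in the first quadrant.\<close>
  define b :: "nat \<Rightarrow> nat \<Rightarrow> nat" where "b i j = (if j = 0 then a i 0 else if j = 1 then nat (fst (\<phi> (p i))) else nat (snd (\<phi> (p i))))" for i j
  have b0: "b i 0 = a i 0" for i by (simp add: b_def)
  have b: "\<phi> (p i) = (int (b i 1), int (b i 2))" if "i < 4" for i
  proof -
    have "\<phi> (p i) \<in> Q" using S(2) that by (auto simp: C.points_def)
    thus ?thesis using genus_one_polygons_axes(3)[OF PQ] by (simp add: b_def prod_eq_iff)
  qed
  define g where "g = (four_term_poly b :: 'k poly fract poly poly)"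
  have inj: "inj_on (\<lambda>i. (b i 0, b i 1, b i 2)) {..<4}"
  proof (rule inj_onI)
    fix i j :: nat assume ij: "i \<in> {..<4}" "j \<in> {..<4}" "(b i 0, b i 1, b i 2) = (b j 0, b j 1, b j 2)"
    obtain \<psi> where "\<And>v. \<psi> (\<phi> v) = v" using unimodular_inverse[OF \<phi>] by metis
    moreover have "\<phi> (p i) = \<phi> (p j)" using b[of i] b[of j] ij by simp
    ultimately have "p i = p j" by metis
    thus "i = j" using exponents_distinct[OF det, of i j] ij b0 by (simp add: p_def)
  qed
  have axis: "\<exists>l<4. b l 1 = 0" "\<exists>l<4. b l 2 = 0"
  proof -
    obtain q q' where "q \<in> P" "fst q = 0" "q' \<in> P" "snd q' = 0"
      using genus_one_polygons_axes(1,2)[OF PQ] by blast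
    moreover have "\<exists>l<4. \<phi> (p l) = q" if "q \<in> P" for q using S(1) that by (auto simp: C.points_def)
    ultimately obtain l l' where l: "l < 4" "fst (\<phi> (p l)) = 0" "l' < 4" "snd (\<phi> (p l')) = 0" by metis
    thus "\<exists>l<4. b l 1 = 0" "\<exists>l<4. b l 2 = 0" using b[of l] b[of l'] by auto
  qed
  have "\<exists>l<4. (a l 1, a l 2) \<noteq> (i, j)" for i j
  proof (rule ccontr)
    assume "\<not> ?thesis"
    hence "1 * int (a l 1) + 0 * int (a l 2) = int i" if "l < 4" for l using that by auto
    from exponents_not_collinear[OF det this] show False by simp
  qed
  hence stf: "stripped f"
    using irreducible_four_term_stripped[of a] irreducible_of_base_change[OF irr] unfolding assms(1) by blast
  have "birational f g"
    unfolding assms(1) g_def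
    by (rule four_term_birational[OF \<phi>])
      (use b b0 irreducible_of_base_change[OF irr] stf stripped_four_term[OF axis] in \<open>simp_all add: assms(1) p_def\<close>)
  moreover have "newton_polygon g = convex hull ((\<lambda>v. (real_of_int (fst v), real_of_int (snd v))) ` P)"
  proof -
    have "(\<lambda>l. (real (b l 1), real (b l 2))) ` {..<4} = (\<lambda>v. (real_of_int (fst v), real_of_int (snd v))) ` \<phi> ` C.points"
      unfolding C.points_def image_image by (rule image_cong) (simp_all add: b)
    thus ?thesis unfolding g_def newton_polygon_four_term using genus_one_polygons_hull[OF PQ S] by simp
  qed
  ultimately show ?thesis using inj genus_one_polygons_corners[OF PQ] g_def by blast
qed

end
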